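(* (Dual Maschke Theorem for Hopf algebroids.) Let $\mathcal{A}=(\mathcal{A}_L,\mathcal{A}_R,S)$ be a Hopf algebroid over a commutative ring $k$, with $\mathcal{A}_L=(A,L,s_L,t_L,\gamma_L,\pi_L)$ and $\mathcal{A}_R=(A,R,s_R,t_R,\gamma_R,\pi_R)$. The following assertions are equivalent: 1.a) The $R$-coring $({}^RA^R,\gamma_R,\pi_R)$ is coseparable, i.e. the comultiplication $\gamma_R:A\to A^R\otimes{}^RA$ splits as an $\mathcal{A}_R$-$\mathcal{A}_R$ bicomodule monomorphism. 1.b) The $L$-coring $({}_LA_L,\gamma_L,\pi_L)$ is coseparable, i.e. the comultiplication $\gamma_L:A\to A_L\otimes{}_LA$ splits as an $\mathcal{A}_L$-$\mathcal{A}_L$ bicomodule monomorphism. 2.a) Any right $\mathcal{A}_R$-comodule is $(\mathcal{A}_R,R)$-injective. 2.b) Any left $\mathcal{A}_R$-comodule is $(\mathcal{A}_R,R)$-injective. 2.c) Any left $\mathcal{A}_L$-comodule is $(\mathcal{A}_L,L)$-injective. 2.d) Any right $\mathcal{A}_L$-comodule is $(\mathcal{A}_L,L)$-injective. 3.a) There exists a normalized left $s$-integral on $\mathcal{A}$, i.e. an element $\lambda^*\in\mathcal{L}(\mathcal{A}^* )$ such that $\lambda^*(1_A)=1_R$. 3.b) There exists a normalized left $t$-integral on $\mathcal{A}$, i.e. an element ${}^*\lambda\in\mathcal{L}({}^*\mathcal{A})$ such that ${}^*\lambda(1_A)=1_R$. 3.c) There exists a normalized right $s$-integral on $\mathcal{A}$,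 i.e. an element ${}_*\rho\in\mathcal{R}({}_*\mathcal{A})$ such that ${}_*\rho(1_A)=1_L$. 3.d) There exists a normalized right $t$-integral on $\mathcal{A}$, i.e. an element $\rho_*\in\mathcal{R}(\mathcal{A}_* )$ such that $\rho_*(1_A)=1_L$. 4.a) The monomorphism $s_R:R\to A$ splits as a right $\mathcal{A}_R$-comodule map. 4.b) The monomorphism $t_R:R\to A$ splits as a left $\mathcal{A}_R$-comodule map. 4.c) The monomorphism $s_L:L\to A$ splits as a left $\mathcal{A}_L$-comodule map. 4.d) The monomorphism $t_L:L\to A$ splits as a right $\mathcal{A}_L$-comodule map.
   Context: Algebras are associative unital algebras over a commutative ring $k$. **Left bialgebroid.** A left bialgebroid $(A,L,s,t,\gamma,\pi)$ consists of $k$-algebras $A$ (total) and $L$ (base), algebra homomorphisms $s:L\to A$ and $t:L^{op}\to A$ with commuting ranges, and an $L$-coring structure (coassociative coproduct $\gamma:A\to A\otimes_L A$ and counit $\pi:A\to L$, both $L$-$L$ bimodule maps) on the $L$-$L$ bimodule ${}_LA_L$, i.e. $A$ with actions $l\cdot a\cdot l'=s(l)t(l')a$. Writing $\gamma(a)=a_{(1)}\otimes a_{(2)}$, it is required that $a_{(1)}t(l)\otimes a_{(2)}=a_{(1)}\otimes a_{(2)}s(l)$, $\gamma(1)=1\otimes 1$, $\gamma(aa')=\gamma(a)\gamma(a')$, $\pi(1)=1$, $\pi(a\,s(\pi(a')))=\pi(aa')=\pi(a\,t(\pi(a')))$. **Right bialgebroid.** $(A,R,s,t,\gamma,\pi)$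 is a right bialgebroid if $(A^{op},R,t,s,\gamma,\pi)$ is a left bialgebroid. Explicitly: $s:R\to A$, $t:R^{op}\to A$ are algebra maps with commuting ranges; $(A,\gamma,\pi)$ is an $R$-coring for the bimodule ${}^RA^R$ with $r\cdot a\cdot r'=a\,s(r')t(r)$; and, with $\gamma(a)=a^{(1)}\otimes a^{(2)}$: $s(r)a^{(1)}\otimes a^{(2)}=a^{(1)}\otimes t(r)a^{(2)}$, $\gamma(1)=1\otimes1$, $\gamma(aa')=\gamma(a)\gamma(a')$, $\pi(1)=1$, $\pi(s(\pi(a))a')=\pi(aa')=\pi(t(\pi(a))a')$. **Module notation.** For $B\in\{L,R\}$ with $s=s_B,t=t_B$: ${}_BA$ is $A$ with left action $b\cdot a=s(b)a$; $A_B$ has right action $a\cdot b=t(b)a$; $A^B$ has right action $a\cdot b=a\,s(b)$; ${}^BA$ has left action $b\cdot a=a\,t(b)$. In a tensor product the displayed module structures are the ones balanced over $B$, e.g. $A_L\otimes{}_LA$ has $t_L(l)a\otimes b=a\otimes s_L(l)b$, $A^R\otimes{}^RA$ has $as_R(r)\otimes b=a\otimes bt_R(r)$. **Hopf algebroid.** $\mathcal{A}=(\mathcal{A}_L,\mathcal{A}_R,S)$ consists of a left bialgebroid $\mathcal{A}_L=(A,L,s_L,t_L,\gamma_L,\pi_L)$ and a right bialgebroid $\mathcal{A}_R=(A,R,s_R,t_R,\gamma_R,\pi_R)$ on the same total algebra $A$ and a $k$-linear map $S:A\to A$ (antipode, not assumed bijective) such that (i) $s_L\pi_Lt_R=t_R$,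 $t_L\pi_Ls_R=s_R$, $s_R\pi_Rt_L=t_L$, $t_R\pi_Rs_L=s_L$; (ii) $(\gamma_L\otimes{}^RA)\gamma_R=(A_L\otimes\gamma_R)\gamma_L$ as maps $A\to A_L\otimes{}_LA^R\otimes{}^RA$, and $(\gamma_R\otimes{}_LA)\gamma_L=(A^R\otimes\gamma_L)\gamma_R$ as maps $A\to A^R\otimes{}^RA_L\otimes{}_LA$; (iii) $S(t_L(l')\,a\,t_L(l))=s_L(l)S(a)s_L(l')$ and $S(t_R(r')\,a\,t_R(r))=s_R(r)S(a)s_R(r')$; (iv) $S(a_{(1)})a_{(2)}=s_R\pi_R(a)$ and $a^{(1)}S(a^{(2)})=s_L\pi_L(a)$, where $\gamma_L(a)=a_{(1)}\otimes a_{(2)}$ and $\gamma_R(a)=a^{(1)}\otimes a^{(2)}$. **Comodules.** $\mathcal{A}_L$-comodules are comodules over the $L$-coring $({}_LA_L,\gamma_L,\pi_L)$; $\mathcal{A}_R$-comodules are comodules over the $R$-coring $({}^RA^R,\gamma_R,\pi_R)$. $A$ is a left and right comodule over either coring via the coproduct. $R$ is a right $\mathcal{A}_R$-comodule via $r\mapsto1_R\otimes s_R(r)$ and a left $\mathcal{A}_R$-comodule via $r\mapsto t_R(r)\otimes1_R$; $L$ is a left $\mathcal{A}_L$-comodule via $l\mapsto s_L(l)\otimes1_L$ and a right $\mathcal{A}_L$-comodule via $l\mapsto1_L\otimes t_L(l)$. The tensor square $A\otimes A$ of a coring is a bicomodule via (coproduct)$\otimes A$ and $A\otimes$(coproduct).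 A comodule $M$ over a $B$-coring $C$ is $(C,B)$-injective if every monomorphism of $C$-comodules from $M$ which splits as a $B$-module map splits as a $C$-comodule map; "$(\mathcal{A}_R,R)$-injective" and "$(\mathcal{A}_L,L)$-injective" refer to the corings above. **Duals and integrals on $\mathcal{A}$.** ${}_*\mathcal{A}={}_L\mathrm{Hom}({}_LA,L)$, $\mathcal{A}_*=\mathrm{Hom}_L(A_L,L)$, $\mathcal{A}^*=\mathrm{Hom}_R(A^R,R)$, ${}^*\mathcal{A}={}_R\mathrm{Hom}({}^RA,R)$; $\mathcal{R}({}_*\mathcal{A})=\{{}_*\rho\in{}_*\mathcal{A}\mid t_L({}_*\rho(a_{(2)}))a_{(1)}=s_L({}_*\rho(a))\ \forall a\}$; $\mathcal{R}(\mathcal{A}_* )=\{\rho_*\in\mathcal{A}_*\mid s_L(\rho_*(a_{(1)}))a_{(2)}=t_L(\rho_*(a))\ \forall a\}$; $\mathcal{L}(\mathcal{A}^* )=\{\lambda^*\in\mathcal{A}^*\mid a^{(2)}t_R(\lambda^*(a^{(1)}))=s_R(\lambda^*(a))\ \forall a\}$; $\mathcal{L}({}^*\mathcal{A})=\{{}^*\lambda\in{}^*\mathcal{A}\mid a^{(1)}s_R({}^*\lambda(a^{(2)}))=t_R({}^*\lambda(a))\ \forall a\}$. *)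

theory Defs
  imports "HOL-Algebra.Module" "HOL-Algebra.Free_Abelian_Groups"
begin

section \<open>Modules over a noncommutative ring\<close>

text \<open>
  The additive group underlying a module is a \<^locale>\<open>comm_group\<close>, so it is written
  multiplicatively, as the library does for free Abelian groups: if \<open>M\<close> is a module then
  \<open>x \<otimes>\<^bsub>M\<^esub> y\<close> is the sum of \<open>x\<close> and \<open>y\<close> and \<open>\<one>\<^bsub>M\<^esub>\<close> is zero. In rings, \<open>\<oplus>\<close> and \<open>\<otimes>\<close> have
  their usual meaning.
\<close>

definition addgrp :: "('a, 'x) ring_scheme \<Rightarrow> 'a monoid"
  where "addgrp A = \<lparr>carrier = carrier A, monoid.mult = add A, one = \<zero>\<^bsub>A\<^esub>\<rparr>"

record ('b, 'm) rmodule = "'m monoid" +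
  ract :: "'m \<Rightarrow> 'b \<Rightarrow> 'm"

record ('b, 'm) lmodule = "'m monoid" +
  lact :: "'b \<Rightarrow> 'm \<Rightarrow> 'm"

locale right_module = B: ring B + M: comm_group M
  for B :: "('b, 'x) ring_scheme" and M :: "('b, 'm, 'y) rmodule_scheme" +
  assumes ract_closed: "\<lbrakk>m \<in> carrier M; b \<in> carrier B\<rbrakk> \<Longrightarrow> ract M m b \<in> carrier M"
    and ract_add_left: "\<lbrakk>m \<in> carrier M; m' \<in> carrier M; b \<in> carrier B\<rbrakk> \<Longrightarrow>
      ract M (m \<otimes>\<^bsub>M\<^esub> m') b = ract M m b \<otimes>\<^bsub>M\<^esub> ract M m' b"
    and ract_add_right: "\<lbrakk>m \<in> carrier M; b \<in> carrier B; b' \<in> carrier B\<rbrakk> \<Longrightarrow>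
      ract M m (b \<oplus>\<^bsub>B\<^esub> b') = ract M m b \<otimes>\<^bsub>M\<^esub> ract M m b'"
    and ract_mult: "\<lbrakk>m \<in> carrier M; b \<in> carrier B; b' \<in> carrier B\<rbrakk> \<Longrightarrow>
      ract M m (b \<otimes>\<^bsub>B\<^esub> b') = ract M (ract M m b) b'"
    and ract_one: "m \<in> carrier M \<Longrightarrow> ract M m \<one>\<^bsub>B\<^esub> = m"

locale left_module = B: ring B + M: comm_group M
  for B :: "('b, 'x) ring_scheme" and M :: "('b, 'm, 'y) lmodule_scheme" +
  assumes lact_closed: "\<lbrakk>m \<in> carrier M; b \<in> carrier B\<rbrakk> \<Longrightarrow> lact M b m \<in> carrier M"
    and lact_add_right: "\<lbrakk>m \<in> carrier M; m' \<in> carrier M; b \<in> carrier B\<rbrakk> \<Longrightarrow>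
      lact M b (m \<otimes>\<^bsub>M\<^esub> m') = lact M b m \<otimes>\<^bsub>M\<^esub> lact M b m'"
    and lact_add_left: "\<lbrakk>m \<in> carrier M; b \<in> carrier B; b' \<in> carrier B\<rbrakk> \<Longrightarrow>
      lact M (b \<oplus>\<^bsub>B\<^esub> b') m = lact M b m \<otimes>\<^bsub>M\<^esub> lact M b' m"
    and lact_mult: "\<lbrakk>m \<in> carrier M; b \<in> carrier B; b' \<in> carrier B\<rbrakk> \<Longrightarrow>
      lact M (b \<otimes>\<^bsub>B\<^esub> b') m = lact M b (lact M b' m)"
    and lact_one: "m \<in> carrier M \<Longrightarrow> lact M \<one>\<^bsub>B\<^esub> m = m"

definition rmod_hom ::
  "('b, 'x) ring_scheme \<Rightarrow> ('b, 'm, 'y) rmodule_scheme \<Rightarrow> ('b, 'n, 'z) rmodule_scheme \<Rightarrow> ('m \<Rightarrow> 'n) set"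
  where "rmod_hom B M N =
    {f \<in> hom M N. \<forall>m \<in> carrier M. \<forall>b \<in> carrier B. f (ract M m b) = ract N (f m) b}"

definition lmod_hom ::
  "('b, 'x) ring_scheme \<Rightarrow> ('b, 'm, 'y) lmodule_scheme \<Rightarrow> ('b, 'n, 'z) lmodule_scheme \<Rightarrow> ('m \<Rightarrow> 'n) set"
  where "lmod_hom B M N =
    {f \<in> hom M N. \<forall>m \<in> carrier M. \<forall>b \<in> carrier B. f (lact M b m) = lact N b (f m)}"

definition rreg :: "('b, 'x) ring_scheme \<Rightarrow> ('b, 'b) rmodule"
  where "rreg B = \<lparr>carrier = carrier B, monoid.mult = add B, one = \<zero>\<^bsub>B\<^esub>, ract = monoid.mult B\<rparr>"

definition lreg :: "('b, 'x) ring_scheme \<Rightarrow> ('b, 'b) lmodule"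
  where "lreg B = \<lparr>carrier = carrier B, monoid.mult = add B, one = \<zero>\<^bsub>B\<^esub>, lact = monoid.mult B\<rparr>"


section \<open>Tensor products\<close>

definition free_quot :: "'s set \<Rightarrow> ('s \<Rightarrow>\<^sub>0 int) set \<Rightarrow> ('s \<Rightarrow>\<^sub>0 int) set monoid"
  where "free_quot S Q = free_Abelian_group S Mod generate (free_Abelian_group S) Q"

definition free_cls :: "'s set \<Rightarrow> ('s \<Rightarrow>\<^sub>0 int) set \<Rightarrow> 's \<Rightarrow> ('s \<Rightarrow>\<^sub>0 int) set"
  where "free_cls S Q x =
    generate (free_Abelian_group S) Q #>\<^bsub>free_Abelian_group S\<^esub> frag_of x"

text \<open>
  \<open>tlift G f\<close> is the homomorphism from such a quotient to the Abelian group \<open>G\<close> that sends the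
  class of each generator \<open>x\<close> to \<open>f x\<close>. It is meaningful when the linear extension of \<open>f\<close> kills
  the relators; then the image of a coset under \<open>frag_eval G f\<close> is a singleton.
\<close>

definition frag_eval :: "('g, 'x) monoid_scheme \<Rightarrow> ('s \<Rightarrow> 'g) \<Rightarrow> ('s \<Rightarrow>\<^sub>0 int) \<Rightarrow> 'g"
  where "frag_eval G f c =
    finprod G (\<lambda>x. f x [^]\<^bsub>G\<^esub> Poly_Mapping.lookup c x) (Poly_Mapping.keys c)"

definition tlift :: "('g, 'x) monoid_scheme \<Rightarrow> ('s \<Rightarrow> 'g) \<Rightarrow> ('s \<Rightarrow>\<^sub>0 int) set \<Rightarrow> 'g"
  where "tlift G f X = the_elem (frag_eval G f ` X)"

definition tensor_relators ::
  "('b, 'x) ring_scheme \<Rightarrow> ('b, 'm, 'y) rmodule_scheme \<Rightarrow> ('b, 'n, 'z) lmodule_scheme \<Rightarrow> ('m \<times> 'n \<Rightarrow>\<^sub>0 int) set"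
  where "tensor_relators B M N =
    {frag_of (m \<otimes>\<^bsub>M\<^esub> m', n) - frag_of (m, n) - frag_of (m', n) | m m' n.
       m \<in> carrier M \<and> m' \<in> carrier M \<and> n \<in> carrier N} \<union>
    {frag_of (m, n \<otimes>\<^bsub>N\<^esub> n') - frag_of (m, n) - frag_of (m, n') | m n n'.
       m \<in> carrier M \<and> n \<in> carrier N \<and> n' \<in> carrier N} \<union>
    {frag_of (ract M m b, n) - frag_of (m, lact N b n) | m b n.
       m \<in> carrier M \<and> b \<in> carrier B \<and> n \<in> carrier N}"

definition tensor ::
  "('b, 'x) ring_scheme \<Rightarrow> ('b, 'm, 'y) rmodule_scheme \<Rightarrow> ('b, 'n, 'z) lmodule_scheme \<Rightarrow> ('m \<times> 'n \<Rightarrow>\<^sub>0 int) set monoid"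
  where "tensor B M N = free_quot (carrier M \<times> carrier N) (tensor_relators B M N)"

definition pten ::
  "('b, 'x) ring_scheme \<Rightarrow> ('b, 'm, 'y) rmodule_scheme \<Rightarrow> ('b, 'n, 'z) lmodule_scheme \<Rightarrow> 'm \<Rightarrow> 'n \<Rightarrow> ('m \<times> 'n \<Rightarrow>\<^sub>0 int) set"
  where "pten B M N m n = free_cls (carrier M \<times> carrier N) (tensor_relators B M N) (m, n)"

text \<open>
  \<open>tmap B M N f g\<close> is \<open>f \<otimes> g\<close> as a map into \<open>M \<otimes>\<^sub>B N\<close>.
\<close>

definition tmap ::
  "('b, 'x) ring_scheme \<Rightarrow> ('b, 'm, 'y) rmodule_scheme \<Rightarrow> ('b, 'n, 'z) lmodule_scheme \<Rightarrow>
   ('m0 \<Rightarrow> 'm) \<Rightarrow> ('n0 \<Rightarrow> 'n) \<Rightarrow> ('m0 \<times> 'n0 \<Rightarrow>\<^sub>0 int) set \<Rightarrow> ('m \<times> 'n \<Rightarrow>\<^sub>0 int) set"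
  where "tmap B M N f g = tlift (tensor B M N) (\<lambda>(x, y). pten B M N (f x) (g y))"

text \<open>
  Threefold tensor products \<open>M \<otimes>\<^sub>B N \<otimes>\<^sub>D P\<close> are formed at once, without brackets. The middle
  factor is a \<open>B\<close>-\<open>D\<close> bimodule, passed as its left \<open>B\<close>-module \<open>N\<close> and its right \<open>D\<close>-module \<open>N'\<close>
  (with the same underlying group).
\<close>

definition tensor3_relators ::
  "('b, 'x) ring_scheme \<Rightarrow> ('b, 'm, 'y) rmodule_scheme \<Rightarrow> ('b, 'n, 'z) lmodule_scheme \<Rightarrow>
   ('d, 'u) ring_scheme \<Rightarrow> ('d, 'n, 'v) rmodule_scheme \<Rightarrow> ('d, 'p, 'w) lmodule_scheme \<Rightarrow>
   ('m \<times> 'n \<times> 'p \<Rightarrow>\<^sub>0 int) set"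
  where "tensor3_relators B M N D N' P =
    {frag_of (m \<otimes>\<^bsub>M\<^esub> m', n, p) - frag_of (m, n, p) - frag_of (m', n, p) | m m' n p.
       m \<in> carrier M \<and> m' \<in> carrier M \<and> n \<in> carrier N \<and> p \<in> carrier P} \<union>
    {frag_of (m, n \<otimes>\<^bsub>N\<^esub> n', p) - frag_of (m, n, p) - frag_of (m, n', p) | m n n' p.
       m \<in> carrier M \<and> n \<in> carrier N \<and> n' \<in> carrier N \<and> p \<in> carrier P} \<union>
    {frag_of (m, n, p \<otimes>\<^bsub>P\<^esub> p') - frag_of (m, n, p) - frag_of (m, n, p') | m n p p'.
       m \<in> carrier M \<and> n \<in> carrier N \<and> p \<in> carrier P \<and> p' \<in> carrier P} \<union>
    {frag_of (ract M m b, n, p) - frag_of (m, lact N b n, p) | m b n p.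
       m \<in> carrier M \<and> b \<in> carrier B \<and> n \<in> carrier N \<and> p \<in> carrier P} \<union>
    {frag_of (m, ract N' n d, p) - frag_of (m, n, lact P d p) | m n d p.
       m \<in> carrier M \<and> n \<in> carrier N \<and> d \<in> carrier D \<and> p \<in> carrier P}"

definition tensor3 ::
  "('b, 'x) ring_scheme \<Rightarrow> ('b, 'm, 'y) rmodule_scheme \<Rightarrow> ('b, 'n, 'z) lmodule_scheme \<Rightarrow>
   ('d, 'u) ring_scheme \<Rightarrow> ('d, 'n, 'v) rmodule_scheme \<Rightarrow> ('d, 'p, 'w) lmodule_scheme \<Rightarrow>
   ('m \<times> 'n \<times> 'p \<Rightarrow>\<^sub>0 int) set monoid"
  where "tensor3 B M N D N' P =
    free_quot (carrier M \<times> carrier N \<times> carrier P) (tensor3_relators B M N D N' P)"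

definition pten3 ::
  "('b, 'x) ring_scheme \<Rightarrow> ('b, 'm, 'y) rmodule_scheme \<Rightarrow> ('b, 'n, 'z) lmodule_scheme \<Rightarrow>
   ('d, 'u) ring_scheme \<Rightarrow> ('d, 'n, 'v) rmodule_scheme \<Rightarrow> ('d, 'p, 'w) lmodule_scheme \<Rightarrow>
   'm \<Rightarrow> 'n \<Rightarrow> 'p \<Rightarrow> ('m \<times> 'n \<times> 'p \<Rightarrow>\<^sub>0 int) set"
  where "pten3 B M N D N' P m n p =
    free_cls (carrier M \<times> carrier N \<times> carrier P) (tensor3_relators B M N D N' P) (m, n, p)"

text \<open>
  \<open>ten_left B M N D N' P f\<close> is the map \<open>f \<otimes> P\<close> into \<open>M \<otimes>\<^sub>B N \<otimes>\<^sub>D P\<close>, where \<open>f\<close> takes values in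
  \<open>M \<otimes>\<^sub>B N\<close>; and \<open>ten_right B M N D N' P g\<close> is the map \<open>M \<otimes> g\<close> into \<open>M \<otimes>\<^sub>B N \<otimes>\<^sub>D P\<close>, where \<open>g\<close>
  takes values in \<open>N \<otimes>\<^sub>D P\<close>.
\<close>

definition ten_left ::
  "('b, 'x) ring_scheme \<Rightarrow> ('b, 'm, 'y) rmodule_scheme \<Rightarrow> ('b, 'n, 'z) lmodule_scheme \<Rightarrow>
   ('d, 'u) ring_scheme \<Rightarrow> ('d, 'n, 'v) rmodule_scheme \<Rightarrow> ('d, 'p, 'w) lmodule_scheme \<Rightarrow>
   ('q \<Rightarrow> ('m \<times> 'n \<Rightarrow>\<^sub>0 int) set) \<Rightarrow> ('q \<times> 'p \<Rightarrow>\<^sub>0 int) set \<Rightarrow> ('m \<times> 'n \<times> 'p \<Rightarrow>\<^sub>0 int) set"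
  where "ten_left B M N D N' P f =
    tlift (tensor3 B M N D N' P)
      (\<lambda>(q, p). tlift (tensor3 B M N D N' P) (\<lambda>(m, n). pten3 B M N D N' P m n p) (f q))"

definition ten_right ::
  "('b, 'x) ring_scheme \<Rightarrow> ('b, 'm, 'y) rmodule_scheme \<Rightarrow> ('b, 'n, 'z) lmodule_scheme \<Rightarrow>
   ('d, 'u) ring_scheme \<Rightarrow> ('d, 'n, 'v) rmodule_scheme \<Rightarrow> ('d, 'p, 'w) lmodule_scheme \<Rightarrow>
   ('q \<Rightarrow> ('n \<times> 'p \<Rightarrow>\<^sub>0 int) set) \<Rightarrow> ('m \<times> 'q \<Rightarrow>\<^sub>0 int) set \<Rightarrow> ('m \<times> 'n \<times> 'p \<Rightarrow>\<^sub>0 int) set"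
  where "ten_right B M N D N' P g =
    tlift (tensor3 B M N D N' P)
      (\<lambda>(m, q). tlift (tensor3 B M N D N' P) (\<lambda>(n, p). pten3 B M N D N' P m n p) (g q))"


section \<open>Corings and comodules\<close>

text \<open>
  A \<open>B\<close>-\<open>B\<close> bimodule is recorded by its right module \<open>crm\<close> and its left module \<open>clm\<close>, which share
  their underlying group.
\<close>

record ('b, 'c) coring =
  crm :: "('b, 'c) rmodule"
  clm :: "('b, 'c) lmodule"
  comult :: "'c \<Rightarrow> ('c \<times> 'c \<Rightarrow>\<^sub>0 int) set"
  counit :: "'c \<Rightarrow> 'b"

locale is_coring =
  R: right_module B "crm C" + L: left_module B "clm C"
  for B :: "('b, 'x) ring_scheme" and C :: "('b, 'c, 'y) coring_scheme" +
  assumes same_group: "monoid.truncate (crm C) = monoid.truncate (clm C)"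
    and acts_commute: "\<lbrakk>b \<in> carrier B; c \<in> carrier (crm C); b' \<in> carrier B\<rbrakk> \<Longrightarrow>
      ract (crm C) (lact (clm C) b c) b' = lact (clm C) b (ract (crm C) c b')"
    and comult_hom: "comult C \<in> hom (crm C) (tensor B (crm C) (clm C))"
    and comult_ract: "\<lbrakk>c \<in> carrier (crm C); b \<in> carrier B\<rbrakk> \<Longrightarrow>
      comult C (ract (crm C) c b) =
        tmap B (crm C) (clm C) (\<lambda>x. x) (\<lambda>y. ract (crm C) y b) (comult C c)"
    and comult_lact: "\<lbrakk>c \<in> carrier (crm C); b \<in> carrier B\<rbrakk> \<Longrightarrow>
      comult C (lact (clm C) b c) =
        tmap B (crm C) (clm C) (\<lambda>x. lact (clm C) b x) (\<lambda>y. y) (comult C c)"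
    and counit_right: "counit C \<in> rmod_hom B (crm C) (rreg B)"
    and counit_left: "counit C \<in> lmod_hom B (clm C) (lreg B)"
    and coassoc: "c \<in> carrier (crm C) \<Longrightarrow>
      ten_left B (crm C) (clm C) B (crm C) (clm C) (comult C) (comult C c) =
      ten_right B (crm C) (clm C) B (crm C) (clm C) (comult C) (comult C c)"
    and counital_left: "c \<in> carrier (crm C) \<Longrightarrow>
      tlift (clm C) (\<lambda>(x, y). lact (clm C) (counit C x) y) (comult C c) = c"
    and counital_right: "c \<in> carrier (crm C) \<Longrightarrow>
      tlift (crm C) (\<lambda>(x, y). ract (crm C) x (counit C y)) (comult C c) = c"

record ('b, 'm, 'c) rcomodule = "('b, 'm) rmodule" +
  rcoact :: "'m \<Rightarrow> ('m \<times> 'c \<Rightarrow>\<^sub>0 int) set"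

record ('b, 'm, 'c) lcomodule = "('b, 'm) lmodule" +
  lcoact :: "'m \<Rightarrow> ('c \<times> 'm \<Rightarrow>\<^sub>0 int) set"

locale right_comodule = right_module B M
  for B :: "('b, 'x) ring_scheme" and C :: "('b, 'c, 'y) coring_scheme"
    and M :: "('b, 'm, 'c, 'z) rcomodule_scheme" +
  assumes rcoact_hom: "rcoact M \<in> hom M (tensor B M (clm C))"
    and rcoact_ract: "\<lbrakk>m \<in> carrier M; b \<in> carrier B\<rbrakk> \<Longrightarrow>
      rcoact M (ract M m b) = tmap B M (clm C) (\<lambda>x. x) (\<lambda>c. ract (crm C) c b) (rcoact M m)"
    and rcoact_coassoc: "m \<in> carrier M \<Longrightarrow>
      ten_left B M (clm C) B (crm C) (clm C) (rcoact M) (rcoact M m) =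
      ten_right B M (clm C) B (crm C) (clm C) (comult C) (rcoact M m)"
    and rcoact_counital: "m \<in> carrier M \<Longrightarrow>
      tlift M (\<lambda>(x, c). ract M x (counit C c)) (rcoact M m) = m"

locale left_comodule = left_module B M
  for B :: "('b, 'x) ring_scheme" and C :: "('b, 'c, 'y) coring_scheme"
    and M :: "('b, 'm, 'c, 'z) lcomodule_scheme" +
  assumes lcoact_hom: "lcoact M \<in> hom M (tensor B (crm C) M)"
    and lcoact_lact: "\<lbrakk>m \<in> carrier M; b \<in> carrier B\<rbrakk> \<Longrightarrow>
      lcoact M (lact M b m) = tmap B (crm C) M (\<lambda>c. lact (clm C) b c) (\<lambda>x. x) (lcoact M m)"
    and lcoact_coassoc: "m \<in> carrier M \<Longrightarrow>
      ten_left B (crm C) (clm C) B (crm C) M (comult C) (lcoact M m) =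
      ten_right B (crm C) (clm C) B (crm C) M (lcoact M) (lcoact M m)"
    and lcoact_counital: "m \<in> carrier M \<Longrightarrow>
      tlift M (\<lambda>(c, x). lact M (counit C c) x) (lcoact M m) = m"

definition rcomod_hom ::
  "('b, 'x) ring_scheme \<Rightarrow> ('b, 'c, 'y) coring_scheme \<Rightarrow>
   ('b, 'm, 'c, 'z) rcomodule_scheme \<Rightarrow> ('b, 'n, 'c, 'w) rcomodule_scheme \<Rightarrow> ('m \<Rightarrow> 'n) set"
  where "rcomod_hom B C M N =
    {f \<in> rmod_hom B M N. \<forall>m \<in> carrier M.
       rcoact N (f m) = tmap B N (clm C) f (\<lambda>c. c) (rcoact M m)}"

definition lcomod_hom ::
  "('b, 'x) ring_scheme \<Rightarrow> ('b, 'c, 'y) coring_scheme \<Rightarrow>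
   ('b, 'm, 'c, 'z) lcomodule_scheme \<Rightarrow> ('b, 'n, 'c, 'w) lcomodule_scheme \<Rightarrow> ('m \<Rightarrow> 'n) set"
  where "lcomod_hom B C M N =
    {f \<in> lmod_hom B M N. \<forall>m \<in> carrier M.
       lcoact N (f m) = tmap B (crm C) N (\<lambda>c. c) f (lcoact M m)}"

definition splits_rmod ::
  "('b, 'x) ring_scheme \<Rightarrow> ('b, 'm, 'y) rmodule_scheme \<Rightarrow> ('b, 'n, 'z) rmodule_scheme \<Rightarrow> ('m \<Rightarrow> 'n) \<Rightarrow> bool"
  where "splits_rmod B M N f \<longleftrightarrow>
    f \<in> rmod_hom B M N \<and> (\<exists>g \<in> rmod_hom B N M. \<forall>m \<in> carrier M. g (f m) = m)"

definition splits_lmod ::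
  "('b, 'x) ring_scheme \<Rightarrow> ('b, 'm, 'y) lmodule_scheme \<Rightarrow> ('b, 'n, 'z) lmodule_scheme \<Rightarrow> ('m \<Rightarrow> 'n) \<Rightarrow> bool"
  where "splits_lmod B M N f \<longleftrightarrow>
    f \<in> lmod_hom B M N \<and> (\<exists>g \<in> lmod_hom B N M. \<forall>m \<in> carrier M. g (f m) = m)"

definition splits_rcomod ::
  "('b, 'x) ring_scheme \<Rightarrow> ('b, 'c, 'y) coring_scheme \<Rightarrow>
   ('b, 'm, 'c, 'z) rcomodule_scheme \<Rightarrow> ('b, 'n, 'c, 'w) rcomodule_scheme \<Rightarrow> ('m \<Rightarrow> 'n) \<Rightarrow> bool"
  where "splits_rcomod B C M N f \<longleftrightarrow>
    f \<in> rcomod_hom B C M N \<and> (\<exists>g \<in> rcomod_hom B C N M. \<forall>m \<in> carrier M. g (f m) = m)"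

definition splits_lcomod ::
  "('b, 'x) ring_scheme \<Rightarrow> ('b, 'c, 'y) coring_scheme \<Rightarrow>
   ('b, 'm, 'c, 'z) lcomodule_scheme \<Rightarrow> ('b, 'n, 'c, 'w) lcomodule_scheme \<Rightarrow> ('m \<Rightarrow> 'n) \<Rightarrow> bool"
  where "splits_lcomod B C M N f \<longleftrightarrow>
    f \<in> lcomod_hom B C M N \<and> (\<exists>g \<in> lcomod_hom B C N M. \<forall>m \<in> carrier M. g (f m) = m)"

text \<open>
  The monomorphisms tested here are injective: a comodule map that splits as a module map is
  injective, so the two readings of ``monomorphism'' agree on the maps in question.
  HOL cannot quantify over types inside a formula, so the test comodules \<open>N\<close> have their carrier
  in the same type as that of \<open>M\<close>.
\<close>

definition right_rel_injective ::
  "('b, 'x) ring_scheme \<Rightarrow> ('b, 'c, 'y) coring_scheme \<Rightarrow> ('b, 'm, 'c) rcomodule \<Rightarrow> bool"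
  where "right_rel_injective B C M \<longleftrightarrow>
    (\<forall>(N :: ('b, 'm, 'c) rcomodule) f.
       right_comodule B C N \<and> f \<in> rcomod_hom B C M N \<and> inj_on f (carrier M) \<and>
       splits_rmod B M N f \<longrightarrow> splits_rcomod B C M N f)"

definition left_rel_injective ::
  "('b, 'x) ring_scheme \<Rightarrow> ('b, 'c, 'y) coring_scheme \<Rightarrow> ('b, 'm, 'c) lcomodule \<Rightarrow> bool"
  where "left_rel_injective B C M \<longleftrightarrow>
    (\<forall>(N :: ('b, 'm, 'c) lcomodule) f.
       left_comodule B C N \<and> f \<in> lcomod_hom B C M N \<and> inj_on f (carrier M) \<and>
       splits_lmod B M N f \<longrightarrow> splits_lcomod B C M N f)"

text \<open>
  Bicomodule maps \<open>p : C \<otimes>\<^sub>B C \<rightarrow> C\<close>, where \<open>C \<otimes>\<^sub>B C\<close> has the left coaction \<open>comult \<otimes> C\<close> and the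
  right coaction \<open>C \<otimes> comult\<close>, both with values in \<open>C \<otimes>\<^sub>B C \<otimes>\<^sub>B C\<close>. The last two conditions are
  \<open>comult \<circ> p = (C \<otimes> p) \<circ> (comult \<otimes> C)\<close> and \<open>comult \<circ> p = (p \<otimes> C) \<circ> (C \<otimes> comult)\<close>.
\<close>

definition square_bicomod_hom ::
  "('b, 'x) ring_scheme \<Rightarrow> ('b, 'c, 'y) coring_scheme \<Rightarrow> (('c \<times> 'c \<Rightarrow>\<^sub>0 int) set \<Rightarrow> 'c) set"
  where "square_bicomod_hom B C =
    {p \<in> hom (tensor B (crm C) (clm C)) (crm C). \<forall>X \<in> carrier (tensor B (crm C) (clm C)).
       (\<forall>b \<in> carrier B.
          p (tmap B (crm C) (clm C) (\<lambda>x. x) (\<lambda>y. ract (crm C) y b) X) = ract (crm C) (p X) b \<and>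
          p (tmap B (crm C) (clm C) (\<lambda>x. lact (clm C) b x) (\<lambda>y. y) X) = lact (clm C) b (p X)) \<and>
       comult C (p X) =
         tlift (tensor B (crm C) (clm C))
           (\<lambda>(x, y, z). pten B (crm C) (clm C) x (p (pten B (crm C) (clm C) y z)))
           (ten_left B (crm C) (clm C) B (crm C) (clm C) (comult C) X) \<and>
       comult C (p X) =
         tlift (tensor B (crm C) (clm C))
           (\<lambda>(x, y, z). pten B (crm C) (clm C) (p (pten B (crm C) (clm C) x y)) z)
           (ten_right B (crm C) (clm C) B (crm C) (clm C) (comult C) X)}"

definition coseparable :: "('b, 'x) ring_scheme \<Rightarrow> ('b, 'c, 'y) coring_scheme \<Rightarrow> bool"
  where "coseparable B C \<longleftrightarrow>
    (\<exists>p \<in> square_bicomod_hom B C. \<forall>c \<in> carrier (crm C). p (comult C c) = c)"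

definition rcomod_self :: "('b, 'c, 'y) coring_scheme \<Rightarrow> ('b, 'c, 'c) rcomodule"
  where "rcomod_self C =
    \<lparr>carrier = carrier (crm C), monoid.mult = monoid.mult (crm C), one = one (crm C),
     ract = ract (crm C), rcoact = comult C\<rparr>"

definition lcomod_self :: "('b, 'c, 'y) coring_scheme \<Rightarrow> ('b, 'c, 'c) lcomodule"
  where "lcomod_self C =
    \<lparr>carrier = carrier (clm C), monoid.mult = monoid.mult (clm C), one = one (clm C),
     lact = lact (clm C), lcoact = comult C\<rparr>"


section \<open>Bialgebroids\<close>

text \<open>
  The library's \<^locale>\<open>algebra\<close> is restricted to commutative algebras.
\<close>

locale assoc_algebra = module k A + A: ring A
  for k :: "('k, 'x) ring_scheme" and A :: "('k, 'a, 'y) module_scheme" +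
  assumes smult_mult_left: "\<lbrakk>c \<in> carrier k; a \<in> carrier A; a' \<in> carrier A\<rbrakk> \<Longrightarrow>
      (c \<odot>\<^bsub>A\<^esub> a) \<otimes>\<^bsub>A\<^esub> a' = c \<odot>\<^bsub>A\<^esub> (a \<otimes>\<^bsub>A\<^esub> a')"
    and smult_mult_right: "\<lbrakk>c \<in> carrier k; a \<in> carrier A; a' \<in> carrier A\<rbrakk> \<Longrightarrow>
      a \<otimes>\<^bsub>A\<^esub> (c \<odot>\<^bsub>A\<^esub> a') = c \<odot>\<^bsub>A\<^esub> (a \<otimes>\<^bsub>A\<^esub> a')"

definition op_alg :: "('k, 'a, 'y) module_scheme \<Rightarrow> ('k, 'a, 'y) module_scheme"
  where "op_alg A = A\<lparr>monoid.mult := \<lambda>x y. y \<otimes>\<^bsub>A\<^esub> x\<rparr>"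

definition alg_hom ::
  "('k, 'x) ring_scheme \<Rightarrow> ('k, 'a, 'y) module_scheme \<Rightarrow> ('k, 'b, 'z) module_scheme \<Rightarrow> ('a \<Rightarrow> 'b) set"
  where "alg_hom k A B =
    {f \<in> ring_hom A B. \<forall>c \<in> carrier k. \<forall>a \<in> carrier A. f (c \<odot>\<^bsub>A\<^esub> a) = c \<odot>\<^bsub>B\<^esub> f a}"

text \<open>
  The module structures \<open>\<^sub>BA\<close>, \<open>A\<^sub>B\<close>, \<open>A\<^sup>B\<close>, \<open>\<^sup>BA\<close>, in this order.
\<close>

definition low_l :: "('a, 'x) ring_scheme \<Rightarrow> ('b \<Rightarrow> 'a) \<Rightarrow> ('b, 'a) lmodule"
  where "low_l A s = \<lparr>carrier = carrier A, monoid.mult = add A, one = \<zero>\<^bsub>A\<^esub>, lact = \<lambda>b a. s b \<otimes>\<^bsub>A\<^esub> a\<rparr>"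

definition low_r :: "('a, 'x) ring_scheme \<Rightarrow> ('b \<Rightarrow> 'a) \<Rightarrow> ('b, 'a) rmodule"
  where "low_r A t = \<lparr>carrier = carrier A, monoid.mult = add A, one = \<zero>\<^bsub>A\<^esub>, ract = \<lambda>a b. t b \<otimes>\<^bsub>A\<^esub> a\<rparr>"

definition up_r :: "('a, 'x) ring_scheme \<Rightarrow> ('b \<Rightarrow> 'a) \<Rightarrow> ('b, 'a) rmodule"
  where "up_r A s = \<lparr>carrier = carrier A, monoid.mult = add A, one = \<zero>\<^bsub>A\<^esub>, ract = \<lambda>a b. a \<otimes>\<^bsub>A\<^esub> s b\<rparr>"

definition up_l :: "('a, 'x) ring_scheme \<Rightarrow> ('b \<Rightarrow> 'a) \<Rightarrow> ('b, 'a) lmodule"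
  where "up_l A t = \<lparr>carrier = carrier A, monoid.mult = add A, one = \<zero>\<^bsub>A\<^esub>, lact = \<lambda>b a. a \<otimes>\<^bsub>A\<^esub> t b\<rparr>"

definition L_coring ::
  "('a, 'x) ring_scheme \<Rightarrow> ('b \<Rightarrow> 'a) \<Rightarrow> ('b \<Rightarrow> 'a) \<Rightarrow> ('a \<Rightarrow> ('a \<times> 'a \<Rightarrow>\<^sub>0 int) set) \<Rightarrow> ('a \<Rightarrow> 'b) \<Rightarrow> ('b, 'a) coring"
  where "L_coring A s t \<gamma> \<pi> = \<lparr>crm = low_r A t, clm = low_l A s, comult = \<gamma>, counit = \<pi>\<rparr>"

definition R_coring ::
  "('a, 'x) ring_scheme \<Rightarrow> ('b \<Rightarrow> 'a) \<Rightarrow> ('b \<Rightarrow> 'a) \<Rightarrow> ('a \<Rightarrow> ('a \<times> 'a \<Rightarrow>\<^sub>0 int) set) \<Rightarrow> ('a \<Rightarrow> 'b) \<Rightarrow> ('b, 'a) coring"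
  where "R_coring A s t \<gamma> \<pi> = \<lparr>crm = up_r A s, clm = up_l A t, comult = \<gamma>, counit = \<pi>\<rparr>"

text \<open>
  The factorwise product \<open>(\<Sum> x \<otimes> y) (\<Sum> x' \<otimes> y') = \<Sum> x x' \<otimes> y y'\<close>, in \<open>A\<^sub>L \<otimes> \<^sub>LA\<close>. It is
  well defined if the left factor satisfies \<open>\<Sum> x t(l) \<otimes> y = \<Sum> x \<otimes> y s(l)\<close>.
\<close>

definition low_tmult ::
  "('b, 'x) ring_scheme \<Rightarrow> ('a, 'y) ring_scheme \<Rightarrow> ('b \<Rightarrow> 'a) \<Rightarrow> ('b \<Rightarrow> 'a) \<Rightarrow>
   ('a \<times> 'a \<Rightarrow>\<^sub>0 int) set \<Rightarrow> ('a \<times> 'a \<Rightarrow>\<^sub>0 int) set \<Rightarrow> ('a \<times> 'a \<Rightarrow>\<^sub>0 int) set"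
  where "low_tmult L A s t X Y =
    tlift (tensor L (low_r A t) (low_l A s))
      (\<lambda>(x', y'). tmap L (low_r A t) (low_l A s) (\<lambda>x. x \<otimes>\<^bsub>A\<^esub> x') (\<lambda>y. y \<otimes>\<^bsub>A\<^esub> y') X) Y"

locale left_bialgebroid =
  A: assoc_algebra k A + L: assoc_algebra k L + is_coring L "L_coring A s t \<gamma> \<pi>"
  for k :: "('k, 'x) ring_scheme" and A :: "('k, 'a, 'y) module_scheme"
    and L :: "('k, 'l, 'z) module_scheme" and s :: "'l \<Rightarrow> 'a" and t :: "'l \<Rightarrow> 'a"
    and \<gamma> :: "'a \<Rightarrow> ('a \<times> 'a \<Rightarrow>\<^sub>0 int) set" and \<pi> :: "'a \<Rightarrow> 'l" +
  assumes source_hom: "s \<in> alg_hom k L A"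
    and target_hom: "t \<in> alg_hom k (op_alg L) A"
    and ranges_commute: "\<lbrakk>l \<in> carrier L; l' \<in> carrier L\<rbrakk> \<Longrightarrow> s l \<otimes>\<^bsub>A\<^esub> t l' = t l' \<otimes>\<^bsub>A\<^esub> s l"
    and takeuchi: "\<lbrakk>a \<in> carrier A; l \<in> carrier L\<rbrakk> \<Longrightarrow>
      tmap L (low_r A t) (low_l A s) (\<lambda>x. x \<otimes>\<^bsub>A\<^esub> t l) (\<lambda>y. y) (\<gamma> a) =
      tmap L (low_r A t) (low_l A s) (\<lambda>x. x) (\<lambda>y. y \<otimes>\<^bsub>A\<^esub> s l) (\<gamma> a)"
    and comult_one: "\<gamma> \<one>\<^bsub>A\<^esub> = pten L (low_r A t) (low_l A s) \<one>\<^bsub>A\<^esub> \<one>\<^bsub>A\<^esub>"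
    and comult_mult: "\<lbrakk>a \<in> carrier A; a' \<in> carrier A\<rbrakk> \<Longrightarrow>
      \<gamma> (a \<otimes>\<^bsub>A\<^esub> a') = low_tmult L A s t (\<gamma> a) (\<gamma> a')"
    and counit_one: "\<pi> \<one>\<^bsub>A\<^esub> = \<one>\<^bsub>L\<^esub>"
    and counit_source: "\<lbrakk>a \<in> carrier A; a' \<in> carrier A\<rbrakk> \<Longrightarrow> \<pi> (a \<otimes>\<^bsub>A\<^esub> s (\<pi> a')) = \<pi> (a \<otimes>\<^bsub>A\<^esub> a')"
    and counit_target: "\<lbrakk>a \<in> carrier A; a' \<in> carrier A\<rbrakk> \<Longrightarrow> \<pi> (a \<otimes>\<^bsub>A\<^esub> t (\<pi> a')) = \<pi> (a \<otimes>\<^bsub>A\<^esub> a')"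

definition right_bialgebroid ::
  "('k, 'x) ring_scheme \<Rightarrow> ('k, 'a, 'y) module_scheme \<Rightarrow> ('k, 'r, 'z) module_scheme \<Rightarrow>
   ('r \<Rightarrow> 'a) \<Rightarrow> ('r \<Rightarrow> 'a) \<Rightarrow> ('a \<Rightarrow> ('a \<times> 'a \<Rightarrow>\<^sub>0 int) set) \<Rightarrow> ('a \<Rightarrow> 'r) \<Rightarrow> bool"
  where "right_bialgebroid k A R s t \<gamma> \<pi> \<longleftrightarrow> left_bialgebroid k (op_alg A) R t s \<gamma> \<pi>"

text \<open>
  Passing to the opposite algebra turns \<open>\<^sub>RA\<^sub>R\<close> into \<open>\<^sup>RA\<^sup>R\<close>, so a right bialgebroid has the coring
  that it should have.
\<close>

lemma L_coring_op_alg: "L_coring (op_alg A) t s \<gamma> \<pi> = R_coring A s t \<gamma> \<pi>"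
  by (simp add: L_coring_def R_coring_def low_r_def low_l_def up_r_def up_l_def op_alg_def)


section \<open>Hopf algebroids and integrals\<close>

locale hopf_algebroid =
  fixes k :: "('k, 'x) ring_scheme" and A :: "('k, 'a, 'y) module_scheme"
    and L :: "('k, 'l, 'z) module_scheme" and s\<^sub>L :: "'l \<Rightarrow> 'a" and t\<^sub>L :: "'l \<Rightarrow> 'a"
    and \<gamma>\<^sub>L :: "'a \<Rightarrow> ('a \<times> 'a \<Rightarrow>\<^sub>0 int) set" and \<pi>\<^sub>L :: "'a \<Rightarrow> 'l"
    and R :: "('k, 'r, 'w) module_scheme" and s\<^sub>R :: "'r \<Rightarrow> 'a" and t\<^sub>R :: "'r \<Rightarrow> 'a"
    and \<gamma>\<^sub>R :: "'a \<Rightarrow> ('a \<times> 'a \<Rightarrow>\<^sub>0 int) set" and \<pi>\<^sub>R :: "'a \<Rightarrow> 'r"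
    and S :: "'a \<Rightarrow> 'a"
  assumes left_bialgebroid: "left_bialgebroid k A L s\<^sub>L t\<^sub>L \<gamma>\<^sub>L \<pi>\<^sub>L"
    and right_bialgebroid: "right_bialgebroid k A R s\<^sub>R t\<^sub>R \<gamma>\<^sub>R \<pi>\<^sub>R"
    and antipode_hom: "S \<in> hom (addgrp A) (addgrp A)"
    and antipode_smult: "\<lbrakk>c \<in> carrier k; a \<in> carrier A\<rbrakk> \<Longrightarrow> S (c \<odot>\<^bsub>A\<^esub> a) = c \<odot>\<^bsub>A\<^esub> S a"
    and sL_piL_tR: "r \<in> carrier R \<Longrightarrow> s\<^sub>L (\<pi>\<^sub>L (t\<^sub>R r)) = t\<^sub>R r"
    and tL_piL_sR: "r \<in> carrier R \<Longrightarrow> t\<^sub>L (\<pi>\<^sub>L (s\<^sub>R r)) = s\<^sub>R r"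
    and sR_piR_tL: "l \<in> carrier L \<Longrightarrow> s\<^sub>R (\<pi>\<^sub>R (t\<^sub>L l)) = t\<^sub>L l"
    and tR_piR_sL: "l \<in> carrier L \<Longrightarrow> t\<^sub>R (\<pi>\<^sub>R (s\<^sub>L l)) = s\<^sub>L l"
    and coassoc_LR: "a \<in> carrier A \<Longrightarrow>
      ten_left L (low_r A t\<^sub>L) (low_l A s\<^sub>L) R (up_r A s\<^sub>R) (up_l A t\<^sub>R) \<gamma>\<^sub>L (\<gamma>\<^sub>R a) =
      ten_right L (low_r A t\<^sub>L) (low_l A s\<^sub>L) R (up_r A s\<^sub>R) (up_l A t\<^sub>R) \<gamma>\<^sub>R (\<gamma>\<^sub>L a)"
    and coassoc_RL: "a \<in> carrier A \<Longrightarrow>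
      ten_left R (up_r A s\<^sub>R) (up_l A t\<^sub>R) L (low_r A t\<^sub>L) (low_l A s\<^sub>L) \<gamma>\<^sub>R (\<gamma>\<^sub>L a) =
      ten_right R (up_r A s\<^sub>R) (up_l A t\<^sub>R) L (low_r A t\<^sub>L) (low_l A s\<^sub>L) \<gamma>\<^sub>L (\<gamma>\<^sub>R a)"
    and antipode_L: "\<lbrakk>a \<in> carrier A; l \<in> carrier L; l' \<in> carrier L\<rbrakk> \<Longrightarrow>
      S (t\<^sub>L l' \<otimes>\<^bsub>A\<^esub> a \<otimes>\<^bsub>A\<^esub> t\<^sub>L l) = s\<^sub>L l \<otimes>\<^bsub>A\<^esub> S a \<otimes>\<^bsub>A\<^esub> s\<^sub>L l'"
    and antipode_R: "\<lbrakk>a \<in> carrier A; r \<in> carrier R; r' \<in> carrier R\<rbrakk> \<Longrightarrow>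
      S (t\<^sub>R r' \<otimes>\<^bsub>A\<^esub> a \<otimes>\<^bsub>A\<^esub> t\<^sub>R r) = s\<^sub>R r \<otimes>\<^bsub>A\<^esub> S a \<otimes>\<^bsub>A\<^esub> s\<^sub>R r'"
    and antipode_left_inv: "a \<in> carrier A \<Longrightarrow>
      tlift (addgrp A) (\<lambda>(x, y). S x \<otimes>\<^bsub>A\<^esub> y) (\<gamma>\<^sub>L a) = s\<^sub>R (\<pi>\<^sub>R a)"
    and antipode_right_inv: "a \<in> carrier A \<Longrightarrow>
      tlift (addgrp A) (\<lambda>(x, y). x \<otimes>\<^bsub>A\<^esub> S y) (\<gamma>\<^sub>R a) = s\<^sub>L (\<pi>\<^sub>L a)"

text \<open>
  The base algebra as a comodule: over the right bialgebroid by \<open>r \<mapsto> 1 \<otimes> s(r)\<close> and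
  \<open>r \<mapsto> t(r) \<otimes> 1\<close>, over the left bialgebroid by \<open>l \<mapsto> s(l) \<otimes> 1\<close> and \<open>l \<mapsto> 1 \<otimes> t(l)\<close>. The first
  factor, respectively the second, is the unit of the base algebra. The coring serves only to
  form the tensor product in which the coaction takes its values.
\<close>

definition base_rcomod :: "('b, 'x) ring_scheme \<Rightarrow> ('b, 'c, 'y) coring_scheme \<Rightarrow> ('b \<Rightarrow> 'c) \<Rightarrow> ('b, 'b, 'c) rcomodule"
  where "base_rcomod B C u =
    \<lparr>carrier = carrier B, monoid.mult = add B, one = \<zero>\<^bsub>B\<^esub>, ract = monoid.mult B,
     rcoact = \<lambda>b. pten B (rreg B) (clm C) \<one>\<^bsub>B\<^esub> (u b)\<rparr>"

definition base_lcomod :: "('b, 'x) ring_scheme \<Rightarrow> ('b, 'c, 'y) coring_scheme \<Rightarrow> ('b \<Rightarrow> 'c) \<Rightarrow> ('b, 'b, 'c) lcomodule"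
  where "base_lcomod B C u =
    \<lparr>carrier = carrier B, monoid.mult = add B, one = \<zero>\<^bsub>B\<^esub>, lact = monoid.mult B,
     lcoact = \<lambda>b. pten B (crm C) (lreg B) (u b) \<one>\<^bsub>B\<^esub>\<rparr>"

text \<open>
  Integrals on a Hopf algebroid. The left ones involve only the right bialgebroid and the right
  ones only the left bialgebroid.
\<close>

definition left_s_integrals ::
  "('a, 'x) ring_scheme \<Rightarrow> ('r, 'z) ring_scheme \<Rightarrow> ('r \<Rightarrow> 'a) \<Rightarrow> ('r \<Rightarrow> 'a) \<Rightarrow>
   ('a \<Rightarrow> ('a \<times> 'a \<Rightarrow>\<^sub>0 int) set) \<Rightarrow> ('a \<Rightarrow> 'r) set"
  where "left_s_integrals A R s\<^sub>R t\<^sub>R \<gamma>\<^sub>R =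
    {\<phi> \<in> rmod_hom R (up_r A s\<^sub>R) (rreg R). \<forall>a \<in> carrier A.
       tlift (addgrp A) (\<lambda>(x, y). y \<otimes>\<^bsub>A\<^esub> t\<^sub>R (\<phi> x)) (\<gamma>\<^sub>R a) = s\<^sub>R (\<phi> a)}"

definition left_t_integrals ::
  "('a, 'x) ring_scheme \<Rightarrow> ('r, 'z) ring_scheme \<Rightarrow> ('r \<Rightarrow> 'a) \<Rightarrow> ('r \<Rightarrow> 'a) \<Rightarrow>
   ('a \<Rightarrow> ('a \<times> 'a \<Rightarrow>\<^sub>0 int) set) \<Rightarrow> ('a \<Rightarrow> 'r) set"
  where "left_t_integrals A R s\<^sub>R t\<^sub>R \<gamma>\<^sub>R =
    {\<phi> \<in> lmod_hom R (up_l A t\<^sub>R) (lreg R). \<forall>a \<in> carrier A.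
       tlift (addgrp A) (\<lambda>(x, y). x \<otimes>\<^bsub>A\<^esub> s\<^sub>R (\<phi> y)) (\<gamma>\<^sub>R a) = t\<^sub>R (\<phi> a)}"

definition right_s_integrals ::
  "('a, 'x) ring_scheme \<Rightarrow> ('l, 'z) ring_scheme \<Rightarrow> ('l \<Rightarrow> 'a) \<Rightarrow> ('l \<Rightarrow> 'a) \<Rightarrow>
   ('a \<Rightarrow> ('a \<times> 'a \<Rightarrow>\<^sub>0 int) set) \<Rightarrow> ('a \<Rightarrow> 'l) set"
  where "right_s_integrals A L s\<^sub>L t\<^sub>L \<gamma>\<^sub>L =
    {\<phi> \<in> lmod_hom L (low_l A s\<^sub>L) (lreg L). \<forall>a \<in> carrier A.
       tlift (addgrp A) (\<lambda>(x, y). t\<^sub>L (\<phi> y) \<otimes>\<^bsub>A\<^esub> x) (\<gamma>\<^sub>L a) = s\<^sub>L (\<phi> a)}"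

definition right_t_integrals ::
  "('a, 'x) ring_scheme \<Rightarrow> ('l, 'z) ring_scheme \<Rightarrow> ('l \<Rightarrow> 'a) \<Rightarrow> ('l \<Rightarrow> 'a) \<Rightarrow>
   ('a \<Rightarrow> ('a \<times> 'a \<Rightarrow>\<^sub>0 int) set) \<Rightarrow> ('a \<Rightarrow> 'l) set"
  where "right_t_integrals A L s\<^sub>L t\<^sub>L \<gamma>\<^sub>L =
    {\<phi> \<in> rmod_hom L (low_r A t\<^sub>L) (rreg L). \<forall>a \<in> carrier A.
       tlift (addgrp A) (\<lambda>(x, y). s\<^sub>L (\<phi> x) \<otimes>\<^bsub>A\<^esub> y) (\<gamma>\<^sub>L a) = t\<^sub>L (\<phi> a)}"

definition all_equivalent :: "bool list \<Rightarrow> bool"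
  where "all_equivalent Ps \<longleftrightarrow> (\<forall>P \<in> set Ps. \<forall>Q \<in> set Ps. P \<longleftrightarrow> Q)"

text \<open>
  Comodules in statements about all comodules have their carriers in a type that contains a copy
  of \<open>A\<close>, \<open>L\<close> and \<open>R\<close> and in which \<open>'m\<close> is arbitrary. As \<open>'m\<close> is free, such a statement covers
  comodules of any size; the first three summands only ensure that the type is never too small
  to contain the base and total algebras.
\<close>

type_synonym ('a, 'l, 'r, 'm) univ = "'a + 'l + 'r + 'm"

end

theory Submission
  imports Defs
begin

text \<open>
  In Sweedler notation the implications are as follows. A bicolinear splitting \<open>p\<close> of a
  comultiplication gives \<open>\<theta> = \<epsilon> \<circ> p\<close>, and a \<open>B\<close>-linear retraction \<open>g\<close> of a comodule map into \<open>N\<close>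
  is averaged to the colinear retraction \<open>n \<mapsto> g(n\<^sub>0)\<^sub>0 \<theta>(g(n\<^sub>0)\<^sub>1, n\<^sub>1)\<close>. Relative injectivity of the
  base algebra, applied to the source or target map, which the counit splits, gives a colinear
  retraction of that map, and this is a normalized integral.

  An \<open>s\<close>-integral over one bialgebroid is a \<open>t\<close>-integral over the other one: \<open>\<phi>\<close> and \<open>\<pi>\<^sub>L s\<^sub>R \<phi>\<close>
  correspond, by the mixed coassociativity. Finally a normalized right \<open>t\<close>-integral \<open>\<rho>\<close> splits
  \<open>\<gamma>\<^sub>L\<close> by \<open>a \<otimes> b \<mapsto> a\<^sup>1 t\<^sub>L(\<rho>(S(a\<^sup>2) b))\<close>. On the elements \<open>u\<^sub>1 \<otimes> u\<^sub>2v\<close>, which span \<open>A\<^sub>L \<otimes> \<^sub>LA\<close>, this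
  map is \<open>u t\<^sub>L(\<rho>(v))\<close>, so that its colinearity needs neither the bijectivity nor the
  (co)multiplicativity of \<open>S\<close>. The left \<open>t\<close>-integrals are treated symmetrically.
\<close>

section \<open>Quotients of free Abelian groups\<close>

text \<open>Tensors are cosets, and a Sweedler sum is \<open>tlift\<close> of a function on pairs,
  which has a meaning only if that function is balanced. Hence every rewriting of a sum is
  accompanied by a balancedness proof, and these make up much of the bulk. Threefold tensor products
  carry no brackets, so a coassociativity law is an equality in a single group; it is used by
  evaluating a trilinear map on both sides, which exchanges nested sums. Two further points shape
  the argument. Relative injectivity quantifies over one carrier type, while the base algebra and
  \<open>A\<close> have different types, so comodules are transported along injections into a common
  type. And only t-integrals are used to construct splittings: an s-integral reaches coseparability
  through the coring over the other base algebra, and these crossings tie the implications for the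
  two corings together.\<close>

lemma (in comm_group) frag_eval_superset:
  assumes f: "f \<in> S \<rightarrow> carrier G" and K: "finite K" "Poly_Mapping.keys c \<subseteq> K" "K \<subseteq> S"
  shows "frag_eval G f c = (\<Otimes>x\<in>K. f x [^] Poly_Mapping.lookup c x)"
  unfolding frag_eval_def
  by (rule finprod_mono_neutral_cong_left) (use f K in \<open>auto simp: in_keys_iff\<close>)

lemma (in comm_group) frag_eval_hom:
  assumes f: "f \<in> S \<rightarrow> carrier G"
  shows "frag_eval G f \<in> hom (free_Abelian_group S) G"
proof (rule homI)
  show "frag_eval G f c \<in> carrier G" if "c \<in> carrier (free_Abelian_group S)" for c
    unfolding frag_eval_def by (rule finprod_closed) (use f that in auto)
  show "frag_eval G f (c \<otimes>\<^bsub>free_Abelian_group S\<^esub> d) = frag_eval G f c \<otimes> frag_eval G f d"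
    if "c \<in> carrier (free_Abelian_group S)" "d \<in> carrier (free_Abelian_group S)" for c d
  proof -
    \<comment> \<open>Coefficients may cancel in \<open>c + d\<close>, so its keys can be fewer than
      \<open>?K\<close>; the three products are compared over this common index set, where the extra
      factors are zeroth powers.\<close>
    let ?K = "Poly_Mapping.keys c \<union> Poly_Mapping.keys d"
    have K: "finite ?K" "?K \<subseteq> S" and fK: "f \<in> ?K \<rightarrow> carrier G"
      using that f by auto
    have "frag_eval G f (c + d) = (\<Otimes>x\<in>?K. f x [^] Poly_Mapping.lookup (c + d) x)"
      using frag_eval_superset[OF f K(1) keys_add K(2)] .
    also have "\<dots> = (\<Otimes>x\<in>?K. f x [^] Poly_Mapping.lookup c x \<otimes> f x [^] Poly_Mapping.lookup d x)"
      by (rule finprod_cong') (use fK in \<open>auto simp: Poly_Mapping.lookup_add int_pow_mult Pi_iff\<close>)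
    also have "\<dots> = (\<Otimes>x\<in>?K. f x [^] Poly_Mapping.lookup c x) \<otimes> (\<Otimes>x\<in>?K. f x [^] Poly_Mapping.lookup d x)"
      by (rule finprod_multf) (use fK in auto)
    also have "\<dots> = frag_eval G f c \<otimes> frag_eval G f d"
      using frag_eval_superset[OF f K(1) _ K(2), of c] frag_eval_superset[OF f K(1) _ K(2), of d]
      by simp
    finally show ?thesis by simp
  qed
qed

lemma (in comm_group) frag_eval_of:
  assumes "f x \<in> carrier G"
  shows "frag_eval G f (frag_of x) = f x"
  using assms by (simp add: frag_eval_def finprod_singleton_swap)

locale free_quotient =
  fixes S :: "'s set" and Q :: "('s \<Rightarrow>\<^sub>0 int) set"
  assumes relators: "Q \<subseteq> carrier (free_Abelian_group S)"
begin

abbreviation "F \<equiv> free_Abelian_group S"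
abbreviation "H \<equiv> generate F Q"

lemma comm_group_F: "comm_group F"
  by (rule abelian_free_Abelian_group)

lemma subgroup_H: "subgroup H F"
  by (rule group.generate_is_subgroup) (use relators in auto)

lemma normal_H: "H \<lhd> F"
  by (rule comm_group.subgroup_imp_normal[OF comm_group_F subgroup_H])

lemma comm_group_free_quot: "comm_group (free_quot S Q)"
  unfolding free_quot_def by (rule comm_group.abelian_FactGroup[OF comm_group_F subgroup_H])

lemma coset_hom: "(\<lambda>c. H #>\<^bsub>F\<^esub> c) \<in> hom F (free_quot S Q)"
  unfolding free_quot_def by (rule normal.r_coset_hom_Mod[OF normal_H])

lemma free_cls_closed: "x \<in> S \<Longrightarrow> free_cls S Q x \<in> carrier (free_quot S Q)"
  using coset_hom by (auto simp: free_cls_def hom_def Pi_iff)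

lemma coset_H_mult:
  assumes "h \<in> H" "c \<in> carrier F"
  shows "H #>\<^bsub>F\<^esub> (h + c) = H #>\<^bsub>F\<^esub> c"
proof -
  interpret F: comm_group F by (rule comm_group_F)
  have hF: "h \<in> carrier F" using subgroup.subset[OF subgroup_H] assms by blast
  have "H #>\<^bsub>F\<^esub> (h \<otimes>\<^bsub>F\<^esub> c) = (H #>\<^bsub>F\<^esub> h) #>\<^bsub>F\<^esub> c"
    by (rule F.coset_mult_assoc[symmetric]) (use subgroup.subset[OF subgroup_H] assms hF in auto)
  also have "H #>\<^bsub>F\<^esub> h = H"
    by (rule F.coset_join2) (use subgroup_H assms hF in auto)
  finally show ?thesis by simp
qed

lemma free_cls_eq:
  assumes "frag_of x - frag_of y \<in> Q" "x \<in> S" "y \<in> S"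
  shows "free_cls S Q x = free_cls S Q y"
  using coset_H_mult[OF generate.incl[OF assms(1)], of "frag_of y"] assms(2,3)
  by (simp add: free_cls_def)

lemma free_cls_add:
  assumes "frag_of x - frag_of y - frag_of z \<in> Q" "x \<in> S" "y \<in> S" "z \<in> S"
  shows "free_cls S Q x = free_cls S Q y \<otimes>\<^bsub>free_quot S Q\<^esub> free_cls S Q z"
proof -
  have yz: "frag_of y \<in> carrier F" "frag_of z \<in> carrier F"
    using assms by auto
  have *: "frag_of y + frag_of z \<in> carrier F"
    using monoid.m_closed[OF comm_monoid.axioms(1)[OF comm_group.axioms(1)[OF comm_group_F]] yz] by simp
  have "free_cls S Q x = H #>\<^bsub>F\<^esub> ((frag_of x - frag_of y - frag_of z) + (frag_of y + frag_of z))"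
    by (simp add: free_cls_def)
  also have "\<dots> = H #>\<^bsub>F\<^esub> (frag_of y + frag_of z)"
    by (rule coset_H_mult[OF generate.incl[OF assms(1)] *])
  also have "\<dots> = free_cls S Q y \<otimes>\<^bsub>free_quot S Q\<^esub> free_cls S Q z"
    using hom_mult[OF coset_hom yz] by (simp add: free_cls_def)
  finally show ?thesis .
qed

text \<open>Every coset has a representative in the free group, and induction over integer
  combinations reduces the claim to generators. For tensor products this means that additive maps
  need to be compared on pure tensors only.\<close>

lemma free_quot_ext:
  assumes "group G" and F1: "F1 \<in> hom (free_quot S Q) G" and F2: "F2 \<in> hom (free_quot S Q) G"
    and eq: "\<And>x. x \<in> S \<Longrightarrow> F1 (free_cls S Q x) = F2 (free_cls S Q x)"
    and X: "X \<in> carrier (free_quot S Q)"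
  shows "F1 X = F2 X"
proof -
  obtain c where c: "c \<in> carrier F" "X = H #>\<^bsub>F\<^esub> c"
    using X by (auto simp: free_quot_def carrier_FactGroup)
  interpret G1: group_hom F G "\<lambda>c. F1 (H #>\<^bsub>F\<^esub> c)"
    using hom_compose[OF coset_hom F1] assms(1)
    by (simp add: group_hom_def group_hom_axioms_def comp_def)
  interpret G2: group_hom F G "\<lambda>c. F2 (H #>\<^bsub>F\<^esub> c)"
    using hom_compose[OF coset_hom F2] assms(1)
    by (simp add: group_hom_def group_hom_axioms_def comp_def)
  from c(1) have "Poly_Mapping.keys c \<subseteq> S" by simp
  then have "F1 (H #>\<^bsub>F\<^esub> c) = F2 (H #>\<^bsub>F\<^esub> c)"
  proof (induction rule: free_Abelian_group_induct[consumes 1, case_names zero diff gen])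
    case zero
    show ?case using G1.hom_one G2.hom_one by simp
  next
    case (diff x y)
    have yF: "y \<in> carrier F" "x \<in> carrier F" "- y \<in> carrier F" using diff by auto
    have d: "x - y = x \<otimes>\<^bsub>F\<^esub> inv\<^bsub>F\<^esub> y" using diff by simp
    show ?case
      unfolding d using diff yF G1.hom_mult[of x "inv\<^bsub>F\<^esub> y"] G2.hom_mult[of x "inv\<^bsub>F\<^esub> y"]
        G1.hom_inv[of y] G2.hom_inv[of y] by simp
  next
    case (gen a)
    then show ?case using eq[of a] by (simp add: free_cls_def)
  qed
  with c show ?thesis by simp
qed

context
  fixes G :: "('g, 'x) monoid_scheme" and f :: "'s \<Rightarrow> 'g"
  assumes G: "comm_group G" and f: "f \<in> S \<rightarrow> carrier G"
    and kills: "\<And>q. q \<in> Q \<Longrightarrow> frag_eval G f q = \<one>\<^bsub>G\<^esub>"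
begin

text \<open>The kernel of the linear extension is a subgroup, so killing the relators
  suffices.\<close>

lemma frag_eval_generate: "h \<in> H \<Longrightarrow> frag_eval G f h = \<one>\<^bsub>G\<^esub>"
proof (induction rule: generate.induct)
  interpret E: group_hom F G "frag_eval G f"
    using comm_group.frag_eval_hom[OF G f] G
    by (simp add: group_hom_def group_hom_axioms_def comm_group_def)
  {
    case one
    show ?case using E.hom_one .
  next
    case (incl h)
    then show ?case by (rule kills)
  next
    case (inv h)
    then show ?case using kills relators by (subst E.hom_inv) (auto simp: subset_iff)
  next
    case (eng h1 h2)
    then show ?case
      using E.hom_mult[of h1 h2] subgroup.subset[OF subgroup_H] by (simp add: subset_iff)
  }
qed

text \<open>Changing the representative by an element of \<open>H\<close> multiplies the value by
  the unit. The image of the coset is therefore a singleton, and \<open>the_elem\<close> in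
  \<open>tlift\<close> returns the intended value.\<close>

lemma tlift_coset:
  assumes "c \<in> carrier F"
  shows "tlift G f (H #>\<^bsub>F\<^esub> c) = frag_eval G f c"
proof -
  interpret E: group_hom F G "frag_eval G f"
    using comm_group.frag_eval_hom[OF G f] G
    by (simp add: group_hom_def group_hom_axioms_def comm_group_def)
  have HF: "H \<subseteq> carrier F" by (rule subgroup.subset[OF subgroup_H])
  have "frag_eval G f (h + c) = frag_eval G f c" if "h \<in> H" for h
    using E.hom_mult[of h c] frag_eval_generate[OF that] HF that assms by (auto simp del: E.hom_mult)
  moreover have "H \<noteq> {}" using generate.one by blast
  ultimately have "frag_eval G f ` (H #>\<^bsub>F\<^esub> c) = {frag_eval G f c}"
    by (auto simp: r_coset_def image_UN)
  then show ?thesis by (simp add: tlift_def)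
qed

lemma tlift_free_cls: "x \<in> S \<Longrightarrow> tlift G f (free_cls S Q x) = f x"
  using f by (simp add: free_cls_def tlift_coset comm_group.frag_eval_of[OF G] Pi_iff)

lemma tlift_free_quot_hom: "tlift G f \<in> hom (free_quot S Q) G"
proof (rule homI)
  fix X Y assume X: "X \<in> carrier (free_quot S Q)" and Y: "Y \<in> carrier (free_quot S Q)"
  then obtain c d where c: "c \<in> carrier F" "X = H #>\<^bsub>F\<^esub> c" and d: "d \<in> carrier F" "Y = H #>\<^bsub>F\<^esub> d"
    by (auto simp: free_quot_def carrier_FactGroup)
  have E: "frag_eval G f \<in> hom F G" by (rule comm_group.frag_eval_hom[OF G f])
  show "tlift G f X \<in> carrier G"
    using hom_in_carrier[OF E c(1)] c by (simp add: tlift_coset)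
  have "X \<otimes>\<^bsub>free_quot S Q\<^esub> Y = H #>\<^bsub>F\<^esub> (c \<otimes>\<^bsub>F\<^esub> d)"
    using hom_mult[OF coset_hom c(1) d(1)] c d by simp
  moreover have "c \<otimes>\<^bsub>F\<^esub> d \<in> carrier F"
    using c(1) d(1) group.is_monoid[OF group_free_Abelian_group] by (metis monoid.m_closed)
  ultimately show "tlift G f (X \<otimes>\<^bsub>free_quot S Q\<^esub> Y) = tlift G f X \<otimes>\<^bsub>G\<^esub> tlift G f Y"
    using c d hom_mult[OF E c(1) d(1)] by (metis tlift_coset)
qed

end

end

lemma (in comm_group) frag_eval_diff:
  assumes f: "f \<in> S \<rightarrow> carrier G" and "x \<in> S" "y \<in> S" and eq: "f x = f y"
  shows "frag_eval G f (frag_of x - frag_of y) = \<one>"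
proof -
  interpret E: group_hom "free_Abelian_group S" G "frag_eval G f"
    using frag_eval_hom[OF f] by (simp add: group_hom_def group_hom_axioms_def is_group)
  have xy: "frag_of x \<in> carrier (free_Abelian_group S)" "frag_of y \<in> carrier (free_Abelian_group S)"
    using assms by auto
  have c: "f x \<in> carrier G" "f y \<in> carrier G" using assms by auto
  have "frag_of x - frag_of y = frag_of x \<otimes>\<^bsub>free_Abelian_group S\<^esub> inv\<^bsub>free_Abelian_group S\<^esub> frag_of y"
    using assms by simp
  then have "frag_eval G f (frag_of x - frag_of y) = frag_eval G f (frag_of x) \<otimes> inv (frag_eval G f (frag_of y))"
    using E.hom_mult[OF xy(1) E.G.inv_closed[OF xy(2)]] E.hom_inv[OF xy(2)] by (simp only:)
  then show ?thesis using c eq by (simp add: frag_eval_of)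
qed

lemma (in comm_group) frag_eval_diff_diff:
  assumes f: "f \<in> S \<rightarrow> carrier G" and "x \<in> S" "y \<in> S" "z \<in> S" and eq: "f x = f y \<otimes> f z"
  shows "frag_eval G f (frag_of x - frag_of y - frag_of z) = \<one>"
proof -
  interpret E: group_hom "free_Abelian_group S" G "frag_eval G f"
    using frag_eval_hom[OF f] by (simp add: group_hom_def group_hom_axioms_def is_group)
  let ?F = "free_Abelian_group S"
  have xy: "frag_of x \<in> carrier ?F" "frag_of y \<in> carrier ?F" "frag_of z \<in> carrier ?F"
    using assms by auto
  have c: "f x \<in> carrier G" "f y \<in> carrier G" "f z \<in> carrier G" using assms by auto
  have "frag_of x - frag_of y - frag_of z = frag_of x \<otimes>\<^bsub>?F\<^esub> inv\<^bsub>?F\<^esub> frag_of y \<otimes>\<^bsub>?F\<^esub> inv\<^bsub>?F\<^esub> frag_of z"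
    using assms by simp
  then have "frag_eval G f (frag_of x - frag_of y - frag_of z) =
      frag_eval G f (frag_of x) \<otimes> inv (frag_eval G f (frag_of y)) \<otimes> inv (frag_eval G f (frag_of z))"
    using E.hom_mult[OF xy(1) E.G.inv_closed[OF xy(2)]] E.hom_inv[OF xy(2)] E.hom_inv[OF xy(3)]
      E.hom_mult[OF E.G.m_closed[OF xy(1) E.G.inv_closed[OF xy(2)]] E.G.inv_closed[OF xy(3)]] by (simp only:)
  also have "\<dots> = \<one>" using c eq by (simp add: frag_eval_of m_assoc m_lcomm[of "f z" "inv (f y)"])
  finally show ?thesis .
qed

section \<open>Balanced maps and tensor products\<close>

text \<open>The three clauses after closure correspond one by one to the three families in
  \<open>tensor_relators\<close>: the linear extension of a balanced map descends to the tensor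
  product.\<close>

definition balanced ::
  "('b, 'x) ring_scheme \<Rightarrow> ('b, 'm, 'y) rmodule_scheme \<Rightarrow> ('b, 'n, 'z) lmodule_scheme \<Rightarrow>
   ('g, 'u) monoid_scheme \<Rightarrow> ('m \<Rightarrow> 'n \<Rightarrow> 'g) \<Rightarrow> bool"
  where "balanced B M N G f \<longleftrightarrow>
    (\<forall>m \<in> carrier M. \<forall>n \<in> carrier N. f m n \<in> carrier G) \<and>
    (\<forall>m \<in> carrier M. \<forall>m' \<in> carrier M. \<forall>n \<in> carrier N. f (m \<otimes>\<^bsub>M\<^esub> m') n = f m n \<otimes>\<^bsub>G\<^esub> f m' n) \<and>
    (\<forall>m \<in> carrier M. \<forall>n \<in> carrier N. \<forall>n' \<in> carrier N. f m (n \<otimes>\<^bsub>N\<^esub> n') = f m n \<otimes>\<^bsub>G\<^esub> f m n') \<and>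
    (\<forall>m \<in> carrier M. \<forall>b \<in> carrier B. \<forall>n \<in> carrier N. f (ract M m b) n = f m (lact N b n))"

lemma balancedI:
  assumes "\<And>m n. m \<in> carrier M \<Longrightarrow> n \<in> carrier N \<Longrightarrow> f m n \<in> carrier G"
    and "\<And>m m' n. m \<in> carrier M \<Longrightarrow> m' \<in> carrier M \<Longrightarrow> n \<in> carrier N \<Longrightarrow>
      f (m \<otimes>\<^bsub>M\<^esub> m') n = f m n \<otimes>\<^bsub>G\<^esub> f m' n"
    and "\<And>m n n'. m \<in> carrier M \<Longrightarrow> n \<in> carrier N \<Longrightarrow> n' \<in> carrier N \<Longrightarrow>
      f m (n \<otimes>\<^bsub>N\<^esub> n') = f m n \<otimes>\<^bsub>G\<^esub> f m n'"
    and "\<And>m b n. m \<in> carrier M \<Longrightarrow> b \<in> carrier B \<Longrightarrow> n \<in> carrier N \<Longrightarrow>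
      f (ract M m b) n = f m (lact N b n)"
  shows "balanced B M N G f"
  using assms by (auto simp: balanced_def)

lemma
  assumes "balanced B M N G f"
  shows balanced_closed: "m \<in> carrier M \<Longrightarrow> n \<in> carrier N \<Longrightarrow> f m n \<in> carrier G"
    and balanced_add_left: "m \<in> carrier M \<Longrightarrow> m' \<in> carrier M \<Longrightarrow> n \<in> carrier N \<Longrightarrow>
      f (m \<otimes>\<^bsub>M\<^esub> m') n = f m n \<otimes>\<^bsub>G\<^esub> f m' n"
    and balanced_add_right: "m \<in> carrier M \<Longrightarrow> n \<in> carrier N \<Longrightarrow> n' \<in> carrier N \<Longrightarrow>
      f m (n \<otimes>\<^bsub>N\<^esub> n') = f m n \<otimes>\<^bsub>G\<^esub> f m n'"
    and balanced_act: "m \<in> carrier M \<Longrightarrow> b \<in> carrier B \<Longrightarrow> n \<in> carrier N \<Longrightarrow>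
      f (ract M m b) n = f m (lact N b n)"
  using assms by (auto simp: balanced_def)

locale tensor_pair = M: right_module B M + N: left_module B N
  for B :: "('b, 'x) ring_scheme" and M :: "('b, 'm, 'y) rmodule_scheme"
    and N :: "('b, 'n, 'z) lmodule_scheme"
begin

lemma free_quotient: "free_quotient (carrier M \<times> carrier N) (tensor_relators B M N)"
  by unfold_locales
    (force simp: tensor_relators_def M.ract_closed N.lact_closed dest!: subsetD[OF keys_diff])

lemma comm_group_tensor: "comm_group (tensor B M N)"
  unfolding tensor_def by (rule free_quotient.comm_group_free_quot[OF free_quotient])

lemma pten_closed: "m \<in> carrier M \<Longrightarrow> n \<in> carrier N \<Longrightarrow> pten B M N m n \<in> carrier (tensor B M N)"
  unfolding tensor_def pten_def by (rule free_quotient.free_cls_closed[OF free_quotient]) auto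

lemma balanced_pten: "balanced B M N (tensor B M N) (pten B M N)"
proof (rule balancedI)
  fix m n assume "m \<in> carrier M" "n \<in> carrier N"
  then show "pten B M N m n \<in> carrier (tensor B M N)" by (rule pten_closed)
next
  fix m m' n assume "m \<in> carrier M" "m' \<in> carrier M" "n \<in> carrier N"
  then show "pten B M N (m \<otimes>\<^bsub>M\<^esub> m') n = pten B M N m n \<otimes>\<^bsub>tensor B M N\<^esub> pten B M N m' n"
    unfolding tensor_def pten_def
    by (intro free_quotient.free_cls_add[OF free_quotient]) (auto simp: tensor_relators_def)
next
  fix m n n' assume "m \<in> carrier M" "n \<in> carrier N" "n' \<in> carrier N"
  then show "pten B M N m (n \<otimes>\<^bsub>N\<^esub> n') = pten B M N m n \<otimes>\<^bsub>tensor B M N\<^esub> pten B M N m n'"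
    unfolding tensor_def pten_def
    by (intro free_quotient.free_cls_add[OF free_quotient]) (auto simp: tensor_relators_def)
next
  fix m b n assume "m \<in> carrier M" "b \<in> carrier B" "n \<in> carrier N"
  then show "pten B M N (ract M m b) n = pten B M N m (lact N b n)"
    unfolding tensor_def pten_def
    by (intro free_quotient.free_cls_eq[OF free_quotient])
      (auto simp: tensor_relators_def M.ract_closed N.lact_closed)
qed

lemmas pten_add_left = balanced_add_left[OF balanced_pten]
  and pten_add_right = balanced_add_right[OF balanced_pten]
  and pten_act = balanced_act[OF balanced_pten]

lemma kills:
  assumes G: "comm_group G" and f: "balanced B M N G f" and q: "q \<in> tensor_relators B M N"
  shows "frag_eval G (\<lambda>(x, y). f x y) q = \<one>\<^bsub>G\<^esub>"
proof -
  have fc: "(\<lambda>(x, y). f x y) \<in> carrier M \<times> carrier N \<rightarrow> carrier G"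
    using balanced_closed[OF f] by auto
  show ?thesis
    using q unfolding tensor_relators_def
    by (auto intro!: comm_group.frag_eval_diff[OF G fc] comm_group.frag_eval_diff_diff[OF G fc]
        simp: M.ract_closed N.lact_closed
        balanced_add_left[OF f] balanced_add_right[OF f] balanced_act[OF f])
qed

lemma tlift_hom:
  assumes "comm_group G" "balanced B M N G f"
  shows "tlift G (\<lambda>(x, y). f x y) \<in> hom (tensor B M N) G"
  unfolding tensor_def
  by (rule free_quotient.tlift_free_quot_hom[OF free_quotient assms(1) _ kills[OF assms]])
    (use balanced_closed[OF assms(2)] in auto)

lemma tlift_pten:
  assumes "comm_group G" "balanced B M N G f" "m \<in> carrier M" "n \<in> carrier N"
  shows "tlift G (\<lambda>(x, y). f x y) (pten B M N m n) = f m n"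
  unfolding tensor_def pten_def
  by (subst free_quotient.tlift_free_cls[OF free_quotient assms(1) _ kills[OF assms(1,2)]])
    (use balanced_closed[OF assms(2)] assms in auto)

lemma tlift_closed:
  assumes "comm_group G" "balanced B M N G f" "X \<in> carrier (tensor B M N)"
  shows "tlift G (\<lambda>(x, y). f x y) X \<in> carrier G"
  by (rule hom_in_carrier[OF tlift_hom assms(3)]) (use assms in auto)

lemma tlift_add:
  assumes "comm_group G" "balanced B M N G f" "X \<in> carrier (tensor B M N)" "Y \<in> carrier (tensor B M N)"
  shows "tlift G (\<lambda>(x, y). f x y) (X \<otimes>\<^bsub>tensor B M N\<^esub> Y) =
    tlift G (\<lambda>(x, y). f x y) X \<otimes>\<^bsub>G\<^esub> tlift G (\<lambda>(x, y). f x y) Y"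
  by (rule hom_mult[OF tlift_hom assms(3,4)]) (use assms in auto)

lemma tensor_ext:
  assumes "group G" "F1 \<in> hom (tensor B M N) G" "F2 \<in> hom (tensor B M N) G"
    and "\<And>m n. m \<in> carrier M \<Longrightarrow> n \<in> carrier N \<Longrightarrow> F1 (pten B M N m n) = F2 (pten B M N m n)"
    and "X \<in> carrier (tensor B M N)"
  shows "F1 X = F2 X"
  by (rule free_quotient.free_quot_ext[OF free_quotient assms(1)])
    (use assms in \<open>auto simp: tensor_def pten_def\<close>)

text \<open>Balancedness is demanded of one side only: \<open>f'\<close> inherits it, because the
  carriers are closed under addition and the actions. Later uses are often reversed with
  \<open>symmetric\<close>, so that \<open>f\<close> is the side already known to be
  balanced.\<close>

lemma tlift_cong:
  assumes G: "comm_group G" and f: "balanced B M N G f"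
    and eq: "\<And>m n. m \<in> carrier M \<Longrightarrow> n \<in> carrier N \<Longrightarrow> f m n = f' m n"
    and X: "X \<in> carrier (tensor B M N)"
  shows "tlift G (\<lambda>(x, y). f x y) X = tlift G (\<lambda>(x, y). f' x y) X"
proof -
  have f': "balanced B M N G f'"
    using f by (auto simp: balanced_def eq[symmetric] M.ract_closed N.lact_closed)
  show ?thesis
    by (rule tensor_ext[OF comm_group.axioms(2)[OF G] tlift_hom[OF G f] tlift_hom[OF G f'] _ X])
      (use eq in \<open>auto simp: tlift_pten[OF G f] tlift_pten[OF G f']\<close>)
qed

lemma balanced_hom: "h \<in> hom G H \<Longrightarrow> balanced B M N G f \<Longrightarrow> balanced B M N H (\<lambda>x y. h (f x y))"
  by (auto simp: balanced_def hom_def Pi_iff)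

text \<open>Both sides are additive in \<open>X\<close> and agree on pure tensors. This is the rule
  for pulling an additive map in or out of a Sweedler sum.\<close>

lemma hom_tlift:
  assumes G: "comm_group G" and H: "comm_group H" and h: "h \<in> hom G H"
    and f: "balanced B M N G f" and X: "X \<in> carrier (tensor B M N)"
  shows "h (tlift G (\<lambda>(x, y). f x y) X) = tlift H (\<lambda>(x, y). h (f x y)) X"
proof -
  note hf = balanced_hom[OF h f]
  have "(h \<circ> tlift G (\<lambda>(x, y). f x y)) X = tlift H (\<lambda>(x, y). h (f x y)) X"
    by (rule tensor_ext[OF comm_group.axioms(2)[OF H] _ tlift_hom[OF H hf] _ X])
      (use hom_compose[OF tlift_hom[OF G f] h] in \<open>auto simp: comp_def tlift_pten[OF G f] tlift_pten[OF H hf]\<close>)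
  then show ?thesis by simp
qed

lemma balanced_mult:
  assumes G: "comm_group G" and f: "balanced B M N G f" and g: "balanced B M N G g"
  shows "balanced B M N G (\<lambda>x y. f x y \<otimes>\<^bsub>G\<^esub> g x y)"
proof -
  interpret G: comm_group G by (rule G)
  show ?thesis
    using f g by (auto simp: balanced_def G.m_ac)
qed

lemma tlift_mult:
  assumes G: "comm_group G" and f: "balanced B M N G f" and g: "balanced B M N G g"
    and X: "X \<in> carrier (tensor B M N)"
  shows "tlift G (\<lambda>(x, y). f x y \<otimes>\<^bsub>G\<^esub> g x y) X =
    tlift G (\<lambda>(x, y). f x y) X \<otimes>\<^bsub>G\<^esub> tlift G (\<lambda>(x, y). g x y) X"
proof -
  interpret G: comm_group G by (rule G)
  have fg: "balanced B M N G (\<lambda>x y. f x y \<otimes>\<^bsub>G\<^esub> g x y)"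
    by (rule balanced_mult[OF G f g])
  have h: "(\<lambda>X. tlift G (\<lambda>(x, y). f x y) X \<otimes>\<^bsub>G\<^esub> tlift G (\<lambda>(x, y). g x y) X) \<in> hom (tensor B M N) G"
    by (rule homI) (auto simp: tlift_add[OF G f] tlift_add[OF G g] tlift_closed[OF G f] tlift_closed[OF G g] G.m_ac)
  show ?thesis
    by (rule tensor_ext[OF G.is_group tlift_hom[OF G fg] h _ X])
      (auto simp: tlift_pten[OF G f] tlift_pten[OF G g] tlift_pten[OF G fg])
qed

lemma tlift_pten_id:
  assumes X: "X \<in> carrier (tensor B M N)"
  shows "tlift (tensor B M N) (\<lambda>(x, y). pten B M N x y) X = X"
proof -
  interpret T: comm_group "tensor B M N" by (rule comm_group_tensor)
  have "(\<lambda>X. X) \<in> hom (tensor B M N) (tensor B M N)" by (simp add: hom_def)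
  then have "tlift (tensor B M N) (\<lambda>(x, y). pten B M N x y) X = (\<lambda>X. X) X"
    by (intro tensor_ext[OF T.is_group tlift_hom[OF T.comm_group_axioms balanced_pten] _ _ X])
      (auto simp: tlift_pten[OF T.comm_group_axioms balanced_pten])
  then show ?thesis by simp
qed

text \<open>One additive group occurs in several records (\<open>crm C\<close>,
  \<open>clm C\<close>, \<open>addgrp A\<close>, the comodules built on them), and
  \<open>tlift\<close> mentions the record. The identity is a homomorphism between two such copies,
  so \<open>hom_tlift\<close> identifies the sums.\<close>

lemma tlift_target_cong:
  assumes G: "comm_group G" and H: "comm_group H" and f: "balanced B M N G f"
    and eq: "carrier G = carrier H" "monoid.mult G = monoid.mult H"
    and X: "X \<in> carrier (tensor B M N)"
  shows "tlift G (\<lambda>(x, y). f x y) X = tlift H (\<lambda>(x, y). f x y) X"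
proof -
  have id: "(\<lambda>x. x) \<in> hom G H" using eq by (auto simp: hom_def)
  show ?thesis using hom_tlift[OF G H id f X] .
qed

text \<open>Each clause is checked under the sum sign: \<open>f'\<close> gives it for fixed
  \<open>x\<close> and \<open>y\<close>, and \<open>tlift_cong\<close> with
  \<open>tlift_mult\<close> carries it over to the sum.\<close>

lemma balanced_tlift:
  assumes G: "comm_group G" and P: "tensor_pair B' M' N'"
    and f: "\<And>x' y'. x' \<in> carrier M' \<Longrightarrow> y' \<in> carrier N' \<Longrightarrow> balanced B M N G (\<lambda>x y. f x y x' y')"
    and f': "\<And>x y. x \<in> carrier M \<Longrightarrow> y \<in> carrier N \<Longrightarrow> balanced B' M' N' G (f x y)"
    and X: "X \<in> carrier (tensor B M N)"
  shows "balanced B' M' N' G (\<lambda>x' y'. tlift G (\<lambda>(x, y). f x y x' y') X)"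
proof -
  interpret P: tensor_pair B' M' N' by (rule P)
  show ?thesis
  proof (rule balancedI)
    fix m n assume "m \<in> carrier M'" "n \<in> carrier N'"
    then show "tlift G (\<lambda>(x, y). f x y m n) X \<in> carrier G"
      by (intro tlift_closed[OF G f X])
  next
    fix m m' n assume m: "m \<in> carrier M'" "m' \<in> carrier M'" "n \<in> carrier N'"
    then have mm: "m \<otimes>\<^bsub>M'\<^esub> m' \<in> carrier M'" by simp
    have "tlift G (\<lambda>(x, y). f x y (m \<otimes>\<^bsub>M'\<^esub> m') n) X
      = tlift G (\<lambda>(x, y). f x y m n \<otimes>\<^bsub>G\<^esub> f x y m' n) X"
      by (rule tlift_cong[OF G f[OF mm m(3)] _ X]) (use balanced_add_left[OF f'] m in auto)
    then show "tlift G (\<lambda>(x, y). f x y (m \<otimes>\<^bsub>M'\<^esub> m') n) X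
      = tlift G (\<lambda>(x, y). f x y m n) X \<otimes>\<^bsub>G\<^esub> tlift G (\<lambda>(x, y). f x y m' n) X"
      using tlift_mult[OF G f f X] m by simp
  next
    fix m n n' assume m: "m \<in> carrier M'" "n \<in> carrier N'" "n' \<in> carrier N'"
    then have mm: "n \<otimes>\<^bsub>N'\<^esub> n' \<in> carrier N'" by simp
    have "tlift G (\<lambda>(x, y). f x y m (n \<otimes>\<^bsub>N'\<^esub> n')) X
      = tlift G (\<lambda>(x, y). f x y m n \<otimes>\<^bsub>G\<^esub> f x y m n') X"
      by (rule tlift_cong[OF G f[OF m(1) mm] _ X]) (use balanced_add_right[OF f'] m in auto)
    then show "tlift G (\<lambda>(x, y). f x y m (n \<otimes>\<^bsub>N'\<^esub> n')) X
      = tlift G (\<lambda>(x, y). f x y m n) X \<otimes>\<^bsub>G\<^esub> tlift G (\<lambda>(x, y). f x y m n') X"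
      using tlift_mult[OF G f f X] m by simp
  next
    fix m b n assume m: "m \<in> carrier M'" "b \<in> carrier B'" "n \<in> carrier N'"
    show "tlift G (\<lambda>(x, y). f x y (ract M' m b) n) X = tlift G (\<lambda>(x, y). f x y m (lact N' b n)) X"
      by (rule tlift_cong[OF G f[OF P.M.ract_closed[OF m(1,2)] m(3)] _ X])
        (use balanced_act[OF f'] m in auto)
  qed
qed

text \<open>For a pure tensor \<open>X\<close> the exchange is immediate, and both sides are
  additive in \<open>X\<close>. The rule serves sums over the legs of two unrelated elements, where
  coassociativity has nothing to say.\<close>

lemma Fubini:
  assumes G: "comm_group G" and P: "tensor_pair B' M' N'"
    and f: "\<And>x' y'. x' \<in> carrier M' \<Longrightarrow> y' \<in> carrier N' \<Longrightarrow> balanced B M N G (\<lambda>x y. f x y x' y')"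
    and f': "\<And>x y. x \<in> carrier M \<Longrightarrow> y \<in> carrier N \<Longrightarrow> balanced B' M' N' G (f x y)"
    and X: "X \<in> carrier (tensor B M N)" and Y: "Y \<in> carrier (tensor B' M' N')"
  shows "tlift G (\<lambda>(x, y). tlift G (\<lambda>(x', y'). f x y x' y') Y) X =
    tlift G (\<lambda>(x', y'). tlift G (\<lambda>(x, y). f x y x' y') X) Y"
proof -
  interpret G: comm_group G by (rule G)
  interpret P: tensor_pair B' M' N' by (rule P)
  have b: "balanced B M N G (\<lambda>x y. tlift G (\<lambda>(x', y'). f x y x' y') Y)"
    by (rule P.balanced_tlift[OF G tensor_pair_axioms f' f Y])
  have eq: "tlift G (\<lambda>(x', y'). tlift G (\<lambda>(x, y). f x y x' y') (pten B M N m n)) Y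
      = tlift G (\<lambda>(x', y'). f m n x' y') Y" if "m \<in> carrier M" "n \<in> carrier N" for m n
    by (rule P.tlift_cong[OF G f'[OF that] _ Y, symmetric]) (use that f in \<open>auto simp: tlift_pten[OF G f]\<close>)
  have b': "balanced B' M' N' G (\<lambda>x' y'. tlift G (\<lambda>(x, y). f x y x' y') X)"
    if X: "X \<in> carrier (tensor B M N)" for X
    by (rule balanced_tlift[OF G P f f' X])
  have h: "(\<lambda>X. tlift G (\<lambda>(x', y'). tlift G (\<lambda>(x, y). f x y x' y') X) Y) \<in> hom (tensor B M N) G"
  proof (rule homI)
    interpret T: comm_group "tensor B M N" by (rule comm_group_tensor)
    fix X X' assume X: "X \<in> carrier (tensor B M N)" "X' \<in> carrier (tensor B M N)"
    show "tlift G (\<lambda>(x', y'). tlift G (\<lambda>(x, y). f x y x' y') X) Y \<in> carrier G"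
      by (rule P.tlift_closed[OF G b'[OF X(1)] Y])
    have "tlift G (\<lambda>(x', y'). tlift G (\<lambda>(x, y). f x y x' y') (X \<otimes>\<^bsub>tensor B M N\<^esub> X')) Y
      = tlift G (\<lambda>(x', y'). tlift G (\<lambda>(x, y). f x y x' y') X \<otimes>\<^bsub>G\<^esub> tlift G (\<lambda>(x, y). f x y x' y') X') Y"
      by (rule P.tlift_cong[OF G b' _ Y]) (use X f in \<open>auto simp: tlift_add[OF G f]\<close>)
    also have "\<dots> = tlift G (\<lambda>(x', y'). tlift G (\<lambda>(x, y). f x y x' y') X) Y \<otimes>\<^bsub>G\<^esub>
        tlift G (\<lambda>(x', y'). tlift G (\<lambda>(x, y). f x y x' y') X') Y"
      by (rule P.tlift_mult[OF G b'[OF X(1)] b'[OF X(2)] Y])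
    finally show "tlift G (\<lambda>(x', y'). tlift G (\<lambda>(x, y). f x y x' y') (X \<otimes>\<^bsub>tensor B M N\<^esub> X')) Y
      = tlift G (\<lambda>(x', y'). tlift G (\<lambda>(x, y). f x y x' y') X) Y \<otimes>\<^bsub>G\<^esub>
        tlift G (\<lambda>(x', y'). tlift G (\<lambda>(x, y). f x y x' y') X') Y" .
  qed
  show ?thesis
    by (rule tensor_ext[OF G.is_group tlift_hom[OF G b] h _ X])
      (simp add: tlift_pten[OF G b] eq)
qed

end

section \<open>Functoriality of the tensor product\<close>

lemma rmod_hom_id: "(\<lambda>x. x) \<in> rmod_hom B M M"
  by (auto simp: rmod_hom_def hom_def)

lemma lmod_hom_id: "(\<lambda>x. x) \<in> lmod_hom B M M"
  by (auto simp: lmod_hom_def hom_def)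

lemma
  assumes "f \<in> rmod_hom B M N"
  shows rmod_hom_hom: "f \<in> hom M N"
    and rmod_hom_closed: "m \<in> carrier M \<Longrightarrow> f m \<in> carrier N"
    and rmod_hom_add: "m \<in> carrier M \<Longrightarrow> m' \<in> carrier M \<Longrightarrow> f (m \<otimes>\<^bsub>M\<^esub> m') = f m \<otimes>\<^bsub>N\<^esub> f m'"
    and rmod_hom_act: "m \<in> carrier M \<Longrightarrow> b \<in> carrier B \<Longrightarrow> f (ract M m b) = ract N (f m) b"
  using assms by (auto simp: rmod_hom_def hom_def)

lemma
  assumes "f \<in> lmod_hom B M N"
  shows lmod_hom_hom: "f \<in> hom M N"
    and lmod_hom_closed: "m \<in> carrier M \<Longrightarrow> f m \<in> carrier N"
    and lmod_hom_add: "m \<in> carrier M \<Longrightarrow> m' \<in> carrier M \<Longrightarrow> f (m \<otimes>\<^bsub>M\<^esub> m') = f m \<otimes>\<^bsub>N\<^esub> f m'"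
    and lmod_hom_act: "m \<in> carrier M \<Longrightarrow> b \<in> carrier B \<Longrightarrow> f (lact M b m) = lact N b (f m)"
  using assms by (auto simp: lmod_hom_def hom_def)

lemma (in tensor_pair) balanced_compose:
  assumes g: "g \<in> rmod_hom B M M'" and h: "h \<in> lmod_hom B N N'" and f: "balanced B M' N' G f"
  shows "balanced B M N G (\<lambda>x y. f (g x) (h y))"
  by (rule balancedI)
    (auto simp: rmod_hom_closed[OF g] rmod_hom_add[OF g] rmod_hom_act[OF g] lmod_hom_closed[OF h]
      lmod_hom_add[OF h] lmod_hom_act[OF h] balanced_closed[OF f] balanced_add_left[OF f]
      balanced_add_right[OF f] balanced_act[OF f])

context tensor_pair
begin

context
  fixes M' :: "('b, 'm1, 'y1) rmodule_scheme" and N' :: "('b, 'n1, 'z1) lmodule_scheme"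
    and g :: "'m \<Rightarrow> 'm1" and h :: "'n \<Rightarrow> 'n1"
  assumes P: "tensor_pair B M' N'" and g: "g \<in> rmod_hom B M M'" and h: "h \<in> lmod_hom B N N'"
begin

interpretation P: tensor_pair B M' N' by (rule P)

lemma balanced_tmap: "balanced B M N (tensor B M' N') (\<lambda>x y. pten B M' N' (g x) (h y))"
  by (rule balanced_compose[OF g h P.balanced_pten])

lemma tmap_hom: "tmap B M' N' g h \<in> hom (tensor B M N) (tensor B M' N')"
  unfolding tmap_def by (rule tlift_hom[OF P.comm_group_tensor balanced_tmap])

lemma tmap_pten:
  "m \<in> carrier M \<Longrightarrow> n \<in> carrier N \<Longrightarrow> tmap B M' N' g h (pten B M N m n) = pten B M' N' (g m) (h n)"
  unfolding tmap_def by (rule tlift_pten[OF P.comm_group_tensor balanced_tmap])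

text \<open>Substitution in a Sweedler sum: on pure tensors \<open>tmap\<close> only relabels the
  two legs.\<close>

lemma tlift_tmap:
  assumes G: "comm_group G" and f: "balanced B M' N' G f" and X: "X \<in> carrier (tensor B M N)"
  shows "tlift G (\<lambda>(x, y). f x y) (tmap B M' N' g h X) = tlift G (\<lambda>(x, y). f (g x) (h y)) X"
proof -
  have "tlift G (\<lambda>(x, y). f x y) (tmap B M' N' g h X) =
      tlift G (\<lambda>(x, y). tlift G (\<lambda>(x, y). f x y) (pten B M' N' (g x) (h y))) X"
    unfolding tmap_def
    by (rule hom_tlift[OF P.comm_group_tensor G P.tlift_hom[OF G f] balanced_tmap X])
  also have "\<dots> = tlift G (\<lambda>(x, y). f (g x) (h y)) X"
    by (rule tlift_cong[OF G balanced_hom[OF P.tlift_hom[OF G f] balanced_tmap] _ X])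
      (simp add: P.tlift_pten[OF G f] rmod_hom_closed[OF g] lmod_hom_closed[OF h])
  finally show ?thesis .
qed

end

end


section \<open>Threefold tensor products\<close>

definition balanced3 ::
  "('b, 'x) ring_scheme \<Rightarrow> ('b, 'm, 'y) rmodule_scheme \<Rightarrow> ('b, 'n, 'z) lmodule_scheme \<Rightarrow>
   ('d, 'u) ring_scheme \<Rightarrow> ('d, 'n, 'v) rmodule_scheme \<Rightarrow> ('d, 'p, 'w) lmodule_scheme \<Rightarrow>
   ('g, 't) monoid_scheme \<Rightarrow> ('m \<Rightarrow> 'n \<Rightarrow> 'p \<Rightarrow> 'g) \<Rightarrow> bool"
  where "balanced3 B M N D N' P G f \<longleftrightarrow>
    (\<forall>p \<in> carrier P. balanced B M N G (\<lambda>m n. f m n p)) \<and>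
    (\<forall>m \<in> carrier M. balanced D N' P G (f m))"

text \<open>The bimodule in the middle is given by two records, so the agreement of carriers and
  additions is an assumption. The commuting actions let a scalar pass through one tensor sign while
  a map is applied at the other.\<close>

locale tensor_triple = MN: tensor_pair B M N + NP: tensor_pair D N' P
  for B :: "('b, 'x) ring_scheme" and M :: "('b, 'm, 'y) rmodule_scheme"
    and N :: "('b, 'n, 'z) lmodule_scheme" and D :: "('d, 'u) ring_scheme"
    and N' :: "('d, 'n, 'v) rmodule_scheme" and P :: "('d, 'p, 'w) lmodule_scheme" +
  assumes same_carrier: "carrier N' = carrier N" and same_mult: "monoid.mult N' = monoid.mult N"
    and acts_commute: "\<lbrakk>b \<in> carrier B; n \<in> carrier N; d \<in> carrier D\<rbrakk> \<Longrightarrow>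
      ract N' (lact N b n) d = lact N b (ract N' n d)"
begin

abbreviation "T3 \<equiv> tensor3 B M N D N' P"

lemma ract_closed_mid: "n \<in> carrier N \<Longrightarrow> d \<in> carrier D \<Longrightarrow> ract N' n d \<in> carrier N"
  using NP.M.ract_closed same_carrier by metis

lemma free_quotient3: "free_quotient (carrier M \<times> carrier N \<times> carrier P) (tensor3_relators B M N D N' P)"
  by unfold_locales
    (auto simp: tensor3_relators_def MN.M.ract_closed MN.N.lact_closed NP.N.lact_closed ract_closed_mid
      dest!: subsetD[OF keys_diff])

lemma comm_group_tensor3: "comm_group T3"
  unfolding tensor3_def by (rule free_quotient.comm_group_free_quot[OF free_quotient3])

lemma tensor3_relatorsI:
  assumes "m \<in> carrier M" "n \<in> carrier N" "p \<in> carrier P"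
  shows "m' \<in> carrier M \<Longrightarrow>
      frag_of (m \<otimes>\<^bsub>M\<^esub> m', n, p) - frag_of (m, n, p) - frag_of (m', n, p) \<in> tensor3_relators B M N D N' P"
    and "n' \<in> carrier N \<Longrightarrow>
      frag_of (m, n \<otimes>\<^bsub>N\<^esub> n', p) - frag_of (m, n, p) - frag_of (m, n', p) \<in> tensor3_relators B M N D N' P"
    and "p' \<in> carrier P \<Longrightarrow>
      frag_of (m, n, p \<otimes>\<^bsub>P\<^esub> p') - frag_of (m, n, p) - frag_of (m, n, p') \<in> tensor3_relators B M N D N' P"
    and "b \<in> carrier B \<Longrightarrow>
      frag_of (ract M m b, n, p) - frag_of (m, lact N b n, p) \<in> tensor3_relators B M N D N' P"
    and "d \<in> carrier D \<Longrightarrow>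
      frag_of (m, ract N' n d, p) - frag_of (m, n, lact P d p) \<in> tensor3_relators B M N D N' P"
  unfolding tensor3_relators_def using assms by blast+

lemma balanced3_pten3: "balanced3 B M N D N' P T3 (pten3 B M N D N' P)"
  unfolding balanced3_def
proof (intro conjI ballI)
  let ?cls = "free_cls (carrier M \<times> carrier N \<times> carrier P) (tensor3_relators B M N D N' P)"
  note add = free_quotient.free_cls_add[OF free_quotient3, folded tensor3_def]
    and eq = free_quotient.free_cls_eq[OF free_quotient3]
    and closed = free_quotient.free_cls_closed[OF free_quotient3, folded tensor3_def]
  note mem = MN.M.ract_closed MN.N.lact_closed NP.N.lact_closed ract_closed_mid
  show "balanced B M N T3 (\<lambda>m n. pten3 B M N D N' P m n p)" if p: "p \<in> carrier P" for p
  proof (rule balancedI; unfold pten3_def)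
    fix m n assume mn: "m \<in> carrier M" "n \<in> carrier N"
    show "?cls (m, n, p) \<in> carrier T3"
      by (rule closed) (use mn p in auto)
    {
      fix m' assume "m' \<in> carrier M"
      then show "?cls (m \<otimes>\<^bsub>M\<^esub> m', n, p) =
        ?cls (m, n, p) \<otimes>\<^bsub>T3\<^esub>
        ?cls (m', n, p)"
        by (intro add) (use mn p in \<open>auto intro: tensor3_relatorsI\<close>)
    next
      fix n' assume "n' \<in> carrier N"
      then show "?cls (m, n \<otimes>\<^bsub>N\<^esub> n', p) =
        ?cls (m, n, p) \<otimes>\<^bsub>T3\<^esub>
        ?cls (m, n', p)"
        by (intro add) (use mn p in \<open>auto intro: tensor3_relatorsI\<close>)
    next
      fix b assume "b \<in> carrier B"
      then show "?cls (ract M m b, n, p) =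
        ?cls (m, lact N b n, p)"
        by (intro eq) (use mn p in \<open>auto intro: tensor3_relatorsI simp: mem\<close>)
    }
  qed
  show "balanced D N' P T3 (pten3 B M N D N' P m)" if m: "m \<in> carrier M" for m
  proof (rule balancedI; unfold pten3_def same_carrier same_mult)
    fix n p assume np: "n \<in> carrier N" "p \<in> carrier P"
    show "?cls (m, n, p) \<in> carrier T3"
      by (rule closed) (use np m in auto)
    {
      fix n' assume "n' \<in> carrier N"
      then show "?cls (m, n \<otimes>\<^bsub>N\<^esub> n', p) =
        ?cls (m, n, p) \<otimes>\<^bsub>T3\<^esub>
        ?cls (m, n', p)"
        by (intro add) (use np m in \<open>auto intro: tensor3_relatorsI\<close>)
    next
      fix p' assume "p' \<in> carrier P"
      then show "?cls (m, n, p \<otimes>\<^bsub>P\<^esub> p') =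
        ?cls (m, n, p) \<otimes>\<^bsub>T3\<^esub>
        ?cls (m, n, p')"
        by (intro add) (use np m in \<open>auto intro: tensor3_relatorsI\<close>)
    next
      fix d assume "d \<in> carrier D"
      then show "?cls (m, ract N' n d, p) =
        ?cls (m, n, lact P d p)"
        by (intro eq) (use np m in \<open>auto intro: tensor3_relatorsI simp: mem\<close>)
    }
  qed
qed

context
  fixes G :: "('g, 't) monoid_scheme" and h :: "'m \<Rightarrow> 'n \<Rightarrow> 'p \<Rightarrow> 'g"
  assumes G: "comm_group G" and h: "balanced3 B M N D N' P G h"
begin

lemma balanced3_left: "p \<in> carrier P \<Longrightarrow> balanced B M N G (\<lambda>m n. h m n p)"
  using h by (simp add: balanced3_def)

lemma balanced3_right: "m \<in> carrier M \<Longrightarrow> balanced D N' P G (h m)"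
  using h by (simp add: balanced3_def)

lemma balanced3_closed:
  "m \<in> carrier M \<Longrightarrow> n \<in> carrier N \<Longrightarrow> p \<in> carrier P \<Longrightarrow> h m n p \<in> carrier G"
  using balanced_closed[OF balanced3_left] by blast

lemma kills3:
  assumes q: "q \<in> tensor3_relators B M N D N' P"
  shows "frag_eval G (\<lambda>(x, y, z). h x y z) q = \<one>\<^bsub>G\<^esub>"
proof -
  have fc: "(\<lambda>(x, y, z). h x y z) \<in> carrier M \<times> carrier N \<times> carrier P \<rightarrow> carrier G"
    using balanced3_closed by auto
  note r = balanced_add_right[OF balanced3_right, unfolded same_carrier same_mult]
    balanced_act[OF balanced3_right, unfolded same_carrier same_mult]
    balanced_add_left[OF balanced3_left] balanced_add_right[OF balanced3_left] balanced_act[OF balanced3_left]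
  show ?thesis
    using q unfolding tensor3_relators_def
    by (auto intro!: comm_group.frag_eval_diff[OF G fc] comm_group.frag_eval_diff_diff[OF G fc]
        simp: MN.M.ract_closed MN.N.lact_closed NP.N.lact_closed ract_closed_mid r)
qed

lemma tlift3_hom: "tlift G (\<lambda>(x, y, z). h x y z) \<in> hom T3 G"
  unfolding tensor3_def
  by (rule free_quotient.tlift_free_quot_hom[OF free_quotient3 G _ kills3])
    (use balanced3_closed in auto)

lemma tlift_pten3:
  assumes "m \<in> carrier M" "n \<in> carrier N" "p \<in> carrier P"
  shows "tlift G (\<lambda>(x, y, z). h x y z) (pten3 B M N D N' P m n p) = h m n p"
  unfolding tensor3_def pten3_def
  by (subst free_quotient.tlift_free_cls[OF free_quotient3 G _ kills3])
    (use balanced3_closed assms in auto)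

end

lemma ract_mid_lmod_hom: "d \<in> carrier D \<Longrightarrow> (\<lambda>n. ract N' n d) \<in> lmod_hom B N N"
  using NP.M.ract_add_left
  by (auto simp: lmod_hom_def hom_def ract_closed_mid acts_commute same_carrier same_mult)

lemma lact_mid_rmod_hom: "b \<in> carrier B \<Longrightarrow> (\<lambda>n. lact N b n) \<in> rmod_hom D N' N'"
  by (auto simp: rmod_hom_def hom_def MN.N.lact_closed MN.N.lact_add_right acts_commute same_carrier same_mult)

context
  fixes Q :: "('d, 'q, 's) rmodule_scheme" and f :: "'q \<Rightarrow> ('m \<times> 'n \<Rightarrow>\<^sub>0 int) set"
  assumes Q: "right_module D Q" and f: "f \<in> hom Q (tensor B M N)"
    and f_act: "\<And>q d. \<lbrakk>q \<in> carrier Q; d \<in> carrier D\<rbrakk> \<Longrightarrow>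
      f (ract Q q d) = tmap B M N (\<lambda>x. x) (\<lambda>n. ract N' n d) (f q)"
begin

interpretation QP: tensor_pair D Q P
  by (intro tensor_pair.intro Q NP.N.left_module_axioms)

lemma f_closed: "q \<in> carrier Q \<Longrightarrow> f q \<in> carrier (tensor B M N)"
  using f by (auto simp: hom_def)

text \<open>The clause for \<open>d\<close> is the one beyond additivity: \<open>f_act\<close> moves
  the scalar into the second leg of \<open>f q\<close>, and balancedness of \<open>h\<close> in its
  last two arguments moves it on to \<open>p\<close>.\<close>

lemma balanced_nest_left:
  assumes G: "comm_group G" and h: "balanced3 B M N D N' P G h"
  shows "balanced D Q P G (\<lambda>q p. tlift G (\<lambda>(m, n). h m n p) (f q))"
proof (rule balancedI)
  note hl = balanced3_left[OF G h] and hr = balanced3_right[OF G h]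
  fix q p assume q: "q \<in> carrier Q" and p: "p \<in> carrier P"
  show "tlift G (\<lambda>(m, n). h m n p) (f q) \<in> carrier G"
    by (rule MN.tlift_closed[OF G hl[OF p] f_closed[OF q]])
  {
    fix q' assume q': "q' \<in> carrier Q"
    show "tlift G (\<lambda>(m, n). h m n p) (f (q \<otimes>\<^bsub>Q\<^esub> q')) =
      tlift G (\<lambda>(m, n). h m n p) (f q) \<otimes>\<^bsub>G\<^esub> tlift G (\<lambda>(m, n). h m n p) (f q')"
      using q q' by (simp add: hom_mult[OF f] MN.tlift_add[OF G hl[OF p]] f_closed)
  }
  {
    fix p' assume p': "p' \<in> carrier P"
    then have pp: "p \<otimes>\<^bsub>P\<^esub> p' \<in> carrier P" using p by simp
    have "tlift G (\<lambda>(m, n). h m n (p \<otimes>\<^bsub>P\<^esub> p')) (f q) =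
      tlift G (\<lambda>(m, n). h m n p \<otimes>\<^bsub>G\<^esub> h m n p') (f q)"
      by (rule MN.tlift_cong[OF G hl[OF pp] _ f_closed[OF q]])
        (use p p' balanced_add_right[OF hr] in \<open>auto simp: same_carrier\<close>)
    then show "tlift G (\<lambda>(m, n). h m n (p \<otimes>\<^bsub>P\<^esub> p')) (f q) =
      tlift G (\<lambda>(m, n). h m n p) (f q) \<otimes>\<^bsub>G\<^esub> tlift G (\<lambda>(m, n). h m n p') (f q)"
      by (simp add: MN.tlift_mult[OF G hl[OF p] hl[OF p'] f_closed[OF q]])
  }
  {
    fix d assume d: "d \<in> carrier D"
    have dp: "lact P d p \<in> carrier P" using NP.N.lact_closed p d by blast
    have "tlift G (\<lambda>(m, n). h m n p) (f (ract Q q d)) = tlift G (\<lambda>(m, n). h m (ract N' n d) p) (f q)"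
      unfolding f_act[OF q d]
      by (rule MN.tlift_tmap[OF MN.tensor_pair_axioms rmod_hom_id ract_mid_lmod_hom[OF d] G hl[OF p] f_closed[OF q]])
    also have "\<dots> = tlift G (\<lambda>(m, n). h m n (lact P d p)) (f q)"
      by (rule MN.tlift_cong[OF G hl[OF dp] _ f_closed[OF q], symmetric])
        (use balanced_act[OF hr, unfolded same_carrier] p d in auto)
    finally show "tlift G (\<lambda>(m, n). h m n p) (f (ract Q q d)) = tlift G (\<lambda>(m, n). h m n (lact P d p)) (f q)" .
  }
qed

lemma ten_left_hom: "ten_left B M N D N' P f \<in> hom (tensor D Q P) T3"
  unfolding ten_left_def
  by (rule QP.tlift_hom[OF comm_group_tensor3 balanced_nest_left[OF comm_group_tensor3 balanced3_pten3]])

text \<open>\<open>ten_left\<close> is itself a nested sum of pure triple tensors, and the lift of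
  \<open>h\<close> is pulled through both layers. Together with \<open>tlift3_ten_right\<close> this
  converts an equality in the unbracketed product into an exchange of nested sums.\<close>

lemma tlift3_ten_left:
  assumes G: "comm_group G" and h: "balanced3 B M N D N' P G h" and X: "X \<in> carrier (tensor D Q P)"
  shows "tlift G (\<lambda>(m, n, p). h m n p) (ten_left B M N D N' P f X) =
    tlift G (\<lambda>(q, p). tlift G (\<lambda>(m, n). h m n p) (f q)) X"
proof -
  note T = comm_group_tensor3
  note H = tlift3_hom[OF G h] and b = balanced_nest_left[OF T balanced3_pten3]
  have "tlift G (\<lambda>(m, n, p). h m n p) (ten_left B M N D N' P f X) =
    tlift G (\<lambda>(q, p). tlift G (\<lambda>(m, n, p). h m n p) (tlift T3 (\<lambda>(m, n). pten3 B M N D N' P m n p) (f q))) X"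
    unfolding ten_left_def by (rule QP.hom_tlift[OF T G H b X])
  also have "\<dots> = tlift G (\<lambda>(q, p). tlift G (\<lambda>(m, n). h m n p) (f q)) X"
  proof (rule QP.tlift_cong[OF G QP.balanced_hom[OF H b] _ X])
    fix q p assume q: "q \<in> carrier Q" and p: "p \<in> carrier P"
    note b3 = balanced3_left[OF T balanced3_pten3 p]
    have "tlift G (\<lambda>(m, n, p). h m n p) (tlift T3 (\<lambda>(m, n). pten3 B M N D N' P m n p) (f q)) =
      tlift G (\<lambda>(m, n). tlift G (\<lambda>(m, n, p). h m n p) (pten3 B M N D N' P m n p)) (f q)"
      by (rule MN.hom_tlift[OF T G H b3 f_closed[OF q]])
    also have "\<dots> = tlift G (\<lambda>(m, n). h m n p) (f q)"
      by (rule MN.tlift_cong[OF G MN.balanced_hom[OF H b3] _ f_closed[OF q]])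
        (simp add: tlift_pten3[OF G h] p)
    finally show "tlift G (\<lambda>(m, n, p). h m n p) (tlift T3 (\<lambda>(m, n). pten3 B M N D N' P m n p) (f q)) =
      tlift G (\<lambda>(m, n). h m n p) (f q)" .
  qed
  finally show ?thesis .
qed

end

context
  fixes Q :: "('b, 'q, 's) lmodule_scheme" and g :: "'q \<Rightarrow> ('n \<times> 'p \<Rightarrow>\<^sub>0 int) set"
  assumes Q: "left_module B Q" and g: "g \<in> hom Q (tensor D N' P)"
    and g_act: "\<And>q b. \<lbrakk>q \<in> carrier Q; b \<in> carrier B\<rbrakk> \<Longrightarrow>
      g (lact Q b q) = tmap D N' P (\<lambda>n. lact N b n) (\<lambda>x. x) (g q)"
begin

interpretation MQ: tensor_pair B M Q
  by (intro tensor_pair.intro Q MN.M.right_module_axioms)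

lemma g_closed: "q \<in> carrier Q \<Longrightarrow> g q \<in> carrier (tensor D N' P)"
  using g by (auto simp: hom_def)

lemma balanced_nest_right:
  assumes G: "comm_group G" and h: "balanced3 B M N D N' P G h"
  shows "balanced B M Q G (\<lambda>m q. tlift G (\<lambda>(n, p). h m n p) (g q))"
proof (rule balancedI)
  note hl = balanced3_left[OF G h] and hr = balanced3_right[OF G h]
  fix q m assume q: "q \<in> carrier Q" and m: "m \<in> carrier M"
  show "tlift G (\<lambda>(n, p). h m n p) (g q) \<in> carrier G"
    by (rule NP.tlift_closed[OF G hr[OF m] g_closed[OF q]])
  {
    fix q' assume q': "q' \<in> carrier Q"
    show "tlift G (\<lambda>(n, p). h m n p) (g (q \<otimes>\<^bsub>Q\<^esub> q')) =
      tlift G (\<lambda>(n, p). h m n p) (g q) \<otimes>\<^bsub>G\<^esub> tlift G (\<lambda>(n, p). h m n p) (g q')"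
      using q q' by (simp add: hom_mult[OF g] NP.tlift_add[OF G hr[OF m]] g_closed)
  }
  {
    fix m' assume m': "m' \<in> carrier M"
    then have mm: "m \<otimes>\<^bsub>M\<^esub> m' \<in> carrier M" using m by simp
    have "tlift G (\<lambda>(n, p). h (m \<otimes>\<^bsub>M\<^esub> m') n p) (g q) =
      tlift G (\<lambda>(n, p). h m n p \<otimes>\<^bsub>G\<^esub> h m' n p) (g q)"
      by (rule NP.tlift_cong[OF G hr[OF mm] _ g_closed[OF q]])
        (use m m' balanced_add_left[OF hl] in \<open>auto simp: same_carrier\<close>)
    then show "tlift G (\<lambda>(n, p). h (m \<otimes>\<^bsub>M\<^esub> m') n p) (g q) =
      tlift G (\<lambda>(n, p). h m n p) (g q) \<otimes>\<^bsub>G\<^esub> tlift G (\<lambda>(n, p). h m' n p) (g q)"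
      by (simp add: NP.tlift_mult[OF G hr[OF m] hr[OF m'] g_closed[OF q]])
  }
  {
    fix b assume b: "b \<in> carrier B"
    have mb: "ract M m b \<in> carrier M" using MN.M.ract_closed m b by blast
    have "tlift G (\<lambda>(n, p). h m n p) (g (lact Q b q)) = tlift G (\<lambda>(n, p). h m (lact N b n) p) (g q)"
      unfolding g_act[OF q b]
      by (rule NP.tlift_tmap[OF NP.tensor_pair_axioms lact_mid_rmod_hom[OF b] lmod_hom_id G hr[OF m] g_closed[OF q]])
    also have "\<dots> = tlift G (\<lambda>(n, p). h (ract M m b) n p) (g q)"
      by (rule NP.tlift_cong[OF G hr[OF mb] _ g_closed[OF q], symmetric])
        (use balanced_act[OF hl] m b in \<open>auto simp: same_carrier\<close>)
    finally show "tlift G (\<lambda>(n, p). h (ract M m b) n p) (g q) = tlift G (\<lambda>(n, p). h m n p) (g (lact Q b q))" ..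
  }
qed

lemma ten_right_hom: "ten_right B M N D N' P g \<in> hom (tensor B M Q) T3"
  unfolding ten_right_def
  by (rule MQ.tlift_hom[OF comm_group_tensor3 balanced_nest_right[OF comm_group_tensor3 balanced3_pten3]])

lemma tlift3_ten_right:
  assumes G: "comm_group G" and h: "balanced3 B M N D N' P G h" and X: "X \<in> carrier (tensor B M Q)"
  shows "tlift G (\<lambda>(m, n, p). h m n p) (ten_right B M N D N' P g X) =
    tlift G (\<lambda>(m, q). tlift G (\<lambda>(n, p). h m n p) (g q)) X"
proof -
  note T = comm_group_tensor3
  note H = tlift3_hom[OF G h] and b = balanced_nest_right[OF T balanced3_pten3]
  have "tlift G (\<lambda>(m, n, p). h m n p) (ten_right B M N D N' P g X) =
    tlift G (\<lambda>(m, q). tlift G (\<lambda>(m, n, p). h m n p) (tlift T3 (\<lambda>(n, p). pten3 B M N D N' P m n p) (g q))) X"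
    unfolding ten_right_def by (rule MQ.hom_tlift[OF T G H b X])
  also have "\<dots> = tlift G (\<lambda>(m, q). tlift G (\<lambda>(n, p). h m n p) (g q)) X"
  proof (rule MQ.tlift_cong[OF G MQ.balanced_hom[OF H b] _ X])
    fix m q assume q: "q \<in> carrier Q" and m: "m \<in> carrier M"
    note b3 = balanced3_right[OF T balanced3_pten3 m]
    have "tlift G (\<lambda>(m, n, p). h m n p) (tlift T3 (\<lambda>(n, p). pten3 B M N D N' P m n p) (g q)) =
      tlift G (\<lambda>(n, p). tlift G (\<lambda>(m, n, p). h m n p) (pten3 B M N D N' P m n p)) (g q)"
      by (rule NP.hom_tlift[OF T G H b3 g_closed[OF q]])
    also have "\<dots> = tlift G (\<lambda>(n, p). h m n p) (g q)"
      by (rule NP.tlift_cong[OF G NP.balanced_hom[OF H b3] _ g_closed[OF q]])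
        (simp add: tlift_pten3[OF G h] m same_carrier)
    finally show "tlift G (\<lambda>(m, n, p). h m n p) (tlift T3 (\<lambda>(n, p). pten3 B M N D N' P m n p) (g q)) =
      tlift G (\<lambda>(n, p). h m n p) (g q)" .
  qed
  finally show ?thesis .
qed

end

end

lemma (in tensor_triple) balanced3I:
  assumes "\<And>m n p. m \<in> carrier M \<Longrightarrow> n \<in> carrier N \<Longrightarrow> p \<in> carrier P \<Longrightarrow> h m n p \<in> carrier G"
    and "\<And>m m' n p. m \<in> carrier M \<Longrightarrow> m' \<in> carrier M \<Longrightarrow> n \<in> carrier N \<Longrightarrow> p \<in> carrier P \<Longrightarrow>
      h (m \<otimes>\<^bsub>M\<^esub> m') n p = h m n p \<otimes>\<^bsub>G\<^esub> h m' n p"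
    and "\<And>m n n' p. m \<in> carrier M \<Longrightarrow> n \<in> carrier N \<Longrightarrow> n' \<in> carrier N \<Longrightarrow> p \<in> carrier P \<Longrightarrow>
      h m (n \<otimes>\<^bsub>N\<^esub> n') p = h m n p \<otimes>\<^bsub>G\<^esub> h m n' p"
    and "\<And>m n p p'. m \<in> carrier M \<Longrightarrow> n \<in> carrier N \<Longrightarrow> p \<in> carrier P \<Longrightarrow> p' \<in> carrier P \<Longrightarrow>
      h m n (p \<otimes>\<^bsub>P\<^esub> p') = h m n p \<otimes>\<^bsub>G\<^esub> h m n p'"
    and "\<And>m b n p. m \<in> carrier M \<Longrightarrow> b \<in> carrier B \<Longrightarrow> n \<in> carrier N \<Longrightarrow> p \<in> carrier P \<Longrightarrow>
      h (ract M m b) n p = h m (lact N b n) p"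
    and "\<And>m n d p. m \<in> carrier M \<Longrightarrow> n \<in> carrier N \<Longrightarrow> d \<in> carrier D \<Longrightarrow> p \<in> carrier P \<Longrightarrow>
      h m (ract N' n d) p = h m n (lact P d p)"
  shows "balanced3 B M N D N' P G h"
  using assms by (auto simp: balanced3_def balanced_def same_carrier same_mult)

lemma addgrp_simps [simp]:
  "carrier (addgrp A) = carrier A" "monoid.mult (addgrp A) = add A" "one (addgrp A) = \<zero>\<^bsub>A\<^esub>"
  by (simp_all add: addgrp_def)

lemma comm_group_addgrp:
  assumes "ring A"
  shows "comm_group (addgrp A)"
proof -
  interpret ring A by (rule assms)
  show ?thesis
    by (rule comm_groupI) (use l_neg a_inv_closed in \<open>auto simp: a_ac\<close>)
qed

lemma reg_simps [simp]:
  "carrier (rreg B) = carrier B" "monoid.mult (rreg B) = add B" "one (rreg B) = \<zero>\<^bsub>B\<^esub>"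
  "ract (rreg B) = monoid.mult B"
  "carrier (lreg B) = carrier B" "monoid.mult (lreg B) = add B" "one (lreg B) = \<zero>\<^bsub>B\<^esub>"
  "lact (lreg B) = monoid.mult B"
  by (simp_all add: rreg_def lreg_def)


section \<open>Corings and comodules\<close>

context is_coring
begin

text \<open>These rewrite the group of \<open>clm C\<close> to that of \<open>crm C\<close>, which
  serves as the normal form in all later simplifications.\<close>

lemma
  shows clm_carrier [simp]: "carrier (clm C) = carrier (crm C)"
    and clm_mult [simp]: "monoid.mult (clm C) = monoid.mult (crm C)"
    and clm_one [simp]: "one (clm C) = one (crm C)"
  using same_group by (simp_all add: monoid.truncate_def)

lemma tensor_pair_coring: "tensor_pair B (crm C) (clm C)"
  by (intro tensor_pair.intro R.right_module_axioms L.left_module_axioms)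

end

sublocale is_coring \<subseteq> CC: tensor_pair B "crm C" "clm C"
  by (rule tensor_pair_coring)

sublocale is_coring \<subseteq> CCC: tensor_triple B "crm C" "clm C" B "crm C" "clm C"
  by unfold_locales (simp_all add: acts_commute)

context is_coring
begin

abbreviation "CT \<equiv> tensor B (crm C) (clm C)"

lemmas pten_rules = CC.pten_closed[simplified] CC.pten_add_left[simplified] CC.pten_add_right[simplified]

lemma comult_hom_clm: "comult C \<in> hom (clm C) CT"
  using comult_hom by (simp add: hom_def)

lemma comult_lact_clm: "\<lbrakk>c \<in> carrier (clm C); b \<in> carrier B\<rbrakk> \<Longrightarrow>
    comult C (lact (clm C) b c) = tmap B (crm C) (clm C) (\<lambda>x. lact (clm C) b x) (\<lambda>y. y) (comult C c)"
  using comult_lact by simp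

lemma comult_closed: "c \<in> carrier (crm C) \<Longrightarrow> comult C c \<in> carrier CT"
  using comult_hom by (auto simp: hom_def)

lemma counit_closed: "c \<in> carrier (crm C) \<Longrightarrow> counit C c \<in> carrier B"
  using rmod_hom_closed[OF counit_right] by simp

lemma counit_add: "c \<in> carrier (crm C) \<Longrightarrow> d \<in> carrier (crm C) \<Longrightarrow>
    counit C (c \<otimes>\<^bsub>crm C\<^esub> d) = counit C c \<oplus>\<^bsub>B\<^esub> counit C d"
  using rmod_hom_add[OF counit_right] by simp

lemma counit_ract: "c \<in> carrier (crm C) \<Longrightarrow> b \<in> carrier B \<Longrightarrow>
    counit C (ract (crm C) c b) = counit C c \<otimes>\<^bsub>B\<^esub> b"
  using rmod_hom_act[OF counit_right] by simp

lemma counit_lact: "c \<in> carrier (crm C) \<Longrightarrow> b \<in> carrier B \<Longrightarrow>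
    counit C (lact (clm C) b c) = b \<otimes>\<^bsub>B\<^esub> counit C c"
  using lmod_hom_act[OF counit_left] by simp

lemma lact_closed: "c \<in> carrier (crm C) \<Longrightarrow> b \<in> carrier B \<Longrightarrow> lact (clm C) b c \<in> carrier (crm C)"
  using L.lact_closed by simp

lemma ract_lmod_hom: "b \<in> carrier B \<Longrightarrow> (\<lambda>c. ract (crm C) c b) \<in> lmod_hom B (clm C) (clm C)"
  by (rule CCC.ract_mid_lmod_hom)

lemma lact_rmod_hom: "b \<in> carrier B \<Longrightarrow> (\<lambda>c. lact (clm C) b c) \<in> rmod_hom B (crm C) (crm C)"
  by (rule CCC.lact_mid_rmod_hom)

lemma counital_right_balanced: "balanced B (crm C) (clm C) (crm C) (\<lambda>x y. ract (crm C) x (counit C y))"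
  by (rule balancedI)
    (auto simp: R.ract_closed R.ract_add_left R.ract_add_right counit_closed counit_add counit_lact R.ract_mult)

lemma counital_left_balanced: "balanced B (crm C) (clm C) (clm C) (\<lambda>x y. lact (clm C) (counit C x) y)"
  using L.lact_closed L.lact_add_left L.lact_add_right L.lact_mult
  by (intro balancedI) (auto simp: counit_closed counit_add counit_ract)

text \<open>Applying the lift of \<open>h\<close> to both sides of \<open>coassoc\<close> gives
  coassociativity in usable form: inside a trilinear expression the coproduct of the first leg may
  be traded for the coproduct of the second.\<close>

lemma coassoc_sum:
  assumes G: "comm_group G" and h: "balanced3 B (crm C) (clm C) B (crm C) (clm C) G h"
    and c: "c \<in> carrier (crm C)"
  shows "tlift G (\<lambda>(q, p). tlift G (\<lambda>(m, n). h m n p) (comult C q)) (comult C c) =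
    tlift G (\<lambda>(m, q). tlift G (\<lambda>(n, p). h m n p) (comult C q)) (comult C c)"
  using CCC.tlift3_ten_left[OF R.right_module_axioms comult_hom comult_ract G h comult_closed[OF c]]
    CCC.tlift3_ten_right[OF L.left_module_axioms comult_hom_clm comult_lact_clm G h comult_closed[OF c]]
    coassoc[OF c] by simp

end

locale coring_right_comodule = C: is_coring B C + right_comodule B C M
  for B :: "('b, 'x) ring_scheme" and C :: "('b, 'c, 'y) coring_scheme"
    and M :: "('b, 'm, 'c, 'z) rcomodule_scheme"

sublocale coring_right_comodule \<subseteq> MC: tensor_pair B M "clm C"
  by (intro tensor_pair.intro right_module_axioms C.L.left_module_axioms)

sublocale coring_right_comodule \<subseteq> MCC: tensor_triple B M "clm C" B "crm C" "clm C"
  by unfold_locales (simp_all add: C.acts_commute)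

context coring_right_comodule
begin

lemma rcoact_closed: "m \<in> carrier M \<Longrightarrow> rcoact M m \<in> carrier (tensor B M (clm C))"
  using rcoact_hom by (auto simp: hom_def)

lemma coassoc_sum:
  assumes G: "comm_group G" and h: "balanced3 B M (clm C) B (crm C) (clm C) G h" and m: "m \<in> carrier M"
  shows "tlift G (\<lambda>(q, c). tlift G (\<lambda>(n, c'). h n c' c) (rcoact M q)) (rcoact M m) =
    tlift G (\<lambda>(n, q). tlift G (\<lambda>(c', c). h n c' c) (comult C q)) (rcoact M m)"
  using MCC.tlift3_ten_left[OF right_module_axioms rcoact_hom rcoact_ract G h rcoact_closed[OF m]]
    MCC.tlift3_ten_right[OF C.L.left_module_axioms C.comult_hom_clm C.comult_lact_clm G h rcoact_closed[OF m]]
    rcoact_coassoc[OF m] by simp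

lemma counital_balanced: "balanced B M (clm C) M (\<lambda>x c. ract M x (counit C c))"
  by (rule balancedI)
    (auto simp: ract_closed ract_add_left ract_add_right C.counit_closed C.counit_add C.counit_lact ract_mult)

end

locale coring_left_comodule = C: is_coring B C + left_comodule B C M
  for B :: "('b, 'x) ring_scheme" and C :: "('b, 'c, 'y) coring_scheme"
    and M :: "('b, 'm, 'c, 'z) lcomodule_scheme"

sublocale coring_left_comodule \<subseteq> CM: tensor_pair B "crm C" M
  by (intro tensor_pair.intro left_module_axioms C.R.right_module_axioms)

sublocale coring_left_comodule \<subseteq> CCM: tensor_triple B "crm C" "clm C" B "crm C" M
  by unfold_locales (simp_all add: C.acts_commute)

context coring_left_comodule
begin

lemma lcoact_closed: "m \<in> carrier M \<Longrightarrow> lcoact M m \<in> carrier (tensor B (crm C) M)"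
  using lcoact_hom by (auto simp: hom_def)

lemma coassoc_sum:
  assumes G: "comm_group G" and h: "balanced3 B (crm C) (clm C) B (crm C) M G h" and m: "m \<in> carrier M"
  shows "tlift G (\<lambda>(q, n). tlift G (\<lambda>(c, c'). h c c' n) (comult C q)) (lcoact M m) =
    tlift G (\<lambda>(c, q). tlift G (\<lambda>(c', n). h c c' n) (lcoact M q)) (lcoact M m)"
  using CCM.tlift3_ten_left[OF C.R.right_module_axioms C.comult_hom C.comult_ract G h lcoact_closed[OF m]]
    CCM.tlift3_ten_right[OF left_module_axioms lcoact_hom lcoact_lact G h lcoact_closed[OF m]]
    lcoact_coassoc[OF m] by simp

lemma counital_balanced: "balanced B (crm C) M M (\<lambda>c x. lact M (counit C c) x)"
  by (rule balancedI)
    (auto simp: lact_closed lact_add_left lact_add_right C.counit_closed C.counit_add C.counit_ract lact_mult)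

end


section \<open>Coseparable corings\<close>

text \<open>
  The composite \<open>\<theta> = \<epsilon> \<circ> p\<close> of a bicolinear splitting \<open>p\<close> of the comultiplication with the counit.
\<close>

locale cointegral = is_coring B C
  for B :: "('b, 'x) ring_scheme" and C :: "('b, 'c, 'y) coring_scheme" +
  fixes \<theta> :: "'c \<Rightarrow> 'c \<Rightarrow> 'b"
  assumes balanced_theta: "balanced B (crm C) (clm C) (addgrp B) \<theta>"
    and theta_lact: "\<lbrakk>x \<in> carrier (crm C); y \<in> carrier (crm C); b \<in> carrier B\<rbrakk> \<Longrightarrow>
      \<theta> (lact (clm C) b x) y = b \<otimes>\<^bsub>B\<^esub> \<theta> x y"
    and theta_ract: "\<lbrakk>x \<in> carrier (crm C); y \<in> carrier (crm C); b \<in> carrier B\<rbrakk> \<Longrightarrow>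
      \<theta> x (ract (crm C) y b) = \<theta> x y \<otimes>\<^bsub>B\<^esub> b"
    and theta_colinear: "\<lbrakk>x \<in> carrier (crm C); y \<in> carrier (crm C)\<rbrakk> \<Longrightarrow>
      tlift (crm C) (\<lambda>(x1, x2). ract (crm C) x1 (\<theta> x2 y)) (comult C x) =
      tlift (clm C) (\<lambda>(y1, y2). lact (clm C) (\<theta> x y1) y2) (comult C y)"
    and theta_comult: "c \<in> carrier (crm C) \<Longrightarrow> tlift (addgrp B) (\<lambda>(x, y). \<theta> x y) (comult C c) = counit C c"
begin

lemma
  assumes "x \<in> carrier (crm C)" "y \<in> carrier (crm C)"
  shows theta_closed: "\<theta> x y \<in> carrier B"
    and theta_add_left: "x' \<in> carrier (crm C) \<Longrightarrow> \<theta> (x \<otimes>\<^bsub>crm C\<^esub> x') y = \<theta> x y \<oplus>\<^bsub>B\<^esub> \<theta> x' y"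
    and theta_add_right: "y' \<in> carrier (crm C) \<Longrightarrow> \<theta> x (y \<otimes>\<^bsub>crm C\<^esub> y') = \<theta> x y \<oplus>\<^bsub>B\<^esub> \<theta> x y'"
    and theta_act: "b \<in> carrier B \<Longrightarrow> \<theta> (ract (crm C) x b) y = \<theta> x (lact (clm C) b y)"
  using assms balanced_theta by (auto simp: balanced_def)

end

context is_coring
begin

text \<open>Left colinearity of \<open>p\<close> followed by the counit on the right leg gives p(x
  \<otimes> y) = x1 \<theta>(x2, y); right colinearity followed by the counit on the left leg gives
  p(x \<otimes> y) = \<theta>(x, y1) y2. Equating the two expressions is
  \<open>theta_colinear\<close>.\<close>

lemma coseparable_imp_cointegral:
  assumes "coseparable B C"
  obtains \<theta> where "cointegral B C \<theta>"
proof -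
  obtain p where p: "p \<in> square_bicomod_hom B C" and split: "\<And>c. c \<in> carrier (crm C) \<Longrightarrow> p (comult C c) = c"
    using assms by (auto simp: coseparable_def)
  define P where "P x y = p (pten B (crm C) (clm C) x y)" for x y
  define \<theta> where "\<theta> x y = counit C (P x y)" for x y
  note T = CC.comm_group_tensor
  have p_hom: "p \<in> hom CT (crm C)" using p by (simp add: square_bicomod_hom_def)
  have P: "balanced B (crm C) (clm C) (crm C) P"
    unfolding P_def by (rule CC.balanced_hom[OF p_hom CC.balanced_pten])
  note Pc = balanced_closed[OF P, simplified] and Pl = balanced_add_left[OF P, simplified]
    and Pr = balanced_add_right[OF P, simplified] and Pa = balanced_act[OF P, simplified]
  have P_lact: "P (lact (clm C) b x) y = lact (clm C) b (P x y)"
    if "x \<in> carrier (crm C)" "y \<in> carrier (crm C)" "b \<in> carrier B" for x y b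
  proof -
    have "pten B (crm C) (clm C) (lact (clm C) b x) y =
        tmap B (crm C) (clm C) (\<lambda>x. lact (clm C) b x) (\<lambda>y. y) (pten B (crm C) (clm C) x y)"
      by (subst CC.tmap_pten[OF tensor_pair_coring lact_rmod_hom lmod_hom_id]) (use that in auto)
    then show ?thesis
      using p that CC.pten_closed[of x y] by (simp add: P_def square_bicomod_hom_def)
  qed
  have P_ract: "P x (ract (crm C) y b) = ract (crm C) (P x y) b"
    if "x \<in> carrier (crm C)" "y \<in> carrier (crm C)" "b \<in> carrier B" for x y b
  proof -
    have "pten B (crm C) (clm C) x (ract (crm C) y b) =
        tmap B (crm C) (clm C) (\<lambda>x. x) (\<lambda>y. ract (crm C) y b) (pten B (crm C) (clm C) x y)"
      by (subst CC.tmap_pten[OF tensor_pair_coring rmod_hom_id ract_lmod_hom]) (use that in auto)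
    then show ?thesis
      using p that CC.pten_closed[of x y] by (simp add: P_def square_bicomod_hom_def)
  qed
  have eps: "counit C \<in> hom (crm C) (addgrp B)" "counit C \<in> hom (clm C) (addgrp B)"
    using rmod_hom_hom[OF counit_right] by (auto simp: hom_def)
  have left: "P x y = tlift (crm C) (\<lambda>(x1, x2). ract (crm C) x1 (\<theta> x2 y)) (comult C x)"
    if x: "x \<in> carrier (crm C)" and y: "y \<in> carrier (crm C)" for x y
  proof -
    have y': "y \<in> carrier (clm C)" using y by simp
    have h: "balanced3 B (crm C) (clm C) B (crm C) (clm C) CT (\<lambda>a b c. pten B (crm C) (clm C) a (P b c))"
      by (rule CCC.balanced3I)
        (simp_all add: pten_rules CC.pten_act Pc Pl Pr Pa P_lact)
    have b1: "balanced B (crm C) (clm C) CT (\<lambda>m n. pten B (crm C) (clm C) m (P n y))"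
      using h y by (simp add: balanced3_def)
    have b2: "balanced B (crm C) (clm C) CT
        (\<lambda>q z. tlift CT (\<lambda>(m, n). pten B (crm C) (clm C) m (P n z)) (comult C q))"
      by (rule CCC.balanced_nest_left[OF R.right_module_axioms comult_hom comult_ract T h])
    have "comult C (P x y) = tlift CT (\<lambda>(x, y, z). pten B (crm C) (clm C) x (P y z))
        (ten_left B (crm C) (clm C) B (crm C) (clm C) (comult C) (pten B (crm C) (clm C) x y))"
      using p x y CC.pten_closed[of x y] by (simp add: P_def square_bicomod_hom_def)
    also have "\<dots> = tlift CT (\<lambda>(m, n). pten B (crm C) (clm C) m (P n y)) (comult C x)"
      by (rule trans[OF CCC.tlift3_ten_left[OF R.right_module_axioms comult_hom comult_ract T h pten_rules(1)[OF x y]] CC.tlift_pten[OF T b2 x y']])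
    finally have *: "comult C (P x y) = tlift CT (\<lambda>(m, n). pten B (crm C) (clm C) m (P n y)) (comult C x)" .
    note e = CC.tlift_hom[OF R.M.comm_group_axioms counital_right_balanced]
    have "P x y = tlift (crm C) (\<lambda>(x, y). ract (crm C) x (counit C y)) (comult C (P x y))"
      using counital_right[of "P x y"] x y by (simp add: Pc)
    also have "\<dots> = tlift (crm C) (\<lambda>(m, n). tlift (crm C) (\<lambda>(x, y). ract (crm C) x (counit C y))
        (pten B (crm C) (clm C) m (P n y))) (comult C x)"
      unfolding * by (rule CC.hom_tlift[OF T R.M.comm_group_axioms e b1 comult_closed[OF x]])
    also have "\<dots> = tlift (crm C) (\<lambda>(x1, x2). ract (crm C) x1 (\<theta> x2 y)) (comult C x)"
      by (rule CC.tlift_cong[OF R.M.comm_group_axioms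
            CC.balanced_hom[OF e b1] _ comult_closed[OF x]])
        (use y in \<open>auto simp: CC.tlift_pten[OF R.M.comm_group_axioms counital_right_balanced] Pc \<theta>_def\<close>)
    finally show ?thesis .
  qed
  have right: "P x y = tlift (clm C) (\<lambda>(y1, y2). lact (clm C) (\<theta> x y1) y2) (comult C y)"
    if x: "x \<in> carrier (crm C)" and y: "y \<in> carrier (crm C)" for x y
  proof -
    have y': "y \<in> carrier (clm C)" using y by simp
    have h: "balanced3 B (crm C) (clm C) B (crm C) (clm C) CT (\<lambda>a b c. pten B (crm C) (clm C) (P a b) c)"
      by (rule CCC.balanced3I)
        (simp_all add: pten_rules Pc Pl Pr Pa P_ract R.ract_closed flip: CC.pten_act)
    have b1: "balanced B (crm C) (clm C) CT (\<lambda>m n. pten B (crm C) (clm C) (P x m) n)"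
      using h x by (simp add: balanced3_def)
    have b2: "balanced B (crm C) (clm C) CT
        (\<lambda>m q. tlift CT (\<lambda>(n, z). pten B (crm C) (clm C) (P m n) z) (comult C q))"
      by (rule CCC.balanced_nest_right[OF L.left_module_axioms comult_hom_clm comult_lact_clm T h])
    have "comult C (P x y) = tlift CT (\<lambda>(x, y, z). pten B (crm C) (clm C) (P x y) z)
        (ten_right B (crm C) (clm C) B (crm C) (clm C) (comult C) (pten B (crm C) (clm C) x y))"
      using p pten_rules(1)[OF x y] unfolding P_def square_bicomod_hom_def mem_Collect_eq by blast
    also have "\<dots> = tlift CT (\<lambda>(m, n). pten B (crm C) (clm C) (P x m) n) (comult C y)"
      by (rule trans[OF CCC.tlift3_ten_right[OF L.left_module_axioms comult_hom_clm comult_lact_clm T h pten_rules(1)[OF x y]] CC.tlift_pten[OF T b2 x y']])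
    finally have *: "comult C (P x y) = tlift CT (\<lambda>(m, n). pten B (crm C) (clm C) (P x m) n) (comult C y)" .
    note e = CC.tlift_hom[OF L.M.comm_group_axioms counital_left_balanced]
    have "P x y = tlift (clm C) (\<lambda>(x, y). lact (clm C) (counit C x) y) (comult C (P x y))"
      using counital_left[of "P x y"] x y by (simp add: Pc)
    also have "\<dots> = tlift (clm C) (\<lambda>(m, n). tlift (clm C) (\<lambda>(x, y). lact (clm C) (counit C x) y)
        (pten B (crm C) (clm C) (P x m) n)) (comult C y)"
      unfolding * by (rule CC.hom_tlift[OF T L.M.comm_group_axioms e b1 comult_closed[OF y]])
    also have "\<dots> = tlift (clm C) (\<lambda>(y1, y2). lact (clm C) (\<theta> x y1) y2) (comult C y)"
      by (rule CC.tlift_cong[OF L.M.comm_group_axioms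
            CC.balanced_hom[OF e b1] _ comult_closed[OF y]])
        (use x in \<open>auto simp: CC.tlift_pten[OF L.M.comm_group_axioms counital_left_balanced] Pc \<theta>_def\<close>)
    finally show ?thesis .
  qed
  have B: "comm_group (addgrp B)" by (rule comm_group_addgrp[OF R.B.ring_axioms])
  \<comment> \<open>Since \<open>p\<close> splits the coproduct, p(c1 \<otimes> c2) = c; applying
    the counit gives the normalization of \<theta>.\<close>
  have comult: "tlift (addgrp B) (\<lambda>(x, y). \<theta> x y) (comult C c) = counit C c" if c: "c \<in> carrier (crm C)" for c
  proof -
    have "p (comult C c) = p (tlift CT (\<lambda>(x, y). pten B (crm C) (clm C) x y) (comult C c))"
      using CC.tlift_pten_id[OF comult_closed[OF c]] by simp
    also have "\<dots> = tlift (crm C) (\<lambda>(x, y). P x y) (comult C c)"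
      unfolding P_def
      by (rule CC.hom_tlift[OF T R.M.comm_group_axioms p_hom CC.balanced_pten comult_closed[OF c]])
    finally have "c = tlift (crm C) (\<lambda>(x, y). P x y) (comult C c)" using split[OF c] by simp
    then have "counit C c = counit C (tlift (crm C) (\<lambda>(x, y). P x y) (comult C c))" by simp
    also have "\<dots> = tlift (addgrp B) (\<lambda>(x, y). \<theta> x y) (comult C c)"
      unfolding \<theta>_def by (rule CC.hom_tlift[OF R.M.comm_group_axioms B eps(1) P comult_closed[OF c]])
    finally show ?thesis ..
  qed
  have "cointegral B C \<theta>"
  proof unfold_locales
    show "balanced B (crm C) (clm C) (addgrp B) \<theta>"
      by (rule balancedI) (auto simp: \<theta>_def Pc Pl Pr Pa counit_closed counit_add)
  qed (auto simp: \<theta>_def P_lact P_ract Pc counit_lact counit_ract comult[unfolded \<theta>_def]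
      left[unfolded \<theta>_def, symmetric] right[unfolded \<theta>_def, symmetric])
  then show ?thesis by (rule that)
qed

end

section \<open>Averaging with a cointegral: right comodules\<close>

lemma (in coring_right_comodule) pten_closed:
  "m \<in> carrier M \<Longrightarrow> c \<in> carrier (crm C) \<Longrightarrow> pten B M (clm C) m c \<in> carrier (tensor B M (clm C))"
  by (rule MC.pten_closed) simp_all

lemma (in coring_right_comodule) pten_add_right:
  "m \<in> carrier M \<Longrightarrow> c \<in> carrier (crm C) \<Longrightarrow> d \<in> carrier (crm C) \<Longrightarrow>
    pten B M (clm C) m (c \<otimes>\<^bsub>crm C\<^esub> d) = pten B M (clm C) m c \<otimes>\<^bsub>tensor B M (clm C)\<^esub> pten B M (clm C) m d"
  using MC.pten_add_right[of m c d] by simp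

lemma (in coring_right_comodule) pten_add_left:
  "m \<in> carrier M \<Longrightarrow> m' \<in> carrier M \<Longrightarrow> c \<in> carrier (crm C) \<Longrightarrow>
    pten B M (clm C) (m \<otimes>\<^bsub>M\<^esub> m') c = pten B M (clm C) m c \<otimes>\<^bsub>tensor B M (clm C)\<^esub> pten B M (clm C) m' c"
  using MC.pten_add_left[of m m' c] by simp

lemma (in coring_right_comodule) pten_act:
  "m \<in> carrier M \<Longrightarrow> b \<in> carrier B \<Longrightarrow> c \<in> carrier (crm C) \<Longrightarrow>
    pten B M (clm C) (ract M m b) c = pten B M (clm C) m (lact (clm C) b c)"
  using MC.pten_act[of m b c] by simp

locale cointegral_right = cointegral B C \<theta> + right_comodule B C M
  for B :: "('b, 'x) ring_scheme" and C :: "('b, 'c, 'y) coring_scheme" and \<theta> :: "'c \<Rightarrow> 'c \<Rightarrow> 'b"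
    and M :: "('b, 'm, 'c, 'z) rcomodule_scheme"

sublocale cointegral_right \<subseteq> RM: coring_right_comodule B C M
  by unfold_locales

context cointegral_right
begin

text \<open>On \<open>M \<otimes> C\<close> with the coaction induced by the comultiplication of
  \<open>C\<close>, this induces a colinear retraction of the coaction of \<open>M\<close>:
  colinearity is \<open>rcoact_avg\<close>, the retraction property is
  \<open>avg_rcoact\<close>.\<close>

definition avg :: "'m \<Rightarrow> 'c \<Rightarrow> 'm"
  where "avg m d = tlift M (\<lambda>(m0, c). ract M m0 (\<theta> c d)) (rcoact M m)"

text \<open>Linearity of \<theta> in its first argument serves the first tensor sign, balancedness
  of \<theta> the second.\<close>

lemma balanced3_ract_theta: "balanced3 B M (clm C) B (crm C) (clm C) M (\<lambda>m c d. ract M m (\<theta> c d))"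
  by (rule RM.MCC.balanced3I)
    (simp_all add: ract_closed ract_add_left ract_add_right theta_closed theta_add_left theta_add_right
      theta_act theta_lact ract_mult)

lemma balanced_ract_theta: "d \<in> carrier (crm C) \<Longrightarrow> balanced B M (clm C) M (\<lambda>m c. ract M m (\<theta> c d))"
  using balanced3_ract_theta by (simp add: balanced3_def)

lemma balanced_avg: "balanced B M (clm C) M avg"
  unfolding avg_def
  by (rule RM.MCC.balanced_nest_left[OF right_module_axioms rcoact_hom rcoact_ract M.comm_group_axioms
        balanced3_ract_theta])

lemma avg_closed: "m \<in> carrier M \<Longrightarrow> d \<in> carrier (crm C) \<Longrightarrow> avg m d \<in> carrier M"
  using balanced_closed[OF balanced_avg] by simp

lemma ract_hom: "b \<in> carrier B \<Longrightarrow> (\<lambda>m. ract M m b) \<in> hom M M"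
  by (auto simp: hom_def ract_closed ract_add_left)

lemma avg_ract:
  assumes m: "m \<in> carrier M" and d: "d \<in> carrier (crm C)" and b: "b \<in> carrier B"
  shows "avg m (ract (crm C) d b) = ract M (avg m d) b"
proof -
  have db: "ract (crm C) d b \<in> carrier (crm C)" using R.ract_closed d b by blast
  note G = M.comm_group_axioms and X = RM.rcoact_closed[OF m]
  have "avg m (ract (crm C) d b) = tlift M (\<lambda>(m0, c). ract M (ract M m0 (\<theta> c d)) b) (rcoact M m)"
    unfolding avg_def
    by (rule RM.MC.tlift_cong[OF G balanced_ract_theta[OF db] _ X])
      (simp add: theta_ract theta_closed ract_mult d b)
  also have "\<dots> = ract M (avg m d) b"
    unfolding avg_def
    by (rule RM.MC.hom_tlift[OF G G ract_hom[OF b] balanced_ract_theta[OF d] X, symmetric])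
  finally show ?thesis .
qed

text \<open>Coassociativity puts both arguments of \<theta> into the coproduct of one leg, where
  \<open>theta_comult\<close> collapses \<theta> to the counit; then the counit axiom of
  \<open>M\<close> applies.\<close>

lemma avg_rcoact:
  assumes m: "m \<in> carrier M"
  shows "tlift M (\<lambda>(m0, d). avg m0 d) (rcoact M m) = m"
proof -
  note G = M.comm_group_axioms and X = RM.rcoact_closed[OF m]
  have B: "comm_group (addgrp B)" by (rule comm_group_addgrp[OF R.B.ring_axioms])
  have "tlift M (\<lambda>(m0, d). avg m0 d) (rcoact M m) =
      tlift M (\<lambda>(m0, q). tlift M (\<lambda>(c, d). ract M m0 (\<theta> c d)) (comult C q)) (rcoact M m)"
    unfolding avg_def by (rule RM.coassoc_sum[OF G balanced3_ract_theta m])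
  also have "\<dots> = tlift M (\<lambda>(m0, q). ract M m0 (counit C q)) (rcoact M m)"
  proof (rule RM.MC.tlift_cong[OF G RM.counital_balanced _ X, symmetric])
    fix m0 q assume m0: "m0 \<in> carrier M" and q: "q \<in> carrier (clm C)"
    then have q': "q \<in> carrier (crm C)" by simp
    have h: "(\<lambda>b. ract M m0 b) \<in> hom (addgrp B) M"
      using m0 by (auto simp: hom_def ract_closed ract_add_right)
    show "ract M m0 (counit C q) = tlift M (\<lambda>(c, d). ract M m0 (\<theta> c d)) (comult C q)"
      unfolding theta_comult[OF q', symmetric]
      by (rule CC.hom_tlift[OF B G h balanced_theta comult_closed[OF q']])
  qed
  also have "\<dots> = m" by (rule rcoact_counital[OF m])
  finally show ?thesis .
qed

text \<open>The computation is m0 \<otimes> m1 \<theta>(m2, d) = m0 \<otimes> \<theta>(m1, d1) d2 =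
  m0 \<theta>(m1, d1) \<otimes> d2: the first equality is \<open>theta_colinear\<close>, the second
  moves a scalar across the tensor sign.\<close>

lemma rcoact_avg:
  assumes m: "m \<in> carrier M" and d: "d \<in> carrier (crm C)"
  shows "rcoact M (avg m d) =
    tlift (tensor B M (clm C)) (\<lambda>(d1, d2). pten B M (clm C) (avg m d1) d2) (comult C d)"
proof -
  let ?T = "tensor B M (clm C)" and ?p = "pten B M (clm C)"
  note G = M.comm_group_axioms and X = RM.rcoact_closed[OF m] and T = RM.MC.comm_group_tensor
  note Y = comult_closed[OF d]
  have h3: "balanced3 B M (clm C) B (crm C) (clm C) ?T (\<lambda>m1 c' c. ?p m1 (ract (crm C) c' (\<theta> c d)))"
    by (rule RM.MCC.balanced3I)
      (simp_all add: RM.pten_closed RM.pten_add_left RM.pten_add_right RM.pten_act R.ract_closed R.ract_add_left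
        R.ract_add_right theta_closed theta_add_left theta_lact d R.ract_mult acts_commute lact_closed)
  have b1: "balanced B M (clm C) ?T (\<lambda>m0 c. rcoact M (ract M m0 (\<theta> c d)))"
    by (rule RM.MC.balanced_hom[OF rcoact_hom balanced_ract_theta[OF d]])
  have s: "balanced B (crm C) (clm C) (crm C) (\<lambda>c' c. ract (crm C) c' (\<theta> c d))"
    by (rule balancedI)
      (simp_all add: R.ract_closed R.ract_add_left R.ract_add_right theta_closed theta_add_left theta_lact d R.ract_mult)
  have s': "balanced B (crm C) (clm C) (clm C) (\<lambda>d1 d2. lact (clm C) (\<theta> q d1) d2)"
    if q: "q \<in> carrier (crm C)" for q
    using L.lact_add_left L.lact_add_right L.lact_mult q
    by (intro balancedI) (simp_all add: lact_closed theta_closed theta_add_right theta_ract)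
  have f: "balanced B M (clm C) ?T (\<lambda>m0 q. ?p m0 (lact (clm C) (\<theta> q d1) d2))"
    if "d1 \<in> carrier (crm C)" "d2 \<in> carrier (clm C)" for d1 d2
    using that L.lact_add_left L.lact_mult
    by (intro balancedI) (simp_all add: RM.pten_closed RM.pten_add_left RM.pten_add_right RM.pten_act lact_closed
        theta_closed theta_add_left theta_lact)
  have f': "balanced B (crm C) (clm C) ?T (\<lambda>d1 d2. ?p m0 (lact (clm C) (\<theta> q d1) d2))"
    if "m0 \<in> carrier M" "q \<in> carrier (clm C)" for m0 q
    using that L.lact_add_left L.lact_add_right L.lact_mult
    by (intro balancedI) (simp_all add: RM.pten_closed RM.pten_add_right lact_closed theta_closed theta_add_right theta_ract)
  have "rcoact M (avg m d) = tlift ?T (\<lambda>(m0, c). rcoact M (ract M m0 (\<theta> c d))) (rcoact M m)"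
    unfolding avg_def by (rule RM.MC.hom_tlift[OF G T rcoact_hom balanced_ract_theta[OF d] X])
  also have "\<dots> = tlift ?T (\<lambda>(m0, c). tlift ?T (\<lambda>(m1, c'). ?p m1 (ract (crm C) c' (\<theta> c d))) (rcoact M m0)) (rcoact M m)"
  proof (rule RM.MC.tlift_cong[OF T b1 _ X])
    fix m0 c assume m0: "m0 \<in> carrier M" and c: "c \<in> carrier (clm C)"
    then have t: "\<theta> c d \<in> carrier B" using theta_closed d by simp
    show "rcoact M (ract M m0 (\<theta> c d)) = tlift ?T (\<lambda>(m1, c'). ?p m1 (ract (crm C) c' (\<theta> c d))) (rcoact M m0)"
      using rcoact_ract[OF m0 t] by (simp add: tmap_def)
  qed
  also have "\<dots> = tlift ?T (\<lambda>(m0, q). tlift ?T (\<lambda>(c', c). ?p m0 (ract (crm C) c' (\<theta> c d))) (comult C q)) (rcoact M m)"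
    by (rule RM.coassoc_sum[OF T h3 m])
  also have "\<dots> = tlift ?T (\<lambda>(m0, q). tlift ?T (\<lambda>(d1, d2). ?p m0 (lact (clm C) (\<theta> q d1) d2)) (comult C d)) (rcoact M m)"
  proof (rule RM.MC.tlift_cong[OF T _ _ X])
    show "balanced B M (clm C) ?T (\<lambda>m0 q. tlift ?T (\<lambda>(c', c). ?p m0 (ract (crm C) c' (\<theta> c d))) (comult C q))"
      by (rule RM.MCC.balanced_nest_right[OF L.left_module_axioms comult_hom_clm comult_lact_clm T h3])
    fix m0 q assume m0: "m0 \<in> carrier M" and q: "q \<in> carrier (clm C)"
    then have q': "q \<in> carrier (crm C)" by simp
    have h: "?p m0 \<in> hom (crm C) ?T" "?p m0 \<in> hom (clm C) ?T"
      using m0 by (auto simp: hom_def RM.pten_closed RM.pten_add_right)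
    have "tlift ?T (\<lambda>(c', c). ?p m0 (ract (crm C) c' (\<theta> c d))) (comult C q) =
        ?p m0 (tlift (crm C) (\<lambda>(c', c). ract (crm C) c' (\<theta> c d)) (comult C q))"
      by (rule CC.hom_tlift[OF R.M.comm_group_axioms T h(1) s comult_closed[OF q'], symmetric])
    also have "\<dots> = ?p m0 (tlift (clm C) (\<lambda>(d1, d2). lact (clm C) (\<theta> q d1) d2) (comult C d))"
      using theta_colinear[OF q' d] by simp
    also have "\<dots> = tlift ?T (\<lambda>(d1, d2). ?p m0 (lact (clm C) (\<theta> q d1) d2)) (comult C d)"
      by (rule CC.hom_tlift[OF L.M.comm_group_axioms T h(2) s'[OF q'] Y])
    finally show "tlift ?T (\<lambda>(c', c). ?p m0 (ract (crm C) c' (\<theta> c d))) (comult C q) =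
        tlift ?T (\<lambda>(d1, d2). ?p m0 (lact (clm C) (\<theta> q d1) d2)) (comult C d)" .
  qed
  \<comment> \<open>The legs of \<open>m\<close> and of \<open>d\<close> are independent, so the sum
    over the coproduct of \<open>d\<close> can be taken outermost.\<close>
  also have "\<dots> = tlift ?T (\<lambda>(d1, d2). tlift ?T (\<lambda>(m0, q). ?p m0 (lact (clm C) (\<theta> q d1) d2)) (rcoact M m)) (comult C d)"
    by (rule RM.MC.Fubini[OF T tensor_pair_coring f f' X Y])
  also have "\<dots> = tlift ?T (\<lambda>(d1, d2). ?p (avg m d1) d2) (comult C d)"
  proof (rule CC.tlift_cong[OF T _ _ Y, symmetric])
    show "balanced B (crm C) (clm C) ?T (\<lambda>d1 d2. ?p (avg m d1) d2)"
      using m balanced_add_right[OF balanced_avg]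
      by (intro balancedI)
        (simp_all add: RM.pten_closed RM.pten_add_left RM.pten_add_right avg_closed avg_ract flip: RM.pten_act)
    fix d1 d2 assume d1: "d1 \<in> carrier (crm C)" and d2: "d2 \<in> carrier (clm C)"
    have h: "(\<lambda>n. ?p n d2) \<in> hom M ?T"
      using d2 by (auto simp: hom_def RM.pten_closed RM.pten_add_left)
    have "?p (avg m d1) d2 = tlift ?T (\<lambda>(m0, q). ?p (ract M m0 (\<theta> q d1)) d2) (rcoact M m)"
      unfolding avg_def by (rule RM.MC.hom_tlift[OF G T h balanced_ract_theta[OF d1] X])
    also have "\<dots> = tlift ?T (\<lambda>(m0, q). ?p m0 (lact (clm C) (\<theta> q d1) d2)) (rcoact M m)"
      by (rule RM.MC.tlift_cong[OF T RM.MC.balanced_hom[OF h balanced_ract_theta[OF d1]] _ X])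
        (use d1 d2 in \<open>simp add: RM.pten_act theta_closed\<close>)
    finally show "?p (avg m d1) d2 = tlift ?T (\<lambda>(m0, q). ?p m0 (lact (clm C) (\<theta> q d1) d2)) (rcoact M m)" .
  qed
  finally show ?thesis .
qed

text \<open>The retraction is the composite of the coaction of \<open>N\<close>, of g \<otimes> C
  and of \<open>avg\<close>, each of which is colinear. On the image of \<open>f\<close> it reduces
  to \<open>avg_rcoact\<close>, because \<open>f\<close> commutes with the coactions and
  \<open>g\<close> undoes \<open>f\<close>.\<close>

lemma splits:
  fixes N :: "('b, 'n, 'c, 'w) rcomodule_scheme"
  assumes N: "right_comodule B C N" and f: "f \<in> rcomod_hom B C M N" and split: "splits_rmod B M N f"
  shows "splits_rcomod B C M N f"
proof -
  obtain g where g: "g \<in> rmod_hom B N M" and gf: "\<And>m. m \<in> carrier M \<Longrightarrow> g (f m) = m"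
    using split by (auto simp: splits_rmod_def)
  interpret N: right_comodule B C N by (rule N)
  interpret RN: coring_right_comodule B C N by unfold_locales
  note G = M.comm_group_axioms and T = RM.MC.comm_group_tensor
  let ?T = "tensor B M (clm C)" and ?p = "pten B M (clm C)"
  define g' where "g' n = tlift M (\<lambda>(n0, d). avg (g n0) d) (rcoact N n)" for n
  note gc = rmod_hom_closed[OF g]
  have b: "balanced B N (clm C) M (\<lambda>n0 d. avg (g n0) d)"
    by (rule RN.MC.balanced_compose[OF g lmod_hom_id balanced_avg])
  have g'_hom: "g' \<in> hom N M"
    using hom_compose[OF N.rcoact_hom RN.MC.tlift_hom[OF G b]] by (simp add: g'_def[abs_def] comp_def)
  have g': "g' \<in> rmod_hom B N M"
    unfolding rmod_hom_def
  proof (intro CollectI conjI ballI g'_hom)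
    fix n c assume n: "n \<in> carrier N" and c: "c \<in> carrier B"
    note X = RN.rcoact_closed[OF n]
    have "g' (ract N n c) = tlift M (\<lambda>(n0, d). avg (g n0) (ract (crm C) d c)) (rcoact N n)"
      unfolding g'_def N.rcoact_ract[OF n c]
      by (rule RN.MC.tlift_tmap[OF RN.MC.tensor_pair_axioms rmod_hom_id ract_lmod_hom[OF c] G b X])
    also have "\<dots> = tlift M (\<lambda>(n0, d). ract M (avg (g n0) d) c) (rcoact N n)"
      by (rule RN.MC.tlift_cong[OF G RN.MC.balanced_hom[OF ract_hom[OF c] b] _ X, symmetric])
        (simp add: avg_ract gc c)
    also have "\<dots> = ract M (g' n) c"
      unfolding g'_def by (rule RN.MC.hom_tlift[OF G G ract_hom[OF c] b X, symmetric])
    finally show "g' (ract N n c) = ract M (g' n) c" .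
  qed
  have fr: "f \<in> rmod_hom B M N" and fco: "\<And>m. m \<in> carrier M \<Longrightarrow>
      rcoact N (f m) = tmap B N (clm C) f (\<lambda>c. c) (rcoact M m)"
    using f by (auto simp: rcomod_hom_def)
  have "g' (f m) = m" if m: "m \<in> carrier M" for m
  proof -
    note X = RM.rcoact_closed[OF m]
    have "g' (f m) = tlift M (\<lambda>(m0, d). avg (g (f m0)) d) (rcoact M m)"
      unfolding g'_def fco[OF m]
      by (rule RM.MC.tlift_tmap[OF RN.MC.tensor_pair_axioms fr lmod_hom_id G b X])
    also have "\<dots> = tlift M (\<lambda>(m0, d). avg m0 d) (rcoact M m)"
      by (rule RM.MC.tlift_cong[OF G balanced_avg _ X, symmetric]) (simp add: gf)
    also have "\<dots> = m" by (rule avg_rcoact[OF m])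
    finally show ?thesis .
  qed
  moreover have "rcoact M (g' n) = tmap B M (clm C) g' (\<lambda>c. c) (rcoact N n)" if n: "n \<in> carrier N" for n
  proof -
    note X = RN.rcoact_closed[OF n]
    have h3: "balanced3 B N (clm C) B (crm C) (clm C) ?T (\<lambda>n0 d1 d2. ?p (avg (g n0) d1) d2)"
      using balanced_add_left[OF b] balanced_add_right[OF b] balanced_act[OF b]
      by (intro RN.MCC.balanced3I)
        (simp_all add: gc avg_closed RM.pten_closed RM.pten_add_left RM.pten_add_right avg_ract flip: RM.pten_act)
    have "rcoact M (g' n) = tlift ?T (\<lambda>(n0, d). rcoact M (avg (g n0) d)) (rcoact N n)"
      unfolding g'_def by (rule RN.MC.hom_tlift[OF G T rcoact_hom b X])
    also have "\<dots> = tlift ?T (\<lambda>(n0, d). tlift ?T (\<lambda>(d1, d2). ?p (avg (g n0) d1) d2) (comult C d)) (rcoact N n)"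
      by (rule RN.MC.tlift_cong[OF T RN.MC.balanced_hom[OF rcoact_hom b] _ X]) (simp add: rcoact_avg gc)
    also have "\<dots> = tlift ?T (\<lambda>(q, d2). tlift ?T (\<lambda>(n0, d1). ?p (avg (g n0) d1) d2) (rcoact N q)) (rcoact N n)"
      by (rule RN.coassoc_sum[OF T h3 n, symmetric])
    also have "\<dots> = tlift ?T (\<lambda>(q, d2). ?p (g' q) d2) (rcoact N n)"
    proof (rule RN.MC.tlift_cong[OF T RN.MC.balanced_tmap[OF RM.MC.tensor_pair_axioms g' lmod_hom_id] _ X, symmetric])
      fix q d2 assume q: "q \<in> carrier N" and d2: "d2 \<in> carrier (clm C)"
      have h: "(\<lambda>n. ?p n d2) \<in> hom M ?T"
        using d2 by (auto simp: hom_def RM.pten_closed RM.pten_add_left)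
      show "?p (g' q) d2 = tlift ?T (\<lambda>(n0, d1). ?p (avg (g n0) d1) d2) (rcoact N q)"
        unfolding g'_def by (rule RN.MC.hom_tlift[OF G T h b RN.rcoact_closed[OF q]])
    qed
    finally show ?thesis by (simp add: tmap_def)
  qed
  ultimately show ?thesis
    using f g' by (auto simp: splits_rcomod_def rcomod_hom_def)
qed

end

theorem (in is_coring) coseparable_right_rel_injective:
  assumes "coseparable B C" "right_comodule B C M"
  shows "right_rel_injective B C M"
proof -
  obtain \<theta> where "cointegral B C \<theta>" by (rule coseparable_imp_cointegral[OF assms(1)])
  then interpret cointegral_right B C \<theta> M
    using assms(2) by (simp add: cointegral_right_def)
  show ?thesis unfolding right_rel_injective_def by (blast intro: splits)
qed

section \<open>Averaging with a cointegral: left comodules\<close>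

lemma (in coring_left_comodule) pten_closed:
  "m \<in> carrier M \<Longrightarrow> c \<in> carrier (crm C) \<Longrightarrow> pten B (crm C) M c m \<in> carrier (tensor B (crm C) M)"
  by (rule CM.pten_closed) simp_all

lemma (in coring_left_comodule) pten_add_left:
  "m \<in> carrier M \<Longrightarrow> c \<in> carrier (crm C) \<Longrightarrow> d \<in> carrier (crm C) \<Longrightarrow>
    pten B (crm C) M (c \<otimes>\<^bsub>crm C\<^esub> d) m = pten B (crm C) M c m \<otimes>\<^bsub>tensor B (crm C) M\<^esub> pten B (crm C) M d m"
  using CM.pten_add_left[of c d m] by simp

lemma (in coring_left_comodule) pten_add_right:
  "m \<in> carrier M \<Longrightarrow> m' \<in> carrier M \<Longrightarrow> c \<in> carrier (crm C) \<Longrightarrow>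
    pten B (crm C) M c (m \<otimes>\<^bsub>M\<^esub> m') = pten B (crm C) M c m \<otimes>\<^bsub>tensor B (crm C) M\<^esub> pten B (crm C) M c m'"
  using CM.pten_add_right[of c m m'] by simp

lemma (in coring_left_comodule) pten_act:
  "m \<in> carrier M \<Longrightarrow> b \<in> carrier B \<Longrightarrow> c \<in> carrier (crm C) \<Longrightarrow>
    pten B (crm C) M (ract (crm C) c b) m = pten B (crm C) M c (lact M b m)"
  using CM.pten_act[of c b m] by simp

locale cointegral_left = cointegral B C \<theta> + left_comodule B C M
  for B :: "('b, 'x) ring_scheme" and C :: "('b, 'c, 'y) coring_scheme" and \<theta> :: "'c \<Rightarrow> 'c \<Rightarrow> 'b"
    and M :: "('b, 'm, 'c, 'z) lcomodule_scheme"

sublocale cointegral_left \<subseteq> LM: coring_left_comodule B C M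
  by unfold_locales

context cointegral_left
begin

definition avg :: "'c \<Rightarrow> 'm \<Rightarrow> 'm"
  where "avg d m = tlift M (\<lambda>(c, m0). lact M (\<theta> d c) m0) (lcoact M m)"

lemmas act_simps = left_module.lact_closed[OF left_module_axioms] left_module.lact_add_left[OF left_module_axioms]
  left_module.lact_add_right[OF left_module_axioms] left_module.lact_mult[OF left_module_axioms]
lemmas cact_simps = L.lact_closed[simplified] L.lact_add_left[simplified] L.lact_add_right[simplified] L.lact_mult[simplified]

lemma balanced3_lact_theta: "balanced3 B (crm C) (clm C) B (crm C) M M (\<lambda>d c m. lact M (\<theta> d c) m)"
  by (rule LM.CCM.balanced3I)
    (simp_all add: act_simps theta_closed theta_add_left theta_add_right theta_act theta_ract)

lemma balanced_lact_theta: "d \<in> carrier (crm C) \<Longrightarrow> balanced B (crm C) M M (\<lambda>c m. lact M (\<theta> d c) m)"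
  using balanced3_lact_theta by (simp add: balanced3_def)

lemma balanced_avg: "balanced B (crm C) M M avg"
  unfolding avg_def
  by (rule LM.CCM.balanced_nest_right[OF left_module_axioms lcoact_hom lcoact_lact M.comm_group_axioms
        balanced3_lact_theta])

lemma avg_closed: "m \<in> carrier M \<Longrightarrow> d \<in> carrier (crm C) \<Longrightarrow> avg d m \<in> carrier M"
  using balanced_closed[OF balanced_avg] by simp

lemma lact_hom: "b \<in> carrier B \<Longrightarrow> (\<lambda>m. lact M b m) \<in> hom M M"
  by (auto simp: hom_def act_simps)

lemma avg_lact:
  assumes m: "m \<in> carrier M" and d: "d \<in> carrier (crm C)" and b: "b \<in> carrier B"
  shows "avg (lact (clm C) b d) m = lact M b (avg d m)"
proof -
  have db: "lact (clm C) b d \<in> carrier (crm C)" using cact_simps d b by blast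
  note G = M.comm_group_axioms and X = LM.lcoact_closed[OF m]
  have "avg (lact (clm C) b d) m = tlift M (\<lambda>(c, m0). lact M b (lact M (\<theta> d c) m0)) (lcoact M m)"
    unfolding avg_def
    by (rule LM.CM.tlift_cong[OF G balanced_lact_theta[OF db] _ X])
      (simp add: theta_lact theta_closed act_simps d b)
  also have "\<dots> = lact M b (avg d m)"
    unfolding avg_def
    by (rule LM.CM.hom_tlift[OF G G lact_hom[OF b] balanced_lact_theta[OF d] X, symmetric])
  finally show ?thesis .
qed

lemma avg_lcoact:
  assumes m: "m \<in> carrier M"
  shows "tlift M (\<lambda>(d, m0). avg d m0) (lcoact M m) = m"
proof -
  note G = M.comm_group_axioms and X = LM.lcoact_closed[OF m]
  have B: "comm_group (addgrp B)" by (rule comm_group_addgrp[OF R.B.ring_axioms])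
  have "tlift M (\<lambda>(d, m0). avg d m0) (lcoact M m) =
      tlift M (\<lambda>(q, m0). tlift M (\<lambda>(d, c). lact M (\<theta> d c) m0) (comult C q)) (lcoact M m)"
    unfolding avg_def by (rule LM.coassoc_sum[OF G balanced3_lact_theta m, symmetric])
  also have "\<dots> = tlift M (\<lambda>(q, m0). lact M (counit C q) m0) (lcoact M m)"
  proof (rule LM.CM.tlift_cong[OF G LM.counital_balanced _ X, symmetric])
    fix m0 q assume m0: "m0 \<in> carrier M" and q: "q \<in> carrier (crm C)"
    have h: "(\<lambda>b. lact M b m0) \<in> hom (addgrp B) M"
      using m0 by (auto simp: hom_def act_simps)
    show "lact M (counit C q) m0 = tlift M (\<lambda>(d, c). lact M (\<theta> d c) m0) (comult C q)"
      unfolding theta_comult[OF q, symmetric]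
      by (rule CC.hom_tlift[OF B G h balanced_theta comult_closed[OF q]])
  qed
  also have "\<dots> = m" by (rule lcoact_counital[OF m])
  finally show ?thesis .
qed

text \<open>Here \<open>theta_colinear\<close> is read from right to left. If c \<otimes> m0 is the
  coaction of \<open>m\<close>, then \<theta>(d, c1) c2 \<otimes> m0 = d1 \<theta>(d2, c) \<otimes>
  m0 = d1 \<otimes> \<theta>(d2, c) m0.\<close>

lemma lcoact_avg:
  assumes m: "m \<in> carrier M" and d: "d \<in> carrier (crm C)"
  shows "lcoact M (avg d m) =
    tlift (tensor B (crm C) M) (\<lambda>(d1, d2). pten B (crm C) M d1 (avg d2 m)) (comult C d)"
proof -
  let ?T = "tensor B (crm C) M" and ?p = "pten B (crm C) M"
  note G = M.comm_group_axioms and X = LM.lcoact_closed[OF m] and T = LM.CM.comm_group_tensor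
  note Y = comult_closed[OF d]
  have h3: "balanced3 B (crm C) (clm C) B (crm C) M ?T (\<lambda>c c' m1. ?p (lact (clm C) (\<theta> d c) c') m1)"
    by (rule LM.CCM.balanced3I)
      (simp_all add: LM.pten_closed LM.pten_add_left LM.pten_add_right cact_simps act_simps
        theta_closed theta_add_right theta_ract d acts_commute R.ract_closed flip: LM.pten_act)
  have b1: "balanced B (crm C) M ?T (\<lambda>c m0. lcoact M (lact M (\<theta> d c) m0))"
    by (rule LM.CM.balanced_hom[OF lcoact_hom balanced_lact_theta[OF d]])
  have s: "balanced B (crm C) (clm C) (clm C) (\<lambda>c c'. lact (clm C) (\<theta> d c) c')"
    by (rule balancedI) (simp_all add: cact_simps theta_closed theta_add_right theta_ract d)
  have s': "balanced B (crm C) (clm C) (crm C) (\<lambda>d1 d2. ract (crm C) d1 (\<theta> d2 q))"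
    if q: "q \<in> carrier (crm C)" for q
    using q
    by (intro balancedI)
      (simp_all add: R.ract_closed R.ract_add_left R.ract_add_right R.ract_mult theta_closed theta_add_left theta_lact)
  have f: "balanced B (crm C) M ?T (\<lambda>q m0. ?p (ract (crm C) d1 (\<theta> d2 q)) m0)"
    if "d1 \<in> carrier (crm C)" "d2 \<in> carrier (clm C)" for d1 d2
    using that
    by (intro balancedI) (simp_all add: LM.pten_closed LM.pten_add_left LM.pten_add_right LM.pten_act act_simps
        R.ract_closed R.ract_add_right R.ract_mult theta_closed theta_add_right theta_ract)
  have f': "balanced B (crm C) (clm C) ?T (\<lambda>d1 d2. ?p (ract (crm C) d1 (\<theta> d2 q)) m0)"
    if "q \<in> carrier (crm C)" "m0 \<in> carrier M" for m0 q
    using that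
    by (intro balancedI) (simp_all add: LM.pten_closed LM.pten_add_left R.ract_closed R.ract_add_left
        R.ract_add_right R.ract_mult theta_closed theta_add_left theta_lact)
  have "lcoact M (avg d m) = tlift ?T (\<lambda>(c, m0). lcoact M (lact M (\<theta> d c) m0)) (lcoact M m)"
    unfolding avg_def by (rule LM.CM.hom_tlift[OF G T lcoact_hom balanced_lact_theta[OF d] X])
  also have "\<dots> = tlift ?T (\<lambda>(c, m0). tlift ?T (\<lambda>(c', m1). ?p (lact (clm C) (\<theta> d c) c') m1) (lcoact M m0)) (lcoact M m)"
  proof (rule LM.CM.tlift_cong[OF T b1 _ X])
    fix m0 c assume m0: "m0 \<in> carrier M" and c: "c \<in> carrier (crm C)"
    then have t: "\<theta> d c \<in> carrier B" using theta_closed d by simp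
    show "lcoact M (lact M (\<theta> d c) m0) = tlift ?T (\<lambda>(c', m1). ?p (lact (clm C) (\<theta> d c) c') m1) (lcoact M m0)"
      using lcoact_lact[OF m0 t] by (simp add: tmap_def)
  qed
  also have "\<dots> = tlift ?T (\<lambda>(q, m0). tlift ?T (\<lambda>(c, c'). ?p (lact (clm C) (\<theta> d c) c') m0) (comult C q)) (lcoact M m)"
    by (rule LM.coassoc_sum[OF T h3 m, symmetric])
  also have "\<dots> = tlift ?T (\<lambda>(q, m0). tlift ?T (\<lambda>(d1, d2). ?p (ract (crm C) d1 (\<theta> d2 q)) m0) (comult C d)) (lcoact M m)"
  proof (rule LM.CM.tlift_cong[OF T _ _ X])
    show "balanced B (crm C) M ?T (\<lambda>q m0. tlift ?T (\<lambda>(c, c'). ?p (lact (clm C) (\<theta> d c) c') m0) (comult C q))"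
      by (rule LM.CCM.balanced_nest_left[OF R.right_module_axioms comult_hom comult_ract T h3])
    fix m0 q assume m0: "m0 \<in> carrier M" and q: "q \<in> carrier (crm C)"
    have h: "(\<lambda>c. ?p c m0) \<in> hom (crm C) ?T" "(\<lambda>c. ?p c m0) \<in> hom (clm C) ?T"
      using m0 by (auto simp: hom_def LM.pten_closed LM.pten_add_left)
    have "tlift ?T (\<lambda>(c, c'). ?p (lact (clm C) (\<theta> d c) c') m0) (comult C q) =
        ?p (tlift (clm C) (\<lambda>(c, c'). lact (clm C) (\<theta> d c) c') (comult C q)) m0"
      by (rule CC.hom_tlift[OF L.M.comm_group_axioms T h(2) s comult_closed[OF q], symmetric])
    also have "\<dots> = ?p (tlift (crm C) (\<lambda>(d1, d2). ract (crm C) d1 (\<theta> d2 q)) (comult C d)) m0"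
      using theta_colinear[OF d q] by simp
    also have "\<dots> = tlift ?T (\<lambda>(d1, d2). ?p (ract (crm C) d1 (\<theta> d2 q)) m0) (comult C d)"
      by (rule CC.hom_tlift[OF R.M.comm_group_axioms T h(1) s'[OF q] Y])
    finally show "tlift ?T (\<lambda>(c, c'). ?p (lact (clm C) (\<theta> d c) c') m0) (comult C q) =
        tlift ?T (\<lambda>(d1, d2). ?p (ract (crm C) d1 (\<theta> d2 q)) m0) (comult C d)" .
  qed
  also have "\<dots> = tlift ?T (\<lambda>(d1, d2). tlift ?T (\<lambda>(q, m0). ?p (ract (crm C) d1 (\<theta> d2 q)) m0) (lcoact M m)) (comult C d)"
    by (rule LM.CM.Fubini[OF T tensor_pair_coring f f' X Y])
  also have "\<dots> = tlift ?T (\<lambda>(d1, d2). ?p d1 (avg d2 m)) (comult C d)"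
  proof (rule CC.tlift_cong[OF T _ _ Y, symmetric])
    show "balanced B (crm C) (clm C) ?T (\<lambda>d1 d2. ?p d1 (avg d2 m))"
      using m balanced_add_left[OF balanced_avg]
      by (intro balancedI)
        (simp_all add: LM.pten_closed LM.pten_add_left LM.pten_add_right avg_closed avg_lact LM.pten_act)
    fix d1 d2 assume d1: "d1 \<in> carrier (crm C)" and d2: "d2 \<in> carrier (clm C)"
    have d2': "d2 \<in> carrier (crm C)" using d2 by simp
    have h: "?p d1 \<in> hom M ?T"
      using d1 by (auto simp: hom_def LM.pten_closed LM.pten_add_right)
    have "?p d1 (avg d2 m) = tlift ?T (\<lambda>(q, m0). ?p d1 (lact M (\<theta> d2 q) m0)) (lcoact M m)"
      unfolding avg_def by (rule LM.CM.hom_tlift[OF G T h balanced_lact_theta[OF d2'] X])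
    also have "\<dots> = tlift ?T (\<lambda>(q, m0). ?p (ract (crm C) d1 (\<theta> d2 q)) m0) (lcoact M m)"
      by (rule LM.CM.tlift_cong[OF T LM.CM.balanced_hom[OF h balanced_lact_theta[OF d2']] _ X])
        (use d1 d2' in \<open>simp add: LM.pten_act theta_closed\<close>)
    finally show "?p d1 (avg d2 m) = tlift ?T (\<lambda>(q, m0). ?p (ract (crm C) d1 (\<theta> d2 q)) m0) (lcoact M m)" .
  qed
  finally show ?thesis .
qed

lemma splits:
  fixes N :: "('b, 'n, 'c, 'w) lcomodule_scheme"
  assumes N: "left_comodule B C N" and f: "f \<in> lcomod_hom B C M N" and split: "splits_lmod B M N f"
  shows "splits_lcomod B C M N f"
proof -
  obtain g where g: "g \<in> lmod_hom B N M" and gf: "\<And>m. m \<in> carrier M \<Longrightarrow> g (f m) = m"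
    using split by (auto simp: splits_lmod_def)
  interpret N: left_comodule B C N by (rule N)
  interpret LN: coring_left_comodule B C N by unfold_locales
  note G = M.comm_group_axioms and T = LM.CM.comm_group_tensor
  let ?T = "tensor B (crm C) M" and ?p = "pten B (crm C) M"
  define g' where "g' n = tlift M (\<lambda>(d, n0). avg d (g n0)) (lcoact N n)" for n
  note gc = lmod_hom_closed[OF g]
  have b: "balanced B (crm C) N M (\<lambda>d n0. avg d (g n0))"
    by (rule LN.CM.balanced_compose[OF rmod_hom_id g balanced_avg])
  have g'_hom: "g' \<in> hom N M"
    using hom_compose[OF N.lcoact_hom LN.CM.tlift_hom[OF G b]] by (simp add: g'_def[abs_def] comp_def)
  have g': "g' \<in> lmod_hom B N M"
    unfolding lmod_hom_def
  proof (intro CollectI conjI ballI g'_hom)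
    fix n c assume n: "n \<in> carrier N" and c: "c \<in> carrier B"
    note X = LN.lcoact_closed[OF n]
    have "g' (lact N c n) = tlift M (\<lambda>(d, n0). avg (lact (clm C) c d) (g n0)) (lcoact N n)"
      unfolding g'_def N.lcoact_lact[OF n c]
      by (rule LN.CM.tlift_tmap[OF LN.CM.tensor_pair_axioms lact_rmod_hom[OF c] lmod_hom_id G b X])
    also have "\<dots> = tlift M (\<lambda>(d, n0). lact M c (avg d (g n0))) (lcoact N n)"
      by (rule LN.CM.tlift_cong[OF G LN.CM.balanced_hom[OF lact_hom[OF c] b] _ X, symmetric])
        (simp add: avg_lact gc c)
    also have "\<dots> = lact M c (g' n)"
      unfolding g'_def by (rule LN.CM.hom_tlift[OF G G lact_hom[OF c] b X, symmetric])
    finally show "g' (lact N c n) = lact M c (g' n)" .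
  qed
  have fr: "f \<in> lmod_hom B M N" and fco: "\<And>m. m \<in> carrier M \<Longrightarrow>
      lcoact N (f m) = tmap B (crm C) N (\<lambda>c. c) f (lcoact M m)"
    using f by (auto simp: lcomod_hom_def)
  have "g' (f m) = m" if m: "m \<in> carrier M" for m
  proof -
    note X = LM.lcoact_closed[OF m]
    have "g' (f m) = tlift M (\<lambda>(d, m0). avg d (g (f m0))) (lcoact M m)"
      unfolding g'_def fco[OF m]
      by (rule LM.CM.tlift_tmap[OF LN.CM.tensor_pair_axioms rmod_hom_id fr G b X])
    also have "\<dots> = tlift M (\<lambda>(d, m0). avg d m0) (lcoact M m)"
      by (rule LM.CM.tlift_cong[OF G balanced_avg _ X, symmetric]) (simp add: gf)
    also have "\<dots> = m" by (rule avg_lcoact[OF m])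
    finally show ?thesis .
  qed
  moreover have "lcoact M (g' n) = tmap B (crm C) M (\<lambda>c. c) g' (lcoact N n)" if n: "n \<in> carrier N" for n
  proof -
    note X = LN.lcoact_closed[OF n]
    have h3: "balanced3 B (crm C) (clm C) B (crm C) N ?T (\<lambda>d1 d2 n0. ?p d1 (avg d2 (g n0)))"
      using balanced_add_left[OF b] balanced_add_right[OF b] balanced_act[OF b]
      by (intro LN.CCM.balanced3I)
        (simp_all add: gc avg_closed LM.pten_closed LM.pten_add_left LM.pten_add_right avg_lact LM.pten_act)
    have "lcoact M (g' n) = tlift ?T (\<lambda>(d, n0). lcoact M (avg d (g n0))) (lcoact N n)"
      unfolding g'_def by (rule LN.CM.hom_tlift[OF G T lcoact_hom b X])
    also have "\<dots> = tlift ?T (\<lambda>(d, n0). tlift ?T (\<lambda>(d1, d2). ?p d1 (avg d2 (g n0))) (comult C d)) (lcoact N n)"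
      by (rule LN.CM.tlift_cong[OF T LN.CM.balanced_hom[OF lcoact_hom b] _ X]) (simp add: lcoact_avg gc)
    also have "\<dots> = tlift ?T (\<lambda>(d1, q). tlift ?T (\<lambda>(d2, n0). ?p d1 (avg d2 (g n0))) (lcoact N q)) (lcoact N n)"
      by (rule LN.coassoc_sum[OF T h3 n])
    also have "\<dots> = tlift ?T (\<lambda>(d1, q). ?p d1 (g' q)) (lcoact N n)"
    proof (rule LN.CM.tlift_cong[OF T LN.CM.balanced_tmap[OF LM.CM.tensor_pair_axioms rmod_hom_id g'] _ X, symmetric])
      fix q d1 assume q: "q \<in> carrier N" and d1: "d1 \<in> carrier (crm C)"
      have h: "?p d1 \<in> hom M ?T"
        using d1 by (auto simp: hom_def LM.pten_closed LM.pten_add_right)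
      show "?p d1 (g' q) = tlift ?T (\<lambda>(d2, n0). ?p d1 (avg d2 (g n0))) (lcoact N q)"
        unfolding g'_def by (rule LN.CM.hom_tlift[OF G T h b LN.lcoact_closed[OF q]])
    qed
    finally show ?thesis by (simp add: tmap_def)
  qed
  ultimately show ?thesis
    using f g' by (auto simp: splits_lcomod_def lcomod_hom_def)
qed

end

theorem (in is_coring) coseparable_left_rel_injective:
  assumes "coseparable B C" "left_comodule B C M"
  shows "left_rel_injective B C M"
proof -
  obtain \<theta> where "cointegral B C \<theta>" by (rule coseparable_imp_cointegral[OF assms(1)])
  then interpret cointegral_left B C \<theta> M
    using assms(2) by (simp add: cointegral_left_def)
  show ?thesis unfolding left_rel_injective_def by (blast intro: splits)
qed

section \<open>Transport of comodules\<close>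

text \<open>A tensor product inspects only the carrier, the addition and the action of its factor,
  so records that differ elsewhere have literally equal tensor products and no isomorphism has to be
  carried along.\<close>

lemma tensor_cong_left:
  assumes "carrier M = carrier M'" "monoid.mult M = monoid.mult M'" "ract M = ract M'"
  shows "tensor B M N = tensor B M' N" "pten B M N = pten B M' N" "tmap B M N = tmap B M' N"
    "ten_left B M N D N' P = ten_left B M' N D N' P" "ten_right B M N D N' P = ten_right B M' N D N' P"
  by (simp_all add: tensor_def tensor_relators_def pten_def tmap_def ten_left_def ten_right_def tensor3_def
      pten3_def tensor3_relators_def assms fun_eq_iff)

lemma tensor_cong_right:
  assumes "carrier N = carrier N'" "monoid.mult N = monoid.mult N'" "lact N = lact N'"
  shows "tensor B M N = tensor B M N'" "pten B M N = pten B M N'" "tmap B M N = tmap B M N'"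
    "ten_left E P Q B M N = ten_left E P Q B M N'" "ten_right E P Q B M N = ten_right E P Q B M N'"
  by (simp_all add: tensor_def tensor_relators_def pten_def tmap_def ten_left_def ten_right_def tensor3_def
      pten3_def tensor3_relators_def assms fun_eq_iff)

lemma rmod_hom_compose: "f \<in> rmod_hom B M N \<Longrightarrow> g \<in> rmod_hom B N P \<Longrightarrow> g \<circ> f \<in> rmod_hom B M P"
  using hom_compose[of f M N g P] by (auto simp: rmod_hom_def dest: hom_in_carrier)

lemma lmod_hom_compose: "f \<in> lmod_hom B M N \<Longrightarrow> g \<in> lmod_hom B N P \<Longrightarrow> g \<circ> f \<in> lmod_hom B M P"
  using hom_compose[of f M N g P] by (auto simp: lmod_hom_def dest: hom_in_carrier)

text \<open>A relative injectivity hypothesis covers comodules with carriers in one fixed type,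
  whereas the base algebra and the coring live in different types; the structure is therefore pushed
  forward along \<open>j\<close>. With \<open>j\<close> injective on the carrier,
  \<open>inv_into\<close> inverts it on the image.\<close>

definition transport_rmod :: "('m \<Rightarrow> 'n) \<Rightarrow> ('b, 'm, 'y) rmodule_scheme \<Rightarrow> ('b, 'n) rmodule"
  where "transport_rmod j M = \<lparr>carrier = j ` carrier M,
    monoid.mult = \<lambda>x y. j (inv_into (carrier M) j x \<otimes>\<^bsub>M\<^esub> inv_into (carrier M) j y),
    one = j \<one>\<^bsub>M\<^esub>, ract = \<lambda>x b. j (ract M (inv_into (carrier M) j x) b)\<rparr>"

text \<open>The coaction takes values in a tensor product over the very comodule being defined.
  Using the bare module \<open>transport_rmod j M\<close> there avoids the circularity, and
  \<open>rcoact_transport\<close> restates the coaction with the comodule itself.\<close>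

definition transport_rcomod ::
  "('b, 'x) ring_scheme \<Rightarrow> ('b, 'c, 'u) coring_scheme \<Rightarrow> ('m \<Rightarrow> 'n) \<Rightarrow> ('b, 'm, 'c, 'z) rcomodule_scheme \<Rightarrow>
   ('b, 'n, 'c) rcomodule"
  where "transport_rcomod B C j M = rmodule.extend (transport_rmod j M)
    \<lparr>rcoact = \<lambda>x. tmap B (transport_rmod j M) (clm C) j (\<lambda>c. c) (rcoact M (inv_into (carrier M) j x))\<rparr>"

lemma transport_rcomod_simps [simp]:
  "carrier (transport_rcomod B C j M) = j ` carrier M"
  "monoid.mult (transport_rcomod B C j M) =
    (\<lambda>x y. j (inv_into (carrier M) j x \<otimes>\<^bsub>M\<^esub> inv_into (carrier M) j y))"
  "one (transport_rcomod B C j M) = j \<one>\<^bsub>M\<^esub>"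
  "ract (transport_rcomod B C j M) = (\<lambda>x b. j (ract M (inv_into (carrier M) j x) b))"
  by (simp_all add: transport_rcomod_def transport_rmod_def rmodule.defs)

lemma rcoact_transport:
  "rcoact (transport_rcomod B C j M) = (\<lambda>x. tmap B (transport_rcomod B C j M) (clm C) j (\<lambda>c. c)
    (rcoact M (inv_into (carrier M) j x)))"
proof -
  have "tmap B (transport_rcomod B C j M) (clm C) = tmap B (transport_rmod j M) (clm C)"
    by (rule tensor_cong_left) (simp_all add: transport_rmod_def)
  then show ?thesis
    unfolding \<open>tmap B (transport_rcomod B C j M) (clm C) = _\<close>
    by (simp add: transport_rcomod_def rmodule.defs)
qed

context coring_right_comodule
begin

context
  fixes j :: "'m \<Rightarrow> 'n"
  assumes inj: "inj_on j (carrier M)"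
begin

abbreviation "M' \<equiv> transport_rcomod B C j M"
abbreviation "i \<equiv> inv_into (carrier M) j"

lemma ij: "m \<in> carrier M \<Longrightarrow> i (j m) = m"
  using inj by simp

lemma transport_module: "right_module B M'"
proof -
  have "comm_group M'"
  proof (rule comm_groupI)
    fix x assume "x \<in> carrier M'"
    then obtain m where m: "m \<in> carrier M" "x = j m" by auto
    then show "\<exists>y\<in>carrier M'. y \<otimes>\<^bsub>M'\<^esub> x = \<one>\<^bsub>M'\<^esub>"
      by (intro bexI[of _ "j (inv\<^bsub>M\<^esub> m)"]) (simp_all add: ij)
  qed (auto simp: ij M.m_ac)
  then show ?thesis
    by (intro right_module.intro C.R.B.ring_axioms right_module_axioms.intro)
      (auto simp: ij ract_closed ract_add_left ract_add_right ract_mult ract_one)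
qed

lemma j_hom: "j \<in> rmod_hom B M M'" and i_hom: "i \<in> rmod_hom B M' M"
  by (auto simp: rmod_hom_def hom_def ij ract_closed)

interpretation M': right_module B M' by (rule transport_module)

interpretation MC': tensor_pair B M' "clm C"
  by (intro tensor_pair.intro transport_module C.L.left_module_axioms)

interpretation MCC': tensor_triple B M' "clm C" B "crm C" "clm C"
  by unfold_locales (simp_all add: C.acts_commute)

lemma rcoact'_hom: "rcoact M' \<in> hom M' (tensor B M' (clm C))"
  using hom_compose[OF rmod_hom_hom[OF i_hom]
      hom_compose[OF rcoact_hom MC.tmap_hom[OF MC'.tensor_pair_axioms j_hom lmod_hom_id]]]
  by (simp add: comp_def rcoact_transport)

lemma rcoact'_j: "m \<in> carrier M \<Longrightarrow> rcoact M' (j m) = tmap B M' (clm C) j (\<lambda>c. c) (rcoact M m)"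
  by (simp add: ij rcoact_transport)

lemma rcoact'_ract:
  assumes x: "x \<in> carrier M'" and b: "b \<in> carrier B"
  shows "rcoact M' (ract M' x b) = tmap B M' (clm C) (\<lambda>x. x) (\<lambda>c. ract (crm C) c b) (rcoact M' x)"
proof -
  obtain m where m: "m \<in> carrier M" and xm: "x = j m" using x by auto
  note X = rcoact_closed[OF m] and T' = MC'.comm_group_tensor
  have "ract M' x b = j (ract M m b)" using m xm by (simp add: ij)
  then have "rcoact M' (ract M' x b) = tmap B M' (clm C) j (\<lambda>c. c) (rcoact M (ract M m b))"
    by (simp only: rcoact'_j ract_closed m b)
  also have "\<dots> = tlift (tensor B M' (clm C)) (\<lambda>(x, c). pten B M' (clm C) (j x) (ract (crm C) c b)) (rcoact M m)"
    unfolding rcoact_ract[OF m b]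
    by (subst tmap_def, rule MC.tlift_tmap[OF MC.tensor_pair_axioms rmod_hom_id C.ract_lmod_hom[OF b] T'
          MC.balanced_tmap[OF MC'.tensor_pair_axioms j_hom lmod_hom_id] X])
  also have "\<dots> = tmap B M' (clm C) (\<lambda>x. x) (\<lambda>c. ract (crm C) c b) (tmap B M' (clm C) j (\<lambda>c. c) (rcoact M m))"
    by (subst tmap_def[of B M' "clm C" "\<lambda>x. x"], rule MC.tlift_tmap[OF MC'.tensor_pair_axioms j_hom lmod_hom_id T'
          MC'.balanced_tmap[OF MC'.tensor_pair_axioms rmod_hom_id C.ract_lmod_hom[OF b]] X, symmetric])
  finally show ?thesis by (simp only: xm rcoact'_j m)
qed

text \<open>Both iterated coactions of j(m) are obtained from those of m by applying
  \<open>j\<close> to the first leg, so the axioms carry over.\<close>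

lemma transport_right_comodule: "right_comodule B C M'"
proof (intro right_comodule.intro right_comodule_axioms.intro transport_module rcoact'_hom rcoact'_ract)
  let ?T3 = "tensor3 B M' (clm C) B (crm C) (clm C)" and ?p = "pten3 B M' (clm C) B (crm C) (clm C)"
  fix x assume "x \<in> carrier M'"
  then obtain m where m: "m \<in> carrier M" and xm: "x = j m" by auto
  note X = rcoact_closed[OF m] and T' = MCC'.comm_group_tensor3
  note p3 = MCC'.balanced3_pten3
  \<comment> \<open>Precomposing the universal trilinear map with \<open>j\<close> lets the
    coassociativity of \<open>M\<close> be evaluated directly in the triple product over
    \<open>M'\<close>.\<close>
  have h3: "balanced3 B M (clm C) B (crm C) (clm C) ?T3 (\<lambda>m n p. ?p (j m) n p)"
    unfolding balanced3_def
  proof (intro conjI ballI)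
    show "balanced B M (clm C) ?T3 (\<lambda>m n. ?p (j m) n p)" if "p \<in> carrier (clm C)" for p
      by (rule MC.balanced_compose[OF j_hom lmod_hom_id MCC'.balanced3_left[OF T' p3 that]])
    show "balanced B (crm C) (clm C) ?T3 (?p (j m))" if "m \<in> carrier M" for m
      by (rule MCC'.balanced3_right[OF T' p3]) (rule rmod_hom_closed[OF j_hom that])
  qed
  have "ten_left B M' (clm C) B (crm C) (clm C) (rcoact M') (rcoact M' x) =
      tlift ?T3 (\<lambda>(q, p). tlift ?T3 (\<lambda>(m, n). ?p m n p) (rcoact M' (j q))) (rcoact M m)"
    unfolding xm rcoact'_j[OF m] ten_left_def
    by (rule MC.tlift_tmap[OF MC'.tensor_pair_axioms j_hom lmod_hom_id T'
          MCC'.balanced_nest_left[OF transport_module rcoact'_hom rcoact'_ract T' p3] X])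
  also have "\<dots> = tlift ?T3 (\<lambda>(q, p). tlift ?T3 (\<lambda>(m, n). ?p (j m) n p) (rcoact M q)) (rcoact M m)"
  proof (rule MC.tlift_cong[OF T' _ _ X, symmetric])
    show "balanced B M (clm C) ?T3 (\<lambda>q p. tlift ?T3 (\<lambda>(m, n). ?p (j m) n p) (rcoact M q))"
      by (rule MCC.balanced_nest_left[OF right_module_axioms rcoact_hom rcoact_ract T' h3])
    fix q p assume q: "q \<in> carrier M" and p: "p \<in> carrier (clm C)"
    show "tlift ?T3 (\<lambda>(m, n). ?p (j m) n p) (rcoact M q) = tlift ?T3 (\<lambda>(m, n). ?p m n p) (rcoact M' (j q))"
      unfolding rcoact'_j[OF q]
      by (rule MC.tlift_tmap[OF MC'.tensor_pair_axioms j_hom lmod_hom_id T'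
          MCC'.balanced3_left[OF T' p3 p] rcoact_closed[OF q], symmetric])
  qed
  also have "\<dots> = tlift ?T3 (\<lambda>(m, q). tlift ?T3 (\<lambda>(n, p). ?p (j m) n p) (comult C q)) (rcoact M m)"
    by (rule coassoc_sum[OF T' h3 m])
  also have "\<dots> = ten_right B M' (clm C) B (crm C) (clm C) (comult C) (rcoact M' x)"
    unfolding xm rcoact'_j[OF m] ten_right_def
    by (rule MC.tlift_tmap[OF MC'.tensor_pair_axioms j_hom lmod_hom_id T'
          MCC'.balanced_nest_right[OF C.L.left_module_axioms C.comult_hom_clm C.comult_lact_clm T' p3] X, symmetric])
  finally show "ten_left B M' (clm C) B (crm C) (clm C) (rcoact M') (rcoact M' x) =
    ten_right B M' (clm C) B (crm C) (clm C) (comult C) (rcoact M' x)" .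
  have b': "balanced B M' (clm C) M' (\<lambda>x c. ract M' x (counit C c))"
    using M'.ract_closed M'.ract_add_left M'.ract_add_right M'.ract_mult
    by (intro balancedI) (simp_all add: C.counit_closed C.counit_add C.counit_lact del: transport_rcomod_simps)
  have "tlift M' (\<lambda>(x, c). ract M' x (counit C c)) (rcoact M' x) =
      tlift M' (\<lambda>(x, c). ract M' (j x) (counit C c)) (rcoact M m)"
    unfolding xm rcoact'_j[OF m]
    by (rule MC.tlift_tmap[OF MC'.tensor_pair_axioms j_hom lmod_hom_id M'.M.comm_group_axioms b' X])
  also have "\<dots> = tlift M' (\<lambda>(x, c). j (ract M x (counit C c))) (rcoact M m)"
    by (rule MC.tlift_cong[OF M'.M.comm_group_axioms MC.balanced_hom[OF rmod_hom_hom[OF j_hom] counital_balanced] _ X,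
          symmetric]) (simp add: ij)
  also have "\<dots> = j (tlift M (\<lambda>(x, c). ract M x (counit C c)) (rcoact M m))"
    by (rule MC.hom_tlift[OF M.comm_group_axioms M'.M.comm_group_axioms rmod_hom_hom[OF j_hom] counital_balanced X,
          symmetric])
  also have "\<dots> = x" using rcoact_counital[OF m] xm by simp
  finally show "tlift M' (\<lambda>(x, c). ract M' x (counit C c)) (rcoact M' x) = x" .
qed

lemma transport_to: "j \<in> rcomod_hom B C M M'"
  using j_hom by (simp add: rcomod_hom_def rcoact'_j)

lemma transport_from: "i \<in> rcomod_hom B C M' M"
  unfolding rcomod_hom_def
proof (intro CollectI conjI ballI i_hom)
  fix x assume "x \<in> carrier M'"
  then obtain m where m: "m \<in> carrier M" and xm: "x = j m" by auto
  note X = rcoact_closed[OF m] and T = MC.comm_group_tensor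
  have "tmap B M (clm C) i (\<lambda>c. c) (rcoact M' x) = tlift (tensor B M (clm C)) (\<lambda>(x, c). pten B M (clm C) (i (j x)) c) (rcoact M m)"
    unfolding xm rcoact'_j[OF m]
    by (subst tmap_def, rule MC.tlift_tmap[OF MC'.tensor_pair_axioms j_hom lmod_hom_id T
          MC'.balanced_tmap[OF MC.tensor_pair_axioms i_hom lmod_hom_id] X])
  also have "\<dots> = tlift (tensor B M (clm C)) (\<lambda>(x, c). pten B M (clm C) x c) (rcoact M m)"
    by (rule MC.tlift_cong[OF T MC.balanced_pten _ X, symmetric]) (simp add: ij)
  also have "\<dots> = rcoact M m" by (rule MC.tlift_pten_id[OF X])
  finally show "rcoact M (i x) = tmap B M (clm C) i (\<lambda>c. c) (rcoact M' x)"
    using m by (simp only: xm ij)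
qed

end

end

context is_coring
begin

lemma rcomod_hom_compose:
  assumes "right_comodule B C M" "right_comodule B C N" "right_comodule B C P"
    and f: "f \<in> rcomod_hom B C M N" and g: "g \<in> rcomod_hom B C N P"
  shows "g \<circ> f \<in> rcomod_hom B C M P"
proof -
  interpret M: coring_right_comodule B C M using assms(1) by (simp add: coring_right_comodule_def is_coring_axioms)
  interpret N: coring_right_comodule B C N using assms(2) by (simp add: coring_right_comodule_def is_coring_axioms)
  interpret P: coring_right_comodule B C P using assms(3) by (simp add: coring_right_comodule_def is_coring_axioms)
  have f': "f \<in> rmod_hom B M N" and g': "g \<in> rmod_hom B N P" using f g by (auto simp: rcomod_hom_def)
  have "rcoact P (g (f m)) = tmap B P (clm C) (g \<circ> f) (\<lambda>c. c) (rcoact M m)" if m: "m \<in> carrier M" for m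
  proof -
    have "rcoact P (g (f m)) = tmap B P (clm C) g (\<lambda>c. c) (tmap B N (clm C) f (\<lambda>c. c) (rcoact M m))"
      using f g m rmod_hom_closed[OF f' m] by (simp add: rcomod_hom_def)
    also have "\<dots> = tlift (tensor B P (clm C)) (\<lambda>(x, c). pten B P (clm C) (g (f x)) c) (rcoact M m)"
      by (subst tmap_def, rule M.MC.tlift_tmap[OF N.MC.tensor_pair_axioms f' lmod_hom_id P.MC.comm_group_tensor
        N.MC.balanced_tmap[OF P.MC.tensor_pair_axioms g' lmod_hom_id] M.rcoact_closed[OF m]])
    also have "\<dots> = tmap B P (clm C) (g \<circ> f) (\<lambda>c. c) (rcoact M m)"
      by (simp add: tmap_def)
    finally show ?thesis .
  qed
  then show ?thesis using rmod_hom_compose[OF f' g'] by (simp add: rcomod_hom_def)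
qed

text \<open>Conjugating \<open>f\<close> by the two transports yields a map of comodules with
  carriers in \<open>'u\<close>. The linear retraction is conjugated along with it,
  \<open>rel\<close> makes the conjugate split, and the colinear retraction is carried back.\<close>

lemma splits_rcomod_of_transport:
  fixes M :: "('b, 'm, 'c, 'z) rcomodule_scheme" and N :: "('b, 'n, 'c, 'w) rcomodule_scheme"
    and jM :: "'m \<Rightarrow> 'u" and jN :: "'n \<Rightarrow> 'u"
  assumes M: "right_comodule B C M" and N: "right_comodule B C N"
    and f: "f \<in> rcomod_hom B C M N" and split: "splits_rmod B M N f"
    and inj: "inj jM" "inj jN"
    and rel: "\<And>P :: ('b, 'u, 'c) rcomodule. right_comodule B C P \<Longrightarrow> right_rel_injective B C P"
  shows "splits_rcomod B C M N f"
proof -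
  interpret M: coring_right_comodule B C M using M by (simp add: coring_right_comodule_def is_coring_axioms)
  interpret N: coring_right_comodule B C N using N by (simp add: coring_right_comodule_def is_coring_axioms)
  have inj': "inj_on jM (carrier M)" "inj_on jN (carrier N)" using inj by (auto intro: inj_on_subset)
  let ?M = "transport_rcomod B C jM M" and ?N = "transport_rcomod B C jN N"
  let ?iM = "inv_into (carrier M) jM" and ?iN = "inv_into (carrier N) jN"
  note M' = M.transport_right_comodule[OF inj'(1)] and N' = N.transport_right_comodule[OF inj'(2)]
  note iM = M.transport_from[OF inj'(1)] and jM = M.transport_to[OF inj'(1)]
  note jN = N.transport_to[OF inj'(2)]
  have rm: "h \<in> rmod_hom B P Q" if "h \<in> rcomod_hom B C P Q" for h
    and P :: "('b, 'p1, 'c, 'p2) rcomodule_scheme" and Q :: "('b, 'q1, 'c, 'q2) rcomodule_scheme"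
    using that by (simp add: rcomod_hom_def)
  obtain g where g: "g \<in> rmod_hom B N M" and gf: "\<And>m. m \<in> carrier M \<Longrightarrow> g (f m) = m"
    using split by (auto simp: splits_rmod_def)
  have f_closed: "m \<in> carrier M \<Longrightarrow> f m \<in> carrier N" for m
    using f by (auto simp: rcomod_hom_def dest: rmod_hom_closed)
  let ?f = "jN \<circ> (f \<circ> ?iM)" and ?g = "jM \<circ> (g \<circ> ?iN)"
  have f': "?f \<in> rcomod_hom B C ?M ?N"
    by (rule rcomod_hom_compose[OF M' N N' rcomod_hom_compose[OF M' M N iM f] jN])
  have g': "?g \<in> rmod_hom B ?N ?M"
    by (rule rmod_hom_compose[OF rmod_hom_compose[OF N.i_hom[OF inj'(2)] g] M.j_hom[OF inj'(1)]])
  have gf': "?g (?f x) = x" if x: "x \<in> carrier ?M" for x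
  proof -
    obtain m where m: "m \<in> carrier M" "x = jM m" using x by auto
    then show ?thesis using inj' f_closed[OF m(1)] by (simp add: gf)
  qed
  have "inj_on ?f (carrier ?M)" by (rule inj_on_inverseI[where g = ?g]) (rule gf')
  moreover have "splits_rmod B ?M ?N ?f"
    unfolding splits_rmod_def using rm[OF f'] g' gf' by blast
  ultimately have "splits_rcomod B C ?M ?N ?f"
    using rel[OF M'] N' f' unfolding right_rel_injective_def by blast
  then obtain h where h: "h \<in> rcomod_hom B C ?N ?M" and hf: "\<And>x. x \<in> carrier ?M \<Longrightarrow> h (?f x) = x"
    by (auto simp: splits_rcomod_def)
  have h': "?iM \<circ> (h \<circ> jN) \<in> rcomod_hom B C N M"
    by (rule rcomod_hom_compose[OF N M' M rcomod_hom_compose[OF N N' M' jN h] iM])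
  have "(?iM \<circ> (h \<circ> jN)) (f m) = m" if m: "m \<in> carrier M" for m
    using hf[of "jM m"] m inj' by simp
  with f h' show ?thesis unfolding splits_rcomod_def by blast
qed

end

section \<open>Transport of left comodules along an injection\<close>

definition transport_lmod :: "('m \<Rightarrow> 'n) \<Rightarrow> ('b, 'm, 'y) lmodule_scheme \<Rightarrow> ('b, 'n) lmodule"
  where "transport_lmod j M = \<lparr>carrier = j ` carrier M,
    monoid.mult = \<lambda>x y. j (inv_into (carrier M) j x \<otimes>\<^bsub>M\<^esub> inv_into (carrier M) j y),
    one = j \<one>\<^bsub>M\<^esub>, lact = \<lambda>b x. j (lact M b (inv_into (carrier M) j x))\<rparr>"

definition transport_lcomod ::
  "('b, 'x) ring_scheme \<Rightarrow> ('b, 'c, 'u) coring_scheme \<Rightarrow> ('m \<Rightarrow> 'n) \<Rightarrow> ('b, 'm, 'c, 'z) lcomodule_scheme \<Rightarrow>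
   ('b, 'n, 'c) lcomodule"
  where "transport_lcomod B C j M = lmodule.extend (transport_lmod j M)
    \<lparr>lcoact = \<lambda>x. tmap B (crm C) (transport_lmod j M) (\<lambda>c. c) j (lcoact M (inv_into (carrier M) j x))\<rparr>"

lemma transport_lcomod_simps [simp]:
  "carrier (transport_lcomod B C j M) = j ` carrier M"
  "monoid.mult (transport_lcomod B C j M) =
    (\<lambda>x y. j (inv_into (carrier M) j x \<otimes>\<^bsub>M\<^esub> inv_into (carrier M) j y))"
  "one (transport_lcomod B C j M) = j \<one>\<^bsub>M\<^esub>"
  "lact (transport_lcomod B C j M) = (\<lambda>b x. j (lact M b (inv_into (carrier M) j x)))"
  by (simp_all add: transport_lcomod_def transport_lmod_def lmodule.defs)

lemma lcoact_transport:
  "lcoact (transport_lcomod B C j M) = (\<lambda>x. tmap B (crm C) (transport_lcomod B C j M) (\<lambda>c. c) j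
    (lcoact M (inv_into (carrier M) j x)))"
proof -
  have "tmap B (crm C) (transport_lcomod B C j M) = tmap B (crm C) (transport_lmod j M)"
    by (rule tensor_cong_right) (simp_all add: transport_lmod_def)
  then show ?thesis
    unfolding \<open>tmap B (crm C) (transport_lcomod B C j M) = _\<close>
    by (simp add: transport_lcomod_def lmodule.defs)
qed

context coring_left_comodule
begin

context
  fixes j :: "'m \<Rightarrow> 'n"
  assumes inj: "inj_on j (carrier M)"
begin

abbreviation "M' \<equiv> transport_lcomod B C j M"
abbreviation "i \<equiv> inv_into (carrier M) j"

lemma ij: "m \<in> carrier M \<Longrightarrow> i (j m) = m"
  using inj by simp

lemma transport_module: "left_module B M'"
proof -
  have "comm_group M'"
  proof (rule comm_groupI)
    fix x assume "x \<in> carrier M'"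
    then obtain m where m: "m \<in> carrier M" "x = j m" by auto
    then show "\<exists>y\<in>carrier M'. y \<otimes>\<^bsub>M'\<^esub> x = \<one>\<^bsub>M'\<^esub>"
      by (intro bexI[of _ "j (inv\<^bsub>M\<^esub> m)"]) (simp_all add: ij)
  qed (auto simp: ij M.m_ac)
  then show ?thesis
    by (intro left_module.intro C.R.B.ring_axioms left_module_axioms.intro)
      (auto simp: ij lact_closed lact_add_left lact_add_right lact_mult lact_one)
qed

lemma j_hom: "j \<in> lmod_hom B M M'" and i_hom: "i \<in> lmod_hom B M' M"
  by (auto simp: lmod_hom_def hom_def ij lact_closed)

interpretation M': left_module B M' by (rule transport_module)

interpretation CM': tensor_pair B "crm C" M'
  by (intro tensor_pair.intro transport_module C.R.right_module_axioms)

interpretation CCM': tensor_triple B "crm C" "clm C" B "crm C" M'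
  by unfold_locales (simp_all add: C.acts_commute)

lemma lcoact'_hom: "lcoact M' \<in> hom M' (tensor B (crm C) M')"
  using hom_compose[OF lmod_hom_hom[OF i_hom]
      hom_compose[OF lcoact_hom CM.tmap_hom[OF CM'.tensor_pair_axioms rmod_hom_id j_hom]]]
  by (simp add: comp_def lcoact_transport)

lemma lcoact'_j: "m \<in> carrier M \<Longrightarrow> lcoact M' (j m) = tmap B (crm C) M' (\<lambda>c. c) j (lcoact M m)"
  by (simp add: ij lcoact_transport)

lemma lcoact'_lact:
  assumes x: "x \<in> carrier M'" and b: "b \<in> carrier B"
  shows "lcoact M' (lact M' b x) = tmap B (crm C) M' (\<lambda>c. lact (clm C) b c) (\<lambda>x. x) (lcoact M' x)"
proof -
  obtain m where m: "m \<in> carrier M" and xm: "x = j m" using x by auto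
  note X = lcoact_closed[OF m] and T' = CM'.comm_group_tensor
  have "lact M' b x = j (lact M b m)" using m xm by (simp add: ij)
  then have "lcoact M' (lact M' b x) = tmap B (crm C) M' (\<lambda>c. c) j (lcoact M (lact M b m))"
    by (simp only: lcoact'_j lact_closed m b)
  also have "\<dots> = tlift (tensor B (crm C) M') (\<lambda>(c, x). pten B (crm C) M' (lact (clm C) b c) (j x)) (lcoact M m)"
    unfolding lcoact_lact[OF m b]
    by (subst tmap_def, rule CM.tlift_tmap[OF CM.tensor_pair_axioms C.lact_rmod_hom[OF b] lmod_hom_id T'
          CM.balanced_tmap[OF CM'.tensor_pair_axioms rmod_hom_id j_hom] X])
  also have "\<dots> = tmap B (crm C) M' (\<lambda>c. lact (clm C) b c) (\<lambda>x. x) (tmap B (crm C) M' (\<lambda>c. c) j (lcoact M m))"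
    by (subst tmap_def[of B "crm C" M' "\<lambda>c. lact (clm C) b c"],
        rule CM.tlift_tmap[OF CM'.tensor_pair_axioms rmod_hom_id j_hom T'
          CM'.balanced_tmap[OF CM'.tensor_pair_axioms C.lact_rmod_hom[OF b] lmod_hom_id] X, symmetric])
  finally show ?thesis by (simp only: xm lcoact'_j m)
qed

lemma transport_left_comodule: "left_comodule B C M'"
proof (intro left_comodule.intro left_comodule_axioms.intro transport_module lcoact'_hom lcoact'_lact)
  let ?T3 = "tensor3 B (crm C) (clm C) B (crm C) M'" and ?p = "pten3 B (crm C) (clm C) B (crm C) M'"
  fix x assume "x \<in> carrier M'"
  then obtain m where m: "m \<in> carrier M" and xm: "x = j m" by auto
  note X = lcoact_closed[OF m] and T' = CCM'.comm_group_tensor3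
  note p3 = CCM'.balanced3_pten3
  have h3: "balanced3 B (crm C) (clm C) B (crm C) M ?T3 (\<lambda>n p m. ?p n p (j m))"
    unfolding balanced3_def
  proof (intro conjI ballI)
    show "balanced B (crm C) (clm C) ?T3 (\<lambda>n p. ?p n p (j m))" if "m \<in> carrier M" for m
      by (rule CCM'.balanced3_left[OF T' p3]) (rule lmod_hom_closed[OF j_hom that])
    show "balanced B (crm C) M ?T3 (\<lambda>p m. ?p n p (j m))" if "n \<in> carrier (crm C)" for n
      by (rule CM.balanced_compose[OF rmod_hom_id j_hom CCM'.balanced3_right[OF T' p3 that]])
  qed
  have "ten_left B (crm C) (clm C) B (crm C) M' (comult C) (lcoact M' x) =
      tlift ?T3 (\<lambda>(q, m). tlift ?T3 (\<lambda>(n, p). ?p n p (j m)) (comult C q)) (lcoact M m)"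
    unfolding xm lcoact'_j[OF m] ten_left_def
    by (rule CM.tlift_tmap[OF CM'.tensor_pair_axioms rmod_hom_id j_hom T'
          CCM'.balanced_nest_left[OF C.R.right_module_axioms C.comult_hom C.comult_ract T' p3] X])
  also have "\<dots> = tlift ?T3 (\<lambda>(n, q). tlift ?T3 (\<lambda>(p, m). ?p n p (j m)) (lcoact M q)) (lcoact M m)"
    by (rule coassoc_sum[OF T' h3 m])
  also have "\<dots> = tlift ?T3 (\<lambda>(n, q). tlift ?T3 (\<lambda>(p, m). ?p n p m) (lcoact M' (j q))) (lcoact M m)"
  proof (rule CM.tlift_cong[OF T' _ _ X])
    show "balanced B (crm C) M ?T3 (\<lambda>n q. tlift ?T3 (\<lambda>(p, m). ?p n p (j m)) (lcoact M q))"
      by (rule CCM.balanced_nest_right[OF left_module_axioms lcoact_hom lcoact_lact T' h3])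
    fix n q assume n: "n \<in> carrier (crm C)" and q: "q \<in> carrier M"
    show "tlift ?T3 (\<lambda>(p, m). ?p n p (j m)) (lcoact M q) = tlift ?T3 (\<lambda>(p, m). ?p n p m) (lcoact M' (j q))"
      unfolding lcoact'_j[OF q]
      by (rule CM.tlift_tmap[OF CM'.tensor_pair_axioms rmod_hom_id j_hom T'
          CCM'.balanced3_right[OF T' p3 n] lcoact_closed[OF q], symmetric])
  qed
  also have "\<dots> = ten_right B (crm C) (clm C) B (crm C) M' (lcoact M') (lcoact M' x)"
    unfolding xm lcoact'_j[OF m] ten_right_def
    by (rule CM.tlift_tmap[OF CM'.tensor_pair_axioms rmod_hom_id j_hom T'
          CCM'.balanced_nest_right[OF transport_module lcoact'_hom lcoact'_lact T' p3] X, symmetric])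
  finally show "ten_left B (crm C) (clm C) B (crm C) M' (comult C) (lcoact M' x) =
    ten_right B (crm C) (clm C) B (crm C) M' (lcoact M') (lcoact M' x)" .
  have b': "balanced B (crm C) M' M' (\<lambda>c x. lact M' (counit C c) x)"
    using M'.lact_closed M'.lact_add_left M'.lact_add_right M'.lact_mult
    by (intro balancedI) (simp_all add: C.counit_closed C.counit_add C.counit_ract del: transport_lcomod_simps)
  have "tlift M' (\<lambda>(c, x). lact M' (counit C c) x) (lcoact M' x) =
      tlift M' (\<lambda>(c, x). lact M' (counit C c) (j x)) (lcoact M m)"
    unfolding xm lcoact'_j[OF m]
    by (rule CM.tlift_tmap[OF CM'.tensor_pair_axioms rmod_hom_id j_hom M'.M.comm_group_axioms b' X])
  also have "\<dots> = tlift M' (\<lambda>(c, x). j (lact M (counit C c) x)) (lcoact M m)"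
    by (rule CM.tlift_cong[OF M'.M.comm_group_axioms CM.balanced_hom[OF lmod_hom_hom[OF j_hom] counital_balanced] _ X,
          symmetric]) (simp add: ij)
  also have "\<dots> = j (tlift M (\<lambda>(c, x). lact M (counit C c) x) (lcoact M m))"
    by (rule CM.hom_tlift[OF M.comm_group_axioms M'.M.comm_group_axioms lmod_hom_hom[OF j_hom] counital_balanced X,
          symmetric])
  also have "\<dots> = x" using lcoact_counital[OF m] xm by simp
  finally show "tlift M' (\<lambda>(c, x). lact M' (counit C c) x) (lcoact M' x) = x" .
qed

lemma transport_to: "j \<in> lcomod_hom B C M M'"
  using j_hom by (simp add: lcomod_hom_def lcoact'_j)

lemma transport_from: "i \<in> lcomod_hom B C M' M"
  unfolding lcomod_hom_def
proof (intro CollectI conjI ballI i_hom)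
  fix x assume "x \<in> carrier M'"
  then obtain m where m: "m \<in> carrier M" and xm: "x = j m" by auto
  note X = lcoact_closed[OF m] and T = CM.comm_group_tensor
  have "tmap B (crm C) M (\<lambda>c. c) i (lcoact M' x) = tlift (tensor B (crm C) M) (\<lambda>(c, x). pten B (crm C) M c (i (j x))) (lcoact M m)"
    unfolding xm lcoact'_j[OF m]
    by (subst tmap_def, rule CM.tlift_tmap[OF CM'.tensor_pair_axioms rmod_hom_id j_hom T
          CM'.balanced_tmap[OF CM.tensor_pair_axioms rmod_hom_id i_hom] X])
  also have "\<dots> = tlift (tensor B (crm C) M) (\<lambda>(c, x). pten B (crm C) M c x) (lcoact M m)"
    by (rule CM.tlift_cong[OF T CM.balanced_pten _ X, symmetric]) (simp add: ij)
  also have "\<dots> = lcoact M m" by (rule CM.tlift_pten_id[OF X])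
  finally show "lcoact M (i x) = tmap B (crm C) M (\<lambda>c. c) i (lcoact M' x)"
    using m by (simp only: xm ij)
qed

end

end

context is_coring
begin

lemma lcomod_hom_compose:
  assumes "left_comodule B C M" "left_comodule B C N" "left_comodule B C P"
    and f: "f \<in> lcomod_hom B C M N" and g: "g \<in> lcomod_hom B C N P"
  shows "g \<circ> f \<in> lcomod_hom B C M P"
proof -
  interpret M: coring_left_comodule B C M using assms(1) by (simp add: coring_left_comodule_def is_coring_axioms)
  interpret N: coring_left_comodule B C N using assms(2) by (simp add: coring_left_comodule_def is_coring_axioms)
  interpret P: coring_left_comodule B C P using assms(3) by (simp add: coring_left_comodule_def is_coring_axioms)
  have f': "f \<in> lmod_hom B M N" and g': "g \<in> lmod_hom B N P" using f g by (auto simp: lcomod_hom_def)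
  have "lcoact P (g (f m)) = tmap B (crm C) P (\<lambda>c. c) (g \<circ> f) (lcoact M m)" if m: "m \<in> carrier M" for m
  proof -
    have "lcoact P (g (f m)) = tmap B (crm C) P (\<lambda>c. c) g (tmap B (crm C) N (\<lambda>c. c) f (lcoact M m))"
      using f g m lmod_hom_closed[OF f' m] by (simp add: lcomod_hom_def)
    also have "\<dots> = tlift (tensor B (crm C) P) (\<lambda>(c, x). pten B (crm C) P c (g (f x))) (lcoact M m)"
      by (subst tmap_def, rule M.CM.tlift_tmap[OF N.CM.tensor_pair_axioms rmod_hom_id f' P.CM.comm_group_tensor
        N.CM.balanced_tmap[OF P.CM.tensor_pair_axioms rmod_hom_id g'] M.lcoact_closed[OF m]])
    also have "\<dots> = tmap B (crm C) P (\<lambda>c. c) (g \<circ> f) (lcoact M m)"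
      by (simp add: tmap_def)
    finally show ?thesis .
  qed
  then show ?thesis using lmod_hom_compose[OF f' g'] by (simp add: lcomod_hom_def)
qed

lemma splits_lcomod_of_transport:
  fixes M :: "('b, 'm, 'c, 'z) lcomodule_scheme" and N :: "('b, 'n, 'c, 'w) lcomodule_scheme"
    and jM :: "'m \<Rightarrow> 'u" and jN :: "'n \<Rightarrow> 'u"
  assumes M: "left_comodule B C M" and N: "left_comodule B C N"
    and f: "f \<in> lcomod_hom B C M N" and split: "splits_lmod B M N f"
    and inj: "inj jM" "inj jN"
    and rel: "\<And>P :: ('b, 'u, 'c) lcomodule. left_comodule B C P \<Longrightarrow> left_rel_injective B C P"
  shows "splits_lcomod B C M N f"
proof -
  interpret M: coring_left_comodule B C M using M by (simp add: coring_left_comodule_def is_coring_axioms)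
  interpret N: coring_left_comodule B C N using N by (simp add: coring_left_comodule_def is_coring_axioms)
  have inj': "inj_on jM (carrier M)" "inj_on jN (carrier N)" using inj by (auto intro: inj_on_subset)
  let ?M = "transport_lcomod B C jM M" and ?N = "transport_lcomod B C jN N"
  let ?iM = "inv_into (carrier M) jM" and ?iN = "inv_into (carrier N) jN"
  note M' = M.transport_left_comodule[OF inj'(1)] and N' = N.transport_left_comodule[OF inj'(2)]
  note iM = M.transport_from[OF inj'(1)] and jM = M.transport_to[OF inj'(1)]
  note jN = N.transport_to[OF inj'(2)]
  have rm: "h \<in> lmod_hom B P Q" if "h \<in> lcomod_hom B C P Q" for h
    and P :: "('b, 'p1, 'c, 'p2) lcomodule_scheme" and Q :: "('b, 'q1, 'c, 'q2) lcomodule_scheme"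
    using that by (simp add: lcomod_hom_def)
  obtain g where g: "g \<in> lmod_hom B N M" and gf: "\<And>m. m \<in> carrier M \<Longrightarrow> g (f m) = m"
    using split by (auto simp: splits_lmod_def)
  have f_closed: "m \<in> carrier M \<Longrightarrow> f m \<in> carrier N" for m
    using f by (auto simp: lcomod_hom_def dest: lmod_hom_closed)
  let ?f = "jN \<circ> (f \<circ> ?iM)" and ?g = "jM \<circ> (g \<circ> ?iN)"
  have f': "?f \<in> lcomod_hom B C ?M ?N"
    by (rule lcomod_hom_compose[OF M' N N' lcomod_hom_compose[OF M' M N iM f] jN])
  have g': "?g \<in> lmod_hom B ?N ?M"
    by (rule lmod_hom_compose[OF lmod_hom_compose[OF N.i_hom[OF inj'(2)] g] M.j_hom[OF inj'(1)]])
  have gf': "?g (?f x) = x" if x: "x \<in> carrier ?M" for x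
  proof -
    obtain m where m: "m \<in> carrier M" "x = jM m" using x by auto
    then show ?thesis using inj' f_closed[OF m(1)] by (simp add: gf)
  qed
  have "inj_on ?f (carrier ?M)" by (rule inj_on_inverseI[where g = ?g]) (rule gf')
  moreover have "splits_lmod B ?M ?N ?f"
    unfolding splits_lmod_def using rm[OF f'] g' gf' by blast
  ultimately have "splits_lcomod B C ?M ?N ?f"
    using rel[OF M'] N' f' unfolding left_rel_injective_def by blast
  then obtain h where h: "h \<in> lcomod_hom B C ?N ?M" and hf: "\<And>x. x \<in> carrier ?M \<Longrightarrow> h (?f x) = x"
    by (auto simp: splits_lcomod_def)
  have h': "?iM \<circ> (h \<circ> jN) \<in> lcomod_hom B C N M"
    by (rule lcomod_hom_compose[OF N M' M lcomod_hom_compose[OF N N' M' jN h] iM])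
  have "(?iM \<circ> (h \<circ> jN)) (f m) = m" if m: "m \<in> carrier M" for m
    using hf[of "jM m"] m inj' by simp
  with f h' show ?thesis unfolding splits_lcomod_def by blast
qed

end

section \<open>The base algebra as a comodule\<close>

lemma comodule_simps [simp]:
  "carrier (base_rcomod B C u) = carrier B" "monoid.mult (base_rcomod B C u) = add B"
  "one (base_rcomod B C u) = \<zero>\<^bsub>B\<^esub>" "ract (base_rcomod B C u) = monoid.mult B"
  "carrier (base_lcomod B C u) = carrier B" "monoid.mult (base_lcomod B C u) = add B"
  "one (base_lcomod B C u) = \<zero>\<^bsub>B\<^esub>" "lact (base_lcomod B C u) = monoid.mult B"
  "carrier (rcomod_self C) = carrier (crm C)" "monoid.mult (rcomod_self C) = monoid.mult (crm C)"
  "one (rcomod_self C) = one (crm C)" "ract (rcomod_self C) = ract (crm C)" "rcoact (rcomod_self C) = comult C"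
  "carrier (lcomod_self C) = carrier (clm C)" "monoid.mult (lcomod_self C) = monoid.mult (clm C)"
  "one (lcomod_self C) = one (clm C)" "lact (lcomod_self C) = lact (clm C)" "lcoact (lcomod_self C) = comult C"
  by (simp_all add: base_rcomod_def base_lcomod_def rcomod_self_def lcomod_self_def)

context is_coring
begin

lemma right_module_base: "right_module B (base_rcomod B C u)"
proof -
  have "comm_group (base_rcomod B C u)"
  proof (rule comm_groupI)
    fix x assume "x \<in> carrier (base_rcomod B C u)"
    then show "\<exists>y\<in>carrier (base_rcomod B C u). y \<otimes>\<^bsub>base_rcomod B C u\<^esub> x = \<one>\<^bsub>base_rcomod B C u\<^esub>"
      using R.B.l_neg R.B.a_inv_closed by auto
  qed (simp_all add: R.B.a_ac)
  then show ?thesis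
    by (intro right_module.intro R.B.ring_axioms right_module_axioms.intro)
      (simp_all add: R.B.l_distr R.B.r_distr R.B.m_assoc)
qed

lemma left_module_base: "left_module B (base_lcomod B C u)"
proof -
  have "comm_group (base_lcomod B C u)"
  proof (rule comm_groupI)
    fix x assume "x \<in> carrier (base_lcomod B C u)"
    then show "\<exists>y\<in>carrier (base_lcomod B C u). y \<otimes>\<^bsub>base_lcomod B C u\<^esub> x = \<one>\<^bsub>base_lcomod B C u\<^esub>"
      using R.B.l_neg R.B.a_inv_closed by auto
  qed (simp_all add: R.B.a_ac)
  then show ?thesis
    by (intro left_module.intro R.B.ring_axioms left_module_axioms.intro)
      (simp_all add: R.B.l_distr R.B.r_distr R.B.m_assoc)
qed

lemma tensor_self:
  "tensor B (rcomod_self C) (clm C) = tensor B (crm C) (clm C)"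
  "pten B (rcomod_self C) (clm C) = pten B (crm C) (clm C)"
  "tmap B (rcomod_self C) (clm C) = tmap B (crm C) (clm C)"
  "ten_left B (rcomod_self C) (clm C) B (crm C) (clm C) = ten_left B (crm C) (clm C) B (crm C) (clm C)"
  "ten_right B (rcomod_self C) (clm C) B (crm C) (clm C) = ten_right B (crm C) (clm C) B (crm C) (clm C)"
  "tensor B (crm C) (lcomod_self C) = tensor B (crm C) (clm C)"
  "pten B (crm C) (lcomod_self C) = pten B (crm C) (clm C)"
  "tmap B (crm C) (lcomod_self C) = tmap B (crm C) (clm C)"
  "ten_left B (crm C) (clm C) B (crm C) (lcomod_self C) = ten_left B (crm C) (clm C) B (crm C) (clm C)"
  "ten_right B (crm C) (clm C) B (crm C) (lcomod_self C) = ten_right B (crm C) (clm C) B (crm C) (clm C)"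
  by (rule tensor_cong_left tensor_cong_right; simp)+

lemma right_module_self: "right_module B (rcomod_self C)"
proof -
  have "comm_group (rcomod_self C)"
  proof (rule comm_groupI)
    fix x assume "x \<in> carrier (rcomod_self C)"
    then show "\<exists>y\<in>carrier (rcomod_self C). y \<otimes>\<^bsub>rcomod_self C\<^esub> x = \<one>\<^bsub>rcomod_self C\<^esub>"
      using R.M.l_inv R.M.inv_closed by auto
  qed (simp_all add: R.M.m_ac)
  then show ?thesis
    by (intro right_module.intro R.B.ring_axioms right_module_axioms.intro)
      (simp_all add: R.ract_closed R.ract_add_left R.ract_add_right R.ract_mult R.ract_one)
qed

lemma left_module_self: "left_module B (lcomod_self C)"
proof -
  have "comm_group (lcomod_self C)"
  proof (rule comm_groupI)
    fix x assume "x \<in> carrier (lcomod_self C)"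
    then show "\<exists>y\<in>carrier (lcomod_self C). y \<otimes>\<^bsub>lcomod_self C\<^esub> x = \<one>\<^bsub>lcomod_self C\<^esub>"
      using R.M.l_inv R.M.inv_closed by auto
  qed (simp_all add: R.M.m_ac)
  then show ?thesis
    using L.lact_closed L.lact_add_left L.lact_add_right L.lact_mult L.lact_one
    by (intro left_module.intro R.B.ring_axioms left_module_axioms.intro) simp_all
qed

lemma right_comodule_self: "right_comodule B C (rcomod_self C)"
proof (intro right_comodule.intro right_comodule_axioms.intro right_module_self)
  show "rcoact (rcomod_self C) \<in> hom (rcomod_self C) (tensor B (rcomod_self C) (clm C))"
    using comult_hom by (simp add: tensor_self hom_def)
  fix c assume c: "c \<in> carrier (rcomod_self C)"
  have "tlift (rcomod_self C) (\<lambda>(x, c). ract (crm C) x (counit C c)) (comult C c) =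
      tlift (crm C) (\<lambda>(x, c). ract (crm C) x (counit C c)) (comult C c)"
    by (rule CC.tlift_target_cong[symmetric, OF R.M.comm_group_axioms _ counital_right_balanced])
      (use c right_module.axioms(2)[OF right_module_self] comult_closed in simp_all)
  then show "tlift (rcomod_self C) (\<lambda>(x, c). ract (rcomod_self C) x (counit C c)) (rcoact (rcomod_self C) c) = c"
    using c counital_right by simp
qed (simp_all add: tensor_self comult_ract coassoc)

lemma left_comodule_self: "left_comodule B C (lcomod_self C)"
proof (intro left_comodule.intro left_comodule_axioms.intro left_module_self)
  show "lcoact (lcomod_self C) \<in> hom (lcomod_self C) (tensor B (crm C) (lcomod_self C))"
    using comult_hom by (simp add: tensor_self hom_def)
  fix c assume c: "c \<in> carrier (lcomod_self C)"
  have "tlift (lcomod_self C) (\<lambda>(c, x). lact (clm C) (counit C c) x) (comult C c) =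
      tlift (clm C) (\<lambda>(c, x). lact (clm C) (counit C c) x) (comult C c)"
    by (rule CC.tlift_target_cong[symmetric, OF L.M.comm_group_axioms _ counital_left_balanced])
      (use c left_module.axioms(2)[OF left_module_self] comult_closed in simp_all)
  then show "tlift (lcomod_self C) (\<lambda>(c, x). lact (lcomod_self C) (counit C c) x) (lcoact (lcomod_self C) c) = c"
    using c counital_left by simp
qed (simp_all add: tensor_self comult_lact coassoc)

end

text \<open>A grouplike element \<open>g\<close> makes the base algebra a comodule, by \<open>b \<mapsto> 1 \<otimes> gb\<close> and \<open>b \<mapsto> bg \<otimes> 1\<close>.\<close>

locale grouplike = is_coring B C
  for B :: "('b, 'x) ring_scheme" and C :: "('b, 'c, 'y) coring_scheme" +
  fixes g :: 'c
  assumes g_closed: "g \<in> carrier (crm C)" and comult_g: "comult C g = pten B (crm C) (clm C) g g"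
    and counit_g: "counit C g = \<one>\<^bsub>B\<^esub>"

text \<open>The map \<open>u\<close> is a parameter, tied to \<open>g\<close> on the carrier only,
  so that it can be instantiated by a given source or target map.\<close>

locale grouplike_right = grouplike B C g
  for B :: "('b, 'x) ring_scheme" and C :: "('b, 'c, 'y) coring_scheme" and g +
  fixes u :: "'b \<Rightarrow> 'c"
  assumes u: "b \<in> carrier B \<Longrightarrow> u b = ract (crm C) g b"
begin

abbreviation "Br \<equiv> base_rcomod B C u"

interpretation Br: right_module B Br by (rule right_module_base)

interpretation BC: tensor_pair B Br "clm C"
  by (intro tensor_pair.intro right_module_base L.left_module_axioms)

interpretation BCC: tensor_triple B Br "clm C" B "crm C" "clm C"
  by unfold_locales (simp_all add: acts_commute)

lemma u_closed: "b \<in> carrier B \<Longrightarrow> u b \<in> carrier (crm C)"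
  by (simp add: u R.ract_closed g_closed)

lemma u_add: "b \<in> carrier B \<Longrightarrow> b' \<in> carrier B \<Longrightarrow> u (b \<oplus>\<^bsub>B\<^esub> b') = u b \<otimes>\<^bsub>crm C\<^esub> u b'"
  by (simp add: u R.ract_add_right g_closed)

lemma u_mult: "b \<in> carrier B \<Longrightarrow> b' \<in> carrier B \<Longrightarrow> u (b \<otimes>\<^bsub>B\<^esub> b') = ract (crm C) (u b) b'"
  by (simp add: u R.ract_mult g_closed)

lemma u_one: "u \<one>\<^bsub>B\<^esub> = g"
  by (simp add: u R.ract_one g_closed)

lemma counit_u: "b \<in> carrier B \<Longrightarrow> counit C (u b) = b"
  by (simp add: u counit_ract g_closed counit_g)

lemma comult_u: "b \<in> carrier B \<Longrightarrow> comult C (u b) = pten B (crm C) (clm C) g (u b)"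
  using CC.tmap_pten[OF tensor_pair_coring rmod_hom_id ract_lmod_hom, of b g g]
  by (simp add: u comult_ract g_closed comult_g)

lemma rcoact_base: "rcoact Br b = pten B Br (clm C) \<one>\<^bsub>B\<^esub> (u b)"
proof -
  have "pten B (rreg B) (clm C) = pten B Br (clm C)"
    by (rule tensor_cong_left) simp_all
  then show ?thesis by (simp add: base_rcomod_def)
qed

lemma u_rmod_hom: "u \<in> rmod_hom B Br (rcomod_self C)"
  by (auto simp: rmod_hom_def hom_def u_closed u_add u_mult)

lemma rcoact_base_closed: "b \<in> carrier B \<Longrightarrow> rcoact Br b \<in> carrier (tensor B Br (clm C))"
  unfolding rcoact_base by (rule BC.pten_closed) (simp_all add: u_closed)

text \<open>The coproduct is right linear and \<open>g\<close> is grouplike, so u(b) has coproduct g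
  \<otimes> u(b); both iterated coactions then send b to 1 \<otimes> g \<otimes> u(b).\<close>

lemma right_comodule_base: "right_comodule B C Br"
proof (intro right_comodule.intro right_comodule_axioms.intro right_module_base)
  note pten_add = BC.pten_add_right[simplified]
  show hom: "rcoact Br \<in> hom Br (tensor B Br (clm C))"
    by (rule homI) (auto simp: rcoact_base_closed; simp add: rcoact_base u_add u_closed pten_add)+
  show act: "rcoact Br (ract Br b c) = tmap B Br (clm C) (\<lambda>x. x) (\<lambda>c'. ract (crm C) c' c) (rcoact Br b)"
    if "b \<in> carrier Br" "c \<in> carrier B" for b c
    using that BC.tmap_pten[OF BC.tensor_pair_axioms rmod_hom_id ract_lmod_hom[OF that(2)], of "\<one>\<^bsub>B\<^esub>" "u b"]
    by (simp add: rcoact_base u_mult u_closed)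
  fix b assume "b \<in> carrier Br"
  then have b: "b \<in> carrier B" by simp
  let ?T3 = "tensor3 B Br (clm C) B (crm C) (clm C)" and ?p = "pten3 B Br (clm C) B (crm C) (clm C)"
  note T = BCC.comm_group_tensor3 and p3 = BCC.balanced3_pten3
  have 1: "\<one>\<^bsub>B\<^esub> \<in> carrier Br" and ub: "u b \<in> carrier (clm C)" and gC: "g \<in> carrier (clm C)"
    using b by (simp_all add: u_closed g_closed)
  have "ten_left B Br (clm C) B (crm C) (clm C) (rcoact Br) (rcoact Br b) =
      tlift ?T3 (\<lambda>(m, n). ?p m n (u b)) (rcoact Br \<one>\<^bsub>B\<^esub>)"
    unfolding rcoact_base[of b] ten_left_def
    by (rule BC.tlift_pten[OF T BCC.balanced_nest_left[OF right_module_base hom act T p3] 1 ub])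
  also have "\<dots> = ?p \<one>\<^bsub>B\<^esub> g (u b)"
    unfolding rcoact_base[of "\<one>\<^bsub>B\<^esub>"] u_one
    by (rule BC.tlift_pten[OF T BCC.balanced3_left[OF T p3 ub] 1 gC])
  also have "\<dots> = tlift ?T3 (\<lambda>(n, p). ?p \<one>\<^bsub>B\<^esub> n p) (comult C (u b))"
    unfolding comult_u[OF b]
    by (rule CC.tlift_pten[OF T BCC.balanced3_right[OF T p3 1] g_closed ub, symmetric])
  also have "\<dots> = ten_right B Br (clm C) B (crm C) (clm C) (comult C) (rcoact Br b)"
    unfolding rcoact_base[of b] ten_right_def
    by (rule BC.tlift_pten[OF T BCC.balanced_nest_right[OF L.left_module_axioms comult_hom_clm comult_lact_clm T p3]
          1 ub, symmetric])
  finally show "ten_left B Br (clm C) B (crm C) (clm C) (rcoact Br) (rcoact Br b) =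
    ten_right B Br (clm C) B (crm C) (clm C) (comult C) (rcoact Br b)" .
  have bal: "balanced B Br (clm C) Br (\<lambda>x c. ract Br x (counit C c))"
    by (rule balancedI)
      (simp_all add: counit_closed counit_add counit_lact R.B.l_distr R.B.r_distr R.B.m_assoc)
  show "tlift Br (\<lambda>(x, c). ract Br x (counit C c)) (rcoact Br b) = b"
    unfolding rcoact_base using BC.tlift_pten[OF Br.M.comm_group_axioms bal 1 ub] b
    by (simp add: counit_u)
qed

lemma u_rcomod_hom: "u \<in> rcomod_hom B C Br (rcomod_self C)"
proof -
  have P: "tensor_pair B (rcomod_self C) (clm C)"
    by (intro tensor_pair.intro right_module_self L.left_module_axioms)
  have "tmap B (rcomod_self C) (clm C) u (\<lambda>c. c) (rcoact Br b) = comult C (u b)" if "b \<in> carrier B" for b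
    unfolding rcoact_base using that BC.tmap_pten[OF P u_rmod_hom lmod_hom_id, of "\<one>\<^bsub>B\<^esub>" "u b"]
    by (simp add: u_closed comult_u u_one tensor_self)
  then show ?thesis using u_rmod_hom by (simp add: rcomod_hom_def)
qed

lemma rel_injective_imp_splits:
  fixes j :: "'b \<Rightarrow> 'u" and j' :: "'c \<Rightarrow> 'u"
  assumes "inj j" "inj j'"
    and "\<And>P :: ('b, 'u, 'c) rcomodule. right_comodule B C P \<Longrightarrow> right_rel_injective B C P"
  shows "splits_rcomod B C Br (rcomod_self C) u"
proof (rule splits_rcomod_of_transport[OF right_comodule_base right_comodule_self u_rcomod_hom _ assms])
  have "counit C \<in> rmod_hom B (rcomod_self C) Br"
    using counit_right by (simp add: rmod_hom_def hom_def)
  then show "splits_rmod B Br (rcomod_self C) u"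
    using u_rmod_hom unfolding splits_rmod_def
    by (intro conjI bexI[of _ "counit C"] ballI) (simp_all add: counit_u)
qed

text \<open>Colinearity of \<phi> reads 1 \<otimes> u(\<phi>(c)) = \<phi>(c1) \<otimes> c2 in the
  tensor product of the base algebra with \<open>C\<close>. The left action induces a map from there
  to \<open>C\<close>, which turns this into the integral equation; the retraction property at the
  unit is the normalization. \<open>G\<close> is another copy of the group of \<open>C\<close>,
  chosen later as \<open>addgrp A\<close>.\<close>

lemma splits_imp_integral:
  assumes "splits_rcomod B C Br (rcomod_self C) u"
    and G: "comm_group G" "carrier G = carrier (crm C)" "monoid.mult G = monoid.mult (crm C)"
  shows "\<exists>\<phi> \<in> rmod_hom B (crm C) (rreg B). \<phi> g = \<one>\<^bsub>B\<^esub> \<and>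
    (\<forall>c \<in> carrier (crm C). tlift G (\<lambda>(x, y). lact (clm C) (\<phi> x) y) (comult C c) = u (\<phi> c))"
proof -
  obtain \<phi> where \<phi>: "\<phi> \<in> rcomod_hom B C (rcomod_self C) Br" and \<phi>u: "\<And>b. b \<in> carrier B \<Longrightarrow> \<phi> (u b) = b"
    using assms by (auto simp: splits_rcomod_def)
  have \<phi>': "\<phi> \<in> rmod_hom B (crm C) Br" and \<phi>'': "\<phi> \<in> rmod_hom B (crm C) (rreg B)"
    using \<phi> by (auto simp: rcomod_hom_def rmod_hom_def hom_def)
  have bal: "balanced B Br (clm C) G (lact (clm C))"
    using L.lact_closed L.lact_add_left L.lact_add_right L.lact_mult by (intro balancedI) (simp_all add: G)
  have "tlift G (\<lambda>(x, y). lact (clm C) (\<phi> x) y) (comult C c) = u (\<phi> c)" if c: "c \<in> carrier (crm C)" for c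
  proof -
    have \<phi>c: "\<phi> c \<in> carrier B" using rmod_hom_closed[OF \<phi>'' c] by simp
    have "rcoact Br (\<phi> c) = tmap B Br (clm C) \<phi> (\<lambda>c. c) (comult C c)"
      using \<phi> c by (simp add: rcomod_hom_def)
    then have "tlift G (\<lambda>(x, y). lact (clm C) x y) (pten B Br (clm C) \<one>\<^bsub>B\<^esub> (u (\<phi> c))) =
        tlift G (\<lambda>(x, y). lact (clm C) (\<phi> x) y) (comult C c)"
      unfolding rcoact_base
      using CC.tlift_tmap[OF BC.tensor_pair_axioms \<phi>' lmod_hom_id G(1) bal comult_closed[OF c]]
      by simp
    moreover have "tlift G (\<lambda>(x, y). lact (clm C) x y) (pten B Br (clm C) \<one>\<^bsub>B\<^esub> (u (\<phi> c))) = u (\<phi> c)"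
      using BC.tlift_pten[OF G(1) bal, of "\<one>\<^bsub>B\<^esub>" "u (\<phi> c)"] \<phi>c L.lact_one
      by (simp add: u_closed)
    ultimately show ?thesis by simp
  qed
  moreover have "\<phi> g = \<one>\<^bsub>B\<^esub>" using \<phi>u[of "\<one>\<^bsub>B\<^esub>"] by (simp add: u_one)
  ultimately show ?thesis using \<phi>'' by blast
qed

end

locale grouplike_left = grouplike B C g
  for B :: "('b, 'x) ring_scheme" and C :: "('b, 'c, 'y) coring_scheme" and g +
  fixes u :: "'b \<Rightarrow> 'c"
  assumes u: "b \<in> carrier B \<Longrightarrow> u b = lact (clm C) b g"
begin

abbreviation "Bl \<equiv> base_lcomod B C u"

interpretation Bl: left_module B Bl by (rule left_module_base)

interpretation CB: tensor_pair B "crm C" Bl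
  by (intro tensor_pair.intro left_module_base R.right_module_axioms)

interpretation CCB: tensor_triple B "crm C" "clm C" B "crm C" Bl
  by unfold_locales (simp_all add: acts_commute)

lemma u_closed: "b \<in> carrier B \<Longrightarrow> u b \<in> carrier (crm C)"
  by (simp add: u lact_closed g_closed)

lemma u_add: "b \<in> carrier B \<Longrightarrow> b' \<in> carrier B \<Longrightarrow> u (b \<oplus>\<^bsub>B\<^esub> b') = u b \<otimes>\<^bsub>crm C\<^esub> u b'"
  using L.lact_add_left g_closed by (simp add: u)

lemma u_mult: "b \<in> carrier B \<Longrightarrow> b' \<in> carrier B \<Longrightarrow> u (b \<otimes>\<^bsub>B\<^esub> b') = lact (clm C) b (u b')"
  using L.lact_mult g_closed by (simp add: u)

lemma u_one: "u \<one>\<^bsub>B\<^esub> = g"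
  using L.lact_one g_closed by (simp add: u)

lemma counit_u: "b \<in> carrier B \<Longrightarrow> counit C (u b) = b"
  by (simp add: u counit_lact g_closed counit_g)

lemma comult_u: "b \<in> carrier B \<Longrightarrow> comult C (u b) = pten B (crm C) (clm C) (u b) g"
  using CC.tmap_pten[OF tensor_pair_coring lact_rmod_hom lmod_hom_id, of b g g]
  by (simp add: u comult_lact g_closed comult_g)

lemma lcoact_base: "lcoact Bl b = pten B (crm C) Bl (u b) \<one>\<^bsub>B\<^esub>"
proof -
  have "pten B (crm C) (lreg B) = pten B (crm C) Bl"
    by (rule tensor_cong_right) simp_all
  then show ?thesis by (simp add: base_lcomod_def)
qed

lemma u_lmod_hom: "u \<in> lmod_hom B Bl (lcomod_self C)"
  by (auto simp: lmod_hom_def hom_def u_closed u_add u_mult)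

lemma lcoact_base_closed: "b \<in> carrier B \<Longrightarrow> lcoact Bl b \<in> carrier (tensor B (crm C) Bl)"
  unfolding lcoact_base by (rule CB.pten_closed) (simp_all add: u_closed)

text \<open>Here u(b) has coproduct u(b) \<otimes> g, and both iterated coactions send b to u(b)
  \<otimes> g \<otimes> 1.\<close>

lemma left_comodule_base: "left_comodule B C Bl"
proof (intro left_comodule.intro left_comodule_axioms.intro left_module_base)
  note pten_add = CB.pten_add_left[simplified]
  show hom: "lcoact Bl \<in> hom Bl (tensor B (crm C) Bl)"
    by (rule homI) (auto simp: lcoact_base_closed; simp add: lcoact_base u_add u_closed pten_add)+
  show act: "lcoact Bl (lact Bl c b) = tmap B (crm C) Bl (\<lambda>c'. lact (clm C) c c') (\<lambda>x. x) (lcoact Bl b)"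
    if "b \<in> carrier Bl" "c \<in> carrier B" for b c
    using that CB.tmap_pten[OF CB.tensor_pair_axioms lact_rmod_hom[OF that(2)] lmod_hom_id, of "u b" "\<one>\<^bsub>B\<^esub>"]
    by (simp add: lcoact_base u_mult u_closed)
  fix b assume "b \<in> carrier Bl"
  then have b: "b \<in> carrier B" by simp
  let ?T3 = "tensor3 B (crm C) (clm C) B (crm C) Bl" and ?p = "pten3 B (crm C) (clm C) B (crm C) Bl"
  note T = CCB.comm_group_tensor3 and p3 = CCB.balanced3_pten3
  have 1: "\<one>\<^bsub>B\<^esub> \<in> carrier Bl" and ub: "u b \<in> carrier (crm C)" and gC: "g \<in> carrier (clm C)"
    using b by (simp_all add: u_closed g_closed)
  have "ten_left B (crm C) (clm C) B (crm C) Bl (comult C) (lcoact Bl b) =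
      tlift ?T3 (\<lambda>(m, n). ?p m n \<one>\<^bsub>B\<^esub>) (comult C (u b))"
    unfolding lcoact_base[of b] ten_left_def
    by (rule CB.tlift_pten[OF T CCB.balanced_nest_left[OF R.right_module_axioms comult_hom comult_ract T p3] ub 1])
  also have "\<dots> = ?p (u b) g \<one>\<^bsub>B\<^esub>"
    unfolding comult_u[OF b]
    by (rule CC.tlift_pten[OF T CCB.balanced3_left[OF T p3 1] ub gC])
  also have "\<dots> = tlift ?T3 (\<lambda>(n, p). ?p (u b) n p) (lcoact Bl \<one>\<^bsub>B\<^esub>)"
    unfolding lcoact_base[of "\<one>\<^bsub>B\<^esub>"] u_one
    by (rule CB.tlift_pten[OF T CCB.balanced3_right[OF T p3 ub] g_closed 1, symmetric])
  also have "\<dots> = ten_right B (crm C) (clm C) B (crm C) Bl (lcoact Bl) (lcoact Bl b)"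
    unfolding lcoact_base[of b] ten_right_def
    by (rule CB.tlift_pten[OF T CCB.balanced_nest_right[OF left_module_base hom act T p3] ub 1, symmetric])
  finally show "ten_left B (crm C) (clm C) B (crm C) Bl (comult C) (lcoact Bl b) =
    ten_right B (crm C) (clm C) B (crm C) Bl (lcoact Bl) (lcoact Bl b)" .
  have bal: "balanced B (crm C) Bl Bl (\<lambda>c x. lact Bl (counit C c) x)"
    by (rule balancedI)
      (simp_all add: counit_closed counit_add counit_ract R.B.l_distr R.B.r_distr R.B.m_assoc)
  show "tlift Bl (\<lambda>(c, x). lact Bl (counit C c) x) (lcoact Bl b) = b"
    unfolding lcoact_base using CB.tlift_pten[OF Bl.M.comm_group_axioms bal ub 1] b
    by (simp add: counit_u)
qed

lemma u_lcomod_hom: "u \<in> lcomod_hom B C Bl (lcomod_self C)"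
proof -
  have P: "tensor_pair B (crm C) (lcomod_self C)"
    by (intro tensor_pair.intro left_module_self R.right_module_axioms)
  have "tmap B (crm C) (lcomod_self C) (\<lambda>c. c) u (lcoact Bl b) = comult C (u b)" if "b \<in> carrier B" for b
    unfolding lcoact_base using that CB.tmap_pten[OF P rmod_hom_id u_lmod_hom, of "u b" "\<one>\<^bsub>B\<^esub>"]
    by (simp add: u_closed comult_u u_one tensor_self)
  then show ?thesis using u_lmod_hom by (simp add: lcomod_hom_def)
qed

lemma rel_injective_imp_splits:
  fixes j :: "'b \<Rightarrow> 'u" and j' :: "'c \<Rightarrow> 'u"
  assumes "inj j" "inj j'"
    and "\<And>P :: ('b, 'u, 'c) lcomodule. left_comodule B C P \<Longrightarrow> left_rel_injective B C P"
  shows "splits_lcomod B C Bl (lcomod_self C) u"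
proof (rule splits_lcomod_of_transport[OF left_comodule_base left_comodule_self u_lcomod_hom _ assms])
  have "counit C \<in> lmod_hom B (lcomod_self C) Bl"
    using counit_left by (simp add: lmod_hom_def hom_def)
  then show "splits_lmod B Bl (lcomod_self C) u"
    using u_lmod_hom unfolding splits_lmod_def
    by (intro conjI bexI[of _ "counit C"] ballI) (simp_all add: counit_u)
qed

text \<open>Colinearity reads u(\<phi>(c)) \<otimes> 1 = c1 \<otimes> \<phi>(c2), and this time the
  right action of the base algebra on \<open>C\<close> evaluates both sides.\<close>

lemma splits_imp_integral:
  assumes "splits_lcomod B C Bl (lcomod_self C) u"
    and G: "comm_group G" "carrier G = carrier (crm C)" "monoid.mult G = monoid.mult (crm C)"
  shows "\<exists>\<phi> \<in> lmod_hom B (clm C) (lreg B). \<phi> g = \<one>\<^bsub>B\<^esub> \<and>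
    (\<forall>c \<in> carrier (crm C). tlift G (\<lambda>(x, y). ract (crm C) x (\<phi> y)) (comult C c) = u (\<phi> c))"
proof -
  obtain \<phi> where \<phi>: "\<phi> \<in> lcomod_hom B C (lcomod_self C) Bl" and \<phi>u: "\<And>b. b \<in> carrier B \<Longrightarrow> \<phi> (u b) = b"
    using assms by (auto simp: splits_lcomod_def)
  have \<phi>': "\<phi> \<in> lmod_hom B (clm C) Bl" and \<phi>'': "\<phi> \<in> lmod_hom B (clm C) (lreg B)"
    using \<phi> by (auto simp: lcomod_hom_def lmod_hom_def hom_def)
  have bal: "balanced B (crm C) Bl G (ract (crm C))"
    using R.ract_closed R.ract_add_left R.ract_add_right R.ract_mult by (intro balancedI) (simp_all add: G)
  have "tlift G (\<lambda>(x, y). ract (crm C) x (\<phi> y)) (comult C c) = u (\<phi> c)" if c: "c \<in> carrier (crm C)" for c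
  proof -
    have \<phi>c: "\<phi> c \<in> carrier B" using lmod_hom_closed[OF \<phi>''] c by simp
    have "lcoact Bl (\<phi> c) = tmap B (crm C) Bl (\<lambda>c. c) \<phi> (comult C c)"
      using \<phi> c by (simp add: lcomod_hom_def)
    then have "tlift G (\<lambda>(x, y). ract (crm C) x y) (pten B (crm C) Bl (u (\<phi> c)) \<one>\<^bsub>B\<^esub>) =
        tlift G (\<lambda>(x, y). ract (crm C) x (\<phi> y)) (comult C c)"
      unfolding lcoact_base
      using CC.tlift_tmap[OF CB.tensor_pair_axioms rmod_hom_id \<phi>' G(1) bal comult_closed[OF c]]
      by simp
    moreover have "tlift G (\<lambda>(x, y). ract (crm C) x y) (pten B (crm C) Bl (u (\<phi> c)) \<one>\<^bsub>B\<^esub>) = u (\<phi> c)"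
      using CB.tlift_pten[OF G(1) bal, of "u (\<phi> c)" "\<one>\<^bsub>B\<^esub>"] \<phi>c R.ract_one
      by (simp add: u_closed)
    ultimately show ?thesis by simp
  qed
  moreover have "\<phi> g = \<one>\<^bsub>B\<^esub>" using \<phi>u[of "\<one>\<^bsub>B\<^esub>"] by (simp add: u_one)
  ultimately show ?thesis using \<phi>'' by blast
qed

end


section \<open>Bialgebroids\<close>

lemma module_simps [simp]:
  "carrier (low_l A s) = carrier A" "monoid.mult (low_l A s) = add A" "one (low_l A s) = \<zero>\<^bsub>A\<^esub>"
  "lact (low_l A s) = (\<lambda>b a. s b \<otimes>\<^bsub>A\<^esub> a)"
  "carrier (low_r A t) = carrier A" "monoid.mult (low_r A t) = add A" "one (low_r A t) = \<zero>\<^bsub>A\<^esub>"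
  "ract (low_r A t) = (\<lambda>a b. t b \<otimes>\<^bsub>A\<^esub> a)"
  "carrier (up_r A s) = carrier A" "monoid.mult (up_r A s) = add A" "one (up_r A s) = \<zero>\<^bsub>A\<^esub>"
  "ract (up_r A s) = (\<lambda>a b. a \<otimes>\<^bsub>A\<^esub> s b)"
  "carrier (up_l A t) = carrier A" "monoid.mult (up_l A t) = add A" "one (up_l A t) = \<zero>\<^bsub>A\<^esub>"
  "lact (up_l A t) = (\<lambda>b a. a \<otimes>\<^bsub>A\<^esub> t b)"
  by (simp_all add: low_l_def low_r_def up_l_def up_r_def)

lemma coring_simps [simp]:
  "crm (L_coring A s t \<gamma> \<pi>) = low_r A t" "clm (L_coring A s t \<gamma> \<pi>) = low_l A s"
  "comult (L_coring A s t \<gamma> \<pi>) = \<gamma>" "counit (L_coring A s t \<gamma> \<pi>) = \<pi>"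
  "crm (R_coring A s t \<gamma> \<pi>) = up_r A s" "clm (R_coring A s t \<gamma> \<pi>) = up_l A t"
  "comult (R_coring A s t \<gamma> \<pi>) = \<gamma>" "counit (R_coring A s t \<gamma> \<pi>) = \<pi>"
  by (simp_all add: L_coring_def R_coring_def)

lemma op_alg_simps [simp]:
  "carrier (op_alg A) = carrier A" "add (op_alg A) = add A" "\<zero>\<^bsub>op_alg A\<^esub> = \<zero>\<^bsub>A\<^esub>" "\<one>\<^bsub>op_alg A\<^esub> = \<one>\<^bsub>A\<^esub>"
  "monoid.mult (op_alg A) = (\<lambda>x y. y \<otimes>\<^bsub>A\<^esub> x)"
  by (simp_all add: op_alg_def)

lemma op_alg_modules [simp]:
  "low_r (op_alg A) s = up_r A s" "low_l (op_alg A) t = up_l A t" "addgrp (op_alg A) = addgrp A"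
  by (simp_all add: low_r_def up_r_def low_l_def up_l_def addgrp_def)

context left_bialgebroid
begin

abbreviation "Al \<equiv> low_l A s"
abbreviation "Ar \<equiv> low_r A t"
abbreviation "T \<equiv> tensor L Ar Al"
abbreviation "bal \<equiv> balanced L Ar Al"
abbreviation "pt \<equiv> pten L Ar Al"

lemma balI:
  assumes "\<And>x y. x \<in> carrier A \<Longrightarrow> y \<in> carrier A \<Longrightarrow> f x y \<in> carrier G"
    and "\<And>x x' y. x \<in> carrier A \<Longrightarrow> x' \<in> carrier A \<Longrightarrow> y \<in> carrier A \<Longrightarrow> f (x \<oplus>\<^bsub>A\<^esub> x') y = f x y \<otimes>\<^bsub>G\<^esub> f x' y"
    and "\<And>x y y'. x \<in> carrier A \<Longrightarrow> y \<in> carrier A \<Longrightarrow> y' \<in> carrier A \<Longrightarrow> f x (y \<oplus>\<^bsub>A\<^esub> y') = f x y \<otimes>\<^bsub>G\<^esub> f x y'"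
    and "\<And>x l y. x \<in> carrier A \<Longrightarrow> l \<in> carrier L \<Longrightarrow> y \<in> carrier A \<Longrightarrow> f (t l \<otimes>\<^bsub>A\<^esub> x) y = f x (s l \<otimes>\<^bsub>A\<^esub> y)"
  shows "bal G f"
  using assms by (intro balancedI) simp_all

lemma
  assumes "bal G f" "x \<in> carrier A" "y \<in> carrier A"
  shows bal_closed: "f x y \<in> carrier G"
    and bal_add_left: "x' \<in> carrier A \<Longrightarrow> f (x \<oplus>\<^bsub>A\<^esub> x') y = f x y \<otimes>\<^bsub>G\<^esub> f x' y"
    and bal_add_right: "y' \<in> carrier A \<Longrightarrow> f x (y \<oplus>\<^bsub>A\<^esub> y') = f x y \<otimes>\<^bsub>G\<^esub> f x y'"
    and bal_act: "l \<in> carrier L \<Longrightarrow> f (t l \<otimes>\<^bsub>A\<^esub> x) y = f x (s l \<otimes>\<^bsub>A\<^esub> y)"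
  using assms by (auto simp: balanced_def)

lemma
  shows s_closed [simp]: "l \<in> carrier L \<Longrightarrow> s l \<in> carrier A"
    and s_mult: "l \<in> carrier L \<Longrightarrow> l' \<in> carrier L \<Longrightarrow> s (l \<otimes>\<^bsub>L\<^esub> l') = s l \<otimes>\<^bsub>A\<^esub> s l'"
    and s_add: "l \<in> carrier L \<Longrightarrow> l' \<in> carrier L \<Longrightarrow> s (l \<oplus>\<^bsub>L\<^esub> l') = s l \<oplus>\<^bsub>A\<^esub> s l'"
    and s_one: "s \<one>\<^bsub>L\<^esub> = \<one>\<^bsub>A\<^esub>"
  using source_hom by (auto simp: alg_hom_def ring_hom_def)

lemma
  shows t_closed [simp]: "l \<in> carrier L \<Longrightarrow> t l \<in> carrier A"
    and t_mult: "l \<in> carrier L \<Longrightarrow> l' \<in> carrier L \<Longrightarrow> t (l \<otimes>\<^bsub>L\<^esub> l') = t l' \<otimes>\<^bsub>A\<^esub> t l"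
    and t_add: "l \<in> carrier L \<Longrightarrow> l' \<in> carrier L \<Longrightarrow> t (l \<oplus>\<^bsub>L\<^esub> l') = t l \<oplus>\<^bsub>A\<^esub> t l'"
    and t_one: "t \<one>\<^bsub>L\<^esub> = \<one>\<^bsub>A\<^esub>"
  using target_hom by (auto simp: alg_hom_def ring_hom_def)

text \<open>The coring facts in the vocabulary of \<open>A\<close>: after simplification the fields
  of \<open>L_coring\<close> have disappeared, and the rules match goals about \<open>Ar\<close>,
  \<open>Al\<close>, \<gamma> and \<pi>.\<close>

lemmas pt_closed = pten_rules(1)[simplified]
  and pt_add_left = pten_rules(2)[simplified]
  and pt_add_right = pten_rules(3)[simplified]
  and pt_act = CC.pten_act[simplified]
  and pair = tensor_pair_coring[simplified]
  and comm_group_T = CC.comm_group_tensor[simplified]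
  and balanced_pt = CC.balanced_pten[simplified]
  and gamma_closed = comult_closed[simplified]
  and pi_closed = counit_closed[simplified]
  and pi_add = counit_add[simplified]
  and pi_t = counit_ract[simplified]
  and pi_s = counit_lact[simplified]
  and sum_closed = CC.tlift_closed[simplified]
  and sum_cong = CC.tlift_cong[simplified]
  and sum_hom = CC.hom_tlift[simplified]
  and bal_hom = CC.balanced_hom[simplified]
  and sum_pt = CC.tlift_pten[simplified]
  and sum_ext = CC.tensor_ext[simplified]
  and sum_coassoc = coassoc_sum[simplified]
  and sum_Fubini = CC.Fubini[OF _ tensor_pair_coring, simplified]
  and sum_add = CC.tlift_add[simplified]
  and sum_mult_target = CC.tlift_mult[simplified]
  and sum_tmap = CC.tlift_tmap[simplified]
  and bal_compose = CC.balanced_compose[simplified]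
  and sum_is_hom = CC.tlift_hom[simplified]
  and gamma_hom = comult_hom[simplified]
  and bal3I = CCC.balanced3I[simplified]
  and nest_left = CCC.balanced_nest_left[OF R.right_module_axioms comult_hom comult_ract, simplified]
  and nest_right = CCC.balanced_nest_right[OF L.left_module_axioms comult_hom_clm comult_lact_clm, simplified]
  and ten_left_gamma_hom = CCC.ten_left_hom[OF R.right_module_axioms comult_hom comult_ract, simplified]
  and ten_right_gamma_hom = CCC.ten_right_hom[OF L.left_module_axioms comult_hom_clm comult_lact_clm, simplified]
  and sum3_ten_left = CCC.tlift3_ten_left[OF R.right_module_axioms comult_hom comult_ract, simplified]
  and sum3_ten_right = CCC.tlift3_ten_right[OF L.left_module_axioms comult_hom_clm comult_lact_clm, simplified]
  and sum3_hom = CCC.tlift3_hom[simplified]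
  and bal_sum = CC.balanced_tlift[OF _ tensor_pair_coring, simplified]
  and tmap_pt = CC.tmap_pten[simplified]
  and tmap_hom = CC.tmap_hom[simplified]

lemma gamma_add: "a \<in> carrier A \<Longrightarrow> b \<in> carrier A \<Longrightarrow> \<gamma> (a \<oplus>\<^bsub>A\<^esub> b) = \<gamma> a \<otimes>\<^bsub>T\<^esub> \<gamma> b"
  using hom_mult[OF gamma_hom, of a b] by simp

lemma sum_add_arg:
  assumes "comm_group G" "bal G f" "a \<in> carrier A" "b \<in> carrier A"
  shows "tlift G (\<lambda>(x, y). f x y) (\<gamma> (a \<oplus>\<^bsub>A\<^esub> b)) =
    tlift G (\<lambda>(x, y). f x y) (\<gamma> a) \<otimes>\<^bsub>G\<^esub> tlift G (\<lambda>(x, y). f x y) (\<gamma> b)"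
  using assms by (simp add: gamma_add sum_add gamma_closed)

lemma comm_group_A: "comm_group (addgrp A)"
  by (rule comm_group_addgrp[OF A.A.ring_axioms])

lemma right_mult_r: "c \<in> carrier A \<Longrightarrow> (\<lambda>x. x \<otimes>\<^bsub>A\<^esub> c) \<in> rmod_hom L Ar Ar"
  by (auto simp: rmod_hom_def hom_def A.A.l_distr A.A.m_assoc)

lemma right_mult_l: "c \<in> carrier A \<Longrightarrow> (\<lambda>x. x \<otimes>\<^bsub>A\<^esub> c) \<in> lmod_hom L Al Al"
  by (auto simp: lmod_hom_def hom_def A.A.l_distr A.A.m_assoc)

lemma left_t_l: "l \<in> carrier L \<Longrightarrow> (\<lambda>y. t l \<otimes>\<^bsub>A\<^esub> y) \<in> lmod_hom L Al Al"
  using ranges_commute by (auto simp: lmod_hom_def hom_def A.A.r_distr simp flip: A.A.m_assoc)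

lemma left_s_r: "l \<in> carrier L \<Longrightarrow> (\<lambda>y. s l \<otimes>\<^bsub>A\<^esub> y) \<in> rmod_hom L Ar Ar"
  using ranges_commute by (auto simp: rmod_hom_def hom_def A.A.r_distr simp flip: A.A.m_assoc)

context
  fixes G :: "('g, 'v) monoid_scheme" and f :: "'a \<Rightarrow> 'a \<Rightarrow> 'g"
  assumes G: "comm_group G" and f: "bal G f"
begin

lemma bal_right_mult: "c \<in> carrier A \<Longrightarrow> d \<in> carrier A \<Longrightarrow> bal G (\<lambda>x y. f (x \<otimes>\<^bsub>A\<^esub> c) (y \<otimes>\<^bsub>A\<^esub> d))"
  by (rule bal_compose[OF right_mult_r right_mult_l f])

lemma sum_s_left:
  assumes "a \<in> carrier A" "l \<in> carrier L"
  shows "tlift G (\<lambda>(x, y). f x y) (\<gamma> (s l \<otimes>\<^bsub>A\<^esub> a)) = tlift G (\<lambda>(x, y). f (s l \<otimes>\<^bsub>A\<^esub> x) y) (\<gamma> a)"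
  using sum_tmap[OF pair left_s_r[OF assms(2)] lmod_hom_id G f gamma_closed[OF assms(1)]]
    comult_lact[simplified, OF assms] by simp

lemma sum_t_left:
  assumes "a \<in> carrier A" "l \<in> carrier L"
  shows "tlift G (\<lambda>(x, y). f x y) (\<gamma> (t l \<otimes>\<^bsub>A\<^esub> a)) = tlift G (\<lambda>(x, y). f x (t l \<otimes>\<^bsub>A\<^esub> y)) (\<gamma> a)"
  using sum_tmap[OF pair rmod_hom_id left_t_l[OF assms(2)] G f gamma_closed[OF assms(1)]]
    comult_ract[simplified, OF assms] by simp

lemma sum_takeuchi:
  assumes "a \<in> carrier A" "l \<in> carrier L"
  shows "tlift G (\<lambda>(x, y). f (x \<otimes>\<^bsub>A\<^esub> t l) y) (\<gamma> a) = tlift G (\<lambda>(x, y). f x (y \<otimes>\<^bsub>A\<^esub> s l)) (\<gamma> a)"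
  using sum_tmap[OF pair right_mult_r[of "t l"] lmod_hom_id G f gamma_closed[OF assms(1)]]
    sum_tmap[OF pair rmod_hom_id right_mult_l[of "s l"] G f gamma_closed[OF assms(1)]]
    takeuchi[OF assms] assms by simp

end

text \<open>The balancing clause is the Takeuchi condition for \<open>\<gamma> a\<close>; the other
  clauses are distributivity. This makes the factorwise product in \<open>low_tmult\<close> well
  defined in its second argument.\<close>

lemma bal_mult:
  assumes G: "comm_group G" and f: "bal G f" and a: "a \<in> carrier A"
  shows "bal G (\<lambda>x' y'. tlift G (\<lambda>(x, y). f (x \<otimes>\<^bsub>A\<^esub> x') (y \<otimes>\<^bsub>A\<^esub> y')) (\<gamma> a))"
proof (rule balI)
  note X = gamma_closed[OF a] and b = bal_right_mult[OF G f]
  fix x' y' assume x': "x' \<in> carrier A" and y': "y' \<in> carrier A"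
  show "tlift G (\<lambda>(x, y). f (x \<otimes>\<^bsub>A\<^esub> x') (y \<otimes>\<^bsub>A\<^esub> y')) (\<gamma> a) \<in> carrier G"
    by (rule sum_closed[OF G b[OF x' y'] X])
  {
    fix x'' assume x'': "x'' \<in> carrier A"
    have "tlift G (\<lambda>(x, y). f (x \<otimes>\<^bsub>A\<^esub> (x' \<oplus>\<^bsub>A\<^esub> x'')) (y \<otimes>\<^bsub>A\<^esub> y')) (\<gamma> a) =
      tlift G (\<lambda>(x, y). f (x \<otimes>\<^bsub>A\<^esub> x') (y \<otimes>\<^bsub>A\<^esub> y') \<otimes>\<^bsub>G\<^esub> f (x \<otimes>\<^bsub>A\<^esub> x'') (y \<otimes>\<^bsub>A\<^esub> y')) (\<gamma> a)"
      by (rule sum_cong[OF G b _ X]) (use x' x'' y' in \<open>simp_all add: A.A.r_distr bal_add_left[OF f]\<close>)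
    then show "tlift G (\<lambda>(x, y). f (x \<otimes>\<^bsub>A\<^esub> (x' \<oplus>\<^bsub>A\<^esub> x'')) (y \<otimes>\<^bsub>A\<^esub> y')) (\<gamma> a) =
      tlift G (\<lambda>(x, y). f (x \<otimes>\<^bsub>A\<^esub> x') (y \<otimes>\<^bsub>A\<^esub> y')) (\<gamma> a) \<otimes>\<^bsub>G\<^esub>
      tlift G (\<lambda>(x, y). f (x \<otimes>\<^bsub>A\<^esub> x'') (y \<otimes>\<^bsub>A\<^esub> y')) (\<gamma> a)"
      by (simp add: sum_mult_target[OF G b[OF x' y'] b[OF x'' y'] X])
  next
    fix y'' assume y'': "y'' \<in> carrier A"
    have "tlift G (\<lambda>(x, y). f (x \<otimes>\<^bsub>A\<^esub> x') (y \<otimes>\<^bsub>A\<^esub> (y' \<oplus>\<^bsub>A\<^esub> y''))) (\<gamma> a) =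
      tlift G (\<lambda>(x, y). f (x \<otimes>\<^bsub>A\<^esub> x') (y \<otimes>\<^bsub>A\<^esub> y') \<otimes>\<^bsub>G\<^esub> f (x \<otimes>\<^bsub>A\<^esub> x') (y \<otimes>\<^bsub>A\<^esub> y'')) (\<gamma> a)"
      by (rule sum_cong[OF G b _ X]) (use x' y'' y' in \<open>simp_all add: A.A.r_distr bal_add_right[OF f]\<close>)
    then show "tlift G (\<lambda>(x, y). f (x \<otimes>\<^bsub>A\<^esub> x') (y \<otimes>\<^bsub>A\<^esub> (y' \<oplus>\<^bsub>A\<^esub> y''))) (\<gamma> a) =
      tlift G (\<lambda>(x, y). f (x \<otimes>\<^bsub>A\<^esub> x') (y \<otimes>\<^bsub>A\<^esub> y')) (\<gamma> a) \<otimes>\<^bsub>G\<^esub>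
      tlift G (\<lambda>(x, y). f (x \<otimes>\<^bsub>A\<^esub> x') (y \<otimes>\<^bsub>A\<^esub> y'')) (\<gamma> a)"
      by (simp add: sum_mult_target[OF G b[OF x' y'] b[OF x' y''] X])
  next
    fix l assume l: "l \<in> carrier L"
    have "tlift G (\<lambda>(x, y). f (x \<otimes>\<^bsub>A\<^esub> (t l \<otimes>\<^bsub>A\<^esub> x')) (y \<otimes>\<^bsub>A\<^esub> y')) (\<gamma> a) =
      tlift G (\<lambda>(x, y). f (x \<otimes>\<^bsub>A\<^esub> t l \<otimes>\<^bsub>A\<^esub> x') (y \<otimes>\<^bsub>A\<^esub> y')) (\<gamma> a)"
      by (rule sum_cong[OF G b _ X]) (use x' y' l in \<open>simp_all add: A.A.m_assoc\<close>)
    also have "\<dots> = tlift G (\<lambda>(x, y). f (x \<otimes>\<^bsub>A\<^esub> x') (y \<otimes>\<^bsub>A\<^esub> s l \<otimes>\<^bsub>A\<^esub> y')) (\<gamma> a)"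
      by (rule sum_takeuchi[OF G b[OF x' y'] a l])
    also have "\<dots> = tlift G (\<lambda>(x, y). f (x \<otimes>\<^bsub>A\<^esub> x') (y \<otimes>\<^bsub>A\<^esub> (s l \<otimes>\<^bsub>A\<^esub> y'))) (\<gamma> a)"
      by (rule sum_cong[OF G b _ X, symmetric]) (use x' y' l in \<open>simp_all add: A.A.m_assoc\<close>)
    finally show "tlift G (\<lambda>(x, y). f (x \<otimes>\<^bsub>A\<^esub> (t l \<otimes>\<^bsub>A\<^esub> x')) (y \<otimes>\<^bsub>A\<^esub> y')) (\<gamma> a) =
      tlift G (\<lambda>(x, y). f (x \<otimes>\<^bsub>A\<^esub> x') (y \<otimes>\<^bsub>A\<^esub> (s l \<otimes>\<^bsub>A\<^esub> y'))) (\<gamma> a)" .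
  }
qed

text \<open>Multiplicativity of the coproduct under the sum sign. The legs of \<open>b\<close> form
  the outer sum, as in \<open>low_tmult\<close>, and \<open>bal_mult\<close> gives that sum a
  meaning.\<close>

lemma sum_mult:
  assumes G: "comm_group G" and f: "bal G f" and a: "a \<in> carrier A" and b: "b \<in> carrier A"
  shows "tlift G (\<lambda>(x, y). f x y) (\<gamma> (a \<otimes>\<^bsub>A\<^esub> b)) =
    tlift G (\<lambda>(x', y'). tlift G (\<lambda>(x, y). f (x \<otimes>\<^bsub>A\<^esub> x') (y \<otimes>\<^bsub>A\<^esub> y')) (\<gamma> a)) (\<gamma> b)"
proof -
  have eq: "tmap L Ar Al (\<lambda>x. x \<otimes>\<^bsub>A\<^esub> x') (\<lambda>y. y \<otimes>\<^bsub>A\<^esub> y') (\<gamma> a) =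
      tlift T (\<lambda>(x, y). pt (x \<otimes>\<^bsub>A\<^esub> x') (y \<otimes>\<^bsub>A\<^esub> y')) (\<gamma> a)" for x' y'
    by (simp add: tmap_def)
  note bm = bal_mult[OF comm_group_T balanced_pt a]
  have "tlift G (\<lambda>(x, y). f x y) (\<gamma> (a \<otimes>\<^bsub>A\<^esub> b)) = tlift G (\<lambda>(x', y').
      tlift G (\<lambda>(x, y). f x y) (tlift T (\<lambda>(x, y). pt (x \<otimes>\<^bsub>A\<^esub> x') (y \<otimes>\<^bsub>A\<^esub> y')) (\<gamma> a))) (\<gamma> b)"
    unfolding comult_mult[OF a b] low_tmult_def eq
    by (rule sum_hom[OF comm_group_T G sum_is_hom[OF G f] bm gamma_closed[OF b]])
  also have "\<dots> = tlift G (\<lambda>(x', y'). tlift G (\<lambda>(x, y). f (x \<otimes>\<^bsub>A\<^esub> x') (y \<otimes>\<^bsub>A\<^esub> y')) (\<gamma> a)) (\<gamma> b)"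
  proof (rule sum_cong[OF G bal_hom[OF sum_is_hom[OF G f] bm] _ gamma_closed[OF b]])
    fix x' y' assume x': "x' \<in> carrier A" and y': "y' \<in> carrier A"
    show "tlift G (\<lambda>(x, y). f x y) (tlift T (\<lambda>(x, y). pt (x \<otimes>\<^bsub>A\<^esub> x') (y \<otimes>\<^bsub>A\<^esub> y')) (\<gamma> a)) =
        tlift G (\<lambda>(x, y). f (x \<otimes>\<^bsub>A\<^esub> x') (y \<otimes>\<^bsub>A\<^esub> y')) (\<gamma> a)"
      unfolding eq[symmetric]
      by (rule sum_tmap[OF pair right_mult_r[OF x'] right_mult_l[OF y'] G f gamma_closed[OF a]])
  qed
  finally show ?thesis .
qed

lemma gamma_s: "l \<in> carrier L \<Longrightarrow> \<gamma> (s l) = pt (s l) \<one>\<^bsub>A\<^esub>"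
  using comult_lact[simplified, of "\<one>\<^bsub>A\<^esub>" l] CC.tmap_pten[simplified, OF pair left_s_r lmod_hom_id, of l "\<one>\<^bsub>A\<^esub>" "\<one>\<^bsub>A\<^esub>"]
  by (simp add: comult_one)

lemma gamma_t: "l \<in> carrier L \<Longrightarrow> \<gamma> (t l) = pt \<one>\<^bsub>A\<^esub> (t l)"
  using comult_ract[simplified, of "\<one>\<^bsub>A\<^esub>" l] CC.tmap_pten[simplified, OF pair rmod_hom_id left_t_l, of l "\<one>\<^bsub>A\<^esub>" "\<one>\<^bsub>A\<^esub>"]
  by (simp add: comult_one)

text \<open>The bimodule axioms speak of left multiplication by s(l); right multiplication is
  reached through multiplicativity and \<gamma>(s(l)) = s(l) \<otimes> 1.\<close>

lemma sum_s_right: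
  assumes G: "comm_group G" and f: "bal G f" and a: "a \<in> carrier A" and l: "l \<in> carrier L"
  shows "tlift G (\<lambda>(x, y). f x y) (\<gamma> (a \<otimes>\<^bsub>A\<^esub> s l)) = tlift G (\<lambda>(x, y). f (x \<otimes>\<^bsub>A\<^esub> s l) y) (\<gamma> a)"
proof -
  have "tlift G (\<lambda>(x, y). f x y) (\<gamma> (a \<otimes>\<^bsub>A\<^esub> s l)) = tlift G (\<lambda>(x, y). f (x \<otimes>\<^bsub>A\<^esub> s l) (y \<otimes>\<^bsub>A\<^esub> \<one>\<^bsub>A\<^esub>)) (\<gamma> a)"
    using l by (subst sum_mult[OF G f a]) (simp_all add: gamma_s sum_pt[OF G bal_mult[OF G f a]])
  also have "\<dots> = tlift G (\<lambda>(x, y). f (x \<otimes>\<^bsub>A\<^esub> s l) y) (\<gamma> a)"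
    by (rule sum_cong[OF G bal_right_mult[OF G f] _ gamma_closed[OF a]]) (use l in simp_all)
  finally show ?thesis .
qed

lemma sum_t_right:
  assumes G: "comm_group G" and f: "bal G f" and a: "a \<in> carrier A" and l: "l \<in> carrier L"
  shows "tlift G (\<lambda>(x, y). f x y) (\<gamma> (a \<otimes>\<^bsub>A\<^esub> t l)) = tlift G (\<lambda>(x, y). f x (y \<otimes>\<^bsub>A\<^esub> t l)) (\<gamma> a)"
proof -
  have "tlift G (\<lambda>(x, y). f x y) (\<gamma> (a \<otimes>\<^bsub>A\<^esub> t l)) = tlift G (\<lambda>(x, y). f (x \<otimes>\<^bsub>A\<^esub> \<one>\<^bsub>A\<^esub>) (y \<otimes>\<^bsub>A\<^esub> t l)) (\<gamma> a)"
    using l by (subst sum_mult[OF G f a]) (simp_all add: gamma_t sum_pt[OF G bal_mult[OF G f a]])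
  also have "\<dots> = tlift G (\<lambda>(x, y). f x (y \<otimes>\<^bsub>A\<^esub> t l)) (\<gamma> a)"
    by (rule sum_cong[OF G bal_right_mult[OF G f] _ gamma_closed[OF a]]) (use l in simp_all)
  finally show ?thesis .
qed

lemma bal_pi_left: "bal (addgrp A) (\<lambda>x y. s (\<pi> x) \<otimes>\<^bsub>A\<^esub> y)"
  by (rule balI) (simp_all add: pi_closed pi_add pi_t s_add s_mult A.A.l_distr A.A.r_distr A.A.m_assoc)

lemma bal_pi_right: "bal (addgrp A) (\<lambda>x y. t (\<pi> y) \<otimes>\<^bsub>A\<^esub> x)"
  by (rule balI) (simp_all add: pi_closed pi_add pi_s t_add t_mult A.A.l_distr A.A.r_distr A.A.m_assoc)

lemma sum_counit_left: "a \<in> carrier A \<Longrightarrow> tlift (addgrp A) (\<lambda>(x, y). s (\<pi> x) \<otimes>\<^bsub>A\<^esub> y) (\<gamma> a) = a"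
  using CC.tlift_target_cong[simplified, OF comm_group_A L.M.comm_group_axioms[simplified] bal_pi_left]
    counital_left[simplified, of a] gamma_closed[of a] by simp

lemma sum_counit_right: "a \<in> carrier A \<Longrightarrow> tlift (addgrp A) (\<lambda>(x, y). t (\<pi> y) \<otimes>\<^bsub>A\<^esub> x) (\<gamma> a) = a"
  using CC.tlift_target_cong[simplified, OF comm_group_A R.M.comm_group_axioms[simplified] bal_pi_right]
    counital_right[simplified, of a] gamma_closed[of a] by simp

end

section \<open>Integrals on Hopf algebroids\<close>

sublocale hopf_algebroid \<subseteq> LB: left_bialgebroid k A L s\<^sub>L t\<^sub>L \<gamma>\<^sub>L \<pi>\<^sub>L
  by (rule left_bialgebroid)

text \<open>Over \<open>op_alg A\<close> the source and target maps change places and left and right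
  multiplications are exchanged, while the coproduct keeps the order of its legs. The facts about
  left bialgebroids thereby serve the right one.\<close>

sublocale hopf_algebroid \<subseteq> RB: left_bialgebroid k "op_alg A" R t\<^sub>R s\<^sub>R \<gamma>\<^sub>R \<pi>\<^sub>R
  using right_bialgebroid by (simp add: right_bialgebroid_def)

context hopf_algebroid
begin

abbreviation mult_A (infixl "\<cdot>" 70)
  where "a \<cdot> b \<equiv> a \<otimes>\<^bsub>A\<^esub> b"

text \<open>These are the Sweedler sums f(a_1, a_2) and f(a^1, a^2) formed in \<open>G\<close>; in
  the comments below, lower indices belong to the left coproduct and upper ones to the right
  coproduct.\<close>

abbreviation "SumL G f a \<equiv> tlift G (\<lambda>(x, y). f x y) (\<gamma>\<^sub>L a)"
abbreviation "SumR G f a \<equiv> tlift G (\<lambda>(x, y). f x y) (\<gamma>\<^sub>R a)"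
abbreviation "TL \<equiv> tensor L (low_r A t\<^sub>L) (low_l A s\<^sub>L)"
abbreviation "TR \<equiv> tensor R (up_r A s\<^sub>R) (up_l A t\<^sub>R)"
abbreviation "ptL \<equiv> pten L (low_r A t\<^sub>L) (low_l A s\<^sub>L)"
abbreviation "ptR \<equiv> pten R (up_r A s\<^sub>R) (up_l A t\<^sub>R)"
abbreviation "balL \<equiv> balanced L (low_r A t\<^sub>L) (low_l A s\<^sub>L)"
abbreviation "balR \<equiv> balanced R (up_r A s\<^sub>R) (up_l A t\<^sub>R)"
abbreviation "gA \<equiv> addgrp A"

lemmas L_simps = LB.pi_closed LB.pi_add LB.pi_s LB.pi_t LB.s_add LB.s_mult LB.s_one LB.t_add LB.t_mult LB.t_one

lemmas R_closed [simp] = RB.s_closed[simplified] RB.t_closed[simplified]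
lemmas R_simps = RB.pi_closed[simplified] RB.pi_add[simplified] RB.pi_s[simplified] RB.pi_t[simplified]
  RB.s_add[simplified] RB.s_mult[simplified] RB.s_one[simplified]
  RB.t_add[simplified] RB.t_mult[simplified] RB.t_one[simplified]

text \<open>The new names refer to \<open>A\<close> rather than to its opposite: left multiplication
  by the source map of \<open>RB\<close> is right multiplication by \<open>t\<^sub>R\<close>, so
  \<open>RB.sum_s_left\<close> becomes \<open>R_sum_t_right\<close>.\<close>

lemmas R_balI = RB.balI[simplified]
  and R_bal_closed = RB.bal_closed[simplified]
  and R_bal_add_left = RB.bal_add_left[simplified]
  and R_bal_add_right = RB.bal_add_right[simplified]
  and R_bal_act = RB.bal_act[simplified]
  and R_pt_closed = RB.pt_closed[simplified]
  and R_pt_add_left = RB.pt_add_left[simplified]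
  and R_pt_add_right = RB.pt_add_right[simplified]
  and R_pt_act = RB.pt_act[simplified]
  and R_pair = RB.pair[simplified]
  and R_comm_group_T = RB.comm_group_T[simplified]
  and R_balanced_pt = RB.balanced_pt[simplified]
  and R_gamma_closed = RB.gamma_closed[simplified]
  and R_gamma_hom = RB.gamma_hom[simplified]
  and R_sum_closed = RB.sum_closed[simplified]
  and R_sum_cong = RB.sum_cong[simplified]
  and R_sum_hom = RB.sum_hom[simplified]
  and R_bal_hom = RB.bal_hom[simplified]
  and R_sum_pt = RB.sum_pt[simplified]
  and R_sum_ext = RB.sum_ext[simplified]
  and R_sum_coassoc = RB.sum_coassoc[simplified]
  and R_sum_Fubini = RB.sum_Fubini[simplified]
  and R_sum_mult_target = RB.sum_mult_target[simplified]
  and R_sum_is_hom = RB.sum_is_hom[simplified]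
  and R_sum_add_arg = RB.sum_add_arg[simplified]
  and R_bal_mult = RB.bal_mult[simplified]
  and R_sum_mult = RB.sum_mult[simplified]
  and R_sum_takeuchi = RB.sum_takeuchi[simplified]
  and R_sum_t_right = RB.sum_s_left[simplified]
  and R_sum_t_left = RB.sum_s_right[simplified]
  and R_sum_s_left = RB.sum_t_right[simplified]
  and R_sum_counit_left = RB.sum_counit_left[simplified]
  and R_sum_counit_right = RB.sum_counit_right[simplified]

lemma tlift_pt_gamma:
  assumes "a \<in> carrier A"
  shows "SumL TL ptL a = \<gamma>\<^sub>L a" "SumR TR ptR a = \<gamma>\<^sub>R a"
  using LB.CC.tlift_pten_id[simplified, OF LB.gamma_closed] RB.CC.tlift_pten_id[simplified, OF R_gamma_closed] assms
  by auto

lemma base_closed [simp]: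
  "r \<in> carrier R \<Longrightarrow> \<pi>\<^sub>L (s\<^sub>R r) \<in> carrier L" "r \<in> carrier R \<Longrightarrow> \<pi>\<^sub>L (t\<^sub>R r) \<in> carrier L"
  "l \<in> carrier L \<Longrightarrow> \<pi>\<^sub>R (s\<^sub>L l) \<in> carrier R" "l \<in> carrier L \<Longrightarrow> \<pi>\<^sub>R (t\<^sub>L l) \<in> carrier R"
  by (simp_all add: LB.pi_closed R_simps)

text \<open>The axioms such as \<open>tL_piL_sR\<close> place the values of each structure map of
  one bialgebroid in the range of a structure map of the other. Hence each coproduct is linear for
  the other base algebra as well, which is what gives the maps in the mixed coassociativity laws a
  meaning on tensors.\<close>

lemma gamma_actions:
  assumes a: "a \<in> carrier A"
  shows "r \<in> carrier R \<Longrightarrow> \<gamma>\<^sub>L (a \<cdot> s\<^sub>R r) =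
      tmap L (low_r A t\<^sub>L) (low_l A s\<^sub>L) (\<lambda>x. x) (\<lambda>y. y \<cdot> s\<^sub>R r) (\<gamma>\<^sub>L a)"
    and "l \<in> carrier L \<Longrightarrow> \<gamma>\<^sub>R (s\<^sub>L l \<cdot> a) =
      tmap R (up_r A s\<^sub>R) (up_l A t\<^sub>R) (\<lambda>x. s\<^sub>L l \<cdot> x) (\<lambda>y. y) (\<gamma>\<^sub>R a)"
    and "l \<in> carrier L \<Longrightarrow> \<gamma>\<^sub>R (t\<^sub>L l \<cdot> a) =
      tmap R (up_r A s\<^sub>R) (up_l A t\<^sub>R) (\<lambda>x. x) (\<lambda>y. t\<^sub>L l \<cdot> y) (\<gamma>\<^sub>R a)"
    and "r \<in> carrier R \<Longrightarrow> \<gamma>\<^sub>L (a \<cdot> t\<^sub>R r) =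
      tmap L (low_r A t\<^sub>L) (low_l A s\<^sub>L) (\<lambda>x. x \<cdot> t\<^sub>R r) (\<lambda>y. y) (\<gamma>\<^sub>L a)"
proof -
  show "\<gamma>\<^sub>L (a \<cdot> s\<^sub>R r) = tmap L (low_r A t\<^sub>L) (low_l A s\<^sub>L) (\<lambda>x. x) (\<lambda>y. y \<cdot> s\<^sub>R r) (\<gamma>\<^sub>L a)"
    if "r \<in> carrier R"
    using that a tlift_pt_gamma(1)[of "a \<cdot> s\<^sub>R r"]
      LB.sum_t_right[OF LB.comm_group_T LB.balanced_pt a, of "\<pi>\<^sub>L (s\<^sub>R r)"]
    by (simp add: tmap_def tL_piL_sR)
  show "\<gamma>\<^sub>R (s\<^sub>L l \<cdot> a) = tmap R (up_r A s\<^sub>R) (up_l A t\<^sub>R) (\<lambda>x. s\<^sub>L l \<cdot> x) (\<lambda>y. y) (\<gamma>\<^sub>R a)"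
    if "l \<in> carrier L"
    using that a tlift_pt_gamma(2)[of "s\<^sub>L l \<cdot> a"]
      R_sum_t_left[OF R_comm_group_T R_balanced_pt a, of "\<pi>\<^sub>R (s\<^sub>L l)"]
    by (simp add: tmap_def tR_piR_sL)
  show "\<gamma>\<^sub>R (t\<^sub>L l \<cdot> a) = tmap R (up_r A s\<^sub>R) (up_l A t\<^sub>R) (\<lambda>x. x) (\<lambda>y. t\<^sub>L l \<cdot> y) (\<gamma>\<^sub>R a)"
    if "l \<in> carrier L"
    using that a tlift_pt_gamma(2)[of "t\<^sub>L l \<cdot> a"]
      R_sum_s_left[OF R_comm_group_T R_balanced_pt a, of "\<pi>\<^sub>R (t\<^sub>L l)"]
    by (simp add: tmap_def sR_piR_tL)
  show "\<gamma>\<^sub>L (a \<cdot> t\<^sub>R r) = tmap L (low_r A t\<^sub>L) (low_l A s\<^sub>L) (\<lambda>x. x \<cdot> t\<^sub>R r) (\<lambda>y. y) (\<gamma>\<^sub>L a)"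
    if "r \<in> carrier R"
    using that a tlift_pt_gamma(1)[of "a \<cdot> t\<^sub>R r"]
      LB.sum_s_right[OF LB.comm_group_T LB.balanced_pt a, of "\<pi>\<^sub>L (t\<^sub>R r)"]
    by (simp add: tmap_def sL_piL_tR)
qed

lemma R_modules: "right_module R (up_r A s\<^sub>R)" "left_module R (up_l A t\<^sub>R)"
  and L_modules: "right_module L (low_r A t\<^sub>L)" "left_module L (low_l A s\<^sub>L)"
  using RB.R.right_module_axioms RB.L.left_module_axioms LB.R.right_module_axioms LB.L.left_module_axioms
  by simp_all

end

sublocale hopf_algebroid \<subseteq> LR: tensor_triple L "low_r A t\<^sub>L" "low_l A s\<^sub>L" R "up_r A s\<^sub>R" "up_l A t\<^sub>R"
  by (intro tensor_triple.intro tensor_triple_axioms.intro LB.pair R_pair) (simp_all add: LB.A.A.m_assoc)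

sublocale hopf_algebroid \<subseteq> RL: tensor_triple R "up_r A s\<^sub>R" "up_l A t\<^sub>R" L "low_r A t\<^sub>L" "low_l A s\<^sub>L"
  by (intro tensor_triple.intro tensor_triple_axioms.intro LB.pair R_pair) (simp_all add: LB.A.A.m_assoc)

context hopf_algebroid
begin

abbreviation "bal_LR \<equiv> balanced3 L (low_r A t\<^sub>L) (low_l A s\<^sub>L) R (up_r A s\<^sub>R) (up_l A t\<^sub>R)"
abbreviation "bal_RL \<equiv> balanced3 R (up_r A s\<^sub>R) (up_l A t\<^sub>R) L (low_r A t\<^sub>L) (low_l A s\<^sub>L)"

lemmas bal_LR_I = LR.balanced3I[simplified] and bal_RL_I = RL.balanced3I[simplified]

context
  fixes G :: "('g, 'v) monoid_scheme" and h :: "'a \<Rightarrow> 'a \<Rightarrow> 'a \<Rightarrow> 'g"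
  assumes G: "comm_group G"
begin

lemma bal_SumL_LR: "bal_LR G h \<Longrightarrow> balR G (\<lambda>q p. SumL G (\<lambda>m n. h m n p) q)"
  using LR.balanced_nest_left[OF R_modules(1), of \<gamma>\<^sub>L, OF _ _ G] LB.gamma_hom gamma_actions(1)
  by (simp add: hom_def)

lemma bal_SumR_LR: "bal_LR G h \<Longrightarrow> balL G (\<lambda>m q. SumR G (\<lambda>n p. h m n p) q)"
  using LR.balanced_nest_right[OF L_modules(2), of \<gamma>\<^sub>R, OF _ _ G] R_gamma_hom gamma_actions(2)
  by (simp add: hom_def)

lemma bal_SumR_RL: "bal_RL G h \<Longrightarrow> balL G (\<lambda>q p. SumR G (\<lambda>m n. h m n p) q)"
  using RL.balanced_nest_left[OF L_modules(1), of \<gamma>\<^sub>R, OF _ _ G] R_gamma_hom gamma_actions(3)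
  by (simp add: hom_def)

lemma bal_SumL_RL: "bal_RL G h \<Longrightarrow> balR G (\<lambda>m q. SumL G (\<lambda>n p. h m n p) q)"
  using RL.balanced_nest_right[OF R_modules(2), of \<gamma>\<^sub>L, OF _ _ G] LB.gamma_hom gamma_actions(4)
  by (simp add: hom_def)

text \<open>The lift of \<open>h\<close> is applied to both sides of \<open>coassoc_LR\<close>;
  \<open>gamma_actions\<close> supplies the linearity that \<open>ten_left\<close> and
  \<open>ten_right\<close> demand.\<close>

lemma SumL_SumR_LR:
  assumes h: "bal_LR G h" and a: "a \<in> carrier A"
  shows "SumR G (\<lambda>q p. SumL G (\<lambda>m n. h m n p) q) a = SumL G (\<lambda>m q. SumR G (\<lambda>n p. h m n p) q) a"
  using LR.tlift3_ten_left[OF R_modules(1), of \<gamma>\<^sub>L, OF _ _ G h R_gamma_closed[OF a]]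
    LR.tlift3_ten_right[OF L_modules(2), of \<gamma>\<^sub>R, OF _ _ G h LB.gamma_closed[OF a]]
    LB.gamma_hom R_gamma_hom gamma_actions(1,2) coassoc_LR[OF a]
  by (simp add: hom_def)

lemma SumR_SumL_RL:
  assumes h: "bal_RL G h" and a: "a \<in> carrier A"
  shows "SumL G (\<lambda>q p. SumR G (\<lambda>m n. h m n p) q) a = SumR G (\<lambda>m q. SumL G (\<lambda>n p. h m n p) q) a"
  using RL.tlift3_ten_left[OF L_modules(1), of \<gamma>\<^sub>R, OF _ _ G h LB.gamma_closed[OF a]]
    RL.tlift3_ten_right[OF R_modules(2), of \<gamma>\<^sub>L, OF _ _ G h R_gamma_closed[OF a]]
    LB.gamma_hom R_gamma_hom gamma_actions(3,4) coassoc_RL[OF a]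
  by (simp add: hom_def)

end

lemma left_mult_hom: "c \<in> carrier A \<Longrightarrow> (\<lambda>x. c \<cdot> x) \<in> hom gA gA"
  and right_mult_hom: "c \<in> carrier A \<Longrightarrow> (\<lambda>x. x \<cdot> c) \<in> hom gA gA"
  by (auto simp: hom_def LB.A.A.l_distr LB.A.A.r_distr)

text \<open>Linearity of the counit in the shape of right-nested products, which is what
  \<open>m_assoc\<close> leaves behind in the simplifier.\<close>

lemma piR_assoc: "x \<in> carrier A \<Longrightarrow> y \<in> carrier A \<Longrightarrow> r \<in> carrier R \<Longrightarrow>
    \<pi>\<^sub>R (x \<cdot> (y \<cdot> t\<^sub>R r)) = r \<otimes>\<^bsub>R\<^esub> \<pi>\<^sub>R (x \<cdot> y)"
  using R_simps(3)[of "x \<cdot> y" r] by (simp add: LB.A.A.m_assoc)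

text \<open>With \<open>\<rho> = \<pi>\<^sub>L s\<^sub>R \<phi>\<close>, \<open>tL_piL_sR\<close>
  gives \<open>t\<^sub>L \<rho> = s\<^sub>R \<phi>\<close>. In
  \<open>s\<^sub>L(\<rho>(a_1)) a_2\<close> the integral equation of \<phi> is inserted for
  \<rho>(a_1), mixed coassociativity moves the right coproduct outside, the counit of the left
  coproduct absorbs \<open>s\<^sub>L \<pi>\<^sub>L\<close>, and what remains is the integral
  equation of \<phi> at a.\<close>

lemma left_s_integral_imp_right_t_integral:
  assumes \<phi>: "\<phi> \<in> left_s_integrals A R s\<^sub>R t\<^sub>R \<gamma>\<^sub>R" and one: "\<phi> \<one>\<^bsub>A\<^esub> = \<one>\<^bsub>R\<^esub>"
  obtains \<rho> where "\<rho> \<in> right_t_integrals A L s\<^sub>L t\<^sub>L \<gamma>\<^sub>L" "\<rho> \<one>\<^bsub>A\<^esub> = \<one>\<^bsub>L\<^esub>"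
proof -
  have hom: "\<phi> \<in> rmod_hom R (up_r A s\<^sub>R) (rreg R)"
    and int: "\<And>a. a \<in> carrier A \<Longrightarrow> SumR gA (\<lambda>x y. y \<cdot> t\<^sub>R (\<phi> x)) a = s\<^sub>R (\<phi> a)"
    using \<phi> by (auto simp: left_s_integrals_def)
  note phi = rmod_hom_closed[OF hom, simplified] rmod_hom_add[OF hom, simplified] rmod_hom_act[OF hom, simplified]
  note G = LB.comm_group_A
  define \<rho> where "\<rho> a = \<pi>\<^sub>L (s\<^sub>R (\<phi> a))" for a
  have t_rho: "t\<^sub>L (\<rho> a) = s\<^sub>R (\<phi> a)" if "a \<in> carrier A" for a
    using that by (simp add: \<rho>_def tL_piL_sR phi)
  have rho_closed: "\<rho> a \<in> carrier L" if "a \<in> carrier A" for a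
    using that by (simp add: \<rho>_def phi)
  have b: "balR gA (\<lambda>x y. y \<cdot> t\<^sub>R (\<phi> x))"
    by (rule R_balI) (simp_all add: phi R_simps LB.A.A.r_distr LB.A.A.l_distr LB.A.A.m_assoc)
  \<comment> \<open>Membership in the dual gives linearity for right multiplication by
    \<open>s\<^sub>R\<close>. Linearity for left multiplication is forced by the integral equation,
    since \<open>s\<^sub>R(r) a\<close> has right coproduct
    \<open>a^1 \<otimes> s\<^sub>R(r) a^2\<close>; it becomes the \<open>L\<close>-linearity of
    \<rho>.\<close>
  have left: "s\<^sub>R (\<phi> (s\<^sub>R r \<cdot> a)) = s\<^sub>R r \<cdot> s\<^sub>R (\<phi> a)" if a: "a \<in> carrier A" and r: "r \<in> carrier R" for r a
  proof -
    have "s\<^sub>R (\<phi> (s\<^sub>R r \<cdot> a)) = SumR gA (\<lambda>x y. s\<^sub>R r \<cdot> y \<cdot> t\<^sub>R (\<phi> x)) a"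
      using R_sum_s_left[OF G b a r] int[of "s\<^sub>R r \<cdot> a"] a r by simp
    also have "\<dots> = SumR gA (\<lambda>x y. s\<^sub>R r \<cdot> (y \<cdot> t\<^sub>R (\<phi> x))) a"
      by (rule R_sum_cong[OF G R_bal_hom[OF left_mult_hom b] _ R_gamma_closed[OF a], symmetric])
        (use r in \<open>simp_all add: phi LB.A.A.m_assoc\<close>)
    also have "\<dots> = s\<^sub>R r \<cdot> s\<^sub>R (\<phi> a)"
      using R_sum_hom[OF G G left_mult_hom b R_gamma_closed[OF a], of "s\<^sub>R r"] int[OF a] r by simp
    finally show ?thesis .
  qed
  have rho_t: "\<rho> (t\<^sub>L l \<cdot> a) = \<rho> a \<otimes>\<^bsub>L\<^esub> l" if a: "a \<in> carrier A" and l: "l \<in> carrier L" for l a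
  proof -
    have "s\<^sub>R (\<phi> (t\<^sub>L l \<cdot> a)) = t\<^sub>L l \<cdot> s\<^sub>R (\<phi> a)"
      using left[OF a, of "\<pi>\<^sub>R (t\<^sub>L l)"] l by (simp add: sR_piR_tL)
    then show ?thesis using a l by (simp add: \<rho>_def LB.pi_t phi)
  qed
  have h: "bal_RL gA (\<lambda>m n p. s\<^sub>L (\<pi>\<^sub>L (n \<cdot> t\<^sub>R (\<phi> m))) \<cdot> p)"
    by (rule bal_RL_I) (simp_all add: phi R_simps L_simps LB.A.A.r_distr LB.A.A.l_distr LB.A.A.m_assoc)
  have "SumL gA (\<lambda>x y. s\<^sub>L (\<rho> x) \<cdot> y) a = t\<^sub>L (\<rho> a)" if a: "a \<in> carrier A" for a
  proof -
    have "SumL gA (\<lambda>x y. s\<^sub>L (\<rho> x) \<cdot> y) a =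
        SumL gA (\<lambda>q p. SumR gA (\<lambda>m n. s\<^sub>L (\<pi>\<^sub>L (n \<cdot> t\<^sub>R (\<phi> m))) \<cdot> p) q) a"
    proof (rule LB.sum_cong[OF G bal_SumR_RL[OF G h] _ LB.gamma_closed[OF a], symmetric])
      fix q p assume q: "q \<in> carrier A" and p: "p \<in> carrier A"
      have "(\<lambda>c. s\<^sub>L (\<pi>\<^sub>L c) \<cdot> p) \<in> hom gA gA"
        using p by (auto simp: hom_def L_simps LB.A.A.l_distr)
      then show "SumR gA (\<lambda>m n. s\<^sub>L (\<pi>\<^sub>L (n \<cdot> t\<^sub>R (\<phi> m))) \<cdot> p) q = s\<^sub>L (\<rho> q) \<cdot> p"
        using R_sum_hom[OF G G _ b R_gamma_closed[OF q], of "\<lambda>c. s\<^sub>L (\<pi>\<^sub>L c) \<cdot> p"] int[OF q]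
        by (simp add: \<rho>_def)
    qed
    also have "\<dots> = SumR gA (\<lambda>m q. SumL gA (\<lambda>n p. s\<^sub>L (\<pi>\<^sub>L (n \<cdot> t\<^sub>R (\<phi> m))) \<cdot> p) q) a"
      by (rule SumR_SumL_RL[OF G h a])
    also have "\<dots> = SumR gA (\<lambda>m q. q \<cdot> t\<^sub>R (\<phi> m)) a"
    proof (rule R_sum_cong[OF G bal_SumL_RL[OF G h] _ R_gamma_closed[OF a]])
      fix m q assume m: "m \<in> carrier A" and q: "q \<in> carrier A"
      \<comment> \<open>Written as a value of \<open>s\<^sub>L\<close>, the factor
        \<open>t\<^sub>R(\<phi>(m))\<close> acts on the first leg of the left coproduct, so the
        counit axiom applies to the product of \<open>q\<close> with it.\<close>
      have tR: "t\<^sub>R (\<phi> m) = s\<^sub>L (\<pi>\<^sub>L (t\<^sub>R (\<phi> m)))" and l: "\<pi>\<^sub>L (t\<^sub>R (\<phi> m)) \<in> carrier L"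
        using m by (simp_all add: sL_piL_tR phi)
      show "SumL gA (\<lambda>n p. s\<^sub>L (\<pi>\<^sub>L (n \<cdot> t\<^sub>R (\<phi> m))) \<cdot> p) q = q \<cdot> t\<^sub>R (\<phi> m)"
        using LB.sum_s_right[OF G LB.bal_pi_left q l] LB.sum_counit_left[of "q \<cdot> t\<^sub>R (\<phi> m)"] m q
        by (simp add: tR[symmetric] phi)
    qed
    also have "\<dots> = t\<^sub>L (\<rho> a)" using int[OF a] t_rho[OF a] by simp
    finally show ?thesis .
  qed
  then have "\<rho> \<in> right_t_integrals A L s\<^sub>L t\<^sub>L \<gamma>\<^sub>L"
    by (auto simp: right_t_integrals_def rmod_hom_def hom_def rho_closed rho_t)
      (simp add: \<rho>_def phi R_simps L_simps)
  moreover have "\<rho> \<one>\<^bsub>A\<^esub> = \<one>\<^bsub>L\<^esub>" by (simp add: \<rho>_def one R_simps LB.counit_one)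
  ultimately show ?thesis by (rule that)
qed

text \<open>Mirror argument with \<open>\<phi> = \<pi>\<^sub>R s\<^sub>L \<rho>\<close>, hence
  \<open>t\<^sub>R \<phi> = s\<^sub>L \<rho>\<close>: the integral equation of \<rho> is inserted
  for \<phi>(a^2), and the counit of the right coproduct absorbs
  \<open>s\<^sub>R \<pi>\<^sub>R\<close>.\<close>

lemma right_s_integral_imp_left_t_integral:
  assumes \<rho>: "\<rho> \<in> right_s_integrals A L s\<^sub>L t\<^sub>L \<gamma>\<^sub>L" and one: "\<rho> \<one>\<^bsub>A\<^esub> = \<one>\<^bsub>L\<^esub>"
  obtains \<phi> where "\<phi> \<in> left_t_integrals A R s\<^sub>R t\<^sub>R \<gamma>\<^sub>R" "\<phi> \<one>\<^bsub>A\<^esub> = \<one>\<^bsub>R\<^esub>"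
proof -
  have hom: "\<rho> \<in> lmod_hom L (low_l A s\<^sub>L) (lreg L)"
    and int: "\<And>a. a \<in> carrier A \<Longrightarrow> SumL gA (\<lambda>x y. t\<^sub>L (\<rho> y) \<cdot> x) a = s\<^sub>L (\<rho> a)"
    using \<rho> by (auto simp: right_s_integrals_def)
  note rho = lmod_hom_closed[OF hom, simplified] lmod_hom_add[OF hom, simplified] lmod_hom_act[OF hom, simplified]
  note G = LB.comm_group_A
  define \<phi> where "\<phi> a = \<pi>\<^sub>R (s\<^sub>L (\<rho> a))" for a
  have t_phi: "t\<^sub>R (\<phi> a) = s\<^sub>L (\<rho> a)" if "a \<in> carrier A" for a
    using that by (simp add: \<phi>_def tR_piR_sL rho)
  have phi_closed: "\<phi> a \<in> carrier R" if "a \<in> carrier A" for a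
    using that by (simp add: \<phi>_def rho)
  have b: "balL gA (\<lambda>x y. t\<^sub>L (\<rho> y) \<cdot> x)"
    by (rule LB.balI) (simp_all add: rho L_simps LB.A.A.r_distr LB.A.A.l_distr LB.A.A.m_assoc)
  have right: "s\<^sub>L (\<rho> (a \<cdot> s\<^sub>L l)) = s\<^sub>L (\<rho> a) \<cdot> s\<^sub>L l" if a: "a \<in> carrier A" and l: "l \<in> carrier L" for l a
  proof -
    have "s\<^sub>L (\<rho> (a \<cdot> s\<^sub>L l)) = SumL gA (\<lambda>x y. t\<^sub>L (\<rho> y) \<cdot> (x \<cdot> s\<^sub>L l)) a"
      using LB.sum_s_right[OF G b a l] int[of "a \<cdot> s\<^sub>L l"] a l by simp
    also have "\<dots> = SumL gA (\<lambda>x y. t\<^sub>L (\<rho> y) \<cdot> x \<cdot> s\<^sub>L l) a"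
      by (rule LB.sum_cong[OF G LB.bal_hom[OF right_mult_hom b] _ LB.gamma_closed[OF a], symmetric])
        (use l in \<open>simp_all add: rho LB.A.A.m_assoc\<close>)
    also have "\<dots> = s\<^sub>L (\<rho> a) \<cdot> s\<^sub>L l"
      using LB.sum_hom[OF G G right_mult_hom b LB.gamma_closed[OF a], of "s\<^sub>L l"] int[OF a] l by simp
    finally show ?thesis .
  qed
  have phi_t: "\<phi> (a \<cdot> t\<^sub>R r) = r \<otimes>\<^bsub>R\<^esub> \<phi> a" if a: "a \<in> carrier A" and r: "r \<in> carrier R" for r a
  proof -
    have "s\<^sub>L (\<rho> (a \<cdot> t\<^sub>R r)) = s\<^sub>L (\<rho> a) \<cdot> t\<^sub>R r"
      using right[OF a, of "\<pi>\<^sub>L (t\<^sub>R r)"] r by (simp add: sL_piL_tR)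
    then show ?thesis using a r by (simp add: \<phi>_def R_simps rho)
  qed
  have h: "bal_RL gA (\<lambda>m n p. m \<cdot> s\<^sub>R (\<pi>\<^sub>R (t\<^sub>L (\<rho> p) \<cdot> n)))"
    by (rule bal_RL_I) (simp_all add: rho R_simps piR_assoc L_simps LB.A.A.r_distr LB.A.A.l_distr LB.A.A.m_assoc)
  have "SumR gA (\<lambda>x y. x \<cdot> s\<^sub>R (\<phi> y)) a = t\<^sub>R (\<phi> a)" if a: "a \<in> carrier A" for a
  proof -
    have "SumR gA (\<lambda>x y. x \<cdot> s\<^sub>R (\<phi> y)) a =
        SumR gA (\<lambda>m q. SumL gA (\<lambda>n p. m \<cdot> s\<^sub>R (\<pi>\<^sub>R (t\<^sub>L (\<rho> p) \<cdot> n))) q) a"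
    proof (rule R_sum_cong[OF G bal_SumL_RL[OF G h] _ R_gamma_closed[OF a], symmetric])
      fix m q assume q: "q \<in> carrier A" and m: "m \<in> carrier A"
      have "(\<lambda>c. m \<cdot> s\<^sub>R (\<pi>\<^sub>R c)) \<in> hom gA gA"
        using m by (auto simp: hom_def R_simps LB.A.A.r_distr)
      then show "SumL gA (\<lambda>n p. m \<cdot> s\<^sub>R (\<pi>\<^sub>R (t\<^sub>L (\<rho> p) \<cdot> n))) q = m \<cdot> s\<^sub>R (\<phi> q)"
        using LB.sum_hom[OF G G _ b LB.gamma_closed[OF q], of "\<lambda>c. m \<cdot> s\<^sub>R (\<pi>\<^sub>R c)"] int[OF q]
        by (simp add: \<phi>_def)
    qed
    also have "\<dots> = SumL gA (\<lambda>q p. SumR gA (\<lambda>m n. m \<cdot> s\<^sub>R (\<pi>\<^sub>R (t\<^sub>L (\<rho> p) \<cdot> n))) q) a"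
      by (rule SumR_SumL_RL[OF G h a, symmetric])
    also have "\<dots> = SumL gA (\<lambda>q p. t\<^sub>L (\<rho> p) \<cdot> q) a"
    proof (rule LB.sum_cong[OF G bal_SumR_RL[OF G h] _ LB.gamma_closed[OF a]])
      fix p q assume p: "p \<in> carrier A" and q: "q \<in> carrier A"
      have tL: "t\<^sub>L (\<rho> p) = s\<^sub>R (\<pi>\<^sub>R (t\<^sub>L (\<rho> p)))" and l: "\<pi>\<^sub>R (t\<^sub>L (\<rho> p)) \<in> carrier R"
        using p by (simp_all add: sR_piR_tL rho)
      show "SumR gA (\<lambda>m n. m \<cdot> s\<^sub>R (\<pi>\<^sub>R (t\<^sub>L (\<rho> p) \<cdot> n))) q = t\<^sub>L (\<rho> p) \<cdot> q"
        using R_sum_s_left[OF G RB.bal_pi_right[simplified] q l] R_sum_counit_right[of "t\<^sub>L (\<rho> p) \<cdot> q"] p q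
        by (simp add: tL[symmetric] rho)
    qed
    also have "\<dots> = t\<^sub>R (\<phi> a)" using int[OF a] t_phi[OF a] by simp
    finally show ?thesis .
  qed
  then have "\<phi> \<in> left_t_integrals A R s\<^sub>R t\<^sub>R \<gamma>\<^sub>R"
    by (auto simp: left_t_integrals_def lmod_hom_def hom_def phi_closed phi_t)
      (simp add: \<phi>_def rho R_simps L_simps)
  moreover have "\<phi> \<one>\<^bsub>A\<^esub> = \<one>\<^bsub>R\<^esub>" by (simp add: \<phi>_def one L_simps RB.counit_one[simplified])
  ultimately show ?thesis by (rule that)
qed

end

section \<open>The antipode and the canonical (Galois) map of the left bialgebroid\<close>

context hopf_algebroid
begin

lemma
  shows S_closed [simp]: "a \<in> carrier A \<Longrightarrow> S a \<in> carrier A"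
    and S_add: "a \<in> carrier A \<Longrightarrow> b \<in> carrier A \<Longrightarrow> S (a \<oplus>\<^bsub>A\<^esub> b) = S a \<oplus>\<^bsub>A\<^esub> S b"
  using antipode_hom by (auto simp: hom_def)

lemma
  assumes a: "a \<in> carrier A"
  shows S_tL_left: "l \<in> carrier L \<Longrightarrow> S (t\<^sub>L l \<cdot> a) = S a \<cdot> s\<^sub>L l"
    and S_tL_right: "l \<in> carrier L \<Longrightarrow> S (a \<cdot> t\<^sub>L l) = s\<^sub>L l \<cdot> S a"
    and S_tR_left: "r \<in> carrier R \<Longrightarrow> S (t\<^sub>R r \<cdot> a) = S a \<cdot> s\<^sub>R r"
    and S_tR_right: "r \<in> carrier R \<Longrightarrow> S (a \<cdot> t\<^sub>R r) = s\<^sub>R r \<cdot> S a"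
  using a antipode_L[of a "\<one>\<^bsub>L\<^esub>" l] antipode_L[of a l "\<one>\<^bsub>L\<^esub>"] antipode_R[of a "\<one>\<^bsub>R\<^esub>" r] antipode_R[of a r "\<one>\<^bsub>R\<^esub>"]
  by (simp_all add: L_simps R_simps)

lemmas S_simps = S_add S_tL_left S_tL_right S_tR_left S_tR_right
lemmas A_simps = LB.A.A.l_distr LB.A.A.r_distr LB.A.A.m_assoc

lemma SumL_antipode: "a \<in> carrier A \<Longrightarrow> SumL gA (\<lambda>x y. S x \<cdot> y) a = s\<^sub>R (\<pi>\<^sub>R a)"
  by (rule antipode_left_inv)

lemma SumR_antipode: "a \<in> carrier A \<Longrightarrow> SumR gA (\<lambda>x y. x \<cdot> S y) a = s\<^sub>L (\<pi>\<^sub>L a)"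
  by (rule antipode_right_inv)

lemma bal_antipode_L: "balL gA (\<lambda>x y. S x \<cdot> y)"
  by (rule LB.balI) (simp_all add: S_simps A_simps)

lemma bal_antipode_R: "balR gA (\<lambda>x y. x \<cdot> S y)"
  by (rule R_balI) (simp_all add: S_simps A_simps)

text \<open>
  The map \<open>u \<otimes> v \<mapsto> u\<^sub>1 \<otimes> u\<^sub>2v\<close> is surjective onto \<open>A\<^sub>L \<otimes> \<^sub>LA\<close>, since the antipode gives the
  preimage \<open>a\<^sup>1 \<otimes> S(a\<^sup>2)b\<close> of \<open>a \<otimes> b\<close>. Additive maps are therefore determined by their values on
  its image, where the antipode no longer occurs.
\<close>

definition galL :: "'a \<Rightarrow> 'a \<Rightarrow> ('a \<times> 'a \<Rightarrow>\<^sub>0 int) set"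
  where "galL u v = SumL TL (\<lambda>x y. ptL x (y \<cdot> v)) u"

lemma balL_pt_mult: "v \<in> carrier A \<Longrightarrow> balL TL (\<lambda>x y. ptL x (y \<cdot> v))"
  by (rule LB.bal_compose[OF rmod_hom_id LB.right_mult_l LB.balanced_pt])

lemma bal_LR_galL: "b \<in> carrier A \<Longrightarrow> bal_LR TL (\<lambda>x y w. ptL x (y \<cdot> (S w \<cdot> b)))"
  by (rule bal_LR_I) (simp_all add: LB.pt_closed LB.pt_add_left LB.pt_add_right LB.pt_act S_simps A_simps)

text \<open>Mixed coassociativity turns (a^1)_1 \<otimes> (a^1)_2 S(a^2) b into a_1 \<otimes>
  (a_2)^1 S((a_2)^2) b. The antipode axiom makes this
  \<open>a_1 \<otimes> s\<^sub>L(\<pi>\<^sub>L(a_2)) b\<close>, and after moving the scalar to the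
  left the counit gives a \<otimes> b.\<close>

lemma pt_eq_sum_galL:
  assumes a: "a \<in> carrier A" and b: "b \<in> carrier A"
  shows "SumR TL (\<lambda>u w. galL u (S w \<cdot> b)) a = ptL a b"
    and "balR TL (\<lambda>u w. galL u (S w \<cdot> b))"
proof -
  note T = LB.comm_group_T and G = LB.comm_group_A
  note h = bal_LR_galL[OF b]
  show "balR TL (\<lambda>u w. galL u (S w \<cdot> b))"
    unfolding galL_def by (rule bal_SumL_LR[OF T h])
  have "SumR TL (\<lambda>u w. galL u (S w \<cdot> b)) a =
      SumL TL (\<lambda>x q. SumR TL (\<lambda>y w. ptL x (y \<cdot> (S w \<cdot> b))) q) a"
    unfolding galL_def by (rule SumL_SumR_LR[OF T h a])
  also have "\<dots> = SumL TL (\<lambda>x q. ptL (t\<^sub>L (\<pi>\<^sub>L q) \<cdot> x) b) a"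
  proof (rule LB.sum_cong[OF T bal_SumR_LR[OF T h] _ LB.gamma_closed[OF a]])
    fix x q assume x: "x \<in> carrier A" and q: "q \<in> carrier A"
    have m: "(\<lambda>c. ptL x (c \<cdot> b)) \<in> hom gA TL"
      using x b by (auto simp: hom_def LB.pt_closed LB.pt_add_right A_simps)
    have "SumR TL (\<lambda>y w. ptL x (y \<cdot> (S w \<cdot> b))) q = SumR TL (\<lambda>y w. ptL x (y \<cdot> S w \<cdot> b)) q"
      by (rule R_sum_cong[OF T R_bal_hom[OF m bal_antipode_R] _ R_gamma_closed[OF q], symmetric])
        (use b in \<open>simp add: A_simps\<close>)
    also have "\<dots> = ptL x (s\<^sub>L (\<pi>\<^sub>L q) \<cdot> b)"
      using R_sum_hom[OF G T m bal_antipode_R R_gamma_closed[OF q]] by (simp add: SumR_antipode q)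
    also have "\<dots> = ptL (t\<^sub>L (\<pi>\<^sub>L q) \<cdot> x) b"
      using x b q by (simp add: LB.pt_act LB.pi_closed)
    finally show "SumR TL (\<lambda>y w. ptL x (y \<cdot> (S w \<cdot> b))) q = ptL (t\<^sub>L (\<pi>\<^sub>L q) \<cdot> x) b" .
  qed
  also have "\<dots> = ptL a b"
  proof -
    have m: "(\<lambda>c. ptL c b) \<in> hom gA TL"
      using b by (auto simp: hom_def LB.pt_closed LB.pt_add_left)
    show ?thesis
      using LB.sum_hom[OF G T m LB.bal_pi_right LB.gamma_closed[OF a]] by (simp add: LB.sum_counit_right a)
  qed
  finally show "SumR TL (\<lambda>u w. galL u (S w \<cdot> b)) a = ptL a b" .
qed

text \<open>Both maps are pulled inside the representation of a pure tensor given by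
  \<open>pt_eq_sum_galL\<close>.\<close>

lemma galL_ext:
  assumes H: "comm_group H" and F1: "F1 \<in> hom TL H" and F2: "F2 \<in> hom TL H"
    and eq: "\<And>u v. u \<in> carrier A \<Longrightarrow> v \<in> carrier A \<Longrightarrow> F1 (galL u v) = F2 (galL u v)"
    and X: "X \<in> carrier TL"
  shows "F1 X = F2 X"
proof (rule LB.sum_ext[OF comm_group.axioms(2)[OF H] F1 F2 _ X])
  fix a b assume a: "a \<in> carrier A" and b: "b \<in> carrier A"
  note T = LB.comm_group_T and bal = pt_eq_sum_galL(2)[OF a b]
  have "F1 (ptL a b) = SumR H (\<lambda>u w. F1 (galL u (S w \<cdot> b))) a"
    unfolding pt_eq_sum_galL(1)[OF a b, symmetric]
    by (rule R_sum_hom[OF T H F1 bal R_gamma_closed[OF a]])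
  also have "\<dots> = SumR H (\<lambda>u w. F2 (galL u (S w \<cdot> b))) a"
    by (rule R_sum_cong[OF H R_bal_hom[OF F1 bal] _ R_gamma_closed[OF a]]) (use b eq in simp)
  also have "\<dots> = F2 (ptL a b)"
    unfolding pt_eq_sum_galL(1)[OF a b, symmetric]
    by (rule R_sum_hom[OF T H F2 bal R_gamma_closed[OF a], symmetric])
  finally show "F1 (ptL a b) = F2 (ptL a b)" .
qed

lemma hom_galL:
  assumes H: "comm_group H" and F: "F \<in> hom TL H" and u: "u \<in> carrier A" and v: "v \<in> carrier A"
  shows "F (galL u v) = SumL H (\<lambda>x y. F (ptL x (y \<cdot> v))) u"
  unfolding galL_def by (rule LB.sum_hom[OF LB.comm_group_T H F balL_pt_mult[OF v] LB.gamma_closed[OF u]])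

end

section \<open>Splitting the left coproduct with a normalized right t-integral\<close>

locale normalized_right_t_integral = hopf_algebroid k A L s\<^sub>L t\<^sub>L \<gamma>\<^sub>L \<pi>\<^sub>L R s\<^sub>R t\<^sub>R \<gamma>\<^sub>R \<pi>\<^sub>R S
  for k :: "('k, 'x) ring_scheme" and A :: "('k, 'a, 'y) module_scheme"
    and L :: "('k, 'l, 'z) module_scheme" and s\<^sub>L t\<^sub>L \<gamma>\<^sub>L \<pi>\<^sub>L
    and R :: "('k, 'r, 'w) module_scheme" and s\<^sub>R t\<^sub>R \<gamma>\<^sub>R \<pi>\<^sub>R S +
  fixes \<rho> :: "'a \<Rightarrow> 'l"
  assumes \<rho>: "\<rho> \<in> right_t_integrals A L s\<^sub>L t\<^sub>L \<gamma>\<^sub>L" and \<rho>_one: "\<rho> \<one>\<^bsub>A\<^esub> = \<one>\<^bsub>L\<^esub>"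
begin

lemma rho_hom: "\<rho> \<in> rmod_hom L (low_r A t\<^sub>L) (rreg L)"
  and rho_int: "a \<in> carrier A \<Longrightarrow> SumL gA (\<lambda>x y. s\<^sub>L (\<rho> x) \<cdot> y) a = t\<^sub>L (\<rho> a)"
  using \<rho> by (auto simp: right_t_integrals_def)

lemmas rho_simps = rmod_hom_closed[OF rho_hom, simplified] rmod_hom_add[OF rho_hom, simplified]
  rmod_hom_act[OF rho_hom, simplified]

definition \<sigma> :: "'a \<Rightarrow> 'a"
  where "\<sigma> a = t\<^sub>L (\<rho> a)"

lemma bal_rho: "balL gA (\<lambda>x y. s\<^sub>L (\<rho> x) \<cdot> y)"
  by (rule LB.balI) (simp_all add: rho_simps L_simps A_simps)

lemma sigma_closed [simp]: "a \<in> carrier A \<Longrightarrow> \<sigma> a \<in> carrier A"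
  by (simp add: \<sigma>_def rho_simps)

lemma sigma_add: "a \<in> carrier A \<Longrightarrow> b \<in> carrier A \<Longrightarrow> \<sigma> (a \<oplus>\<^bsub>A\<^esub> b) = \<sigma> a \<oplus>\<^bsub>A\<^esub> \<sigma> b"
  by (simp add: \<sigma>_def rho_simps L_simps)

lemma sigma_one: "\<sigma> \<one>\<^bsub>A\<^esub> = \<one>\<^bsub>A\<^esub>"
  by (simp add: \<sigma>_def \<rho>_one L_simps)

lemma sigma_tL: "a \<in> carrier A \<Longrightarrow> l \<in> carrier L \<Longrightarrow> \<sigma> (t\<^sub>L l \<cdot> a) = t\<^sub>L l \<cdot> \<sigma> a"
  by (simp add: \<sigma>_def rho_simps L_simps)

text \<open>Values of \<open>s\<^sub>R\<close> are values of \<open>t\<^sub>L\<close>, for which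
  \<rho> is linear. Paired with \<open>S(y t\<^sub>R(r)) = s\<^sub>R(r) S(y)\<close>, this makes the
  summand of \<open>avg\<close> balanced over \<open>R\<close>.\<close>

lemma sigma_sR: "a \<in> carrier A \<Longrightarrow> r \<in> carrier R \<Longrightarrow> \<sigma> (s\<^sub>R r \<cdot> a) = s\<^sub>R r \<cdot> \<sigma> a"
  using sigma_tL[of a "\<pi>\<^sub>L (s\<^sub>R r)"] by (simp add: tL_piL_sR)

definition avg :: "'a \<Rightarrow> 'a \<Rightarrow> 'a"
  where "avg a b = SumR gA (\<lambda>x y. x \<cdot> \<sigma> (S y \<cdot> b)) a"

lemma bal_avg_summand: "b \<in> carrier A \<Longrightarrow> balR gA (\<lambda>x y. x \<cdot> \<sigma> (S y \<cdot> b))"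
  by (rule R_balI) (simp_all add: sigma_add sigma_sR S_simps A_simps)

lemma avg_closed [simp]: "a \<in> carrier A \<Longrightarrow> b \<in> carrier A \<Longrightarrow> avg a b \<in> carrier A"
  unfolding avg_def using R_sum_closed[OF LB.comm_group_A bal_avg_summand R_gamma_closed] by simp

text \<open>For the balancing clause, left multiplication by \<open>t\<^sub>L(l)\<close> acts on the
  second leg of the right coproduct, and the antipode converts it into \<open>s\<^sub>L(l)\<close>
  standing directly before \<open>b\<close>.\<close>

lemma bal_avg: "balL gA avg"
proof (rule LB.balI)
  note G = LB.comm_group_A
  fix a b assume a: "a \<in> carrier A" and b: "b \<in> carrier A"
  show "avg a b \<in> carrier gA" using a b by simp
  {
    fix a' assume a': "a' \<in> carrier A"
    show "avg (a \<oplus>\<^bsub>A\<^esub> a') b = avg a b \<otimes>\<^bsub>gA\<^esub> avg a' b"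
      unfolding avg_def using R_sum_add_arg[OF G bal_avg_summand[OF b] a a'] by simp
  next
    fix b' assume b': "b' \<in> carrier A"
    have bb: "b \<oplus>\<^bsub>A\<^esub> b' \<in> carrier A" using b b' by simp
    have "avg a (b \<oplus>\<^bsub>A\<^esub> b') = SumR gA (\<lambda>x y. x \<cdot> \<sigma> (S y \<cdot> b) \<oplus>\<^bsub>A\<^esub> x \<cdot> \<sigma> (S y \<cdot> b')) a"
      unfolding avg_def
      by (rule R_sum_cong[OF G bal_avg_summand[OF bb] _ R_gamma_closed[OF a]])
        (use b b' in \<open>simp_all add: A_simps sigma_add\<close>)
    then show "avg a (b \<oplus>\<^bsub>A\<^esub> b') = avg a b \<otimes>\<^bsub>gA\<^esub> avg a b'"
      unfolding avg_def using R_sum_mult_target[OF G bal_avg_summand[OF b] bal_avg_summand[OF b'] R_gamma_closed[OF a]]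
      by simp
  next
    fix l assume l: "l \<in> carrier L"
    have lb: "s\<^sub>L l \<cdot> b \<in> carrier A" using b l by simp
    have "avg (t\<^sub>L l \<cdot> a) b = SumR gA (\<lambda>x y. x \<cdot> \<sigma> (S (t\<^sub>L l \<cdot> y) \<cdot> b)) a"
      unfolding avg_def
      using R_sum_s_left[OF G bal_avg_summand[OF b] a, of "\<pi>\<^sub>R (t\<^sub>L l)"] l by (simp add: sR_piR_tL)
    also have "\<dots> = avg a (s\<^sub>L l \<cdot> b)"
      unfolding avg_def
      by (rule R_sum_cong[OF G bal_avg_summand[OF lb] _ R_gamma_closed[OF a], symmetric])
        (use b l in \<open>simp_all add: S_simps A_simps\<close>)
    finally show "avg (t\<^sub>L l \<cdot> a) b = avg a (s\<^sub>L l \<cdot> b)" .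
  }
qed

text \<open>As a value of \<open>t\<^sub>R\<close>, the factor \<open>s\<^sub>L(l)\<close>
  multiplies the first leg of the right coproduct from the left and can be taken out of the
  sum.\<close>

lemma avg_sL:
  assumes a: "a \<in> carrier A" and b: "b \<in> carrier A" and l: "l \<in> carrier L"
  shows "avg (s\<^sub>L l \<cdot> a) b = s\<^sub>L l \<cdot> avg a b"
proof -
  note G = LB.comm_group_A and sl = LB.s_closed[OF l]
  have "avg (s\<^sub>L l \<cdot> a) b = SumR gA (\<lambda>x y. s\<^sub>L l \<cdot> x \<cdot> \<sigma> (S y \<cdot> b)) a"
    unfolding avg_def
    using R_sum_t_left[OF G bal_avg_summand[OF b] a, of "\<pi>\<^sub>R (s\<^sub>L l)"] l by (simp add: tR_piR_sL)
  also have "\<dots> = SumR gA (\<lambda>x y. s\<^sub>L l \<cdot> (x \<cdot> \<sigma> (S y \<cdot> b))) a"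
    by (rule R_sum_cong[OF G R_bal_hom[OF left_mult_hom[OF sl] bal_avg_summand[OF b]] _ R_gamma_closed[OF a], symmetric])
      (use b l in \<open>simp_all add: A_simps\<close>)
  also have "\<dots> = s\<^sub>L l \<cdot> avg a b"
    unfolding avg_def
    by (rule R_sum_hom[OF G G left_mult_hom[OF sl] bal_avg_summand[OF b] R_gamma_closed[OF a], symmetric])
  finally show ?thesis .
qed

text \<open>Mixed coassociativity rewrites \<open>(u_1)^1 \<sigma>(S((u_1)^2) u_2 v)\<close> as
  \<open>u^1 \<sigma>(S((u^2)_1) (u^2)_2 v)\<close>, and the antipode axiom makes it
  \<open>u^1 \<sigma>(s\<^sub>R(\<pi>\<^sub>R(u^2)) v)\<close>. Then \<open>sigma_sR\<close> and the
  counit remove the remaining coproduct.\<close>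

lemma avg_gal:
  assumes u: "u \<in> carrier A" and v: "v \<in> carrier A"
  shows "SumL gA (\<lambda>x y. avg x (y \<cdot> v)) u = u \<cdot> \<sigma> v"
proof -
  note G = LB.comm_group_A
  have h: "bal_RL gA (\<lambda>m n p. m \<cdot> \<sigma> (S n \<cdot> (p \<cdot> v)))"
    by (rule bal_RL_I) (use v in \<open>simp_all add: sigma_add sigma_sR S_simps A_simps\<close>)
  have "SumL gA (\<lambda>x y. avg x (y \<cdot> v)) u = SumR gA (\<lambda>m q. SumL gA (\<lambda>n p. m \<cdot> \<sigma> (S n \<cdot> (p \<cdot> v))) q) u"
    unfolding avg_def by (rule SumR_SumL_RL[OF G h u])
  also have "\<dots> = SumR gA (\<lambda>m q. m \<cdot> s\<^sub>R (\<pi>\<^sub>R q) \<cdot> \<sigma> v) u"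
  proof (rule R_sum_cong[OF G bal_SumL_RL[OF G h] _ R_gamma_closed[OF u]])
    fix m q assume m: "m \<in> carrier A" and q: "q \<in> carrier A"
    have hm: "(\<lambda>c. m \<cdot> \<sigma> (c \<cdot> v)) \<in> hom gA gA"
      using m v by (auto simp: hom_def sigma_add A_simps)
    have "SumL gA (\<lambda>n p. m \<cdot> \<sigma> (S n \<cdot> (p \<cdot> v))) q = SumL gA (\<lambda>n p. m \<cdot> \<sigma> (S n \<cdot> p \<cdot> v)) q"
      by (rule LB.sum_cong[OF G LB.bal_hom[OF hm bal_antipode_L] _ LB.gamma_closed[OF q], symmetric])
        (use v in \<open>simp add: A_simps\<close>)
    also have "\<dots> = m \<cdot> \<sigma> (s\<^sub>R (\<pi>\<^sub>R q) \<cdot> v)"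
      using LB.sum_hom[OF G G hm bal_antipode_L LB.gamma_closed[OF q]] by (simp add: SumL_antipode q)
    finally show "SumL gA (\<lambda>n p. m \<cdot> \<sigma> (S n \<cdot> (p \<cdot> v))) q = m \<cdot> s\<^sub>R (\<pi>\<^sub>R q) \<cdot> \<sigma> v"
      using m q v by (simp add: sigma_sR R_simps A_simps)
  qed
  also have "\<dots> = u \<cdot> \<sigma> v"
    using R_sum_hom[OF G G right_mult_hom[of "\<sigma> v"] RB.bal_pi_right[simplified] R_gamma_closed[OF u]] u v
    by (simp add: R_sum_counit_right)
  finally show ?thesis .
qed

definition p :: "('a \<times> 'a \<Rightarrow>\<^sub>0 int) set \<Rightarrow> 'a"
  where "p = tlift gA (\<lambda>(x, y). avg x y)"

lemma p_hom: "p \<in> hom TL gA"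
  unfolding p_def by (rule LB.sum_is_hom[OF LB.comm_group_A bal_avg])

lemma p_pt: "a \<in> carrier A \<Longrightarrow> b \<in> carrier A \<Longrightarrow> p (ptL a b) = avg a b"
  unfolding p_def by (rule LB.sum_pt[OF LB.comm_group_A bal_avg])

lemma p_gal:
  assumes u: "u \<in> carrier A" and v: "v \<in> carrier A"
  shows "p (galL u v) = u \<cdot> \<sigma> v"
proof -
  have b: "balL gA (\<lambda>x y. avg x (y \<cdot> v))"
    by (rule LB.bal_compose[OF rmod_hom_id LB.right_mult_l[OF v] bal_avg])
  have "p (galL u v) = SumL gA (\<lambda>x y. p (ptL x (y \<cdot> v))) u"
    by (rule hom_galL[OF LB.comm_group_A p_hom u v])
  also have "\<dots> = SumL gA (\<lambda>x y. avg x (y \<cdot> v)) u"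
    by (rule LB.sum_cong[OF LB.comm_group_A b _ LB.gamma_closed[OF u], symmetric]) (use v in \<open>simp add: p_pt\<close>)
  finally show ?thesis using avg_gal[OF u v] by simp
qed

text \<open>The coproduct of \<open>c\<close> is \<open>galL c \<one>\<close>, so its image is
  \<open>c \<sigma>(\<one>)\<close>; here the normalization of \<rho> enters.\<close>

lemma p_gamma: "c \<in> carrier A \<Longrightarrow> p (\<gamma>\<^sub>L c) = c"
proof -
  assume c: "c \<in> carrier A"
  have "galL c \<one>\<^bsub>A\<^esub> = SumL TL ptL c"
    unfolding galL_def
    by (rule LB.sum_cong[OF LB.comm_group_T balL_pt_mult _ LB.gamma_closed[OF c]]) simp_all
  then have "\<gamma>\<^sub>L c = galL c \<one>\<^bsub>A\<^esub>" using tlift_pt_gamma(1)[OF c] by simp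
  then show "p (\<gamma>\<^sub>L c) = c" using c by (simp add: p_gal sigma_one)
qed

lemma p_left:
  assumes X: "X \<in> carrier TL" and l: "l \<in> carrier L"
  shows "p (tmap L (low_r A t\<^sub>L) (low_l A s\<^sub>L) (\<lambda>x. s\<^sub>L l \<cdot> x) (\<lambda>y. y) X) = s\<^sub>L l \<cdot> p X"
proof -
  note G = LB.comm_group_A
  note m = LB.tmap_hom[OF LB.pair LB.left_s_r[OF l] lmod_hom_id]
  have "(p \<circ> tmap L (low_r A t\<^sub>L) (low_l A s\<^sub>L) (\<lambda>x. s\<^sub>L l \<cdot> x) (\<lambda>y. y)) X = ((\<lambda>x. s\<^sub>L l \<cdot> x) \<circ> p) X"
    by (rule LB.sum_ext[OF comm_group.axioms(2)[OF G] hom_compose[OF m p_hom]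
          hom_compose[OF p_hom left_mult_hom[OF LB.s_closed[OF l]]] _ X])
      (use l in \<open>simp_all add: LB.tmap_pt[OF LB.pair LB.left_s_r[OF l] lmod_hom_id] p_pt avg_sL\<close>)
  then show ?thesis by simp
qed

text \<open>On a pure tensor the factor \<open>t\<^sub>L(l)\<close> would be enclosed inside \<rho>,
  between \<open>S(y)\<close> and \<open>b\<close>. On \<open>galL u v\<close> it is absorbed by the
  coproduct of \<open>u\<close>, giving \<open>galL (t\<^sub>L(l) u) v\<close>, whose image is given
  by \<open>p_gal\<close>.\<close>

lemma p_right:
  assumes X: "X \<in> carrier TL" and l: "l \<in> carrier L"
  shows "p (tmap L (low_r A t\<^sub>L) (low_l A s\<^sub>L) (\<lambda>x. x) (\<lambda>y. t\<^sub>L l \<cdot> y) X) = t\<^sub>L l \<cdot> p X"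
proof -
  note G = LB.comm_group_A and T = LB.comm_group_T
  let ?m = "tmap L (low_r A t\<^sub>L) (low_l A s\<^sub>L) (\<lambda>x. x) (\<lambda>y. t\<^sub>L l \<cdot> y)"
  note m = LB.tmap_hom[OF LB.pair rmod_hom_id LB.left_t_l[OF l]]
  have gal: "?m (galL u v) = galL (t\<^sub>L l \<cdot> u) v" if u: "u \<in> carrier A" and v: "v \<in> carrier A" for u v
  proof -
    have "?m (galL u v) = SumL TL (\<lambda>x y. ?m (ptL x (y \<cdot> v))) u"
      by (rule hom_galL[OF T m u v])
    also have "\<dots> = SumL TL (\<lambda>x y. ptL x (t\<^sub>L l \<cdot> y \<cdot> v)) u"
      by (rule LB.sum_cong[OF T LB.bal_hom[OF m balL_pt_mult[OF v]] _ LB.gamma_closed[OF u]])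
        (use v l in \<open>simp add: LB.tmap_pt[OF LB.pair rmod_hom_id LB.left_t_l[OF l]] A_simps\<close>)
    also have "\<dots> = galL (t\<^sub>L l \<cdot> u) v"
      unfolding galL_def by (rule LB.sum_t_left[OF T balL_pt_mult[OF v] u l, symmetric])
    finally show ?thesis .
  qed
  have "(p \<circ> ?m) X = ((\<lambda>x. t\<^sub>L l \<cdot> x) \<circ> p) X"
    by (rule galL_ext[OF G hom_compose[OF m p_hom] hom_compose[OF p_hom left_mult_hom[OF LB.t_closed[OF l]]] _ X])
      (use l in \<open>simp add: gal p_gal A_simps\<close>)
  then show ?thesis by simp
qed

text \<open>\<open>\<sigma>(v)\<close> is a value of \<open>t\<^sub>L\<close>, so right
  multiplication by it affects the second leg of the coproduct alone.\<close>

lemma gamma_p_gal: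
  assumes u: "u \<in> carrier A" and v: "v \<in> carrier A"
  shows "\<gamma>\<^sub>L (p (galL u v)) = SumL TL (\<lambda>x y. ptL x (y \<cdot> \<sigma> v)) u"
  using LB.sum_t_right[OF LB.comm_group_T LB.balanced_pt u, of "\<rho> v"] tlift_pt_gamma(1)[of "u \<cdot> \<sigma> v"] u v
  by (simp add: p_gal \<sigma>_def rho_simps)

lemma gamma_p_hom: "\<gamma>\<^sub>L \<circ> p \<in> hom TL TL"
  using hom_compose[OF p_hom, of \<gamma>\<^sub>L TL] LB.gamma_hom by (simp add: hom_def)

text \<open>On \<open>galL u v\<close> the right-hand side is u_1 \<otimes> p(u_2 \<otimes> u_3 v)
  by coassociativity. Its second leg contains p at an element of the form \<open>galL q v\<close>,
  hence equals \<open>q \<sigma>(v)\<close>, in agreement with \<open>gamma_p_gal\<close>.\<close>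

lemma p_colinear_left:
  assumes X: "X \<in> carrier TL"
  shows "\<gamma>\<^sub>L (p X) = tlift TL (\<lambda>(x, y, z). ptL x (p (ptL y z)))
    (ten_left L (low_r A t\<^sub>L) (low_l A s\<^sub>L) L (low_r A t\<^sub>L) (low_l A s\<^sub>L) \<gamma>\<^sub>L X)" (is "_ = ?F X")
proof -
  note T = LB.comm_group_T and G = LB.comm_group_A
  note P = LB.bal_closed[OF bal_avg, simplified] LB.bal_add_left[OF bal_avg, simplified]
    LB.bal_add_right[OF bal_avg, simplified] LB.bal_act[OF bal_avg]
  have h: "balanced3 L (low_r A t\<^sub>L) (low_l A s\<^sub>L) L (low_r A t\<^sub>L) (low_l A s\<^sub>L) TL (\<lambda>x y z. ptL x (p (ptL y z)))"
    by (rule LB.bal3I)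
      (simp_all add: p_pt hom_mult[OF p_hom, simplified] LB.pt_closed LB.pt_add_left LB.pt_add_right LB.pt_act P avg_sL)
  have F_hom: "?F \<in> hom TL TL"
    using hom_compose[OF LB.ten_left_gamma_hom
      LB.sum3_hom[OF T h]] by (simp add: comp_def)
  have F_pt: "?F (ptL x c) = SumL TL (\<lambda>m n. ptL m (p (ptL n c))) x" if "x \<in> carrier A" "c \<in> carrier A" for x c
    using LB.sum3_ten_left[OF T h LB.pt_closed[OF that]]
      LB.sum_pt[OF T LB.nest_left[OF T h] that] by simp
  have "(\<gamma>\<^sub>L \<circ> p) X = ?F X"
  proof (rule galL_ext[OF T gamma_p_hom F_hom _ X])
    fix u v assume u: "u \<in> carrier A" and v: "v \<in> carrier A"
    note X = LB.gamma_closed[OF u]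
    have h': "balanced3 L (low_r A t\<^sub>L) (low_l A s\<^sub>L) L (low_r A t\<^sub>L) (low_l A s\<^sub>L) TL (\<lambda>m n y. ptL m (avg n (y \<cdot> v)))"
      by (rule LB.bal3I)
        (use v in \<open>simp_all add: LB.pt_closed LB.pt_add_left LB.pt_add_right LB.pt_act P avg_sL A_simps\<close>)
    have b: "balL gA (\<lambda>x y. avg x (y \<cdot> v))"
      by (rule LB.bal_compose[OF rmod_hom_id LB.right_mult_l[OF v] bal_avg])
    have hp: "ptL m \<in> hom gA TL" if "m \<in> carrier A" for m
      using that by (auto simp: hom_def LB.pt_closed LB.pt_add_right)
    have "?F (galL u v) = SumL TL (\<lambda>x y. ?F (ptL x (y \<cdot> v))) u"
      by (rule hom_galL[OF T F_hom u v])
    also have "\<dots> = SumL TL (\<lambda>x y. SumL TL (\<lambda>m n. ptL m (avg n (y \<cdot> v))) x) u"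
    proof (rule LB.sum_cong[OF T LB.bal_hom[OF F_hom balL_pt_mult[OF v]] _ X])
      fix x y assume x: "x \<in> carrier A" and y: "y \<in> carrier A"
      have b1: "balL TL (\<lambda>m n. ptL m (avg n (y \<cdot> v)))"
        by (rule LB.CCC.balanced3_left[simplified, OF T h' y])
      have "?F (ptL x (y \<cdot> v)) = SumL TL (\<lambda>m n. ptL m (p (ptL n (y \<cdot> v)))) x"
        by (rule F_pt[OF x]) (use y v in simp)
      also have "\<dots> = SumL TL (\<lambda>m n. ptL m (avg n (y \<cdot> v))) x"
        by (rule LB.sum_cong[OF T b1 _ LB.gamma_closed[OF x], symmetric]) (use y v in \<open>simp add: p_pt\<close>)
      finally show "?F (ptL x (y \<cdot> v)) = SumL TL (\<lambda>m n. ptL m (avg n (y \<cdot> v))) x" .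
    qed
    also have "\<dots> = SumL TL (\<lambda>m q. SumL TL (\<lambda>n y. ptL m (avg n (y \<cdot> v))) q) u"
      by (rule LB.sum_coassoc[OF T h' u])
    also have "\<dots> = SumL TL (\<lambda>m q. ptL m (q \<cdot> \<sigma> v)) u"
    proof (rule LB.sum_cong[OF T balL_pt_mult _ X, symmetric])
      show "\<sigma> v \<in> carrier A" using v by simp
      fix m q assume m: "m \<in> carrier A" and q: "q \<in> carrier A"
      show "ptL m (q \<cdot> \<sigma> v) = SumL TL (\<lambda>n y. ptL m (avg n (y \<cdot> v))) q"
        unfolding avg_gal[OF q v, symmetric] by (rule LB.sum_hom[OF G T hp[OF m] b LB.gamma_closed[OF q]])
    qed
    finally show "(\<gamma>\<^sub>L \<circ> p) (galL u v) = ?F (galL u v)"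
      using gamma_p_gal[OF u v] by simp
  qed
  then show ?thesis by simp
qed

text \<open>On \<open>galL u v\<close> the right-hand side is \<open>p(u_1 \<otimes> u_2 v_1)
  \<otimes> u_3 v_2 = u_1 t\<^sub>L(\<rho>(v_1)) \<otimes> u_2 v_2\<close>. The Takeuchi condition
  changes this into \<open>u_1 \<otimes> u_2 s\<^sub>L(\<rho>(v_1)) v_2\<close>, and the integral
  equation at \<open>v\<close> yields \<open>u_1 \<otimes> u_2 \<sigma>(v)\<close>.\<close>

lemma p_colinear_right:
  assumes X: "X \<in> carrier TL"
  shows "\<gamma>\<^sub>L (p X) = tlift TL (\<lambda>(x, y, z). ptL (p (ptL x y)) z)
    (ten_right L (low_r A t\<^sub>L) (low_l A s\<^sub>L) L (low_r A t\<^sub>L) (low_l A s\<^sub>L) \<gamma>\<^sub>L X)" (is "_ = ?F X")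
proof -
  note T = LB.comm_group_T and G = LB.comm_group_A
  note P = LB.bal_closed[OF bal_avg, simplified] LB.bal_add_left[OF bal_avg, simplified]
    LB.bal_add_right[OF bal_avg, simplified] LB.bal_act[OF bal_avg]
  \<comment> \<open>Right linearity of \<open>p\<close>, obtained through \<open>galL\<close>, is
    specialized to pure tensors: it is what makes the trilinear map in \<open>h\<close> balanced at
    the second tensor sign.\<close>
  have avg_tL: "avg x (t\<^sub>L l \<cdot> y) = t\<^sub>L l \<cdot> avg x y" if "x \<in> carrier A" "y \<in> carrier A" "l \<in> carrier L" for x y l
    using p_right[OF LB.pt_closed[OF that(1,2)] that(3)] that
      LB.tmap_pt[OF LB.pair rmod_hom_id LB.left_t_l[OF that(3)] that(1,2)]
    by (simp add: p_pt)
  have h: "balanced3 L (low_r A t\<^sub>L) (low_l A s\<^sub>L) L (low_r A t\<^sub>L) (low_l A s\<^sub>L) TL (\<lambda>x y z. ptL (p (ptL x y)) z)"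
    by (rule LB.bal3I)
      (simp_all add: p_pt hom_mult[OF p_hom, simplified] LB.pt_closed LB.pt_add_left LB.pt_add_right P avg_tL LB.pt_act)
  have F_hom: "?F \<in> hom TL TL"
    using hom_compose[OF LB.ten_right_gamma_hom
      LB.sum3_hom[OF T h]] by (simp add: comp_def)
  have F_pt: "?F (ptL x c) = SumL TL (\<lambda>m n. ptL (p (ptL x m)) n) c" if "x \<in> carrier A" "c \<in> carrier A" for x c
    using LB.sum3_ten_right[OF T h LB.pt_closed[OF that]]
      LB.sum_pt[OF T LB.nest_right[OF T h] that] by simp
  have "(\<gamma>\<^sub>L \<circ> p) X = ?F X"
  proof (rule galL_ext[OF T gamma_p_hom F_hom _ X])
    fix u v assume u: "u \<in> carrier A" and v: "v \<in> carrier A"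
    note U = LB.gamma_closed[OF u] and V = LB.gamma_closed[OF v]
    have bx: "balL TL (\<lambda>m n. ptL (avg x m) n)" if "x \<in> carrier A" for x
      by (rule LB.balI) (use that in \<open>simp_all add: LB.pt_closed LB.pt_add_left LB.pt_add_right P avg_tL LB.pt_act\<close>)
    have h': "balanced3 L (low_r A t\<^sub>L) (low_l A s\<^sub>L) L (low_r A t\<^sub>L) (low_l A s\<^sub>L) TL
        (\<lambda>x z w. ptL (avg x (z \<cdot> z')) (w \<cdot> w'))" if "z' \<in> carrier A" "w' \<in> carrier A" for z' w'
      by (rule LB.bal3I)
        (use that in \<open>simp_all add: LB.pt_closed LB.pt_add_left LB.pt_add_right P avg_tL LB.pt_act A_simps\<close>)
    have f: "balL TL (\<lambda>x y. SumL TL (\<lambda>z w. ptL (avg x (z \<cdot> z')) (w \<cdot> w')) y)"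
      if "z' \<in> carrier A" "w' \<in> carrier A" for z' w'
      by (rule LB.nest_right[OF T h'[OF that]])
    have f': "balL TL (\<lambda>z' w'. SumL TL (\<lambda>z w. ptL (avg x (z \<cdot> z')) (w \<cdot> w')) y)"
      if "x \<in> carrier A" "y \<in> carrier A" for x y
      by (rule LB.bal_mult[OF T bx[OF that(1)] that(2)])
    have b: "balL gA (\<lambda>x y. avg x (y \<cdot> v))" if "v \<in> carrier A" for v
      by (rule LB.bal_compose[OF rmod_hom_id LB.right_mult_l[OF that] bal_avg])
    have f2: "balL TL (\<lambda>q w. ptL q (w \<cdot> (s\<^sub>L (\<rho> z') \<cdot> w')))" if "z' \<in> carrier A" "w' \<in> carrier A" for z' w'
      by (rule balL_pt_mult) (use that in \<open>simp add: rho_simps\<close>)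
    have hp: "(\<lambda>c. ptL q (w \<cdot> c)) \<in> hom gA TL" if "q \<in> carrier A" "w \<in> carrier A" for q w
      using that by (auto simp: hom_def LB.pt_closed LB.pt_add_right A_simps)
    have f2': "balL TL (\<lambda>z' w'. ptL q (w \<cdot> (s\<^sub>L (\<rho> z') \<cdot> w')))" if "q \<in> carrier A" "w \<in> carrier A" for q w
      by (rule LB.bal_hom[OF hp[OF that] bal_rho])
    have "?F (galL u v) = SumL TL (\<lambda>x y. ?F (ptL x (y \<cdot> v))) u"
      by (rule hom_galL[OF T F_hom u v])
    also have "\<dots> = SumL TL (\<lambda>x y. SumL TL (\<lambda>z' w'. SumL TL (\<lambda>z w. ptL (avg x (z \<cdot> z')) (w \<cdot> w')) y) v) u"
    proof (rule LB.sum_cong[OF T LB.bal_hom[OF F_hom balL_pt_mult[OF v]] _ U])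
      fix x y assume x: "x \<in> carrier A" and y: "y \<in> carrier A"
      then have yv: "y \<cdot> v \<in> carrier A" using v by simp
      have "?F (ptL x (y \<cdot> v)) = SumL TL (\<lambda>m n. ptL (p (ptL x m)) n) (y \<cdot> v)"
        by (rule F_pt[OF x yv])
      also have "\<dots> = SumL TL (\<lambda>m n. ptL (avg x m) n) (y \<cdot> v)"
        by (rule LB.sum_cong[OF T bx[OF x] _ LB.gamma_closed[OF yv], symmetric]) (use x in \<open>simp add: p_pt\<close>)
      also have "\<dots> = SumL TL (\<lambda>z' w'. SumL TL (\<lambda>z w. ptL (avg x (z \<cdot> z')) (w \<cdot> w')) y) v"
        by (rule LB.sum_mult[OF T bx[OF x] y v])
      finally show "?F (ptL x (y \<cdot> v)) =
        SumL TL (\<lambda>z' w'. SumL TL (\<lambda>z w. ptL (avg x (z \<cdot> z')) (w \<cdot> w')) y) v" .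
    qed
    \<comment> \<open>The legs of \<open>v\<close> become the outer sum, so that coassociativity can
      be applied to \<open>u\<close> while they are fixed.\<close>
    also have "\<dots> = SumL TL (\<lambda>z' w'. SumL TL (\<lambda>x y. SumL TL (\<lambda>z w. ptL (avg x (z \<cdot> z')) (w \<cdot> w')) y) u) v"
      by (rule LB.sum_Fubini[OF T f f' U V])
    also have "\<dots> = SumL TL (\<lambda>z' w'. SumL TL (\<lambda>q w. ptL q (w \<cdot> (s\<^sub>L (\<rho> z') \<cdot> w'))) u) v"
    proof (rule LB.sum_cong[OF T _ _ V, symmetric])
      fix z' w' assume z': "z' \<in> carrier A" and w': "w' \<in> carrier A"
      have "SumL TL (\<lambda>x y. SumL TL (\<lambda>z w. ptL (avg x (z \<cdot> z')) (w \<cdot> w')) y) u =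
          SumL TL (\<lambda>q w. SumL TL (\<lambda>x z. ptL (avg x (z \<cdot> z')) (w \<cdot> w')) q) u"
        by (rule LB.sum_coassoc[OF T h'[OF z' w'] u, symmetric])
      also have "\<dots> = SumL TL (\<lambda>q w. ptL (q \<cdot> t\<^sub>L (\<rho> z')) (w \<cdot> w')) u"
      proof (rule LB.sum_cong[OF T LB.bal_right_mult[OF T LB.balanced_pt _ w'] _ U, symmetric])
        show "t\<^sub>L (\<rho> z') \<in> carrier A" using z' by (simp add: rho_simps)
        fix q w assume q: "q \<in> carrier A" and w: "w \<in> carrier A"
        have hc: "(\<lambda>c. ptL c (w \<cdot> w')) \<in> hom gA TL"
          using w w' by (auto simp: hom_def LB.pt_closed LB.pt_add_left)
        show "ptL (q \<cdot> t\<^sub>L (\<rho> z')) (w \<cdot> w') = SumL TL (\<lambda>x z. ptL (avg x (z \<cdot> z')) (w \<cdot> w')) q"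
          unfolding \<sigma>_def[symmetric] avg_gal[OF q z', symmetric]
          by (rule LB.sum_hom[OF G T hc b[OF z'] LB.gamma_closed[OF q]])
      qed
      also have "\<dots> = SumL TL (\<lambda>q w. ptL q (w \<cdot> s\<^sub>L (\<rho> z') \<cdot> w')) u"
        by (rule LB.sum_takeuchi[OF T balL_pt_mult[OF w'] u]) (use z' in \<open>simp add: rho_simps\<close>)
      also have "\<dots> = SumL TL (\<lambda>q w. ptL q (w \<cdot> (s\<^sub>L (\<rho> z') \<cdot> w'))) u"
        by (rule LB.sum_cong[OF T f2[OF z' w'] _ U, symmetric]) (use z' w' in \<open>simp add: A_simps rho_simps\<close>)
      finally show "SumL TL (\<lambda>q w. ptL q (w \<cdot> (s\<^sub>L (\<rho> z') \<cdot> w'))) u =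
        SumL TL (\<lambda>x y. SumL TL (\<lambda>z w. ptL (avg x (z \<cdot> z')) (w \<cdot> w')) y) u" ..
    next
      show "balL TL (\<lambda>z' w'. SumL TL (\<lambda>q w. ptL q (w \<cdot> (s\<^sub>L (\<rho> z') \<cdot> w'))) u)"
        by (rule LB.bal_sum[OF T f2 f2' U])
    qed
    \<comment> \<open>The sum over \<open>v\<close> returns to the inside, where the integral
      equation evaluates it.\<close>
    also have "\<dots> = SumL TL (\<lambda>q w. SumL TL (\<lambda>z' w'. ptL q (w \<cdot> (s\<^sub>L (\<rho> z') \<cdot> w'))) v) u"
      by (rule LB.sum_Fubini[OF T f2 f2' U V, symmetric])
    also have "\<dots> = SumL TL (\<lambda>q w. ptL q (w \<cdot> \<sigma> v)) u"
    proof (rule LB.sum_cong[OF T balL_pt_mult _ U, symmetric])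
      show "\<sigma> v \<in> carrier A" using v by simp
      fix q w assume q: "q \<in> carrier A" and w: "w \<in> carrier A"
      show "ptL q (w \<cdot> \<sigma> v) = SumL TL (\<lambda>z' w'. ptL q (w \<cdot> (s\<^sub>L (\<rho> z') \<cdot> w'))) v"
        unfolding \<sigma>_def rho_int[OF v, symmetric] by (rule LB.sum_hom[OF G T hp[OF q w] bal_rho V])
    qed
    finally show "(\<gamma>\<^sub>L \<circ> p) (galL u v) = ?F (galL u v)"
      using gamma_p_gal[OF u v] by simp
  qed
  then show ?thesis by simp
qed

theorem coseparable: "coseparable L (L_coring A s\<^sub>L t\<^sub>L \<gamma>\<^sub>L \<pi>\<^sub>L)"
  unfolding coseparable_def
proof (intro bexI[of _ p] ballI)
  show "p (comult (L_coring A s\<^sub>L t\<^sub>L \<gamma>\<^sub>L \<pi>\<^sub>L) c) = c" if "c \<in> carrier (crm (L_coring A s\<^sub>L t\<^sub>L \<gamma>\<^sub>L \<pi>\<^sub>L))" for c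
    using that p_gamma by simp
  have "p \<in> hom TL (low_r A t\<^sub>L)" using p_hom by (simp add: hom_def)
  then show "p \<in> square_bicomod_hom L (L_coring A s\<^sub>L t\<^sub>L \<gamma>\<^sub>L \<pi>\<^sub>L)"
    unfolding square_bicomod_hom_def coring_simps module_simps
    using p_left p_right p_colinear_left p_colinear_right by blast
qed

end

section \<open>Mirror image: splitting the right coproduct with a normalized left t-integral\<close>

context hopf_algebroid
begin

lemmas R_bal3I = RB.bal3I[simplified]
  and R_nest_left = RB.nest_left[simplified]
  and R_nest_right = RB.nest_right[simplified]
  and R_ten_left_gamma_hom = RB.ten_left_gamma_hom[simplified]
  and R_ten_right_gamma_hom = RB.ten_right_gamma_hom[simplified]
  and R_sum3_ten_left = RB.sum3_ten_left[simplified]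
  and R_sum3_ten_right = RB.sum3_ten_right[simplified]
  and R_sum3_hom = RB.sum3_hom[simplified]
  and R_bal_sum = RB.bal_sum[simplified]
  and R_tmap_pt = RB.tmap_pt[simplified]
  and R_tmap_hom = RB.tmap_hom[simplified]
  and R_left_mult_r = RB.right_mult_r[simplified]
  and R_right_s = RB.left_t_l[simplified]
  and R_right_t = RB.left_s_r[simplified]
  and R_bal_compose = RB.bal_compose[simplified]
  and R_bal_left_mult = RB.bal_right_mult[simplified]

text \<open>The canonical map of the right bialgebroid, counterpart of \<open>galL\<close>: a pure
  tensor a \<otimes> b is the image of a S(b_1) \<otimes> b_2, so additive maps are again determined
  by their values on these elements.\<close>

definition galR :: "'a \<Rightarrow> 'a \<Rightarrow> ('a \<times> 'a \<Rightarrow>\<^sub>0 int) set"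
  where "galR v u = SumR TR (\<lambda>x y. ptR (v \<cdot> x) y) u"

lemma balR_pt_mult: "v \<in> carrier A \<Longrightarrow> balR TR (\<lambda>x y. ptR (v \<cdot> x) y)"
  by (rule R_bal_compose[OF R_left_mult_r lmod_hom_id R_balanced_pt])

lemma bal_LR_galR: "a \<in> carrier A \<Longrightarrow> bal_LR TR (\<lambda>w x y. ptR (a \<cdot> S w \<cdot> x) y)"
  by (rule bal_LR_I)
    (simp_all add: R_pt_closed R_pt_add_left R_pt_add_right S_simps A_simps flip: R_pt_act)

text \<open>Mixed coassociativity turns a S(b_1) (b_2)^1 \<otimes> (b_2)^2 into a S((b^1)_1) (b^1)_2
  \<otimes> b^2. By the antipode axiom this is \<open>a s\<^sub>R(\<pi>\<^sub>R(b^1)) \<otimes> b^2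
  = a \<otimes> b^2 t\<^sub>R(\<pi>\<^sub>R(b^1))\<close>, and the counit gives a \<otimes>
  b.\<close>

lemma pt_eq_sum_galR:
  assumes a: "a \<in> carrier A" and b: "b \<in> carrier A"
  shows "SumL TR (\<lambda>w u. galR (a \<cdot> S w) u) b = ptR a b"
    and "balL TR (\<lambda>w u. galR (a \<cdot> S w) u)"
proof -
  note T = R_comm_group_T and G = LB.comm_group_A
  note h = bal_LR_galR[OF a]
  show "balL TR (\<lambda>w u. galR (a \<cdot> S w) u)"
    unfolding galR_def by (rule bal_SumR_LR[OF T h])
  have "SumL TR (\<lambda>w u. galR (a \<cdot> S w) u) b =
      SumR TR (\<lambda>q y. SumL TR (\<lambda>w x. ptR (a \<cdot> S w \<cdot> x) y) q) b"
    unfolding galR_def by (rule SumL_SumR_LR[OF T h b, symmetric])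
  also have "\<dots> = SumR TR (\<lambda>q y. ptR a (y \<cdot> t\<^sub>R (\<pi>\<^sub>R q))) b"
  proof (rule R_sum_cong[OF T bal_SumL_LR[OF T h] _ R_gamma_closed[OF b]])
    fix q y assume q: "q \<in> carrier A" and y: "y \<in> carrier A"
    have m: "(\<lambda>c. ptR (a \<cdot> c) y) \<in> hom gA TR"
      using a y by (auto simp: hom_def R_pt_closed R_pt_add_left A_simps)
    have "SumL TR (\<lambda>w x. ptR (a \<cdot> S w \<cdot> x) y) q = SumL TR (\<lambda>w x. ptR (a \<cdot> (S w \<cdot> x)) y) q"
      by (rule LB.sum_cong[OF T LB.bal_hom[OF m bal_antipode_L] _ LB.gamma_closed[OF q], symmetric])
        (use a in \<open>simp add: A_simps\<close>)
    also have "\<dots> = ptR (a \<cdot> s\<^sub>R (\<pi>\<^sub>R q)) y"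
      using LB.sum_hom[OF G T m bal_antipode_L LB.gamma_closed[OF q]] by (simp add: SumL_antipode q)
    also have "\<dots> = ptR a (y \<cdot> t\<^sub>R (\<pi>\<^sub>R q))"
      using a y q by (simp add: R_pt_act R_simps)
    finally show "SumL TR (\<lambda>w x. ptR (a \<cdot> S w \<cdot> x) y) q = ptR a (y \<cdot> t\<^sub>R (\<pi>\<^sub>R q))" .
  qed
  also have "\<dots> = ptR a b"
  proof -
    have m: "ptR a \<in> hom gA TR"
      using a by (auto simp: hom_def R_pt_closed R_pt_add_right)
    show ?thesis
      using R_sum_hom[OF G T m RB.bal_pi_left[simplified] R_gamma_closed[OF b]] by (simp add: R_sum_counit_left b)
  qed
  finally show "SumL TR (\<lambda>w u. galR (a \<cdot> S w) u) b = ptR a b" .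
qed

lemma galR_ext:
  assumes H: "comm_group H" and F1: "F1 \<in> hom TR H" and F2: "F2 \<in> hom TR H"
    and eq: "\<And>v u. v \<in> carrier A \<Longrightarrow> u \<in> carrier A \<Longrightarrow> F1 (galR v u) = F2 (galR v u)"
    and X: "X \<in> carrier TR"
  shows "F1 X = F2 X"
proof (rule R_sum_ext[OF comm_group.axioms(2)[OF H] F1 F2 _ X])
  fix a b assume a: "a \<in> carrier A" and b: "b \<in> carrier A"
  note T = R_comm_group_T and bal = pt_eq_sum_galR(2)[OF a b]
  have "F1 (ptR a b) = SumL H (\<lambda>w u. F1 (galR (a \<cdot> S w) u)) b"
    unfolding pt_eq_sum_galR(1)[OF a b, symmetric]
    by (rule LB.sum_hom[OF T H F1 bal LB.gamma_closed[OF b]])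
  also have "\<dots> = SumL H (\<lambda>w u. F2 (galR (a \<cdot> S w) u)) b"
    by (rule LB.sum_cong[OF H LB.bal_hom[OF F1 bal] _ LB.gamma_closed[OF b]]) (use a eq in simp)
  also have "\<dots> = F2 (ptR a b)"
    unfolding pt_eq_sum_galR(1)[OF a b, symmetric]
    by (rule LB.sum_hom[OF T H F2 bal LB.gamma_closed[OF b], symmetric])
  finally show "F1 (ptR a b) = F2 (ptR a b)" .
qed

lemma hom_galR:
  assumes H: "comm_group H" and F: "F \<in> hom TR H" and v: "v \<in> carrier A" and u: "u \<in> carrier A"
  shows "F (galR v u) = SumR H (\<lambda>x y. F (ptR (v \<cdot> x) y)) u"
  unfolding galR_def by (rule R_sum_hom[OF R_comm_group_T H F balR_pt_mult[OF v] R_gamma_closed[OF u]])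

end

locale normalized_left_t_integral = hopf_algebroid k A L s\<^sub>L t\<^sub>L \<gamma>\<^sub>L \<pi>\<^sub>L R s\<^sub>R t\<^sub>R \<gamma>\<^sub>R \<pi>\<^sub>R S
  for k :: "('k, 'x) ring_scheme" and A :: "('k, 'a, 'y) module_scheme"
    and L :: "('k, 'l, 'z) module_scheme" and s\<^sub>L t\<^sub>L \<gamma>\<^sub>L \<pi>\<^sub>L
    and R :: "('k, 'r, 'w) module_scheme" and s\<^sub>R t\<^sub>R \<gamma>\<^sub>R \<pi>\<^sub>R S +
  fixes \<phi> :: "'a \<Rightarrow> 'r"
  assumes \<phi>: "\<phi> \<in> left_t_integrals A R s\<^sub>R t\<^sub>R \<gamma>\<^sub>R" and \<phi>_one: "\<phi> \<one>\<^bsub>A\<^esub> = \<one>\<^bsub>R\<^esub>"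
begin

lemma phi_hom: "\<phi> \<in> lmod_hom R (up_l A t\<^sub>R) (lreg R)"
  and phi_int: "a \<in> carrier A \<Longrightarrow> SumR gA (\<lambda>x y. x \<cdot> s\<^sub>R (\<phi> y)) a = t\<^sub>R (\<phi> a)"
  using \<phi> by (auto simp: left_t_integrals_def)

lemmas phi_simps = lmod_hom_closed[OF phi_hom, simplified] lmod_hom_add[OF phi_hom, simplified]
  lmod_hom_act[OF phi_hom, simplified]

definition \<sigma> :: "'a \<Rightarrow> 'a"
  where "\<sigma> a = t\<^sub>R (\<phi> a)"

lemma bal_phi: "balR gA (\<lambda>x y. x \<cdot> s\<^sub>R (\<phi> y))"
  by (rule R_balI) (simp_all add: phi_simps R_simps A_simps)

lemma sigma_closed [simp]: "a \<in> carrier A \<Longrightarrow> \<sigma> a \<in> carrier A"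
  by (simp add: \<sigma>_def phi_simps)

lemma sigma_add: "a \<in> carrier A \<Longrightarrow> b \<in> carrier A \<Longrightarrow> \<sigma> (a \<oplus>\<^bsub>A\<^esub> b) = \<sigma> a \<oplus>\<^bsub>A\<^esub> \<sigma> b"
  by (simp add: \<sigma>_def phi_simps R_simps)

lemma sigma_one: "\<sigma> \<one>\<^bsub>A\<^esub> = \<one>\<^bsub>A\<^esub>"
  by (simp add: \<sigma>_def \<phi>_one R_simps)

lemma sigma_tR: "a \<in> carrier A \<Longrightarrow> r \<in> carrier R \<Longrightarrow> \<sigma> (a \<cdot> t\<^sub>R r) = \<sigma> a \<cdot> t\<^sub>R r"
  by (simp add: \<sigma>_def phi_simps R_simps)

lemma sigma_sL: "a \<in> carrier A \<Longrightarrow> l \<in> carrier L \<Longrightarrow> \<sigma> (a \<cdot> s\<^sub>L l) = \<sigma> a \<cdot> s\<^sub>L l"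
  using sigma_tR[of a "\<pi>\<^sub>R (s\<^sub>L l)"] by (simp add: tR_piR_sL)

text \<open>A variant for right-nested products: associativity moves the factor deep into the
  product before linearity can be applied. The next lemma goes one level deeper.\<close>

lemma sigma_sL': "a \<in> carrier A \<Longrightarrow> b \<in> carrier A \<Longrightarrow> l \<in> carrier L \<Longrightarrow>
    \<sigma> (a \<cdot> (b \<cdot> s\<^sub>L l)) = \<sigma> (a \<cdot> b) \<cdot> s\<^sub>L l"
  using sigma_sL[of "a \<cdot> b" l] by (simp add: A_simps)

lemma sigma_sL'': "a \<in> carrier A \<Longrightarrow> b \<in> carrier A \<Longrightarrow> c \<in> carrier A \<Longrightarrow> l \<in> carrier L \<Longrightarrow>
    \<sigma> (a \<cdot> (b \<cdot> (c \<cdot> s\<^sub>L l))) = \<sigma> (a \<cdot> (b \<cdot> c)) \<cdot> s\<^sub>L l"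
  using sigma_sL[of "a \<cdot> (b \<cdot> c)" l] by (simp add: A_simps)

definition avg :: "'a \<Rightarrow> 'a \<Rightarrow> 'a"
  where "avg a b = SumL gA (\<lambda>x y. \<sigma> (a \<cdot> S x) \<cdot> y) b"

lemma bal_avg_summand: "a \<in> carrier A \<Longrightarrow> balL gA (\<lambda>x y. \<sigma> (a \<cdot> S x) \<cdot> y)"
  by (rule LB.balI) (simp_all add: sigma_add sigma_sL' S_simps A_simps)

lemma avg_closed [simp]: "a \<in> carrier A \<Longrightarrow> b \<in> carrier A \<Longrightarrow> avg a b \<in> carrier A"
  unfolding avg_def using LB.sum_closed[OF LB.comm_group_A bal_avg_summand LB.gamma_closed] by simp

lemma bal_avg: "balR gA avg"
proof (rule R_balI)
  note G = LB.comm_group_A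
  fix a b assume a: "a \<in> carrier A" and b: "b \<in> carrier A"
  show "avg a b \<in> carrier gA" using a b by simp
  {
    fix b' assume b': "b' \<in> carrier A"
    show "avg a (b \<oplus>\<^bsub>A\<^esub> b') = avg a b \<otimes>\<^bsub>gA\<^esub> avg a b'"
      unfolding avg_def using LB.sum_add_arg[OF G bal_avg_summand[OF a] b b'] by simp
  next
    fix a' assume a': "a' \<in> carrier A"
    have aa: "a \<oplus>\<^bsub>A\<^esub> a' \<in> carrier A" using a a' by simp
    have "avg (a \<oplus>\<^bsub>A\<^esub> a') b = SumL gA (\<lambda>x y. \<sigma> (a \<cdot> S x) \<cdot> y \<oplus>\<^bsub>A\<^esub> \<sigma> (a' \<cdot> S x) \<cdot> y) b"
      unfolding avg_def
      by (rule LB.sum_cong[OF G bal_avg_summand[OF aa] _ LB.gamma_closed[OF b]])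
        (use a a' in \<open>simp_all add: A_simps sigma_add\<close>)
    then show "avg (a \<oplus>\<^bsub>A\<^esub> a') b = avg a b \<otimes>\<^bsub>gA\<^esub> avg a' b"
      unfolding avg_def using LB.sum_mult_target[OF G bal_avg_summand[OF a] bal_avg_summand[OF a'] LB.gamma_closed[OF b]]
      by simp
  next
    fix r assume r: "r \<in> carrier R"
    have ra: "a \<cdot> s\<^sub>R r \<in> carrier A" using a r by simp
    have "avg a (b \<cdot> t\<^sub>R r) = SumL gA (\<lambda>x y. \<sigma> (a \<cdot> S (x \<cdot> t\<^sub>R r)) \<cdot> y) b"
      unfolding avg_def
      using LB.sum_s_right[OF G bal_avg_summand[OF a] b, of "\<pi>\<^sub>L (t\<^sub>R r)"] r by (simp add: sL_piL_tR)
    also have "\<dots> = avg (a \<cdot> s\<^sub>R r) b"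
      unfolding avg_def
      by (rule LB.sum_cong[OF G bal_avg_summand[OF ra] _ LB.gamma_closed[OF b], symmetric])
        (use a r in \<open>simp_all add: S_simps A_simps\<close>)
    finally show "avg (a \<cdot> s\<^sub>R r) b = avg a (b \<cdot> t\<^sub>R r)" ..
  }
qed

lemma avg_sR:
  assumes a: "a \<in> carrier A" and b: "b \<in> carrier A" and r: "r \<in> carrier R"
  shows "avg a (b \<cdot> s\<^sub>R r) = avg a b \<cdot> s\<^sub>R r"
proof -
  note G = LB.comm_group_A and sr = R_closed(2)[OF r]
  have "avg a (b \<cdot> s\<^sub>R r) = SumL gA (\<lambda>x y. \<sigma> (a \<cdot> S x) \<cdot> (y \<cdot> s\<^sub>R r)) b"
    unfolding avg_def
    using LB.sum_t_right[OF G bal_avg_summand[OF a] b, of "\<pi>\<^sub>L (s\<^sub>R r)"] r by (simp add: tL_piL_sR)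
  also have "\<dots> = SumL gA (\<lambda>x y. \<sigma> (a \<cdot> S x) \<cdot> y \<cdot> s\<^sub>R r) b"
    by (rule LB.sum_cong[OF G LB.bal_hom[OF right_mult_hom[OF sr] bal_avg_summand[OF a]] _ LB.gamma_closed[OF b], symmetric])
      (use a r in \<open>simp_all add: A_simps\<close>)
  also have "\<dots> = avg a b \<cdot> s\<^sub>R r"
    unfolding avg_def
    by (rule LB.sum_hom[OF G G right_mult_hom[OF sr] bal_avg_summand[OF a] LB.gamma_closed[OF b], symmetric])
  finally show ?thesis .
qed

text \<open>Mixed coassociativity gives \<open>\<sigma>(v (u_1)^1 S((u_1)^2)) u_2\<close>, which the
  antipode axiom turns into \<open>\<sigma>(v s\<^sub>L(\<pi>\<^sub>L(u_1))) u_2\<close>; linearity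
  of \<sigma> releases the scalar and the counit restores \<open>u\<close>.\<close>

lemma avg_gal:
  assumes v: "v \<in> carrier A" and u: "u \<in> carrier A"
  shows "SumR gA (\<lambda>x y. avg (v \<cdot> x) y) u = \<sigma> v \<cdot> u"
proof -
  note G = LB.comm_group_A
  have h: "bal_RL gA (\<lambda>m n p. \<sigma> (v \<cdot> m \<cdot> S n) \<cdot> p)"
    by (rule bal_RL_I) (use v in \<open>simp_all add: sigma_add sigma_sL'' S_simps A_simps\<close>)
  have "SumR gA (\<lambda>x y. avg (v \<cdot> x) y) u = SumL gA (\<lambda>q p. SumR gA (\<lambda>m n. \<sigma> (v \<cdot> m \<cdot> S n) \<cdot> p) q) u"
    unfolding avg_def by (rule SumR_SumL_RL[OF G h u, symmetric])
  also have "\<dots> = SumL gA (\<lambda>q p. \<sigma> v \<cdot> (s\<^sub>L (\<pi>\<^sub>L q) \<cdot> p)) u"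
  proof (rule LB.sum_cong[OF G bal_SumR_RL[OF G h] _ LB.gamma_closed[OF u]])
    fix q p assume p: "p \<in> carrier A" and q: "q \<in> carrier A"
    have hm: "(\<lambda>c. \<sigma> (v \<cdot> c) \<cdot> p) \<in> hom gA gA"
      using p v by (auto simp: hom_def sigma_add A_simps)
    have "SumR gA (\<lambda>m n. \<sigma> (v \<cdot> m \<cdot> S n) \<cdot> p) q = SumR gA (\<lambda>m n. \<sigma> (v \<cdot> (m \<cdot> S n)) \<cdot> p) q"
      by (rule R_sum_cong[OF G R_bal_hom[OF hm bal_antipode_R] _ R_gamma_closed[OF q], symmetric])
        (use v in \<open>simp add: A_simps\<close>)
    also have "\<dots> = \<sigma> (v \<cdot> s\<^sub>L (\<pi>\<^sub>L q)) \<cdot> p"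
      using R_sum_hom[OF G G hm bal_antipode_R R_gamma_closed[OF q]] by (simp add: SumR_antipode q)
    finally show "SumR gA (\<lambda>m n. \<sigma> (v \<cdot> m \<cdot> S n) \<cdot> p) q = \<sigma> v \<cdot> (s\<^sub>L (\<pi>\<^sub>L q) \<cdot> p)"
      using p q v by (simp add: sigma_sL LB.pi_closed A_simps)
  qed
  also have "\<dots> = \<sigma> v \<cdot> u"
    using LB.sum_hom[OF G G left_mult_hom[of "\<sigma> v"] LB.bal_pi_left LB.gamma_closed[OF u]] u v
    by (simp add: LB.sum_counit_left)
  finally show ?thesis .
qed

definition p :: "('a \<times> 'a \<Rightarrow>\<^sub>0 int) set \<Rightarrow> 'a"
  where "p = tlift gA (\<lambda>(x, y). avg x y)"

lemma p_hom: "p \<in> hom TR gA"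
  unfolding p_def by (rule R_sum_is_hom[OF LB.comm_group_A bal_avg])

lemma p_pt: "a \<in> carrier A \<Longrightarrow> b \<in> carrier A \<Longrightarrow> p (ptR a b) = avg a b"
  unfolding p_def by (rule R_sum_pt[OF LB.comm_group_A bal_avg])

lemma p_gal:
  assumes v: "v \<in> carrier A" and u: "u \<in> carrier A"
  shows "p (galR v u) = \<sigma> v \<cdot> u"
proof -
  have b: "balR gA (\<lambda>x y. avg (v \<cdot> x) y)"
    by (rule R_bal_compose[OF R_left_mult_r[OF v] lmod_hom_id bal_avg])
  have "p (galR v u) = SumR gA (\<lambda>x y. p (ptR (v \<cdot> x) y)) u"
    by (rule hom_galR[OF LB.comm_group_A p_hom v u])
  also have "\<dots> = SumR gA (\<lambda>x y. avg (v \<cdot> x) y) u"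
    by (rule R_sum_cong[OF LB.comm_group_A b _ R_gamma_closed[OF u], symmetric]) (use v in \<open>simp add: p_pt\<close>)
  finally show ?thesis using avg_gal[OF v u] by simp
qed

lemma p_gamma: "c \<in> carrier A \<Longrightarrow> p (\<gamma>\<^sub>R c) = c"
proof -
  assume c: "c \<in> carrier A"
  have "galR \<one>\<^bsub>A\<^esub> c = SumR TR ptR c"
    unfolding galR_def
    by (rule R_sum_cong[OF R_comm_group_T balR_pt_mult _ R_gamma_closed[OF c]]) simp_all
  then have "\<gamma>\<^sub>R c = galR \<one>\<^bsub>A\<^esub> c" using tlift_pt_gamma(2)[OF c] by simp
  then show "p (\<gamma>\<^sub>R c) = c" using c by (simp add: p_gal sigma_one)
qed

lemma p_right:
  assumes X: "X \<in> carrier TR" and r: "r \<in> carrier R"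
  shows "p (tmap R (up_r A s\<^sub>R) (up_l A t\<^sub>R) (\<lambda>x. x) (\<lambda>y. y \<cdot> s\<^sub>R r) X) = p X \<cdot> s\<^sub>R r"
proof -
  note G = LB.comm_group_A
  note m = R_tmap_hom[OF R_pair rmod_hom_id R_right_s[OF r]]
  have "(p \<circ> tmap R (up_r A s\<^sub>R) (up_l A t\<^sub>R) (\<lambda>x. x) (\<lambda>y. y \<cdot> s\<^sub>R r)) X = ((\<lambda>x. x \<cdot> s\<^sub>R r) \<circ> p) X"
    by (rule R_sum_ext[OF comm_group.axioms(2)[OF G] hom_compose[OF m p_hom]
          hom_compose[OF p_hom right_mult_hom[OF R_closed(2)[OF r]]] _ X])
      (use r in \<open>simp_all add: R_tmap_pt[OF R_pair rmod_hom_id R_right_s[OF r]] p_pt avg_sR\<close>)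
  then show ?thesis by simp
qed

text \<open>As for the left coproduct, the scalar is out of reach on a pure tensor but is absorbed
  by \<open>u\<close> on \<open>galR v u\<close>.\<close>

lemma p_left:
  assumes X: "X \<in> carrier TR" and r: "r \<in> carrier R"
  shows "p (tmap R (up_r A s\<^sub>R) (up_l A t\<^sub>R) (\<lambda>x. x \<cdot> t\<^sub>R r) (\<lambda>y. y) X) = p X \<cdot> t\<^sub>R r"
proof -
  note G = LB.comm_group_A and T = R_comm_group_T
  let ?m = "tmap R (up_r A s\<^sub>R) (up_l A t\<^sub>R) (\<lambda>x. x \<cdot> t\<^sub>R r) (\<lambda>y. y)"
  note m = R_tmap_hom[OF R_pair R_right_t[OF r] lmod_hom_id]
  have gal: "?m (galR v u) = galR v (u \<cdot> t\<^sub>R r)" if v: "v \<in> carrier A" and u: "u \<in> carrier A" for u v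
  proof -
    have "?m (galR v u) = SumR TR (\<lambda>x y. ?m (ptR (v \<cdot> x) y)) u"
      by (rule hom_galR[OF T m v u])
    also have "\<dots> = SumR TR (\<lambda>x y. ptR (v \<cdot> (x \<cdot> t\<^sub>R r)) y) u"
      by (rule R_sum_cong[OF T R_bal_hom[OF m balR_pt_mult[OF v]] _ R_gamma_closed[OF u]])
        (use v r in \<open>simp add: R_tmap_pt[OF R_pair R_right_t[OF r] lmod_hom_id] A_simps\<close>)
    also have "\<dots> = galR v (u \<cdot> t\<^sub>R r)"
      unfolding galR_def by (rule R_sum_t_right[OF T balR_pt_mult[OF v] u r, symmetric])
    finally show ?thesis .
  qed
  have "(p \<circ> ?m) X = ((\<lambda>x. x \<cdot> t\<^sub>R r) \<circ> p) X"
    by (rule galR_ext[OF G hom_compose[OF m p_hom] hom_compose[OF p_hom right_mult_hom[OF R_closed(1)[OF r]]] _ X])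
      (use r in \<open>simp add: gal p_gal A_simps\<close>)
  then show ?thesis by simp
qed

lemma gamma_p_gal:
  assumes v: "v \<in> carrier A" and u: "u \<in> carrier A"
  shows "\<gamma>\<^sub>R (p (galR v u)) = SumR TR (\<lambda>x y. ptR (\<sigma> v \<cdot> x) y) u"
  using R_sum_t_left[OF R_comm_group_T R_balanced_pt u, of "\<phi> v"] tlift_pt_gamma(2)[of "\<sigma> v \<cdot> u"] u v
  by (simp add: p_gal \<sigma>_def phi_simps)

lemma gamma_p_hom: "\<gamma>\<^sub>R \<circ> p \<in> hom TR TR"
  using hom_compose[OF p_hom, of \<gamma>\<^sub>R TR] R_gamma_hom by (simp add: hom_def)

text \<open>On \<open>galR v u\<close> the right-hand side is p(v u^1 \<otimes> u^2) \<otimes> u^3,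
  whose first leg is given by \<open>avg_gal\<close>; compare with
  \<open>gamma_p_gal\<close>.\<close>

lemma p_colinear_right:
  assumes X: "X \<in> carrier TR"
  shows "\<gamma>\<^sub>R (p X) = tlift TR (\<lambda>(x, y, z). ptR (p (ptR x y)) z)
    (ten_right R (up_r A s\<^sub>R) (up_l A t\<^sub>R) R (up_r A s\<^sub>R) (up_l A t\<^sub>R) \<gamma>\<^sub>R X)" (is "_ = ?F X")
proof -
  note T = R_comm_group_T and G = LB.comm_group_A
  note P = R_bal_closed[OF bal_avg, simplified] R_bal_add_left[OF bal_avg, simplified]
    R_bal_add_right[OF bal_avg, simplified] R_bal_act[OF bal_avg]
  have h: "balanced3 R (up_r A s\<^sub>R) (up_l A t\<^sub>R) R (up_r A s\<^sub>R) (up_l A t\<^sub>R) TR (\<lambda>x y z. ptR (p (ptR x y)) z)"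
    by (rule R_bal3I)
      (simp_all add: p_pt hom_mult[OF p_hom, simplified] R_pt_closed R_pt_add_left R_pt_add_right R_pt_act P avg_sR)
  have F_hom: "?F \<in> hom TR TR"
    using hom_compose[OF R_ten_right_gamma_hom R_sum3_hom[OF T h]] by (simp add: comp_def)
  have F_pt: "?F (ptR x c) = SumR TR (\<lambda>m n. ptR (p (ptR x m)) n) c" if "x \<in> carrier A" "c \<in> carrier A" for x c
    using R_sum3_ten_right[OF T h R_pt_closed[OF that]] R_sum_pt[OF T R_nest_right[OF T h] that] by simp
  have "(\<gamma>\<^sub>R \<circ> p) X = ?F X"
  proof (rule galR_ext[OF T gamma_p_hom F_hom _ X])
    fix u v assume u: "u \<in> carrier A" and v: "v \<in> carrier A"
    note X = R_gamma_closed[OF u]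
    have h': "balanced3 R (up_r A s\<^sub>R) (up_l A t\<^sub>R) R (up_r A s\<^sub>R) (up_l A t\<^sub>R) TR (\<lambda>x m n. ptR (avg (v \<cdot> x) m) n)"
      by (rule R_bal3I)
        (use v in \<open>simp_all add: R_pt_closed R_pt_add_left R_pt_add_right R_pt_act P avg_sR A_simps flip: P(4)\<close>)
    have b: "balR gA (\<lambda>x y. avg (v \<cdot> x) y)"
      by (rule R_bal_compose[OF R_left_mult_r[OF v] lmod_hom_id bal_avg])
    have hp: "(\<lambda>c. ptR c n) \<in> hom gA TR" if "n \<in> carrier A" for n
      using that by (auto simp: hom_def R_pt_closed R_pt_add_left)
    have "?F (galR v u) = SumR TR (\<lambda>x y. ?F (ptR (v \<cdot> x) y)) u"
      by (rule hom_galR[OF T F_hom v u])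
    also have "\<dots> = SumR TR (\<lambda>x y. SumR TR (\<lambda>m n. ptR (avg (v \<cdot> x) m) n) y) u"
    proof (rule R_sum_cong[OF T R_bal_hom[OF F_hom balR_pt_mult[OF v]] _ X])
      fix x y assume x: "x \<in> carrier A" and y: "y \<in> carrier A"
      then have vx: "v \<cdot> x \<in> carrier A" using v by simp
      have b1: "balR TR (\<lambda>m n. ptR (avg (v \<cdot> x) m) n)"
        using h' x by (simp add: balanced3_def)
      have "?F (ptR (v \<cdot> x) y) = SumR TR (\<lambda>m n. ptR (p (ptR (v \<cdot> x) m)) n) y"
        by (rule F_pt[OF vx y])
      also have "\<dots> = SumR TR (\<lambda>m n. ptR (avg (v \<cdot> x) m) n) y"
        by (rule R_sum_cong[OF T b1 _ R_gamma_closed[OF y], symmetric]) (use vx in \<open>simp add: p_pt\<close>)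
      finally show "?F (ptR (v \<cdot> x) y) = SumR TR (\<lambda>m n. ptR (avg (v \<cdot> x) m) n) y" .
    qed
    also have "\<dots> = SumR TR (\<lambda>q n. SumR TR (\<lambda>x m. ptR (avg (v \<cdot> x) m) n) q) u"
      by (rule R_sum_coassoc[OF T h' u, symmetric])
    also have "\<dots> = SumR TR (\<lambda>q n. ptR (\<sigma> v \<cdot> q) n) u"
    proof (rule R_sum_cong[OF T balR_pt_mult _ X, symmetric])
      show "\<sigma> v \<in> carrier A" using v by simp
      fix q n assume q: "q \<in> carrier A" and n: "n \<in> carrier A"
      show "ptR (\<sigma> v \<cdot> q) n = SumR TR (\<lambda>x m. ptR (avg (v \<cdot> x) m) n) q"
        unfolding avg_gal[OF v q, symmetric] by (rule R_sum_hom[OF G T hp[OF n] b R_gamma_closed[OF q]])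
    qed
    finally show "(\<gamma>\<^sub>R \<circ> p) (galR v u) = ?F (galR v u)"
      using gamma_p_gal[OF v u] by simp
  qed
  then show ?thesis by simp
qed

text \<open>On \<open>galR v u\<close> the chain is \<open>v^1 u^1 \<otimes> p(v^2 u^2 \<otimes>
  u^3) = v^1 u^1 \<otimes> t\<^sub>R(\<phi>(v^2)) u^2 = v^1 s\<^sub>R(\<phi>(v^2)) u^1 \<otimes>
  u^2\<close>, the last step being the Takeuchi condition for \<open>u\<close>; the integral
  equation at \<open>v\<close> then gives \<open>\<sigma>(v)\<close> in front.\<close>

lemma p_colinear_left:
  assumes X: "X \<in> carrier TR"
  shows "\<gamma>\<^sub>R (p X) = tlift TR (\<lambda>(x, y, z). ptR x (p (ptR y z)))
    (ten_left R (up_r A s\<^sub>R) (up_l A t\<^sub>R) R (up_r A s\<^sub>R) (up_l A t\<^sub>R) \<gamma>\<^sub>R X)" (is "_ = ?F X")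
proof -
  note T = R_comm_group_T and G = LB.comm_group_A
  note P = R_bal_closed[OF bal_avg, simplified] R_bal_add_left[OF bal_avg, simplified]
    R_bal_add_right[OF bal_avg, simplified] R_bal_act[OF bal_avg]
  have avg_tR: "avg (x \<cdot> t\<^sub>R r) y = avg x y \<cdot> t\<^sub>R r" if "x \<in> carrier A" "y \<in> carrier A" "r \<in> carrier R" for x y r
    using p_left[OF R_pt_closed[OF that(1,2)] that(3)] that
      R_tmap_pt[OF R_pair R_right_t[OF that(3)] lmod_hom_id that(1,2)]
    by (simp add: p_pt)
  have avg_tR': "avg (z \<cdot> (x \<cdot> t\<^sub>R r)) y = avg (z \<cdot> x) y \<cdot> t\<^sub>R r"
    if "z \<in> carrier A" "x \<in> carrier A" "y \<in> carrier A" "r \<in> carrier R" for x y z r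
    using avg_tR[of "z \<cdot> x" y r] that by (simp add: A_simps)
  have avg_act': "avg (z \<cdot> (x \<cdot> s\<^sub>R r)) y = avg (z \<cdot> x) (y \<cdot> t\<^sub>R r)"
    if "z \<in> carrier A" "x \<in> carrier A" "y \<in> carrier A" "r \<in> carrier R" for x y z r
    using P(4)[of "z \<cdot> x" y r] that by (simp add: A_simps)
  have pt_act': "ptR (z \<cdot> (x \<cdot> s\<^sub>R r)) y = ptR (z \<cdot> x) (y \<cdot> t\<^sub>R r)"
    if "z \<in> carrier A" "x \<in> carrier A" "y \<in> carrier A" "r \<in> carrier R" for x y z r
    using R_pt_act[of "z \<cdot> x" r y] that by (simp add: A_simps)
  have h: "balanced3 R (up_r A s\<^sub>R) (up_l A t\<^sub>R) R (up_r A s\<^sub>R) (up_l A t\<^sub>R) TR (\<lambda>x y z. ptR x (p (ptR y z)))"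
    by (rule R_bal3I)
      (simp_all add: p_pt hom_mult[OF p_hom, simplified] R_pt_closed R_pt_add_left R_pt_add_right P avg_tR R_pt_act)
  have F_hom: "?F \<in> hom TR TR"
    using hom_compose[OF R_ten_left_gamma_hom R_sum3_hom[OF T h]] by (simp add: comp_def)
  have F_pt: "?F (ptR c y) = SumR TR (\<lambda>m n. ptR m (p (ptR n y))) c" if "c \<in> carrier A" "y \<in> carrier A" for c y
    using R_sum3_ten_left[OF T h R_pt_closed[OF that]] R_sum_pt[OF T R_nest_left[OF T h] that] by simp
  have "(\<gamma>\<^sub>R \<circ> p) X = ?F X"
  proof (rule galR_ext[OF T gamma_p_hom F_hom _ X])
    fix u v assume u: "u \<in> carrier A" and v: "v \<in> carrier A"
    note U = R_gamma_closed[OF u] and V = R_gamma_closed[OF v]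
    have by': "balR TR (\<lambda>m n. ptR m (avg n y))" if "y \<in> carrier A" for y
      by (rule R_balI) (use that in \<open>simp_all add: R_pt_closed R_pt_add_left R_pt_add_right P avg_tR R_pt_act\<close>)
    have h': "balanced3 R (up_r A s\<^sub>R) (up_l A t\<^sub>R) R (up_r A s\<^sub>R) (up_l A t\<^sub>R) TR
        (\<lambda>z w y. ptR (z' \<cdot> z) (avg (w' \<cdot> w) y))" if "z' \<in> carrier A" "w' \<in> carrier A" for z' w'
      by (rule R_bal3I)
        (use that in \<open>simp_all add: R_pt_closed R_pt_add_left R_pt_add_right P avg_tR' avg_act' pt_act' A_simps\<close>)
    have f: "balR TR (\<lambda>x y. SumR TR (\<lambda>z w. ptR (z' \<cdot> z) (avg (w' \<cdot> w) y)) x)"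
      if "z' \<in> carrier A" "w' \<in> carrier A" for z' w'
      by (rule R_nest_left[OF T h'[OF that]])
    have f': "balR TR (\<lambda>z' w'. SumR TR (\<lambda>z w. ptR (z' \<cdot> z) (avg (w' \<cdot> w) y)) x)"
      if "x \<in> carrier A" "y \<in> carrier A" for x y
      by (rule R_bal_mult[OF T by'[OF that(2)] that(1)])
    have b: "balR gA (\<lambda>x y. avg (v \<cdot> x) y)" if "v \<in> carrier A" for v
      by (rule R_bal_compose[OF R_left_mult_r[OF that] lmod_hom_id bal_avg])
    have f2: "balR TR (\<lambda>z q. ptR (z' \<cdot> s\<^sub>R (\<phi> w') \<cdot> z) q)" if "z' \<in> carrier A" "w' \<in> carrier A" for z' w'
      by (rule balR_pt_mult) (use that in \<open>simp add: phi_simps\<close>)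
    have hp: "(\<lambda>c. ptR (c \<cdot> z) q) \<in> hom gA TR" if "z \<in> carrier A" "q \<in> carrier A" for z q
      using that by (auto simp: hom_def R_pt_closed R_pt_add_left A_simps)
    have f2': "balR TR (\<lambda>z' w'. ptR (z' \<cdot> s\<^sub>R (\<phi> w') \<cdot> z) q)" if "z \<in> carrier A" "q \<in> carrier A" for z q
      by (rule R_bal_hom[OF hp[OF that] bal_phi])
    have "?F (galR v u) = SumR TR (\<lambda>x y. ?F (ptR (v \<cdot> x) y)) u"
      by (rule hom_galR[OF T F_hom v u])
    also have "\<dots> = SumR TR (\<lambda>x y. SumR TR (\<lambda>z' w'. SumR TR (\<lambda>z w. ptR (z' \<cdot> z) (avg (w' \<cdot> w) y)) x) v) u"
    proof (rule R_sum_cong[OF T R_bal_hom[OF F_hom balR_pt_mult[OF v]] _ U])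
      fix x y assume x: "x \<in> carrier A" and y: "y \<in> carrier A"
      then have vx: "v \<cdot> x \<in> carrier A" using v by simp
      have "?F (ptR (v \<cdot> x) y) = SumR TR (\<lambda>m n. ptR m (p (ptR n y))) (v \<cdot> x)"
        by (rule F_pt[OF vx y])
      also have "\<dots> = SumR TR (\<lambda>m n. ptR m (avg n y)) (v \<cdot> x)"
        by (rule R_sum_cong[OF T by'[OF y] _ R_gamma_closed[OF vx], symmetric]) (use y in \<open>simp add: p_pt\<close>)
      also have "\<dots> = SumR TR (\<lambda>z' w'. SumR TR (\<lambda>z w. ptR (z' \<cdot> z) (avg (w' \<cdot> w) y)) x) v"
        by (rule R_sum_mult[OF T by'[OF y] x v])
      finally show "?F (ptR (v \<cdot> x) y) =
        SumR TR (\<lambda>z' w'. SumR TR (\<lambda>z w. ptR (z' \<cdot> z) (avg (w' \<cdot> w) y)) x) v" .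
    qed
    also have "\<dots> = SumR TR (\<lambda>z' w'. SumR TR (\<lambda>x y. SumR TR (\<lambda>z w. ptR (z' \<cdot> z) (avg (w' \<cdot> w) y)) x) u) v"
      by (rule R_sum_Fubini[OF T f f' U V])
    also have "\<dots> = SumR TR (\<lambda>z' w'. SumR TR (\<lambda>z q. ptR (z' \<cdot> s\<^sub>R (\<phi> w') \<cdot> z) q) u) v"
    proof (rule R_sum_cong[OF T _ _ V, symmetric])
      fix z' w' assume z': "z' \<in> carrier A" and w': "w' \<in> carrier A"
      have "SumR TR (\<lambda>x y. SumR TR (\<lambda>z w. ptR (z' \<cdot> z) (avg (w' \<cdot> w) y)) x) u =
          SumR TR (\<lambda>z q. SumR TR (\<lambda>w y. ptR (z' \<cdot> z) (avg (w' \<cdot> w) y)) q) u"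
        by (rule R_sum_coassoc[OF T h'[OF z' w'] u])
      also have "\<dots> = SumR TR (\<lambda>z q. ptR (z' \<cdot> z) (t\<^sub>R (\<phi> w') \<cdot> q)) u"
      proof (rule R_sum_cong[OF T R_bal_left_mult[OF T R_balanced_pt z'] _ U, symmetric])
        show "t\<^sub>R (\<phi> w') \<in> carrier A" using w' by (simp add: phi_simps)
        fix z q assume z: "z \<in> carrier A" and q: "q \<in> carrier A"
        have hc: "ptR (z' \<cdot> z) \<in> hom gA TR"
          using z z' by (auto simp: hom_def R_pt_closed R_pt_add_right)
        show "ptR (z' \<cdot> z) (t\<^sub>R (\<phi> w') \<cdot> q) = SumR TR (\<lambda>w y. ptR (z' \<cdot> z) (avg (w' \<cdot> w) y)) q"
          unfolding \<sigma>_def[symmetric] avg_gal[OF w' q, symmetric]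
          by (rule R_sum_hom[OF G T hc b[OF w'] R_gamma_closed[OF q]])
      qed
      also have "\<dots> = SumR TR (\<lambda>z q. ptR (z' \<cdot> (s\<^sub>R (\<phi> w') \<cdot> z)) q) u"
        by (rule R_sum_takeuchi[OF T balR_pt_mult[OF z'] u, symmetric]) (use w' in \<open>simp add: phi_simps\<close>)
      also have "\<dots> = SumR TR (\<lambda>z q. ptR (z' \<cdot> s\<^sub>R (\<phi> w') \<cdot> z) q) u"
        by (rule R_sum_cong[OF T f2[OF z' w'] _ U, symmetric]) (use z' w' in \<open>simp add: A_simps phi_simps\<close>)
      finally show "SumR TR (\<lambda>z q. ptR (z' \<cdot> s\<^sub>R (\<phi> w') \<cdot> z) q) u =
        SumR TR (\<lambda>x y. SumR TR (\<lambda>z w. ptR (z' \<cdot> z) (avg (w' \<cdot> w) y)) x) u" ..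
    next
      show "balR TR (\<lambda>z' w'. SumR TR (\<lambda>z q. ptR (z' \<cdot> s\<^sub>R (\<phi> w') \<cdot> z) q) u)"
        by (rule R_bal_sum[OF T f2 f2' U])
    qed
    also have "\<dots> = SumR TR (\<lambda>z q. SumR TR (\<lambda>z' w'. ptR (z' \<cdot> s\<^sub>R (\<phi> w') \<cdot> z) q) v) u"
      by (rule R_sum_Fubini[OF T f2 f2' U V, symmetric])
    also have "\<dots> = SumR TR (\<lambda>z q. ptR (\<sigma> v \<cdot> z) q) u"
    proof (rule R_sum_cong[OF T balR_pt_mult _ U, symmetric])
      show "\<sigma> v \<in> carrier A" using v by simp
      fix z q assume z: "z \<in> carrier A" and q: "q \<in> carrier A"
      show "ptR (\<sigma> v \<cdot> z) q = SumR TR (\<lambda>z' w'. ptR (z' \<cdot> s\<^sub>R (\<phi> w') \<cdot> z) q) v"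
        unfolding \<sigma>_def phi_int[OF v, symmetric] by (rule R_sum_hom[OF G T hp[OF z q] bal_phi V])
    qed
    finally show "(\<gamma>\<^sub>R \<circ> p) (galR v u) = ?F (galR v u)"
      using gamma_p_gal[OF v u] by simp
  qed
  then show ?thesis by simp
qed

theorem coseparable: "coseparable R (R_coring A s\<^sub>R t\<^sub>R \<gamma>\<^sub>R \<pi>\<^sub>R)"
  unfolding coseparable_def
proof (intro bexI[of _ p] ballI)
  show "p (comult (R_coring A s\<^sub>R t\<^sub>R \<gamma>\<^sub>R \<pi>\<^sub>R) c) = c" if "c \<in> carrier (crm (R_coring A s\<^sub>R t\<^sub>R \<gamma>\<^sub>R \<pi>\<^sub>R))" for c
    using that p_gamma by simp
  have "p \<in> hom TR (up_r A s\<^sub>R)" using p_hom by (simp add: hom_def)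
  then show "p \<in> square_bicomod_hom R (R_coring A s\<^sub>R t\<^sub>R \<gamma>\<^sub>R \<pi>\<^sub>R)"
    unfolding square_bicomod_hom_def coring_simps module_simps
    using p_left p_right p_colinear_left p_colinear_right by blast
qed

end

section \<open>The two corings of a Hopf algebroid and the circle of implications\<close>

context hopf_algebroid
begin

abbreviation "CL \<equiv> L_coring A s\<^sub>L t\<^sub>L \<gamma>\<^sub>L \<pi>\<^sub>L"
abbreviation "CR \<equiv> R_coring A s\<^sub>R t\<^sub>R \<gamma>\<^sub>R \<pi>\<^sub>R"

lemma is_coring_CL: "is_coring L CL"
  by (rule LB.is_coring_axioms)

lemma is_coring_CR: "is_coring R CR"
  using RB.is_coring_axioms by (simp add: L_coring_op_alg)

lemma grouplike_CL: "grouplike L CL \<one>\<^bsub>A\<^esub>"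
  by (intro grouplike.intro is_coring_CL grouplike_axioms.intro) (simp_all add: LB.comult_one LB.counit_one)

lemma grouplike_CR: "grouplike R CR \<one>\<^bsub>A\<^esub>"
  using RB.comult_one RB.counit_one
  by (intro grouplike.intro is_coring_CR grouplike_axioms.intro) simp_all

text \<open>The unit of \<open>A\<close> is grouplike for both corings. For the left one its right
  and left multiples by l are \<open>t\<^sub>L(l)\<close> and \<open>s\<^sub>L(l)\<close>, for the
  right one those by r are \<open>s\<^sub>R(r)\<close> and \<open>t\<^sub>R(r)\<close>; this decides
  which structure map belongs to which side.\<close>

sublocale CLr: grouplike_right L CL "\<one>\<^bsub>A\<^esub>" t\<^sub>L
  by (intro grouplike_right.intro grouplike_CL grouplike_right_axioms.intro) simp

sublocale CLl: grouplike_left L CL "\<one>\<^bsub>A\<^esub>" s\<^sub>L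
  by (intro grouplike_left.intro grouplike_CL grouplike_left_axioms.intro) simp

sublocale CRr: grouplike_right R CR "\<one>\<^bsub>A\<^esub>" s\<^sub>R
  by (intro grouplike_right.intro grouplike_CR grouplike_right_axioms.intro) simp

sublocale CRl: grouplike_left R CR "\<one>\<^bsub>A\<^esub>" t\<^sub>R
  by (intro grouplike_left.intro grouplike_CR grouplike_left_axioms.intro) simp

lemma splits_imp_left_s_integral:
  assumes "splits_rcomod R CR (base_rcomod R CR s\<^sub>R) (rcomod_self CR) s\<^sub>R"
  shows "\<exists>\<phi> \<in> left_s_integrals A R s\<^sub>R t\<^sub>R \<gamma>\<^sub>R. \<phi> \<one>\<^bsub>A\<^esub> = \<one>\<^bsub>R\<^esub>"
  using CRr.splits_imp_integral[OF assms LB.comm_group_A]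
  unfolding left_s_integrals_def by simp blast

lemma splits_imp_left_t_integral:
  assumes "splits_lcomod R CR (base_lcomod R CR t\<^sub>R) (lcomod_self CR) t\<^sub>R"
  shows "\<exists>\<phi> \<in> left_t_integrals A R s\<^sub>R t\<^sub>R \<gamma>\<^sub>R. \<phi> \<one>\<^bsub>A\<^esub> = \<one>\<^bsub>R\<^esub>"
  using CRl.splits_imp_integral[OF assms LB.comm_group_A]
  unfolding left_t_integrals_def by simp blast

lemma splits_imp_right_s_integral:
  assumes "splits_lcomod L CL (base_lcomod L CL s\<^sub>L) (lcomod_self CL) s\<^sub>L"
  shows "\<exists>\<phi> \<in> right_s_integrals A L s\<^sub>L t\<^sub>L \<gamma>\<^sub>L. \<phi> \<one>\<^bsub>A\<^esub> = \<one>\<^bsub>L\<^esub>"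
  using CLl.splits_imp_integral[OF assms LB.comm_group_A]
  unfolding right_s_integrals_def by simp blast

lemma splits_imp_right_t_integral:
  assumes "splits_rcomod L CL (base_rcomod L CL t\<^sub>L) (rcomod_self CL) t\<^sub>L"
  shows "\<exists>\<phi> \<in> right_t_integrals A L s\<^sub>L t\<^sub>L \<gamma>\<^sub>L. \<phi> \<one>\<^bsub>A\<^esub> = \<one>\<^bsub>L\<^esub>"
  using CLr.splits_imp_integral[OF assms LB.comm_group_A]
  unfolding right_t_integrals_def by simp blast

lemma right_t_integral_imp_coseparable:
  assumes "\<exists>\<rho> \<in> right_t_integrals A L s\<^sub>L t\<^sub>L \<gamma>\<^sub>L. \<rho> \<one>\<^bsub>A\<^esub> = \<one>\<^bsub>L\<^esub>"
  shows "coseparable L CL"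
proof -
  obtain \<rho> where "\<rho> \<in> right_t_integrals A L s\<^sub>L t\<^sub>L \<gamma>\<^sub>L" "\<rho> \<one>\<^bsub>A\<^esub> = \<one>\<^bsub>L\<^esub>" using assms by blast
  then interpret normalized_right_t_integral k A L s\<^sub>L t\<^sub>L \<gamma>\<^sub>L \<pi>\<^sub>L R s\<^sub>R t\<^sub>R \<gamma>\<^sub>R \<pi>\<^sub>R S \<rho>
    by unfold_locales
  show ?thesis by (rule coseparable)
qed

lemma left_t_integral_imp_coseparable:
  assumes "\<exists>\<phi> \<in> left_t_integrals A R s\<^sub>R t\<^sub>R \<gamma>\<^sub>R. \<phi> \<one>\<^bsub>A\<^esub> = \<one>\<^bsub>R\<^esub>"
  shows "coseparable R CR"
proof -
  obtain \<phi> where "\<phi> \<in> left_t_integrals A R s\<^sub>R t\<^sub>R \<gamma>\<^sub>R" "\<phi> \<one>\<^bsub>A\<^esub> = \<one>\<^bsub>R\<^esub>" using assms by blast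
  then interpret normalized_left_t_integral k A L s\<^sub>L t\<^sub>L \<gamma>\<^sub>L \<pi>\<^sub>L R s\<^sub>R t\<^sub>R \<gamma>\<^sub>R \<pi>\<^sub>R S \<phi>
    by unfold_locales
  show ?thesis by (rule coseparable)
qed

end

text \<open>Four chains lead from coseparability over injectivity and splitting to integrals. Chains
  2 and 4 end in t-integrals and return to the coring where they start; chains 1 and 3 end in
  s-integrals and pass to the other coring through \<open>i4\<close> and \<open>i2\<close>. The two
  crossings make \<open>c1\<close> and \<open>c2\<close> equivalent.\<close>

lemma all_equivalent_dual_Maschke:
  assumes "c1 \<Longrightarrow> r1" "c1 \<Longrightarrow> r2" "c2 \<Longrightarrow> r3" "c2 \<Longrightarrow> r4"
    and "r1 \<Longrightarrow> s1" "r2 \<Longrightarrow> s2" "r3 \<Longrightarrow> s3" "r4 \<Longrightarrow> s4"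
    and "s1 \<Longrightarrow> i1" "s2 \<Longrightarrow> i2" "s3 \<Longrightarrow> i3" "s4 \<Longrightarrow> i4"
    and "i1 \<Longrightarrow> i4" "i3 \<Longrightarrow> i2" "i4 \<Longrightarrow> c2" "i2 \<Longrightarrow> c1"
  shows "all_equivalent [c1, c2, r1, r2, r3, r4, i1, i2, i3, i4, s1, s2, s3, s4]"
proof -
  have "c2 = c1" "r1 = c1" "r2 = c1" "r3 = c1" "r4 = c1" "i1 = c1" "i2 = c1" "i3 = c1" "i4 = c1"
    "s1 = c1" "s2 = c1" "s3 = c1" "s4 = c1"
    using assms by blast+
  then show ?thesis by (simp add: all_equivalent_def)
qed

theorem theorem3p2:
  fixes k :: "('k, 'x) ring_scheme" and A :: "('k, 'a, 'y) module_scheme"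
    and L :: "('k, 'l, 'z) module_scheme" and s\<^sub>L t\<^sub>L :: "'l \<Rightarrow> 'a"
    and \<gamma>\<^sub>L :: "'a \<Rightarrow> ('a \<times> 'a \<Rightarrow>\<^sub>0 int) set" and \<pi>\<^sub>L :: "'a \<Rightarrow> 'l"
    and R :: "('k, 'r, 'w) module_scheme" and s\<^sub>R t\<^sub>R :: "'r \<Rightarrow> 'a"
    and \<gamma>\<^sub>R :: "'a \<Rightarrow> ('a \<times> 'a \<Rightarrow>\<^sub>0 int) set" and \<pi>\<^sub>R :: "'a \<Rightarrow> 'r"
    and S :: "'a \<Rightarrow> 'a"
    and C\<^sub>L :: "('l, 'a) coring" and C\<^sub>R :: "('r, 'a) coring"
  assumes hopf: "hopf_algebroid k A L s\<^sub>L t\<^sub>L \<gamma>\<^sub>L \<pi>\<^sub>L R s\<^sub>R t\<^sub>R \<gamma>\<^sub>R \<pi>\<^sub>R S"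
  defines "C\<^sub>L \<equiv> L_coring A s\<^sub>L t\<^sub>L \<gamma>\<^sub>L \<pi>\<^sub>L"
    and "C\<^sub>R \<equiv> R_coring A s\<^sub>R t\<^sub>R \<gamma>\<^sub>R \<pi>\<^sub>R"
  shows "all_equivalent
    [coseparable R C\<^sub>R,
     coseparable L C\<^sub>L,
     \<forall>M :: ('r, ('a, 'l, 'r, 'm) univ, 'a) rcomodule. right_comodule R C\<^sub>R M \<longrightarrow> right_rel_injective R C\<^sub>R M,
     \<forall>M :: ('r, ('a, 'l, 'r, 'm) univ, 'a) lcomodule. left_comodule R C\<^sub>R M \<longrightarrow> left_rel_injective R C\<^sub>R M,
     \<forall>M :: ('l, ('a, 'l, 'r, 'm) univ, 'a) lcomodule. left_comodule L C\<^sub>L M \<longrightarrow> left_rel_injective L C\<^sub>L M,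
     \<forall>M :: ('l, ('a, 'l, 'r, 'm) univ, 'a) rcomodule. right_comodule L C\<^sub>L M \<longrightarrow> right_rel_injective L C\<^sub>L M,
     \<exists>\<phi> \<in> left_s_integrals A R s\<^sub>R t\<^sub>R \<gamma>\<^sub>R. \<phi> \<one>\<^bsub>A\<^esub> = \<one>\<^bsub>R\<^esub>,
     \<exists>\<phi> \<in> left_t_integrals A R s\<^sub>R t\<^sub>R \<gamma>\<^sub>R. \<phi> \<one>\<^bsub>A\<^esub> = \<one>\<^bsub>R\<^esub>,
     \<exists>\<phi> \<in> right_s_integrals A L s\<^sub>L t\<^sub>L \<gamma>\<^sub>L. \<phi> \<one>\<^bsub>A\<^esub> = \<one>\<^bsub>L\<^esub>,
     \<exists>\<phi> \<in> right_t_integrals A L s\<^sub>L t\<^sub>L \<gamma>\<^sub>L. \<phi> \<one>\<^bsub>A\<^esub> = \<one>\<^bsub>L\<^esub>,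
     splits_rcomod R C\<^sub>R (base_rcomod R C\<^sub>R s\<^sub>R) (rcomod_self C\<^sub>R) s\<^sub>R,
     splits_lcomod R C\<^sub>R (base_lcomod R C\<^sub>R t\<^sub>R) (lcomod_self C\<^sub>R) t\<^sub>R,
     splits_lcomod L C\<^sub>L (base_lcomod L C\<^sub>L s\<^sub>L) (lcomod_self C\<^sub>L) s\<^sub>L,
     splits_rcomod L C\<^sub>L (base_rcomod L C\<^sub>L t\<^sub>L) (rcomod_self C\<^sub>L) t\<^sub>L]"
proof -
  interpret hopf_algebroid k A L s\<^sub>L t\<^sub>L \<gamma>\<^sub>L \<pi>\<^sub>L R s\<^sub>R t\<^sub>R \<gamma>\<^sub>R \<pi>\<^sub>R S by (rule hopf)
  \<comment> \<open>The injectivity hypotheses concern comodules with carriers in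
    \<open>univ\<close>; these injections bring the total and the two base algebras into it.\<close>
  define ja :: "'a \<Rightarrow> ('a, 'l, 'r, 'm) univ" where "ja = Inl"
  define jl :: "'l \<Rightarrow> ('a, 'l, 'r, 'm) univ" where "jl = (\<lambda>x. Inr (Inl x))"
  define jr :: "'r \<Rightarrow> ('a, 'l, 'r, 'm) univ" where "jr = (\<lambda>x. Inr (Inr (Inl x)))"
  have inj: "inj ja" "inj jl" "inj jr"
    by (auto simp: ja_def jl_def jr_def inj_def)
  show ?thesis
    unfolding C\<^sub>L_def C\<^sub>R_def
  proof (rule all_equivalent_dual_Maschke)
    show "\<forall>M :: ('r, ('a, 'l, 'r, 'm) univ, 'a) rcomodule. right_comodule R CR M \<longrightarrow> right_rel_injective R CR M"
      if "coseparable R CR"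
      using CRr.coseparable_right_rel_injective[OF that] by blast
    show "\<forall>M :: ('r, ('a, 'l, 'r, 'm) univ, 'a) lcomodule. left_comodule R CR M \<longrightarrow> left_rel_injective R CR M"
      if "coseparable R CR"
      using CRr.coseparable_left_rel_injective[OF that] by blast
    show "\<forall>M :: ('l, ('a, 'l, 'r, 'm) univ, 'a) lcomodule. left_comodule L CL M \<longrightarrow> left_rel_injective L CL M"
      if "coseparable L CL"
      using LB.coseparable_left_rel_injective[OF that] by blast
    show "\<forall>M :: ('l, ('a, 'l, 'r, 'm) univ, 'a) rcomodule. right_comodule L CL M \<longrightarrow> right_rel_injective L CL M"
      if "coseparable L CL"
      using LB.coseparable_right_rel_injective[OF that] by blast
    show "splits_rcomod R CR (base_rcomod R CR s\<^sub>R) (rcomod_self CR) s\<^sub>R"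
      if "\<forall>M :: ('r, ('a, 'l, 'r, 'm) univ, 'a) rcomodule. right_comodule R CR M \<longrightarrow> right_rel_injective R CR M"
      by (rule CRr.rel_injective_imp_splits[OF inj(3) inj(1)]) (use that in blast)
    show "splits_lcomod R CR (base_lcomod R CR t\<^sub>R) (lcomod_self CR) t\<^sub>R"
      if "\<forall>M :: ('r, ('a, 'l, 'r, 'm) univ, 'a) lcomodule. left_comodule R CR M \<longrightarrow> left_rel_injective R CR M"
      by (rule CRl.rel_injective_imp_splits[OF inj(3) inj(1)]) (use that in blast)
    show "splits_lcomod L CL (base_lcomod L CL s\<^sub>L) (lcomod_self CL) s\<^sub>L"
      if "\<forall>M :: ('l, ('a, 'l, 'r, 'm) univ, 'a) lcomodule. left_comodule L CL M \<longrightarrow> left_rel_injective L CL M"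
      by (rule CLl.rel_injective_imp_splits[OF inj(2) inj(1)]) (use that in blast)
    show "splits_rcomod L CL (base_rcomod L CL t\<^sub>L) (rcomod_self CL) t\<^sub>L"
      if "\<forall>M :: ('l, ('a, 'l, 'r, 'm) univ, 'a) rcomodule. right_comodule L CL M \<longrightarrow> right_rel_injective L CL M"
      by (rule CLr.rel_injective_imp_splits[OF inj(2) inj(1)]) (use that in blast)
    show "\<exists>\<rho> \<in> right_t_integrals A L s\<^sub>L t\<^sub>L \<gamma>\<^sub>L. \<rho> \<one>\<^bsub>A\<^esub> = \<one>\<^bsub>L\<^esub>"
      if "\<exists>\<phi> \<in> left_s_integrals A R s\<^sub>R t\<^sub>R \<gamma>\<^sub>R. \<phi> \<one>\<^bsub>A\<^esub> = \<one>\<^bsub>R\<^esub>"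
      using that left_s_integral_imp_right_t_integral by metis
    show "\<exists>\<phi> \<in> left_t_integrals A R s\<^sub>R t\<^sub>R \<gamma>\<^sub>R. \<phi> \<one>\<^bsub>A\<^esub> = \<one>\<^bsub>R\<^esub>"
      if "\<exists>\<rho> \<in> right_s_integrals A L s\<^sub>L t\<^sub>L \<gamma>\<^sub>L. \<rho> \<one>\<^bsub>A\<^esub> = \<one>\<^bsub>L\<^esub>"
      using that right_s_integral_imp_left_t_integral by metis
  qed (fact splits_imp_left_s_integral splits_imp_left_t_integral splits_imp_right_s_integral
      splits_imp_right_t_integral right_t_integral_imp_coseparable left_t_integral_imp_coseparable)+
qed

end
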